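(* Let $\Bbbk$ be a commutative ring. Let $C$ be a coaugmented differential graded coalgebra over $\Bbbk$, $\Bbbk$-free of finite type, such that $C=\Bbbk\oplus C_{\geq 2}$. If $C$ is cocommutative, then the natural isomorphism of graded modules $HH^{*}(\Omega C)\cong HH_*(C^{\vee})$ (described in the context) is an isomorphism of commutative graded algebras, where $HH^*(\Omega C)$ carries the cup product coming from the shuffle diagonal of the cobar construction $\Omega C$, and $HH_*(C^\vee)$ carries the shuffle product.
   Context: Everything is over $\Bbbk$, $\otimes=\otimes_{\Bbbk}$. DGA, DGC, DGH mean differential graded algebra, coalgebra, Hopf algebra; CDGA means commutative DGA. Koszul signs: $(f\otimes g)(v\otimes w)=(-1)^{|g||v|}f(v)\otimes g(w)$; $M^\vee=\mathrm{Hom}(M,\Bbbk)$ and $\varphi^\vee(f)=(-1)^{|f||\varphi|}f\circ\varphi$. Suspension: $(sV)_{i+1}=V_i$. $\mathrm{T}W=\bigoplus_{k\ge0}W^{\otimes k}$. $\overline C$ denotes the kernel of the counit, $\overline A$ the kernel of the augmentation. Hochschild complex. For an augmented DGA $A$ (for $b\in A$, $sb\in s\overline A$ means $s(b-\varepsilon(b))$), the bar resolution $\mathrm{B}(A;A;A)$ is the $(A,A)$-bimodule $A\otimes \mathrm{T}(s\overline A)\otimes A$, elements $a[sa_1|\cdots|sa_k]b$, differential $d_1+d_2$, $d_1$ the tensor product differential (with $d(sx)=-s\,dx$) and $$d_2\,a[sa_1|\cdots|sa_k]b=(-1)^{|a|}aa_1[sa_2|\cdots|sa_k]b+\sum_{i=1}^{k-1}(-1)^{\varepsilon_i}a[sa_1|\cdots|sa_ia_{i+1}|\cdots|sa_k]b-(-1)^{\varepsilon_{k-1}}a[sa_1|\cdots|sa_{k-1}]a_kb,$$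 $\varepsilon_i=|a|+|sa_1|+\cdots+|sa_i|$. The cyclic bar construction is $\mathrm{C}(A)=A\otimes_{A\otimes A^{op}}\mathrm{B}(A;A;A)=A\otimes\mathrm{T}(s\overline A)$, with the analogous differential whose last term in $d_2$ is $-(-1)^{|sa_k|\varepsilon_{k-1}}a_ka[sa_1|\cdots|sa_{k-1}]$. $HH_*(A)=H_*(\mathrm{C}(A))$, $HH^*(A)=H^*(\mathrm{C}(A)^\vee)$. Cup product. The Alexander-Whitney bimodule map $\mathrm{B}(A\otimes B;A\otimes B;A\otimes B)\to \mathrm{B}(A;A;A)\otimes\mathrm{B}(B;B;B)$ sends $p\otimes q[s(a_1\otimes b_1)|\cdots|s(a_k\otimes b_k)]m\otimes n$ to $\sum_{i=0}^k\pm p[sa_1|\cdots|sa_i]a_{i+1}\cdots a_km\otimes qb_1\cdots b_i[sb_{i+1}|\cdots|sb_k]n$ ($\pm$ Koszul signs) and induces $AW:\mathrm{C}(A\otimes B)\to\mathrm{C}(A)\otimes\mathrm{C}(B)$. For a DGH $K$, $\mathrm{C}(K)$ is a DGC with diagonal $AW\circ\mathrm{C}(\Delta_K)$, and $HH^*(K)$ is a graded algebra by dualization. Cobar construction. $\Omega C$ is the augmented DGA $(\mathrm{T}(s^{-1}\overline C),d_1+d_2)$, with $d_1,d_2$ the derivations $d_1s^{-1}c=-s^{-1}dc$ and $d_2s^{-1}c=\sum(-1)^{|x_i|}s^{-1}x_i\otimes s^{-1}y_i$, where $\overline\Delta c=\sum x_i\otimes y_i$ is the reduced diagonal. The shuffle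 diagonal on a tensor algebra is the unique algebra map diagonal for which the generators are primitive; for $C$ cocommutative, $\Omega C$ with the shuffle diagonal (generators $s^{-1}\overline C$ primitive) is a DGH. Shuffle product. For a CDGA $A$, $\mathrm{C}(A)=A\otimes\mathrm{T}(s\overline A)$ is a CDGA for the product obtained by tensorizing the product of $A$ with the shuffle product $[v_1|\ldots|v_p]\cdot[v_{p+1}|\ldots|v_{p+q}]=\sum_\sigma\sigma\cdot[v_1|\ldots|v_{p+q}]$ (sum over $(p,q)$-shuffles, with Koszul signs); thus $HH_*(A)$ is a commutative graded algebra. The isomorphism. Let $A=C^\vee$. Let $(C\otimes\Omega C,\delta)$ be the complex with $\delta(1\otimes a)=1\otimes d_{\Omega}a$ and, for $c\in\overline C$, $a\in\Omega C$, $\overline\Delta c=\sum x_i\otimes y_i$, $$\delta(c\otimes a)=dc\otimes a+(-1)^{|c|}c\otimes da-1\otimes(s^{-1}c)a-\sum(-1)^{|x_i|}x_i\otimes(s^{-1}y_i)a+(-1)^{|a||s^{-1}c|}1\otimes a\,s^{-1}c+\sum(-1)^{(|a|+|y_i|)|s^{-1}x_i|}y_i\otimes a\,s^{-1}x_i .$$ (1) The map $\nabla:(C\otimes\Omega C,\delta)\to\mathrm{C}(\Omega C)$, $c\otimes a\mapsto(-1)^{|c||a|}a\otimes\sigma_C(c)$, with $\sigma_C(1)=[\,]$ and $\sigma_C(c)=\sum_{i\ge0}\sum[ss^{-1}c_1|\cdots|ss^{-1}c_{i+1}]$ for $c\in\overline C$ (where $\overline\Delta^{i}c=\sum c_1\otimes\cdots\otimes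 c_{i+1}$ is the iterated reduced diagonal), is the inclusion of a strong deformation retract, so $\nabla^\vee$ is a quasi-isomorphism. (2) Let $\Theta:s(\overline C^\vee)\to(s^{-1}\overline C)^\vee$ be the isomorphism with $(s^{-1})^\vee\circ\Theta=s^{-1}$, and $\Phi:V^\vee\otimes W^\vee\to(V\otimes W)^\vee$ the map $\Phi(f\otimes g)=\mu_{\Bbbk}\circ(f\otimes g)$ (and its iterates). Then $\Phi\circ(A\otimes\mathrm{T}(\Theta)):\mathrm{C}(A)\to(C\otimes\Omega C,\delta)^\vee$ is an isomorphism of complexes. The isomorphism $HH^*(\Omega C)\cong HH_*(C^\vee)$ is the one induced in homology by $$\mathrm{C}(\Omega C)^\vee\xrightarrow{\ \nabla^\vee\ }(C\otimes\Omega C,\delta)^\vee\xleftarrow{\ \cong\ }\mathrm{C}(C^\vee).$$ *)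

theory Defs
  imports
    "HOL-Library.Poly_Mapping"
    "HOL-Library.Function_Algebras"
    "HOL-Combinatorics.Permutations"
    "HOL-Algebra.Module"
    "HOL-Algebra.QuotRing"
    "HOL-Decision_Procs.Algebra_Aux"
begin

text \<open>
  Conventions.  The ground ring is a type \<open>'k\<close> of class \<^class>\<open>comm_ring_1\<close>.  Every module of which
  a basis is needed is free on a set of homogeneous basis elements; an element of the free
  module on \<open>X :: 'x set\<close> is a finitely supported \<open>p :: 'x \<Rightarrow>\<^sub>0 'k\<close> with \<open>keys p \<subseteq> X\<close>, a linear map out
  of it is given by its values \<open>'x \<Rightarrow> ('y \<Rightarrow>\<^sub>0 'k)\<close> on the basis, a linear form is given by its values
  \<open>'x \<Rightarrow> 'k\<close>, the tensor product of the free modules on \<open>X\<close> and \<open>Y\<close> is the free module on \<open>X \<times> Y\<close>,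
  and the tensor algebra of the free module on \<open>X\<close> is the free module on the lists over \<open>X\<close>.
  All degrees are lower degrees, differentials have degree \<open>-1\<close>, and the upper degree \<open>n\<close> is the
  lower degree \<open>-n\<close>; in particular the dual of a module in degrees \<open>\<ge> 0\<close> lives in degrees \<open>\<le> 0\<close>.
\<close>

section \<open>Signs and linear extension\<close>

definition sgnp :: "int \<Rightarrow> 'k::comm_ring_1" where
  "sgnp n = (if even n then 1 else -1)"

text \<open>
  The exponent of the Koszul sign of a rearrangement: the list contains, in the original order,
  a pair (target position, degree) for each factor; factors with equal target position keep
  their relative order.
\<close>

primrec koszul :: "(nat \<times> int) list \<Rightarrow> int" where
  "koszul [] = 0"
| "koszul (t # ts) = (\<Sum>u\<leftarrow>filter (\<lambda>u. fst u < fst t) ts. snd t * snd u) + koszul ts"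

definition bv :: "'x \<Rightarrow> 'x \<Rightarrow>\<^sub>0 'k::comm_ring_1" where
  "bv x = Poly_Mapping.single x 1"

definition scl :: "'k \<Rightarrow> ('x \<Rightarrow>\<^sub>0 'k) \<Rightarrow> 'x \<Rightarrow>\<^sub>0 'k::comm_ring_1" where
  "scl a p = Poly_Mapping.map ((*) a) p"

definition lext :: "('x \<Rightarrow> 'y \<Rightarrow>\<^sub>0 'k) \<Rightarrow> ('x \<Rightarrow>\<^sub>0 'k) \<Rightarrow> 'y \<Rightarrow>\<^sub>0 'k::comm_ring_1" where
  "lext f p = (\<Sum>x\<in>Poly_Mapping.keys p. scl (Poly_Mapping.lookup p x) (f x))"

definition ev :: "('x \<Rightarrow> 'k) \<Rightarrow> ('x \<Rightarrow>\<^sub>0 'k) \<Rightarrow> 'k::comm_ring_1" where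
  "ev f p = (\<Sum>x\<in>Poly_Mapping.keys p. Poly_Mapping.lookup p x * f x)"

definition tens :: "('x \<Rightarrow>\<^sub>0 'k) \<Rightarrow> ('y \<Rightarrow>\<^sub>0 'k) \<Rightarrow> ('x \<times> 'y) \<Rightarrow>\<^sub>0 'k::comm_ring_1" where
  "tens p q = lext (\<lambda>x. lext (\<lambda>y. bv (x, y)) q) p"

section \<open>Complexes and their homology\<close>

text \<open>
  A complex of \<open>'k\<close>-modules, as the total module \<open>dgcar\<close> with its homogeneous parts \<open>dgcomp\<close>.
  The addition is the one of the type.
\<close>

record ('k, 'm) dgmod =
  dgcar :: "'m set"
  dgcomp :: "int \<Rightarrow> 'm set"
  dgscl :: "'k \<Rightarrow> 'm \<Rightarrow> 'm"
  dgdif :: "'m \<Rightarrow> 'm"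

definition dgcycles :: "('k, 'm::ab_group_add) dgmod \<Rightarrow> 'm set" where
  "dgcycles M = {z \<in> dgcar M. dgdif M z = 0}"

definition hclass :: "('k, 'm::ab_group_add) dgmod \<Rightarrow> 'm \<Rightarrow> 'm set" where
  "hclass M z = (\<lambda>b. z + b) ` dgdif M ` dgcar M"

definition homology :: "('k, 'm::ab_group_add) dgmod \<Rightarrow> 'm set set" where
  "homology M = hclass M ` dgcycles M"

definition chain_map ::
    "('k, 'm::ab_group_add) dgmod \<Rightarrow> ('k, 'n::ab_group_add) dgmod \<Rightarrow> ('m \<Rightarrow> 'n) \<Rightarrow> bool" where
  "chain_map M N f \<longleftrightarrow>
     (\<forall>x\<in>dgcar M. f x \<in> dgcar N) \<and>
     (\<forall>n. \<forall>x\<in>dgcomp M n. f x \<in> dgcomp N n) \<and>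
     (\<forall>x\<in>dgcar M. \<forall>y\<in>dgcar M. f (x + y) = f x + f y) \<and>
     (\<forall>a. \<forall>x\<in>dgcar M. f (dgscl M a x) = dgscl N a (f x)) \<and>
     (\<forall>x\<in>dgcar M. f (dgdif M x) = dgdif N (f x))"

definition homology_map ::
    "('k, 'm::ab_group_add) dgmod \<Rightarrow> ('k, 'n::ab_group_add) dgmod \<Rightarrow> ('m \<Rightarrow> 'n) \<Rightarrow> 'm set \<Rightarrow> 'n set" where
  "homology_map M N f S = (\<Union>z\<in>S. hclass N (f z))"

definition quasi_iso ::
    "('k, 'm::ab_group_add) dgmod \<Rightarrow> ('k, 'n::ab_group_add) dgmod \<Rightarrow> ('m \<Rightarrow> 'n) \<Rightarrow> bool" where
  "quasi_iso M N f \<longleftrightarrow>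
     chain_map M N f \<and> bij_betw (homology_map M N f) (homology M) (homology N)"

definition complex_iso ::
    "('k, 'm::ab_group_add) dgmod \<Rightarrow> ('k, 'n::ab_group_add) dgmod \<Rightarrow> ('m \<Rightarrow> 'n) \<Rightarrow> bool" where
  "complex_iso M N f \<longleftrightarrow> chain_map M N f \<and> bij_betw f (dgcar M) (dgcar N) \<and>
     (\<forall>n. f ` dgcomp M n = dgcomp N n)"

section \<open>Graded algebras\<close>

record ('k, 'm) graded_algebra = "('k, 'm) module" +
  hgrade :: "int \<Rightarrow> 'm set"

definition commutative_graded_algebra :: "('k::comm_ring_1, 'm) graded_algebra \<Rightarrow> bool" where
  "commutative_graded_algebra H \<longleftrightarrow>
     ring H \<and> module (cring_class_ops :: 'k ring) H \<and>
     (\<forall>a. \<forall>x\<in>carrier H. \<forall>y\<in>carrier H.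
        (a \<odot>\<^bsub>H\<^esub> x) \<otimes>\<^bsub>H\<^esub> y = a \<odot>\<^bsub>H\<^esub> (x \<otimes>\<^bsub>H\<^esub> y) \<and>
        x \<otimes>\<^bsub>H\<^esub> (a \<odot>\<^bsub>H\<^esub> y) = a \<odot>\<^bsub>H\<^esub> (x \<otimes>\<^bsub>H\<^esub> y)) \<and>
     (\<forall>n. submodule (hgrade H n) (cring_class_ops :: 'k ring) H) \<and>
     (\<forall>x\<in>carrier H. \<exists>!c. (\<forall>n. c n \<in> hgrade H n) \<and> finite {n. c n \<noteq> \<zero>\<^bsub>H\<^esub>} \<and>
        x = finsum H c {n. c n \<noteq> \<zero>\<^bsub>H\<^esub>}) \<and>
     \<one>\<^bsub>H\<^esub> \<in> hgrade H 0 \<and>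
     (\<forall>m n. \<forall>x\<in>hgrade H m. \<forall>y\<in>hgrade H n.
        x \<otimes>\<^bsub>H\<^esub> y \<in> hgrade H (m + n) \<and>
        x \<otimes>\<^bsub>H\<^esub> y = sgnp (m * n) \<odot>\<^bsub>H\<^esub> (y \<otimes>\<^bsub>H\<^esub> x))"

definition graded_algebra_iso ::
    "('k, 'm) graded_algebra \<Rightarrow> ('k, 'n) graded_algebra \<Rightarrow> ('m \<Rightarrow> 'n) \<Rightarrow> bool" where
  "graded_algebra_iso H H' h \<longleftrightarrow>
     h \<in> ring_iso H H' \<and>
     (\<forall>a. \<forall>x\<in>carrier H. h (a \<odot>\<^bsub>H\<^esub> x) = a \<odot>\<^bsub>H'\<^esub> h x) \<and>
     (\<forall>n. h ` hgrade H n = hgrade H' n)"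

text \<open>
  The homology of a complex, with the product induced by \<open>m\<close> and the unit represented by \<open>e\<close>
  (the operations on classes are formed as in \<^const>\<open>FactRing\<close>).
\<close>

definition homology_algebra ::
    "('k, 'm::ab_group_add) dgmod \<Rightarrow> ('m \<Rightarrow> 'm \<Rightarrow> 'm) \<Rightarrow> 'm \<Rightarrow> ('k, 'm set) graded_algebra" where
  "homology_algebra M m e =
     \<lparr> carrier = homology M,
       monoid.mult = (\<lambda>S T. \<Union>x\<in>S. \<Union>y\<in>T. hclass M (m x y)),
       monoid.one = hclass M e,
       ring.zero = hclass M 0,
       ring.add = (\<lambda>S T. \<Union>x\<in>S. \<Union>y\<in>T. hclass M (x + y)),
       module.smult = (\<lambda>a S. \<Union>x\<in>S. hclass M (dgscl M a x)),
       hgrade = (\<lambda>n. hclass M ` (dgcycles M \<inter> dgcomp M n)) \<rparr>"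

section \<open>Free complexes, their duals, algebras and coalgebras\<close>

record (overloaded) ('x, 'k::comm_ring_1) free_complex =
  gens :: "'x set"
  gdeg :: "'x \<Rightarrow> int"
  gdif :: "'x \<Rightarrow> 'x \<Rightarrow>\<^sub>0 'k"

definition free_cx :: "('x, 'k::comm_ring_1, 'e) free_complex_scheme \<Rightarrow> ('k, 'x \<Rightarrow>\<^sub>0 'k) dgmod" where
  "free_cx X =
     \<lparr> dgcar = {p. Poly_Mapping.keys p \<subseteq> gens X},
       dgcomp = (\<lambda>n. {p. Poly_Mapping.keys p \<subseteq> {x \<in> gens X. gdeg X x = n}}),
       dgscl = scl,
       dgdif = lext (gdif X) \<rparr>"

text \<open>
  The graded dual \<open>M\<^sup>\<or>\<close>, i.e. the direct sum over \<open>n\<close> of the modules of linear forms on the degree \<open>n\<close>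
  part, placed in degree \<open>-n\<close>.  The differential is that of \<open>Hom(M, k)\<close>, namely
  \<open>df = -(-1)\<^sup>|\<^sup>f\<^sup>| f \<circ> d\<close>; only the component of \<open>f\<close> of degree \<open>|f| = -(|x| - 1)\<close> contributes to
  its value at \<open>x\<close>.  (With the opposite sign the map \<open>PhiTheta\<close> below would not commute with the
  differentials.)
\<close>

definition dual_cx :: "('x, 'k::comm_ring_1, 'e) free_complex_scheme \<Rightarrow> ('k, 'x \<Rightarrow> 'k) dgmod" where
  "dual_cx X =
     \<lparr> dgcar = {f. (\<forall>x. x \<notin> gens X \<longrightarrow> f x = 0) \<and> finite (gdeg X ` {x. f x \<noteq> 0})},
       dgcomp = (\<lambda>n. {f. \<forall>x. f x \<noteq> 0 \<longrightarrow> x \<in> gens X \<and> gdeg X x = - n}),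
       dgscl = (\<lambda>a f x. a * f x),
       dgdif = (\<lambda>f x. if x \<in> gens X then - sgnp (gdeg X x - 1) * ev f (gdif X x) else 0) \<rparr>"

text \<open>
  The map \<open>f \<otimes> g\<close> followed by the multiplication of \<open>k\<close>, for linear forms \<open>f\<close>, \<open>g\<close>: the sign is
  \<open>(-1)\<^sup>|\<^sup>g\<^sup>|\<^sup>|\<^sup>v\<^sup>|\<close>, and the component of \<open>g\<close> that is nonzero on \<open>w\<close> has degree \<open>-|w|\<close>.
\<close>

definition form_tens ::
    "('x, 'k::comm_ring_1, 'e) free_complex_scheme \<Rightarrow> ('x \<Rightarrow> 'k) \<Rightarrow> ('x \<Rightarrow> 'k) \<Rightarrow> 'x \<times> 'x \<Rightarrow> 'k" where
  "form_tens X f g = (\<lambda>(v, w). sgnp (gdeg X w * gdeg X v) * (f v * g w))"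

text \<open>
  Augmented DGAs on a free module: the unit \<open>aunit\<close> is a basis element, and the
  augmentation is the coefficient of \<open>aunit\<close>, so that \<open>gens A - {aunit A}\<close> is a basis of the
  augmentation ideal.
\<close>

record (overloaded) ('x, 'k::comm_ring_1) free_dga = "('x, 'k) free_complex" +
  aunit :: "'x"
  amul :: "'x \<Rightarrow> 'x \<Rightarrow> 'x \<Rightarrow>\<^sub>0 'k"

definition amult :: "('x, 'k::comm_ring_1, 'e) free_dga_scheme \<Rightarrow> ('x \<Rightarrow>\<^sub>0 'k) \<Rightarrow> ('x \<Rightarrow>\<^sub>0 'k) \<Rightarrow> 'x \<Rightarrow>\<^sub>0 'k" where
  "amult A p q = lext (\<lambda>(x, y). amul A x y) (tens p q)"

definition aprod :: "('x, 'k::comm_ring_1, 'e) free_dga_scheme \<Rightarrow> ('x \<Rightarrow>\<^sub>0 'k) list \<Rightarrow> 'x \<Rightarrow>\<^sub>0 'k" where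
  "aprod A ps = foldl (amult A) (bv (aunit A)) ps"

definition tens_dif ::
    "('x, 'k::comm_ring_1, 'e) free_complex_scheme \<Rightarrow> ('y, 'k, 'f) free_complex_scheme \<Rightarrow>
     'x \<times> 'y \<Rightarrow> ('x \<times> 'y) \<Rightarrow>\<^sub>0 'k" where
  "tens_dif X Y = (\<lambda>(x, y). tens (gdif X x) (bv y) + scl (sgnp (gdeg X x)) (tens (bv x) (gdif Y y)))"

definition tens_dga ::
    "('x, 'k::comm_ring_1) free_dga \<Rightarrow> ('y, 'k) free_dga \<Rightarrow> ('x \<times> 'y, 'k) free_dga" where
  "tens_dga A B =
     \<lparr> gens = gens A \<times> gens B,
       gdeg = (\<lambda>(x, y). gdeg A x + gdeg B y),
       gdif = tens_dif A B,
       aunit = (aunit A, aunit B),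
       amul = (\<lambda>(x, y) (x', y'). scl (sgnp (gdeg B y * gdeg A x')) (tens (amul A x x') (amul B y y'))) \<rparr>"

record (overloaded) ('x, 'k::comm_ring_1) free_dgc = "('x, 'k) free_complex" +
  counit :: "'x \<Rightarrow> 'k"
  codiag :: "'x \<Rightarrow> ('x \<times> 'x) \<Rightarrow>\<^sub>0 'k"
  coaug :: "'x"

locale coaugmented_dgc =
  fixes C :: "('b, 'k::comm_ring_1) free_dgc"
  assumes dif_closed: "c \<in> gens C \<Longrightarrow> b \<in> Poly_Mapping.keys (gdif C c) \<Longrightarrow>
      b \<in> gens C \<and> gdeg C b = gdeg C c - 1"
    and dif_dif: "c \<in> gens C \<Longrightarrow> lext (gdif C) (gdif C c) = 0"
    and codiag_closed: "c \<in> gens C \<Longrightarrow> (x, y) \<in> Poly_Mapping.keys (codiag C c) \<Longrightarrow>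
      x \<in> gens C \<and> y \<in> gens C \<and> gdeg C x + gdeg C y = gdeg C c"
    and coassoc: "c \<in> gens C \<Longrightarrow>
      lext (\<lambda>(x, y). lext (\<lambda>(x', x''). bv (x', x'', y)) (codiag C x)) (codiag C c) =
      lext (\<lambda>(x, y). lext (\<lambda>(y', y''). bv (x, y', y'')) (codiag C y)) (codiag C c)"
    and codiag_dif: "c \<in> gens C \<Longrightarrow>
      lext (codiag C) (gdif C c) = lext (tens_dif C C) (codiag C c)"
    and counit_deg: "c \<in> gens C \<Longrightarrow> gdeg C c \<noteq> 0 \<Longrightarrow> counit C c = 0"
    and counit_dif: "c \<in> gens C \<Longrightarrow> ev (counit C) (gdif C c) = 0"
    and counit_left: "c \<in> gens C \<Longrightarrow> lext (\<lambda>(x, y). scl (counit C x) (bv y)) (codiag C c) = bv c"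
    and counit_right: "c \<in> gens C \<Longrightarrow> lext (\<lambda>(x, y). scl (counit C y) (bv x)) (codiag C c) = bv c"
    and coaug_gen: "coaug C \<in> gens C" "gdeg C (coaug C) = 0"
    and coaug_counit: "counit C (coaug C) = 1"
    and coaug_codiag: "codiag C (coaug C) = bv (coaug C, coaug C)"
    and coaug_dif: "gdif C (coaug C) = 0"

definition cocommutative :: "('b, 'k::comm_ring_1) free_dgc \<Rightarrow> bool" where
  "cocommutative C \<longleftrightarrow> (\<forall>c\<in>gens C.
     lext (\<lambda>(x, y). scl (sgnp (gdeg C x * gdeg C y)) (bv (y, x))) (codiag C c) = codiag C c)"

definition finite_type :: "('x, 'k::comm_ring_1, 'e) free_complex_scheme \<Rightarrow> bool" where
  "finite_type X \<longleftrightarrow> (\<forall>n. finite {x \<in> gens X. gdeg X x = n})"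

text \<open>\<open>C = k \<oplus> C\<^sub>\<ge>\<^sub>2\<close>, where \<open>k\<close> is the image of the coaugmentation.\<close>

definition simply_connected :: "('b, 'k::comm_ring_1) free_dgc \<Rightarrow> bool" where
  "simply_connected C \<longleftrightarrow> (\<forall>c\<in>gens C. c \<noteq> coaug C \<longrightarrow> gdeg C c \<ge> 2)"

text \<open>
  \<open>C\<^sup>\<or>\<close> for \<open>C\<close> of finite type with \<open>C = k \<oplus> C\<^sub>\<ge>\<^sub>2\<close>, on the basis dual to \<open>gens C\<close>; the element dual to
  \<open>b\<close> is again written \<open>b\<close>, and has degree \<open>-|b|\<close>.  The product is \<open>f g = \<mu> \<circ> (f \<otimes> g) \<circ> \<Delta>\<close>, with
  \<open>f \<otimes> g\<close> as in \<^const>\<open>form_tens\<close>, and the differential that of \<^const>\<open>dual_cx\<close>.  The unit is the counit of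
  \<open>C\<close>, which takes the value 1 on \<open>coaug C\<close> and 0 on the other basis elements; the augmentation is the
  evaluation at \<open>coaug C\<close>.
\<close>

definition dual_dga :: "('b, 'k::comm_ring_1) free_dgc \<Rightarrow> ('b, 'k) free_dga" where
  "dual_dga C =
     \<lparr> gens = gens C,
       gdeg = (\<lambda>b. - gdeg C b),
       gdif = (\<lambda>b. \<Sum>x\<in>{x \<in> gens C. gdeg C x = gdeg C b + 1}.
                 Poly_Mapping.single x (- sgnp (gdeg C b) * Poly_Mapping.lookup (gdif C x) b)),
       aunit = coaug C,
       amul = (\<lambda>b c. \<Sum>x\<in>{x \<in> gens C. gdeg C x = gdeg C b + gdeg C c}.
                 Poly_Mapping.single x
                   (sgnp (gdeg C c * gdeg C b) * Poly_Mapping.lookup (codiag C x) (b, c))) \<rparr>"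

section \<open>The cyclic bar construction\<close>

text \<open>
  \<open>C(A) = A \<otimes> T(s A\<^sup>-)\<close> has the basis of the \<open>a[sa\<^sub>1|...|sa\<^sub>k]\<close>, encoded as \<open>(a, [a\<^sub>1, ..., a\<^sub>k])\<close>, with
  \<open>a\<close> a basis element of \<open>A\<close> and the \<open>a\<^sub>i\<close> basis elements other than the unit.  For arbitrary
  elements, \<open>cchain A a [p\<^sub>1, ..., p\<^sub>k]\<close> is \<open>a[sp\<^sub>1|...|sp\<^sub>k]\<close>, where \<open>sp\<close> stands for \<open>s(p - \<epsilon>(p))\<close>: this is
  why \<open>bar_word\<close> drops the unit component.
\<close>

primrec bar_word :: "('x, 'k::comm_ring_1, 'e) free_dga_scheme \<Rightarrow> ('x \<Rightarrow>\<^sub>0 'k) list \<Rightarrow> 'x list \<Rightarrow>\<^sub>0 'k" where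
  "bar_word A [] = bv []"
| "bar_word A (p # ps) =
     lext (\<lambda>x. if x = aunit A then 0 else lext (\<lambda>w. bv (x # w)) (bar_word A ps)) p"

definition cchain ::
    "('x, 'k::comm_ring_1, 'e) free_dga_scheme \<Rightarrow> ('x \<Rightarrow>\<^sub>0 'k) \<Rightarrow> ('x \<Rightarrow>\<^sub>0 'k) list \<Rightarrow> ('x \<times> 'x list) \<Rightarrow>\<^sub>0 'k" where
  "cchain A a ps = tens a (bar_word A ps)"

definition bar_deg :: "('x, 'k::comm_ring_1, 'e) free_complex_scheme \<Rightarrow> 'x list \<Rightarrow> int" where
  "bar_deg X xs = (\<Sum>x\<leftarrow>xs. gdeg X x + 1)"

text \<open>
  In \<open>cyclic_dif\<close> the list index is zero-based: \<open>xs ! i\<close> is \<open>a\<^sub>i\<^sub>+\<^sub>1\<close>, while \<open>eps i\<close> is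
  \<open>\<epsilon>\<^sub>i = |a| + |sa\<^sub>1| + ... + |sa\<^sub>i|\<close>.
\<close>

definition cyclic_dif ::
    "('x, 'k::comm_ring_1, 'e) free_dga_scheme \<Rightarrow> 'x \<times> 'x list \<Rightarrow> ('x \<times> 'x list) \<Rightarrow>\<^sub>0 'k" where
  "cyclic_dif A = (\<lambda>(a, xs).
     let k = length xs;
         vs = map bv xs;
         eps = (\<lambda>i. gdeg A a + bar_deg A (take i xs));
         d1 = cchain A (gdif A a) vs
            + (\<Sum>i<k. scl (- sgnp (eps i))
                 (cchain A (bv a) (take i vs @ [gdif A (xs ! i)] @ drop (i + 1) vs)));
         d2 = (if k = 0 then 0 else
                 scl (sgnp (gdeg A a)) (cchain A (amul A a (xs ! 0)) (drop 1 vs))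
               + (\<Sum>i\<in>{1..<k}. scl (sgnp (eps i))
                    (cchain A (bv a) (take (i - 1) vs @ [amul A (xs ! (i - 1)) (xs ! i)] @ drop (i + 1) vs)))
               + scl (- sgnp ((gdeg A (xs ! (k - 1)) + 1) * eps (k - 1)))
                    (cchain A (amul A (xs ! (k - 1)) a) (take (k - 1) vs)))
     in d1 + d2)"

definition cyclic :: "('x, 'k::comm_ring_1, 'e) free_dga_scheme \<Rightarrow> ('x \<times> 'x list, 'k) free_complex" where
  "cyclic A =
     \<lparr> gens = {(a, xs). a \<in> gens A \<and> set xs \<subseteq> gens A - {aunit A}},
       gdeg = (\<lambda>(a, xs). gdeg A a + bar_deg A xs),
       gdif = cyclic_dif A \<rparr>"

text \<open>The map \<open>C(\<phi>)\<close> induced by a morphism \<open>\<phi>\<close> of augmented DGAs with target \<open>B\<close>.\<close>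

definition cyclic_map ::
    "('y, 'k::comm_ring_1, 'e) free_dga_scheme \<Rightarrow> ('x \<Rightarrow> 'y \<Rightarrow>\<^sub>0 'k) \<Rightarrow> 'x \<times> 'x list \<Rightarrow> ('y \<times> 'y list) \<Rightarrow>\<^sub>0 'k" where
  "cyclic_map B \<phi> = (\<lambda>(a, xs). cchain B (\<phi> a) (map \<phi> xs))"

text \<open>
  The Alexander-Whitney map \<open>C(A \<otimes> B) \<rightarrow> C(A) \<otimes> C(B)\<close>,
  \<open>p \<otimes> q[s(a\<^sub>1 \<otimes> b\<^sub>1)|...|s(a\<^sub>k \<otimes> b\<^sub>k)] \<mapsto> \<Sum>\<^sub>i \<plusminus> a\<^sub>i\<^sub>+\<^sub>1...a\<^sub>k p[sa\<^sub>1|...|sa\<^sub>i] \<otimes> q b\<^sub>1...b\<^sub>i[sb\<^sub>i\<^sub>+\<^sub>1|...|sb\<^sub>k]\<close>.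
  It is induced by the bimodule map: in \<open>A \<otimes>\<^bsub>A \<otimes> A\<^sup>o\<^sup>p\<^esub> B(A;A;A)\<close> the right coefficient \<open>a\<^sub>i\<^sub>+\<^sub>1...a\<^sub>k\<close> moves to the
  front.  \<open>AW_sign A B p q xs i\<close> is the exponent of the Koszul sign of the resulting rearrangement of
  \<open>p, q, s, a\<^sub>1, b\<^sub>1, ..., s, a\<^sub>k, b\<^sub>k\<close>: target position 0 is the product \<open>a\<^sub>i\<^sub>+\<^sub>1...a\<^sub>k\<close>, position 1 is
  \<open>p[sa\<^sub>1|...|sa\<^sub>i]\<close> and position 2 is the whole second factor; each suspension (of degree 1)
  follows \<open>a\<^sub>j\<close> for \<open>j \<le> i\<close> and \<open>b\<^sub>j\<close> for \<open>j > i\<close>.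
\<close>

definition AW_sign ::
    "('x, 'k::comm_ring_1, 'e) free_complex_scheme \<Rightarrow> ('y, 'k, 'f) free_complex_scheme \<Rightarrow>
     'x \<Rightarrow> 'y \<Rightarrow> ('x \<times> 'y) list \<Rightarrow> nat \<Rightarrow> int" where
  "AW_sign A B p q xs i = koszul
     ([(1, gdeg A p), (2, gdeg B q)]
      @ concat (map (\<lambda>(a, b). [(1, 1), (1, gdeg A a), (2, gdeg B b)]) (take i xs))
      @ concat (map (\<lambda>(a, b). [(2, 1), (0, gdeg A a), (2, gdeg B b)]) (drop i xs)))"

definition AW ::
    "('x, 'k::comm_ring_1, 'e) free_dga_scheme \<Rightarrow> ('y, 'k, 'f) free_dga_scheme \<Rightarrow>
     ('x \<times> 'y) \<times> ('x \<times> 'y) list \<Rightarrow> (('x \<times> 'x list) \<times> ('y \<times> 'y list)) \<Rightarrow>\<^sub>0 'k" where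
  "AW A B = (\<lambda>((p, q), xs).
     let as = map (bv \<circ> fst) xs; bs = map (bv \<circ> snd) xs in
     \<Sum>i\<le>length xs. scl (sgnp (AW_sign A B p q xs i))
       (tens (cchain A (amult A (aprod A (drop i as)) (bv p)) (take i as))
             (cchain B (amult B (bv q) (aprod B (take i bs))) (drop i bs))))"

section \<open>Hochschild cohomology of a Hopf algebra and Hochschild homology of a commutative algebra\<close>

definition cyclic_diag ::
    "('x, 'k::comm_ring_1) free_dga \<Rightarrow> ('x \<Rightarrow> ('x \<times> 'x) \<Rightarrow>\<^sub>0 'k) \<Rightarrow>
     'x \<times> 'x list \<Rightarrow> (('x \<times> 'x list) \<times> ('x \<times> 'x list)) \<Rightarrow>\<^sub>0 'k" where
  "cyclic_diag K \<Delta> x = lext (AW K K) (cyclic_map (tens_dga K K) \<Delta> x)"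

definition cup ::
    "('x, 'k::comm_ring_1) free_dga \<Rightarrow> ('x \<Rightarrow> ('x \<times> 'x) \<Rightarrow>\<^sub>0 'k) \<Rightarrow>
     ('x \<times> 'x list \<Rightarrow> 'k) \<Rightarrow> ('x \<times> 'x list \<Rightarrow> 'k) \<Rightarrow> 'x \<times> 'x list \<Rightarrow> 'k" where
  "cup K \<Delta> f g x =
     (if x \<in> gens (cyclic K) then ev (form_tens (cyclic K) f g) (cyclic_diag K \<Delta> x) else 0)"

text \<open>
  \<open>HH\<^sup>*(K)\<close> for a DGH \<open>K\<close> with diagonal \<open>\<Delta>\<close> whose counit is the augmentation: its unit is the
  counit \<open>a[] \<mapsto> \<epsilon>(a)\<close>, \<open>a[sa\<^sub>1|...|sa\<^sub>k] \<mapsto> 0\<close> of \<open>C(K)\<close>.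
\<close>

definition HH_cohomology ::
    "('x, 'k::comm_ring_1) free_dga \<Rightarrow> ('x \<Rightarrow> ('x \<times> 'x) \<Rightarrow>\<^sub>0 'k) \<Rightarrow>
     ('k, ('x \<times> 'x list \<Rightarrow> 'k) set) graded_algebra" where
  "HH_cohomology K \<Delta> =
     homology_algebra (dual_cx (cyclic K)) (cup K \<Delta>) (\<lambda>x. if x = (aunit K, []) then 1 else 0)"

definition shuffles_perm :: "nat \<Rightarrow> nat \<Rightarrow> (nat \<Rightarrow> nat) set" where
  "shuffles_perm p q =
     {\<sigma>. \<sigma> permutes {..<p + q} \<and> strict_mono_on {..<p} \<sigma> \<and> strict_mono_on {p..<p + q} \<sigma>}"

text \<open>The entry in position \<open>i\<close> is moved to position \<open>\<sigma> i\<close>.\<close>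

definition shuffle_word ::
    "('x, 'k::comm_ring_1, 'e) free_complex_scheme \<Rightarrow> 'x list \<Rightarrow> 'x list \<Rightarrow> 'x list \<Rightarrow>\<^sub>0 'k" where
  "shuffle_word X xs ys =
     (let vs = xs @ ys in
      \<Sum>\<sigma>\<in>shuffles_perm (length xs) (length ys).
        scl (sgnp (koszul (map (\<lambda>i. (\<sigma> i, gdeg X (vs ! i) + 1)) [0..<length vs])))
            (bv (map (\<lambda>i. vs ! (inv_into UNIV \<sigma> i)) [0..<length vs])))"

definition shuffle_mult ::
    "('x, 'k::comm_ring_1, 'e) free_dga_scheme \<Rightarrow>
     (('x \<times> 'x list) \<Rightarrow>\<^sub>0 'k) \<Rightarrow> (('x \<times> 'x list) \<Rightarrow>\<^sub>0 'k) \<Rightarrow> ('x \<times> 'x list) \<Rightarrow>\<^sub>0 'k" where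
  "shuffle_mult A p q =
     lext (\<lambda>((a, xs), (b, ys)).
       scl (sgnp (gdeg A b * bar_deg A xs)) (tens (amul A a b) (shuffle_word A xs ys))) (tens p q)"

definition HH_homology ::
    "('x, 'k::comm_ring_1) free_dga \<Rightarrow> ('k, (('x \<times> 'x list) \<Rightarrow>\<^sub>0 'k) set) graded_algebra" where
  "HH_homology A = homology_algebra (free_cx (cyclic A)) (shuffle_mult A) (bv (aunit A, []))"

section \<open>The cobar construction\<close>

definition red_diag :: "('b, 'k::comm_ring_1) free_dgc \<Rightarrow> 'b \<Rightarrow> ('b \<times> 'b) \<Rightarrow>\<^sub>0 'k" where
  "red_diag C c =
     lext (\<lambda>(x, y). if x = coaug C \<or> y = coaug C then 0 else bv (x, y)) (codiag C c)"

text \<open>The word \<open>[c\<^sub>1, ..., c\<^sub>k]\<close> stands for \<open>s\<^sup>-\<^sup>1c\<^sub>1 \<otimes> ... \<otimes> s\<^sup>-\<^sup>1c\<^sub>k\<close>.\<close>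

definition cobar_deg :: "('b, 'k::comm_ring_1) free_dgc \<Rightarrow> 'b list \<Rightarrow> int" where
  "cobar_deg C w = (\<Sum>c\<leftarrow>w. gdeg C c - 1)"

definition cobar_dif_gen :: "('b, 'k::comm_ring_1) free_dgc \<Rightarrow> 'b \<Rightarrow> 'b list \<Rightarrow>\<^sub>0 'k" where
  "cobar_dif_gen C c =
     - lext (\<lambda>x. bv [x]) (gdif C c)
     + lext (\<lambda>(x, y). scl (sgnp (gdeg C x)) (bv [x, y])) (red_diag C c)"

definition cobar_dif :: "('b, 'k::comm_ring_1) free_dgc \<Rightarrow> 'b list \<Rightarrow> 'b list \<Rightarrow>\<^sub>0 'k" where
  "cobar_dif C w =
     (\<Sum>i<length w. scl (sgnp (cobar_deg C (take i w)))
        (lext (\<lambda>u. bv (take i w @ u @ drop (i + 1) w)) (cobar_dif_gen C (w ! i))))"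

definition cobar :: "('b, 'k::comm_ring_1) free_dgc \<Rightarrow> ('b list, 'k) free_dga" where
  "cobar C =
     \<lparr> gens = lists (gens C - {coaug C}),
       gdeg = cobar_deg C,
       gdif = cobar_dif C,
       aunit = [],
       amul = (\<lambda>v w. bv (v @ w)) \<rparr>"

text \<open>The morphism of algebras \<open>\<Omega>C \<rightarrow> \<Omega>C \<otimes> \<Omega>C\<close> for which the \<open>s\<^sup>-\<^sup>1c\<close> are primitive.\<close>

definition shuffle_diag :: "('b, 'k::comm_ring_1) free_dgc \<Rightarrow> 'b list \<Rightarrow> ('b list \<times> 'b list) \<Rightarrow>\<^sub>0 'k" where
  "shuffle_diag C w =
     aprod (tens_dga (cobar C) (cobar C)) (map (\<lambda>c. bv ([c], []) + bv ([], [c])) w)"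

section \<open>The comparison isomorphism\<close>

text \<open>
  \<open>(C \<otimes> \<Omega>C, \<delta>)\<close>.  For \<open>c = coaug C\<close>, i.e. \<open>c = 1\<close>, only the term \<open>1 \<otimes> da\<close> is present.
\<close>

definition twisted_dif :: "('b, 'k::comm_ring_1) free_dgc \<Rightarrow> 'b \<times> 'b list \<Rightarrow> ('b \<times> 'b list) \<Rightarrow>\<^sub>0 'k" where
  "twisted_dif C = (\<lambda>(c, a).
     if c = coaug C then tens (bv (coaug C)) (cobar_dif C a)
     else
       tens (gdif C c) (bv a) + scl (sgnp (gdeg C c)) (tens (bv c) (cobar_dif C a))
       - bv (coaug C, [c] @ a)
       - lext (\<lambda>(x, y). scl (sgnp (gdeg C x)) (bv (x, [y] @ a))) (red_diag C c)
       + scl (sgnp (cobar_deg C a * (gdeg C c - 1))) (bv (coaug C, a @ [c]))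
       + lext (\<lambda>(x, y). scl (sgnp ((cobar_deg C a + gdeg C y) * (gdeg C x - 1))) (bv (y, a @ [x])))
           (red_diag C c))"

definition twisted :: "('b, 'k::comm_ring_1) free_dgc \<Rightarrow> ('b \<times> 'b list, 'k) free_complex" where
  "twisted C =
     \<lparr> gens = gens C \<times> lists (gens C - {coaug C}),
       gdeg = (\<lambda>(c, a). gdeg C c + cobar_deg C a),
       gdif = twisted_dif C \<rparr>"

text \<open>The iterated reduced diagonal, with values in \<open>i + 1\<close> tensor factors.\<close>

primrec red_diag_iter :: "('b, 'k::comm_ring_1) free_dgc \<Rightarrow> nat \<Rightarrow> 'b \<Rightarrow> 'b list \<Rightarrow>\<^sub>0 'k" where
  "red_diag_iter C 0 c = bv [c]"
| "red_diag_iter C (Suc i) c =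
     lext (\<lambda>(x, y). lext (\<lambda>w. bv (w @ [y])) (red_diag_iter C i x)) (red_diag C c)"

text \<open>
  The sum over \<open>i\<close> is finite because the \<open>i\<close>-th iterated reduced diagonal vanishes in degrees
  below \<open>2(i + 1)\<close>.  A basis element of \<open>T(s(\<Omega>C)\<^sup>-)\<close> is a list of nonempty words, and
  \<open>ss\<^sup>-\<^sup>1c\<close> is the one-letter word \<open>[c]\<close>.
\<close>

definition sigma_C :: "('b, 'k::comm_ring_1) free_dgc \<Rightarrow> 'b \<Rightarrow> 'b list list \<Rightarrow>\<^sub>0 'k" where
  "sigma_C C c =
     (if c = coaug C then bv []
      else Sum_any (\<lambda>i. lext (\<lambda>w. bv (map (\<lambda>x. [x]) w)) (red_diag_iter C i c)))"

definition nabla ::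
    "('b, 'k::comm_ring_1) free_dgc \<Rightarrow> 'b \<times> 'b list \<Rightarrow> ('b list \<times> 'b list list) \<Rightarrow>\<^sub>0 'k" where
  "nabla C = (\<lambda>(c, a). scl (sgnp (gdeg C c * cobar_deg C a)) (tens (bv a) (sigma_C C c)))"

definition nabla_dual ::
    "('b, 'k::comm_ring_1) free_dgc \<Rightarrow> ('b list \<times> 'b list list \<Rightarrow> 'k) \<Rightarrow> 'b \<times> 'b list \<Rightarrow> 'k" where
  "nabla_dual C f x = (if x \<in> gens (twisted C) then ev f (nabla C x) else 0)"

text \<open>
  \<open>Theta C b c\<close> is the value at \<open>s\<^sup>-\<^sup>1c\<close> of \<open>\<Theta>(sb)\<close>, for \<open>b\<close> in the dual basis.  As
  \<open>(s\<^sup>-\<^sup>1)\<^sup>\<or>(f) = (-1)\<^sup>|\<^sup>f\<^sup>| f \<circ> s\<^sup>-\<^sup>1\<close> and \<open>|\<Theta>(sb)| = 1 - |b|\<close>, the condition \<open>(s\<^sup>-\<^sup>1)\<^sup>\<or> \<circ> \<Theta> = s\<^sup>-\<^sup>1\<close> reads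
  \<open>(-1)\<^bsup>1-|b|\<^esup> \<Theta>(sb)(s\<^sup>-\<^sup>1c) = b(c)\<close>.
\<close>

definition Theta :: "('b, 'k::comm_ring_1) free_dgc \<Rightarrow> 'b \<Rightarrow> 'b \<Rightarrow> 'k" where
  "Theta C b c = sgnp (1 - gdeg C b) * (if c = b then 1 else 0)"

text \<open>
  \<open>\<Phi>(b \<otimes> \<Theta>(sb\<^sub>1) \<otimes> ... \<otimes> \<Theta>(sb\<^sub>k))\<close> as a linear form on \<open>C \<otimes> \<Omega>C\<close>; it vanishes on \<open>C \<otimes> (s\<^sup>-\<^sup>1C\<^sup>-)\<^bsup>\<otimes>l\<^esup>\<close> for
  \<open>l \<noteq> k\<close>.  The Koszul sign is that of moving each form next to its argument.
\<close>

definition PhiTheta_basis :: "('b, 'k::comm_ring_1) free_dgc \<Rightarrow> 'b \<times> 'b list \<Rightarrow> 'b \<times> 'b list \<Rightarrow> 'k" where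
  "PhiTheta_basis C = (\<lambda>(b, bs) (c, cs).
     if length cs = length bs then
       sgnp (koszul
         ([(0, - gdeg C b)] @ map (\<lambda>i. (i + 1, 1 - gdeg C (bs ! i))) [0..<length bs]
          @ [(0, gdeg C c)] @ map (\<lambda>i. (i + 1, gdeg C (cs ! i) - 1)) [0..<length cs]))
       * ((if c = b then 1 else 0) * (\<Prod>i<length bs. Theta C (bs ! i) (cs ! i)))
     else 0)"

definition PhiTheta ::
    "('b, 'k::comm_ring_1) free_dgc \<Rightarrow> (('b \<times> 'b list) \<Rightarrow>\<^sub>0 'k) \<Rightarrow> 'b \<times> 'b list \<Rightarrow> 'k" where
  "PhiTheta C p = (\<lambda>x. ev (\<lambda>y. PhiTheta_basis C y x) p)"

text \<open>\<open>HH\<^sup>*(\<Omega>C) \<rightarrow> HH\<^sub>*(C\<^sup>\<or>)\<close>\<close>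

definition HH_iso ::
    "('b, 'k::comm_ring_1) free_dgc \<Rightarrow>
     ('b list \<times> 'b list list \<Rightarrow> 'k) set \<Rightarrow> (('b \<times> 'b list) \<Rightarrow>\<^sub>0 'k) set" where
  "HH_iso C =
     inv_into (homology (free_cx (cyclic (dual_dga C))))
       (homology_map (free_cx (cyclic (dual_dga C))) (dual_cx (twisted C)) (PhiTheta C))
     \<circ> homology_map (dual_cx (cyclic (cobar C))) (dual_cx (twisted C)) (nabla_dual C)"

end

theory Submission imports Defs begin

text \<open>
  Both sides are compared with the graded dual \<open>D\<close> of the twisted tensor product \<open>C \<otimes> \<Omega>C\<close>.  The
  coproduct of \<open>C\<close> and the shuffle diagonal of \<open>\<Omega>C\<close> together define a product on \<open>D\<close> (\<open>tmul\<close>,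
  \<open>tprod\<close>), which is associative because both diagonals are coassociative and graded commutative
  because both are cocommutative.  The proof shows that \<open>D\<close> is a differential graded algebra, that
  \<open>\<nabla>\<^sup>\<or>\<close> carries the cup product strictly to the product of \<open>D\<close>, and that \<open>\<Phi> \<circ> (A \<otimes> T(\<Theta>))\<close> carries the
  shuffle product strictly to it.  As \<open>\<nabla>\<^sup>\<or>\<close> is a quasi-isomorphism and the other map an isomorphism of
  complexes, the algebra structure on the homology of \<open>D\<close> can be pulled back along both
  (\<open>homology_comparison\<close>), and the theorem follows.  In particular the cup product need be neither
  associative nor commutative before passing to homology.

  The cyclic bar construction of \<open>\<Omega>C\<close> is a tensor algebra on a tensor algebra, and a basis element
  \<open>a[sw\<^sub>1|...|sw\<^sub>k]\<close> is best regarded as the single word \<open>a s w\<^sub>1 s w\<^sub>2 ... s w\<^sub>k\<close> in letters of \<open>s\<^sup>-\<^sup>1C\<^sup>-\<close>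
  and one further letter \<open>s\<close> of degree 1.  All terms of the differential but the last one then form
  the derivation \<open>dW\<close> that extends the cobar differential by \<open>s \<mapsto> 1\<close>: deleting a bar multiplies
  its neighbours.  The last term, which wraps the last entry around, is \<open>Lst\<close>.  Words with an
  empty entry are degenerate and correspond to 0.

  Linear maps are handled through their transposes, which act on functions on words.  So \<open>dQ u F\<close> is
  the value of a form \<open>F\<close> on the boundary of the word \<open>u\<close>, and \<open>nab F (c, a)\<close> is its value on
  \<open>\<nabla>(c \<otimes> a)\<close>.  With this convention an identity between linear maps becomes an identity between
  scalars that is proved by induction on a word, and no bookkeeping of supports is needed until the
  very end.

  The steps that carry the argument are the following.  The Alexander-Whitney diagonal is a chain
  map, where cocommutativity is used for the internal differential (\<open>dQ_Diag\<close>); it restricts along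
  \<open>\<nabla>\<close> to the product of the coproduct and the shuffle diagonal (\<open>nab_Diag\<close>).  The inclusion has a
  retraction \<open>\<pi>\<close>, the cyclic derivative of the single bar entry (\<open>dQ_piw\<close>, \<open>nab_piw\<close>), and an explicit
  homotopy contracts the part of the differential that only multiplies entries (\<open>homotopy\<close>);
  the remaining terms lower the internal degree and are treated by a filtration (\<open>exact\<close>).  The Leibniz rule in \<open>D\<close> need not be computed: it is inherited from \<open>dQ_Diag\<close>
  by lifting forms along \<open>\<pi>\<close> (\<open>dT_tmul\<close>).  On the other side the comparison map is diagonal in the
  given bases, with an explicit sign (\<open>PhiTheta_eq\<close>), so that its compatibility with the differential
  (\<open>dif_transpose\<close>) and the product (\<open>PhiTheta_mult\<close>) are statements about structure constants.
\<close>


section \<open>Signs\<close>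

lemma sgnp_0 [simp]: "sgnp 0 = 1" and sgnp_1 [simp]: "sgnp 1 = -1"
  by (simp_all add: sgnp_def)

lemma sgnp_add: "sgnp (a + b) = sgnp a * sgnp b"
  and sgnp_uminus: "sgnp (- a) = sgnp a"
  and sgnp_diff: "sgnp (a - b) = sgnp a * sgnp b"
  and sgnp_square: "sgnp (a * a) = sgnp a"
  and sgnp_square_mult: "sgnp (a * (a * b)) = sgnp (a * b)"
  and sgnp_double: "sgnp (2 * a) = 1" "sgnp (a * 2) = 1" "sgnp 2 = 1"
  by (auto simp: sgnp_def)

lemma sgnp_self: "sgnp a * sgnp a = 1" and sgnp_cancel: "sgnp a * (sgnp a * x) = x"
  by (auto simp: sgnp_def)

text \<open>
  Together with \<open>algebra_simps\<close> these rules bring a product of signs of polynomial exponents to a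
  normal form: exponents are expanded into monomials, and squares cancel.
\<close>

lemmas sgn_norm = sgnp_add sgnp_uminus sgnp_diff sgnp_square sgnp_square_mult sgnp_double
  sgnp_self sgnp_cancel algebra_simps

lemma sgnp_cong: "even (a - b) \<Longrightarrow> sgnp a = sgnp b"
  by (auto simp: sgnp_def)

lemma koszul_append:
  "koszul (xs @ ys) = koszul xs + koszul ys
     + (\<Sum>t\<leftarrow>xs. \<Sum>u\<leftarrow>filter (\<lambda>u. fst u < fst t) ys. snd t * snd u)"
  by (induction xs) (simp_all add: algebra_simps)

section \<open>Evaluation of linear forms\<close>

lemma lookup_scl [simp]: "Poly_Mapping.lookup (scl a p) x = a * Poly_Mapping.lookup p x"
  by (simp add: scl_def Poly_Mapping.map.rep_eq when_def)

lemma ev_superset: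
  assumes "finite S" "Poly_Mapping.keys p \<subseteq> S"
  shows "ev f p = (\<Sum>x\<in>S. Poly_Mapping.lookup p x * f x)"
  unfolding ev_def using assms
  by (intro sum.mono_neutral_left) (auto simp: in_keys_iff)

lemma ev_cong: "(\<And>x. x \<in> Poly_Mapping.keys p \<Longrightarrow> f x = g x) \<Longrightarrow> ev f p = ev g p"
  unfolding ev_def by (intro sum.cong) auto

lemma ev_0 [simp]: "ev f 0 = 0"
  by (simp add: ev_def)

lemma ev_bv [simp]: "ev f (bv x) = f x"
  by (simp add: ev_def bv_def)

lemma ev_single [simp]: "ev f (Poly_Mapping.single x c) = c * f x"
  by (simp add: ev_def)

lemma ev_add: "ev f (p + q) = ev f p + ev f q"
proof -
  have "Poly_Mapping.keys (p + q) \<subseteq> Poly_Mapping.keys p \<union> Poly_Mapping.keys q"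
    by (rule keys_add)
  thus ?thesis
    by (simp add: ev_superset[of "Poly_Mapping.keys p \<union> Poly_Mapping.keys q"] lookup_add
        distrib_right sum.distrib)
qed

lemma ev_uminus: "ev f (- p) = - ev f p"
  by (simp add: ev_def sum_negf)

lemma ev_diff: "ev f (p - q) = ev f p - ev f q"
  by (metis ev_add ev_uminus diff_conv_add_uminus)

lemma ev_scl: "ev f (scl a p) = a * ev f p"
proof -
  have "Poly_Mapping.keys (scl a p) \<subseteq> Poly_Mapping.keys p"
    by (auto simp: in_keys_iff)
  thus ?thesis
    by (simp add: ev_superset[of "Poly_Mapping.keys p"] sum_distrib_left mult.assoc)
qed

lemma ev_sum: "ev f (sum p S) = (\<Sum>i\<in>S. ev f (p i))"
  by (induction S rule: infinite_finite_induct) (simp_all add: ev_add)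

lemma ev_lext: "ev f (lext g p) = ev (\<lambda>x. ev f (g x)) p"
  unfolding lext_def by (simp add: ev_sum ev_scl ev_def[of "\<lambda>x. ev f (g x)"])

lemma ev_tens: "ev f (tens p q) = ev (\<lambda>x. ev (\<lambda>y. f (x, y)) q) p"
  by (simp add: tens_def ev_lext)

lemma ev_fun_0 [simp]: "ev (\<lambda>x. 0) p = 0"
  by (simp add: ev_def)

lemma ev_fun_add: "ev (\<lambda>x. f x + g x) p = ev f p + ev g p"
  by (simp add: ev_def distrib_left sum.distrib)

lemma ev_fun_uminus: "ev (\<lambda>x. - f x) p = - ev f p"
  by (simp add: ev_def sum_negf)

lemma ev_fun_diff: "ev (\<lambda>x. f x - g x) p = ev f p - ev g p"
  by (simp add: ev_def right_diff_distrib sum_subtractf)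

lemma ev_fun_mult: "ev (\<lambda>x. a * f x) p = a * ev f p"
  by (simp add: ev_def sum_distrib_left mult.left_commute)

lemma ev_fun_sum: "ev (\<lambda>x. \<Sum>i\<in>S. f i x) p = (\<Sum>i\<in>S. ev (f i) p)"
  by (induction S rule: infinite_finite_induct) (simp_all add: ev_fun_add)

lemma ev_swap: "ev (\<lambda>x. ev (\<lambda>y. f x y) q) p = ev (\<lambda>y. ev (\<lambda>x. f x y) p) q"
  unfolding ev_def by (simp add: sum_distrib_left) (subst sum.swap, simp add: mult.left_commute)

lemmas ev_fun_lin = ev_fun_0 ev_fun_add ev_fun_uminus ev_fun_diff ev_fun_mult
lemmas ev_lin = ev_0 ev_bv ev_single ev_add ev_uminus ev_diff ev_scl ev_lext ev_tens

lemma lookup_eq_ev: "Poly_Mapping.lookup p x = ev (\<lambda>y. if y = x then 1 else 0) p"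
  by (simp add: ev_def if_distrib[of "(*) _"] sum.delta in_keys_iff cong: if_cong)

text \<open>
  An element of a free module is determined by the values of all forms on it; this reduces
  identities of chains to the calculus of \<open>ev\<close>.
\<close>

lemma ev_eqI: "(\<And>f. ev f p = ev f q) \<Longrightarrow> p = q"
  by (rule poly_mapping_eqI) (simp only: lookup_eq_ev)

lemma lookup_lext: "Poly_Mapping.lookup (lext f p) y = ev (\<lambda>x. Poly_Mapping.lookup (f x) y) p"
  by (simp only: lookup_eq_ev ev_lext)

lemma lookup_tens: "Poly_Mapping.lookup (tens p q) (x, y) = Poly_Mapping.lookup p x * Poly_Mapping.lookup q y"
proof -
  have "Poly_Mapping.lookup (tens p q) (x, y)
      = ev (\<lambda>x'. ev (\<lambda>y'. (if x' = x then 1 else 0) * (if y' = y then 1 else 0)) q) p"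
    unfolding lookup_eq_ev ev_tens by (intro ev_cong) auto
  also have "\<dots> = ev (\<lambda>x'. Poly_Mapping.lookup q y * (if x' = x then 1 else 0)) p"
    by (simp add: ev_fun_mult lookup_eq_ev mult.commute)
  also have "\<dots> = Poly_Mapping.lookup p x * Poly_Mapping.lookup q y"
    by (simp add: ev_fun_mult lookup_eq_ev[of p] mult.commute)
  finally show ?thesis .
qed

lemma keys_lext: "y \<in> Poly_Mapping.keys (lext f p) \<Longrightarrow> \<exists>x\<in>Poly_Mapping.keys p. y \<in> Poly_Mapping.keys (f x)"
proof (rule ccontr)
  assume y: "y \<in> Poly_Mapping.keys (lext f p)" and n: "\<not> (\<exists>x\<in>Poly_Mapping.keys p. y \<in> Poly_Mapping.keys (f x))"
  have "Poly_Mapping.lookup (lext f p) y = ev (\<lambda>x. 0) p"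
    unfolding lookup_lext using n by (intro ev_cong) (auto simp: in_keys_iff)
  with y show False by (simp add: in_keys_iff)
qed

lemma scl_one [simp]: "scl 1 p = p"
  by (rule poly_mapping_eqI) simp

lemma lext_add: "lext f (p + q) = lext f p + lext f q"
  by (rule ev_eqI) (simp add: ev_lin)

lemma lext_scl: "lext f (scl a p) = scl a (lext f p)"
  by (rule ev_eqI) (simp add: ev_lin)

lemma lext_0 [simp]: "lext f 0 = 0"
  by (rule ev_eqI) (simp add: ev_lin)

lemma lext_bv [simp]: "lext f (bv x) = f x"
  by (rule ev_eqI) (simp add: ev_lin)


section \<open>Reduced diagonal\<close>

locale cobar_setting = coaugmented_dgc C for C :: "('b, 'k::comm_ring_1) free_dgc" +
  assumes sc: "simply_connected C"
begin

abbreviation one :: 'b where "one \<equiv> coaug C"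
abbreviation Cb :: "'b set" where "Cb \<equiv> gens C - {one}"

lemma deg_Cb: "c \<in> Cb \<Longrightarrow> gdeg C c \<ge> 2"
  using sc by (auto simp: simply_connected_def)

lemma counit_gens: "c \<in> gens C \<Longrightarrow> counit C c = (if c = one then 1 else 0)"
  using deg_Cb counit_deg coaug_counit by force

lemma dif_Cb: "c \<in> gens C \<Longrightarrow> b \<in> Poly_Mapping.keys (gdif C c) \<Longrightarrow> b \<in> Cb \<and> gdeg C b = gdeg C c - 1"
  using dif_closed[of c b] deg_Cb[of c] coaug_dif coaug_gen by (cases "c = one") auto

lemma ev_red: "ev f (red_diag C c) = ev (\<lambda>(x, y). if x = one \<or> y = one then 0 else f (x, y)) (codiag C c)"
  unfolding red_diag_def ev_lext by (intro ev_cong) (auto simp: ev_lin)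

lemma red_keys:
  assumes "c \<in> gens C" "(x, y) \<in> Poly_Mapping.keys (red_diag C c)"
  shows "x \<in> Cb \<and> y \<in> Cb \<and> gdeg C x + gdeg C y = gdeg C c"
proof -
  obtain p where "p \<in> Poly_Mapping.keys (codiag C c)"
    "(x, y) \<in> Poly_Mapping.keys ((case p of (x, y) \<Rightarrow> if x = one \<or> y = one then 0 else bv (x, y)) :: _ \<Rightarrow>\<^sub>0 'k)"
    using keys_lext[OF assms(2)[unfolded red_diag_def]] by blast
  then show ?thesis using codiag_closed[OF assms(1)]
    by (cases p) (auto simp: bv_def split: if_splits)
qed

lemma red_keys':
  assumes "c \<in> gens C" "(x, y) \<in> Poly_Mapping.keys (red_diag C c)"
  shows "x \<in> gens C \<and> x \<noteq> one \<and> y \<in> gens C \<and> y \<noteq> one \<and> gdeg C x + gdeg C y = gdeg C c"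
  using red_keys[OF assms] by auto

lemma dif_Cb': "c \<in> gens C \<Longrightarrow> b \<in> Poly_Mapping.keys (gdif C c) \<Longrightarrow> b \<in> gens C \<and> b \<noteq> one \<and> gdeg C b = gdeg C c - 1"
  using dif_Cb by blast

lemma ev_red_cong:
  assumes "c \<in> gens C"
    "\<And>x y. x \<in> Cb \<Longrightarrow> y \<in> Cb \<Longrightarrow> gdeg C x + gdeg C y = gdeg C c \<Longrightarrow> f x y = g x y"
  shows "ev (\<lambda>(x, y). f x y) (red_diag C c) = ev (\<lambda>(x, y). g x y) (red_diag C c)"
proof (intro ev_cong, clarify)
  fix x y assume "(x, y) \<in> Poly_Mapping.keys (red_diag C c)"
  from red_keys[OF assms(1) this] show "f x y = g x y" by (intro assms(2)) auto
qed

lemma ev_dif_cong: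
  assumes "c \<in> gens C" "\<And>x. x \<in> Cb \<Longrightarrow> gdeg C x = gdeg C c - 1 \<Longrightarrow> f x = g x"
  shows "ev f (gdif C c) = ev g (gdif C c)"
proof (intro ev_cong)
  fix x assume "x \<in> Poly_Mapping.keys (gdif C c)"
  from dif_Cb[OF assms(1) this] show "f x = g x" by (intro assms(2)) auto
qed

lemma ev_counit_left:
  assumes "c \<in> gens C"
  shows "ev (\<lambda>(x, y). if x = one then g y else 0) (codiag C c) = g c"
proof -
  have "g c = ev g (lext (\<lambda>(x, y). scl (counit C x) (bv y)) (codiag C c))"
    using counit_left[OF assms] by simp
  also have "\<dots> = ev (\<lambda>(x, y). if x = one then g y else 0) (codiag C c)"
    unfolding ev_lext using codiag_closed[OF assms]
    by (intro ev_cong) (auto simp: ev_lin counit_gens split: prod.splits)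
  finally show ?thesis by simp
qed

lemma ev_counit_right:
  assumes "c \<in> gens C"
  shows "ev (\<lambda>(x, y). if y = one then g x else 0) (codiag C c) = g c"
proof -
  have "g c = ev g (lext (\<lambda>(x, y). scl (counit C y) (bv x)) (codiag C c))"
    using counit_right[OF assms] by simp
  also have "\<dots> = ev (\<lambda>(x, y). if y = one then g x else 0) (codiag C c)"
    unfolding ev_lext using codiag_closed[OF assms]
    by (intro ev_cong) (auto simp: ev_lin counit_gens split: prod.splits)
  finally show ?thesis by simp
qed

lemma ev_codiag:
  assumes "c \<in> Cb"
  shows "ev f (codiag C c) = f (one, c) + f (c, one) + ev f (red_diag C c)"
proof -
  have c: "c \<in> gens C" using assms by auto
  have "ev f (codiag C c) =
      ev (\<lambda>p. (case p of (x, y) \<Rightarrow> if x = one then f (one, y) else 0)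
            + ((case p of (x, y) \<Rightarrow> if y = one then f (x, one) else 0)
            - (case p of (x, y) \<Rightarrow> if x = one then if y = one then f (one, one) else 0 else 0)
            + (case p of (x, y) \<Rightarrow> if x = one \<or> y = one then 0 else f (x, y)))) (codiag C c)"
    by (intro ev_cong) auto
  also have "\<dots> = f (one, c) + (f (c, one) - (if c = one then f (one, one) else 0) + ev f (red_diag C c))"
    unfolding ev_fun_add ev_fun_diff ev_red
    by (simp add: ev_counit_left[OF c] ev_counit_right[OF c])
  finally show ?thesis using assms by simp
qed

text \<open>
  Coassociativity of the reduced diagonal follows from that of the full one by evaluating on
  forms that vanish as soon as one argument is the coaugmentation.
\<close>

lemma red_coassoc:
  assumes "c \<in> Cb"
  shows "ev (\<lambda>(x, y). ev (\<lambda>(x', x''). F x' x'' y) (red_diag C x)) (red_diag C c)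
       = ev (\<lambda>(x, y). ev (\<lambda>(y', y''). F x y' y'') (red_diag C y)) (red_diag C c)"
proof -
  define G where "G = (\<lambda>(x, y, z). if x = one \<or> y = one \<or> z = one then 0 else F x y z)"
  have G: "G (one, p) = 0" "G (x, one, z) = 0" "G (x, y, one) = 0"
    "x \<noteq> one \<Longrightarrow> y \<noteq> one \<Longrightarrow> z \<noteq> one \<Longrightarrow> G (x, y, z) = F x y z" for x y z p
    by (cases p; simp add: G_def)+
  have c: "c \<in> gens C" using assms by auto
  have cod: "ev H (codiag C x) = (if x = one then H (one, one) else H (one, x) + H (x, one) + ev H (red_diag C x))"
    if "x \<in> gens C" for H :: "_ \<Rightarrow> 'k" and x using that ev_codiag[of x H] by (auto simp: coaug_codiag)
  have L: "ev G (lext (\<lambda>(x, y). lext (\<lambda>(x', x''). bv (x', x'', y)) (codiag C x)) (codiag C c))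
      = ev (\<lambda>(x, y). ev (\<lambda>(x', x''). F x' x'' y) (red_diag C x)) (red_diag C c)"
    unfolding ev_lext ev_red[of _ c]
    by (intro ev_cong) (use codiag_closed[OF c] in \<open>auto simp: ev_lext cod G case_prod_unfold
          intro!: ev_cong dest!: red_keys'[rotated]\<close>)
  have R: "ev G (lext (\<lambda>(x, y). lext (\<lambda>(y', y''). bv (x, y', y'')) (codiag C y)) (codiag C c))
      = ev (\<lambda>(x, y). ev (\<lambda>(y', y''). F x y' y'') (red_diag C y)) (red_diag C c)"
    unfolding ev_lext ev_red[of _ c]
    by (intro ev_cong) (use codiag_closed[OF c] in \<open>auto simp: ev_lext cod G case_prod_unfold
          intro!: ev_cong dest!: red_keys'[rotated]\<close>)
  show ?thesis using coassoc[OF c] L R by simp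
qed

lemma red_dif:
  assumes "c \<in> Cb"
  shows "ev (\<lambda>b. ev (\<lambda>(x, y). F x y) (red_diag C b)) (gdif C c)
    = ev (\<lambda>(x, y). ev (\<lambda>x'. F x' y) (gdif C x) + sgnp (gdeg C x) * ev (\<lambda>y'. F x y') (gdif C y)) (red_diag C c)"
proof -
  define G where "G = (\<lambda>(x, y). if x = one \<or> y = one then 0 else F x y)"
  have c: "c \<in> gens C" using assms by auto
  have "ev G (lext (codiag C) (gdif C c)) = ev (\<lambda>b. ev (\<lambda>(x, y). F x y) (red_diag C b)) (gdif C c)"
    unfolding ev_lext by (intro ev_cong) (auto simp: ev_red G_def intro!: ev_cong)
  moreover have "ev G (lext (tens_dif C C) (codiag C c))
     = ev (\<lambda>(x, y). ev (\<lambda>x'. F x' y) (gdif C x) + sgnp (gdeg C x) * ev (\<lambda>y'. F x y') (gdif C y)) (red_diag C c)"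
    unfolding ev_lext ev_red[of _ c]
  proof (intro ev_cong, clarify)
    fix x y assume "(x, y) \<in> Poly_Mapping.keys (codiag C c)"
    then have xy: "x \<in> gens C" "y \<in> gens C" using codiag_closed[OF c] by auto
    have 1: "ev (\<lambda>x'. G (x', y)) (gdif C x) = (if y = one then 0 else ev (\<lambda>x'. F x' y) (gdif C x))"
      by (cases "y = one") (auto simp: G_def intro!: ev_cong dest!: dif_Cb'[OF xy(1)])
    have 2: "ev (\<lambda>y'. G (x, y')) (gdif C y) = (if x = one then 0 else ev (\<lambda>y'. F x y') (gdif C y))"
      by (cases "x = one") (auto simp: G_def intro!: ev_cong dest!: dif_Cb'[OF xy(2)])
    show "ev G (tens_dif C C (x, y)) = (if x = one \<or> y = one then 0
       else ev (\<lambda>x'. F x' y) (gdif C x) + sgnp (gdeg C x) * ev (\<lambda>y'. F x y') (gdif C y))"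
      by (auto simp: tens_dif_def ev_lin 1 2 coaug_dif)
  qed
  ultimately show ?thesis using codiag_dif[OF c] by simp
qed

section \<open>The differential on words\<close>

text \<open>
  In a word, \<open>None\<close> is the suspension \<open>s\<close> that opens a bar entry, and \<open>Some c\<close> is the letter \<open>s\<^sup>-\<^sup>1c\<close>.
\<close>

definition ld :: "'b option \<Rightarrow> int" where
  "ld x = (case x of None \<Rightarrow> 1 | Some c \<Rightarrow> gdeg C c - 1)"

definition wd :: "'b option list \<Rightarrow> int" where
  "wd w = (\<Sum>x\<leftarrow>w. ld x)"

definition ok :: "'b option list \<Rightarrow> bool" where
  "ok w \<longleftrightarrow> set w \<subseteq> insert None (Some ` Cb)"

lemma ld_simps [simp]: "ld None = 1" "ld (Some c) = gdeg C c - 1"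
  by (simp_all add: ld_def)

lemma wd_simps [simp]: "wd [] = 0" "wd (x # w) = ld x + wd w" "wd (u @ v) = wd u + wd v"
  by (simp_all add: wd_def)

lemma ok_simps [simp]: "ok []" "ok (None # w) = ok w" "ok (Some c # w) \<longleftrightarrow> c \<in> Cb \<and> ok w"
  "ok (u @ v) \<longleftrightarrow> ok u \<and> ok v"
  by (auto simp: ok_def)

text \<open>
  The value of \<open>F\<close> on the image of one letter under the derivation \<open>dW\<close>.  The clause for \<open>None\<close>
  says that this derivation sends \<open>s\<close> to the empty word.
\<close>

definition dl :: "'b option \<Rightarrow> ('b option list \<Rightarrow> 'k) \<Rightarrow> 'k" where
  "dl x F = (case x of None \<Rightarrow> F []
     | Some c \<Rightarrow> ev (\<lambda>(x, y). sgnp (gdeg C x) * F [Some x, Some y]) (red_diag C c)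
                 - ev (\<lambda>x. F [Some x]) (gdif C c))"

primrec dW :: "'b option list \<Rightarrow> ('b option list \<Rightarrow> 'k) \<Rightarrow> 'k" where
  "dW [] F = 0"
| "dW (x # w) F = dl x (\<lambda>u. F (u @ w)) + sgnp (ld x) * dW w (\<lambda>v. F (x # v))"

lemma dl_None [simp]: "dl None F = F []" by (simp add: dl_def)

lemma dl_lin:
  "dl x (\<lambda>z. F z + G z) = dl x F + dl x G"
  "dl x (\<lambda>z. F z - G z) = dl x F - dl x G"
  "dl x (\<lambda>z. - F z) = - dl x F"
  "dl x (\<lambda>z. a * F z) = a * dl x F"
  "dl x (\<lambda>z. 0) = 0"
  unfolding dl_def by (cases x; simp add: case_prod_unfold distrib_left right_diff_distrib
    mult.left_commute[of _ a] ev_fun_lin)+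

lemma dW_lin:
  "dW w (\<lambda>z. F z + G z) = dW w F + dW w G"
  "dW w (\<lambda>z. F z - G z) = dW w F - dW w G"
  "dW w (\<lambda>z. - F z) = - dW w F"
  "dW w (\<lambda>z. a * F z) = a * dW w F"
  "dW w (\<lambda>z. 0) = 0"
proof -
  show a: "dW w (\<lambda>z. F z + G z) = dW w F + dW w G" for F G
    by (induction w arbitrary: F G) (simp_all add: dl_lin algebra_simps)
  show b: "dW w (\<lambda>z. - F z) = - dW w F" for F
    by (induction w arbitrary: F) (simp_all add: dl_lin algebra_simps)
  show "dW w (\<lambda>z. F z - G z) = dW w F - dW w G"
    using a[of F "\<lambda>z. - G z"] by (simp add: b)
  show "dW w (\<lambda>z. a * F z) = a * dW w F"
    by (induction w arbitrary: F) (simp_all add: dl_lin algebra_simps)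
  show "dW w (\<lambda>z. 0) = 0"
    by (induction w) (simp_all add: dl_lin)
qed

lemma dl_ev: "dl x (\<lambda>z. ev (\<lambda>b. F b z) p) = ev (\<lambda>b. dl x (F b)) p"
proof (cases x)
  case (Some c)
  have "ev (\<lambda>(x, y). sgnp (gdeg C x) * ev (\<lambda>b. F b [Some x, Some y]) p) (red_diag C c)
     = ev (\<lambda>b. ev (\<lambda>(x, y). sgnp (gdeg C x) * F b [Some x, Some y]) (red_diag C c)) p"
    by (simp only: case_prod_unfold ev_fun_mult[symmetric]) (rule ev_swap)
  then show ?thesis unfolding dl_def Some option.case
    by (simp only: ev_fun_diff ev_swap[of _ p])
qed simp

lemma dl_dl: "dl x (\<lambda>a. dl y (F a)) = dl y (\<lambda>b. dl x (\<lambda>a. F a b))"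
proof (cases x)
  case (Some c)
  show ?thesis unfolding Some dl_def[of "Some c"] option.case
    by (simp only: case_prod_unfold dl_ev dl_lin)
qed simp

lemma dW_dl: "dW w (\<lambda>a. dl y (F a)) = dl y (\<lambda>b. dW w (\<lambda>a. F a b))"
proof (induction w arbitrary: F)
  case (Cons x w)
  show ?case by (simp add: dl_lin Cons.IH dl_dl[of x y])
qed (simp add: dl_lin)

text \<open>
  The words that can occur in the boundary of \<open>w\<close>; forms only matter on these.
\<close>

definition drv :: "'b option list \<Rightarrow> 'b option list \<Rightarrow> bool" where
  "drv w z \<longleftrightarrow> ok z \<and> wd z = wd w - 1 \<and> (None \<notin> set w \<longrightarrow> None \<notin> set z)"

lemma dl_cong:
  assumes "ok [x]" "\<And>z. drv [x] z \<Longrightarrow> F z = G z"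
  shows "dl x F = dl x G"
proof (cases x)
  case None
  then show ?thesis using assms(2)[of "[]"] by (simp add: drv_def)
next
  case (Some c)
  then have c: "c \<in> gens C" using assms(1) by simp
  have "F [Some x, Some y] = G [Some x, Some y]" if "x \<in> Cb" "y \<in> Cb" "gdeg C x + gdeg C y = gdeg C c" for x y
    using that by (intro assms(2)) (simp add: drv_def Some)
  then have 1: "ev (\<lambda>(x, y). sgnp (gdeg C x) * F [Some x, Some y]) (red_diag C c)
      = ev (\<lambda>(x, y). sgnp (gdeg C x) * G [Some x, Some y]) (red_diag C c)"
    by (intro ev_red_cong[OF c]) simp
  have "F [Some x] = G [Some x]" if "x \<in> Cb" "gdeg C x = gdeg C c - 1" for x
    using that by (intro assms(2)) (simp add: drv_def Some)
  then have 2: "ev (\<lambda>x. F [Some x]) (gdif C c) = ev (\<lambda>x. G [Some x]) (gdif C c)"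
    by (intro ev_dif_cong[OF c]) simp
  show ?thesis by (simp add: dl_def Some 1 2)
qed

lemma dW_cong:
  assumes "ok w" "\<And>z. drv w z \<Longrightarrow> F z = G z"
  shows "dW w F = dW w G"
  using assms
proof (induction w arbitrary: F G)
  case (Cons x w)
  have x: "ok [x]" and w: "ok w" using Cons.prems(1) by (auto simp: ok_def)
  have "dl x (\<lambda>u. F (u @ w)) = dl x (\<lambda>u. G (u @ w))"
    by (rule dl_cong[OF x], rule Cons.prems(2)) (use w in \<open>auto simp: drv_def\<close>)
  moreover have "dW w (\<lambda>v. F (x # v)) = dW w (\<lambda>v. G (x # v))"
    by (rule Cons.IH[OF w], rule Cons.prems(2)) (use Cons.prems(1) in \<open>auto simp: drv_def ok_def\<close>)
  ultimately show ?case by simp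
qed simp

lemma dW_append: "dW (u @ v) F = dW u (\<lambda>z. F (z @ v)) + sgnp (wd u) * dW v (\<lambda>z. F (u @ z))"
  by (induction u arbitrary: F) (simp_all add: sgnp_add algebra_simps)

text \<open>
  On a letter, \<open>d\<^sup>2 = 0\<close> is the conjunction of \<open>d\<^sup>2 = 0\<close> in \<open>C\<close>, the compatibility of the reduced
  diagonal with \<open>d\<close>, and coassociativity.
\<close>

lemma dl_dW: "ok [x] \<Longrightarrow> dl x (\<lambda>z. dW z F) = 0"
proof (cases x)
  case (Some c)
  assume "ok [x]"
  then have c: "c \<in> gens C" "c \<in> Cb" using Some by auto
  let ?T = "\<lambda>F. ev (\<lambda>(x, y). ev (\<lambda>(y', y''). F x y' y'') (red_diag C y)) (red_diag C c)"
  have q1: "ev (\<lambda>(x, y). sgnp (gdeg C x) * ev (\<lambda>(x', x''). sgnp (gdeg C x') * F [Some x', Some x'', Some y]) (red_diag C x)) (red_diag C c)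
    = ?T (\<lambda>x y z. sgnp (gdeg C y) * F [Some x, Some y, Some z])"
    (is "?l = _")
  proof -
    have "?l = ev (\<lambda>(x, y). ev (\<lambda>(x', x''). sgnp (gdeg C x'') * F [Some x', Some x'', Some y]) (red_diag C x)) (red_diag C c)"
    proof (intro ev_red_cong c, goal_cases)
      case (1 x y)
      then have x: "x \<in> gens C" by auto
      have e: "sgnp (gdeg C x) * (sgnp (gdeg C x') * v) = (sgnp (gdeg C x'') * v :: 'k)" if "gdeg C x' + gdeg C x'' = gdeg C x" for x' x'' v
        unfolding that[symmetric] by (simp add: sgn_norm)
      show ?case unfolding ev_fun_mult[symmetric] case_prod_unfold
        by (rule ev_cong, rule e) (use red_keys[OF x] in auto)
    qed
    then show ?thesis by (simp add: red_coassoc[OF c(2)])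
  qed
  have q2: "ev (\<lambda>b. ev (\<lambda>(x, y). sgnp (gdeg C x) * F [Some x, Some y]) (red_diag C b)) (gdif C c)
     = ev (\<lambda>(x, y). - (sgnp (gdeg C x) * ev (\<lambda>x'. F [Some x', Some y]) (gdif C x))
            + ev (\<lambda>y'. F [Some x, Some y']) (gdif C y)) (red_diag C c)"
    unfolding red_dif[OF c(2)]
  proof (intro ev_red_cong c, goal_cases)
    case (1 x y)
    have "ev (\<lambda>x'. sgnp (gdeg C x') * F [Some x', Some y]) (gdif C x)
       = ev (\<lambda>x'. - sgnp (gdeg C x) * F [Some x', Some y]) (gdif C x)"
      using 1 by (intro ev_dif_cong) (auto simp: sgnp_diff)
    then show ?case by (simp add: ev_fun_lin sgn_norm)
  qed
  have q3: "ev (\<lambda>b. ev (\<lambda>x. F [Some x]) (gdif C b)) (gdif C c) = 0"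
    using arg_cong[OF dif_dif[OF c(1)], of "ev (\<lambda>x. F [Some x])"] by (simp add: ev_lin)
  show ?thesis using q1 q2 q3 unfolding dl_def Some
    by (simp add: dl_def case_prod_unfold ev_fun_lin sgn_norm)
qed simp

lemma dW_dW: "ok w \<Longrightarrow> dW w (\<lambda>z. dW z F) = 0"
proof (induction w arbitrary: F)
  case (Cons x w)
  have x: "ok [x]" and w: "ok w" using Cons.prems(1) by (auto simp: ok_def)
  have "dl x (\<lambda>u. sgnp (wd u) * dW w (\<lambda>z. F (u @ z))) = dl x (\<lambda>u. - sgnp (ld x) * dW w (\<lambda>z. F (u @ z)))"
    by (rule dl_cong[OF x]) (auto simp: drv_def sgnp_diff)
  then show ?case
    by (simp add: dW_append dl_lin dW_lin dl_dW[OF x] Cons.IH[OF w] dW_dl sgn_norm)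
qed simp

section \<open>The cyclic differential on words\<close>

text \<open>
  The wrap-around term of the cyclic bar differential: the last entry \<open>w\<close> of \<open>u = x s w\<close> is moved to
  the front, and its bar is deleted.
\<close>

definition Lst :: "'b option list \<Rightarrow> ('b option list \<Rightarrow> 'k) \<Rightarrow> 'k" where
  "Lst u F = (if None \<in> set u then
      let w = rev (takeWhile (\<lambda>x. x \<noteq> None) (rev u)); x = rev (tl (dropWhile (\<lambda>x. x \<noteq> None) (rev u)))
      in - sgnp ((wd w + 1) * wd x) * F (w @ x) else 0)"

definition dQ :: "'b option list \<Rightarrow> ('b option list \<Rightarrow> 'k) \<Rightarrow> 'k" where
  "dQ u F = dW u F + Lst u F"

lemma Lst_free [simp]: "None \<notin> set u \<Longrightarrow> Lst u F = 0"
  by (simp add: Lst_def)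

lemma Lst_last [simp]: "None \<notin> set w \<Longrightarrow> Lst (x @ None # w) F = - sgnp ((wd w + 1) * wd x) * F (w @ x)"
proof -
  assume "None \<notin> set w"
  moreover have "takeWhile (\<lambda>x. x \<noteq> None) (v @ None # r) = v \<and> dropWhile (\<lambda>x. x \<noteq> None) (v @ None # r) = None # r"
    if "None \<notin> set v" for v r :: "'b option list" using that by (induction v) (auto, metis option.exhaust)
  ultimately have "takeWhile (\<lambda>x. x \<noteq> None) (rev w @ None # rev x) = rev w"
    "dropWhile (\<lambda>x. x \<noteq> None) (rev w @ None # rev x) = None # rev x" by simp_all
  then show ?thesis by (simp add: Lst_def)
qed

lemma Lst_last' [simp]: "None \<notin> set w \<Longrightarrow> Lst (None # w) F = - F w"
  using Lst_last[of w "[]"] by simp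

lemma word_cases:
  obtains "None \<notin> set u" | x w where "u = x @ None # w" "None \<notin> set w"
  by (metis split_list_last)

lemma Lst_lin:
  "Lst w (\<lambda>z. F z + G z) = Lst w F + Lst w G"
  "Lst w (\<lambda>z. F z - G z) = Lst w F - Lst w G"
  "Lst w (\<lambda>z. - F z) = - Lst w F"
  "Lst w (\<lambda>z. a * F z) = a * Lst w F"
  "Lst w (\<lambda>z. 0) = 0"
  by (simp_all add: Lst_def Let_def algebra_simps)

lemma dQ_lin:
  "dQ w (\<lambda>z. F z + G z) = dQ w F + dQ w G"
  "dQ w (\<lambda>z. F z - G z) = dQ w F - dQ w G"
  "dQ w (\<lambda>z. - F z) = - dQ w F"
  "dQ w (\<lambda>z. a * F z) = a * dQ w F"
  "dQ w (\<lambda>z. 0) = 0"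
  by (simp_all add: dQ_def dW_lin Lst_lin algebra_simps)

lemma Lst_cong:
  assumes "ok u" "\<And>z. ok z \<Longrightarrow> wd z = wd u - 1 \<Longrightarrow> F z = G z"
  shows "Lst u F = Lst u G"
  by (cases u rule: word_cases) (use assms in auto)

lemma dQ_cong:
  assumes "ok u" "\<And>z. ok z \<Longrightarrow> wd z = wd u - 1 \<Longrightarrow> F z = G z"
  shows "dQ u F = dQ u G"
proof -
  have "dW u F = dW u G" by (rule dW_cong) (use assms in \<open>auto simp: drv_def\<close>)
  moreover have "Lst u F = Lst u G" by (rule Lst_cong) (use assms in auto)
  ultimately show ?thesis by (simp add: dQ_def)
qed

text \<open>
  As \<open>dW\<close> squares to zero, only the mixed terms and the square of \<open>Lst\<close> are left.  These cancel according
  to the last and the last but one bar: deleting the last bar and then wrapping around the merged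
  entry is the same as wrapping around twice.
\<close>

lemma dQ_dQ:
  assumes "ok u"
  shows "dQ u (\<lambda>z. dQ z F) = 0"
proof (cases u rule: word_cases)
  case 1
  then have "dW u (\<lambda>z. Lst z F) = dW u (\<lambda>z. 0)"
    by (intro dW_cong assms) (simp add: drv_def)
  then show ?thesis using 1 by (simp add: dQ_def dW_lin dW_dW assms)
next
  case (2 x w)
  have x: "ok x" and w: "ok w" using 2 assms by auto
  have A: "dW x (\<lambda>z. Lst (z @ None # w) F) = - sgnp ((wd w + 1) * (wd x - 1)) * dW x (\<lambda>z. F (w @ z))"
    unfolding dW_lin(4)[symmetric] by (rule dW_cong[OF x]) (auto simp: 2 drv_def)
  have B: "dW w (\<lambda>z. Lst (x @ None # z) F) = - sgnp (wd w * wd x) * dW w (\<lambda>z. F (z @ x))"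
    unfolding dW_lin(4)[symmetric] by (rule dW_cong[OF w]) (use 2 in \<open>auto simp: drv_def\<close>)
  have E: "sgnp (wd x) * Lst (x @ w) F - sgnp ((wd w + 1) * wd x) * Lst (w @ x) F = 0"
  proof (cases x rule: word_cases)
    case 1
    then show ?thesis using 2(2) by simp
  next
    case (2 y v)
    have "Lst (x @ w) F = - sgnp ((wd v + wd w + 1) * wd y) * F (v @ w @ y)"
      using Lst_last[of "v @ w" y F] 2 \<open>None \<notin> set w\<close> by simp
    moreover have "Lst (w @ x) F = - sgnp ((wd v + 1) * (wd w + wd y)) * F (v @ w @ y)"
      using Lst_last[of v "w @ y" F] 2 by simp
    ultimately show ?thesis by (simp add: 2 sgn_norm)
  qed
  have U: "Lst u G = - sgnp ((wd w + 1) * wd x) * G (w @ x)" for G using 2 by simp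
  have DW: "dW u G = dW x (\<lambda>z. G (z @ None # w)) + sgnp (wd x) * (G (x @ w) - dW w (\<lambda>z. G (x @ None # z)))" for G
    by (simp add: 2 dW_append)
  have "dQ u (\<lambda>z. dQ z F) = dW u (\<lambda>z. Lst z F) + Lst u (\<lambda>z. dW z F) + Lst u (\<lambda>z. Lst z F)"
    by (simp add: dQ_def dW_lin Lst_lin dW_dW assms)
  also have "\<dots> = sgnp (wd x) * Lst (x @ w) F - sgnp ((wd w + 1) * wd x) * Lst (w @ x) F"
    unfolding U DW A B by (simp add: dW_append sgn_norm del: Lst_last)
  finally show ?thesis using E by simp
qed

text \<open>
  Reduced words: no entry is empty, that is, every \<open>None\<close> is followed by a letter.
\<close>

primrec rdc :: "'b option list \<Rightarrow> bool" where
  "rdc [] = True"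
| "rdc (x # w) = (rdc w \<and> (x = None \<longrightarrow> w \<noteq> [] \<and> hd w \<noteq> None))"

lemma not_rdc_cases:
  assumes "\<not> rdc u"
  obtains x where "u = x @ [None]" | x y where "u = x @ None # None # y"
proof -
  have "(\<exists>x. u = x @ [None]) \<or> (\<exists>x y. u = x @ None # None # y)"
    using assms
  proof (induction u)
    case (Cons a u)
    show ?case
    proof (cases "rdc u")
      case True
      then show ?thesis using Cons.prems
        by (cases u) (auto intro: exI[of _ "[]"])
    next
      case False
      from Cons.IH[OF this] show ?thesis by (metis append_Cons)
    qed
  qed simp
  then show ?thesis using that by blast
qed

lemma not_rdc_end [simp]: "\<not> rdc (x @ [None])"
  by (induction x) auto

lemma not_rdc_mid [simp]: "\<not> rdc (x @ None # None # y)"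
  by (induction x) auto

text \<open>
  The degenerate words span a subcomplex: if an entry is empty, the two ways of deleting an
  adjacent bar give the same word with opposite signs, and all other terms are degenerate.
\<close>

lemma dQ_not_rdc:
  assumes F: "\<And>z. \<not> rdc z \<Longrightarrow> F z = 0" and u: "\<not> rdc u"
  shows "dQ u F = 0"
  using u
proof (cases rule: not_rdc_cases)
  case (1 x)
  have "dW x (\<lambda>z. F (z @ [None])) = 0" by (simp add: F dW_lin)
  then show ?thesis using Lst_last[of "[]" x F] by (simp add: dQ_def 1 dW_append)
next
  case (2 x y)
  have "dW x (\<lambda>z. F (z @ None # None # y)) = 0" "dW y (\<lambda>z. F (x @ None # None # z)) = 0"
    by (simp_all add: F dW_lin)
  then have D: "dW u F = 0" by (simp add: 2 dW_append)
  have "Lst u F = 0"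
  proof (cases y rule: word_cases)
    case 1
    then show ?thesis using Lst_last[of y "x @ [None]" F] F[of "y @ x @ [None]"] not_rdc_end[of "y @ x"] by (simp add: 2)
  next
    case (2 y' w)
    then show ?thesis using Lst_last[of w "x @ None # None # y'" F] F[of "w @ x @ None # None # y'"] not_rdc_mid[of "w @ x" y']
      by (simp add: \<open>u = _\<close>)
  qed
  with D show ?thesis by (simp add: dQ_def)
qed

end


locale cocommutative_setting = cobar_setting +
  assumes cocomm: "cocommutative C"
begin

lemma red_cocomm:
  assumes "c \<in> gens C"
  shows "ev (\<lambda>(x, y). F x y) (red_diag C c) = ev (\<lambda>(x, y). sgnp (gdeg C x * gdeg C y) * F y x) (red_diag C c)"
proof -
  have "codiag C c = lext (\<lambda>(x, y). scl (sgnp (gdeg C x * gdeg C y)) (bv (y, x))) (codiag C c)"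
    using cocomm assms by (simp add: cocommutative_def)
  then have "ev (\<lambda>(x, y). F x y) (red_diag C c) = ev (\<lambda>(x, y). if x = one \<or> y = one then 0 else F x y)
      (lext (\<lambda>(x, y). scl (sgnp (gdeg C x * gdeg C y)) (bv (y, x))) (codiag C c))"
    by (simp add: ev_red cong: if_cong)
  also have "\<dots> = ev (\<lambda>(x, y). sgnp (gdeg C x * gdeg C y) * F y x) (red_diag C c)"
    unfolding ev_lext ev_red by (intro ev_cong) (auto simp: ev_lin)
  finally show ?thesis .
qed

end

section \<open>Unshuffles and cuts of words\<close>

context cobar_setting
begin

text \<open>
  \<open>lsel b\<close> and \<open>rsel b\<close> switch off the term in which a bar goes to the left or right factor: with
  \<open>b = True\<close> all bars stay on the left, with \<open>b = False\<close> on the right.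
\<close>

definition lsel :: "bool \<Rightarrow> 'b option \<Rightarrow> 'k" where
  "lsel b x = (if x = None \<and> \<not> b then 0 else 1)"

definition rsel :: "bool \<Rightarrow> 'b option \<Rightarrow> 'k" where
  "rsel b x = (if x = None \<and> b then 0 else 1)"

lemma sel_simps [simp]:
  "lsel b (Some c) = 1" "lsel True x = 1" "lsel False None = 0"
  "rsel b (Some c) = 1" "rsel False x = 1" "rsel True None = 0"
  by (simp_all add: lsel_def rsel_def)

text \<open>
  The unshuffles of a word into two, with Koszul signs.  Letters are primitive and go to either side.
\<close>

primrec Ush :: "bool \<Rightarrow> 'b option list \<Rightarrow> ('b option list \<Rightarrow> 'b option list \<Rightarrow> 'k) \<Rightarrow> 'k" where
  "Ush b [] B = B [] []"
| "Ush b (x # u) B = lsel b x * Ush b u (\<lambda>l r. B (x # l) r)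
      + rsel b x * Ush b u (\<lambda>l r. sgnp (ld x * wd l) * B l (x # r))"

lemma Ush_lin:
  "Ush b u (\<lambda>l r. F l r + G l r) = Ush b u F + Ush b u G"
  "Ush b u (\<lambda>l r. - F l r) = - Ush b u F"
  "Ush b u (\<lambda>l r. a * F l r) = a * Ush b u F"
  "Ush b u (\<lambda>l r. 0) = 0"
  by (induction u arbitrary: F G)
    (simp_all add: algebra_simps)

lemma Ush_append:
  "Ush b (u @ v) B = Ush b u (\<lambda>l r. Ush b v (\<lambda>l' r'. sgnp (wd r * wd l') * B (l @ l') (r @ r')))"
proof (induction u arbitrary: B)
  case (Cons x u)
  have "Ush b u (\<lambda>l r. Ush b v (\<lambda>l' r'. sgnp (wd r * wd l') * (sgnp (ld x * (wd l + wd l')) * B (l @ l') (x # r @ r'))))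
      = Ush b u (\<lambda>l r. sgnp (ld x * wd l) * Ush b v (\<lambda>l' r'. sgnp ((ld x + wd r) * wd l') * B (l @ l') (x # r @ r')))"
    unfolding Ush_lin(3)[symmetric] by (simp add: sgn_norm)
  then show ?case by (simp add: Cons.IH)
qed simp

text \<open>
  The invariants of the pairs that occur in \<open>Ush b u\<close>.
\<close>

definition un :: "bool \<Rightarrow> 'b option list \<Rightarrow> 'b option list \<Rightarrow> 'b option list \<Rightarrow> bool" where
  "un b u l r \<longleftrightarrow> wd l + wd r = wd u \<and> (ok u \<longrightarrow> ok l \<and> ok r)
     \<and> (b \<or> None \<notin> set u \<longrightarrow> None \<notin> set r) \<and> (\<not> b \<or> None \<notin> set u \<longrightarrow> None \<notin> set l)"

lemma Ush_cong:
  "(\<And>l r. un b u l r \<Longrightarrow> F l r = G l r) \<Longrightarrow> Ush b u F = Ush b u G"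
proof (induction u arbitrary: F G)
  case (Cons x u)
  have "lsel b x * Ush b u (\<lambda>l r. F (x # l) r) = lsel b x * Ush b u (\<lambda>l r. G (x # l) r)"
  proof (cases "x = None \<and> \<not> b")
    case False
    have "Ush b u (\<lambda>l r. F (x # l) r) = Ush b u (\<lambda>l r. G (x # l) r)"
      by (rule Cons.IH, rule Cons.prems) (use False in \<open>auto simp: un_def ok_def\<close>)
    then show ?thesis by simp
  qed simp
  moreover have "rsel b x * Ush b u (\<lambda>l r. sgnp (ld x * wd l) * F l (x # r))
     = rsel b x * Ush b u (\<lambda>l r. sgnp (ld x * wd l) * G l (x # r))"
  proof (cases "x = None \<and> b")
    case False
    have "Ush b u (\<lambda>l r. sgnp (ld x * wd l) * F l (x # r)) = Ush b u (\<lambda>l r. sgnp (ld x * wd l) * G l (x # r))"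
      by (rule Cons.IH, subst Cons.prems) (use False in \<open>auto simp: un_def ok_def\<close>)
    then show ?thesis by simp
  qed auto
  ultimately show ?case by simp
qed (simp add: un_def)

lemma Ush_dW_swap: "Ush b u (\<lambda>l r. dW w (F l r)) = dW w (\<lambda>z. Ush b u (\<lambda>l r. F l r z))"
  by (induction u arbitrary: F) (simp_all add: dW_lin(4)[symmetric] dW_lin(1))

lemma Ush_ev: "Ush b u (\<lambda>l r. ev (F l r) p) = ev (\<lambda>z. Ush b u (\<lambda>l r. F l r z)) p"
  by (induction u arbitrary: F) (simp_all add: ev_fun_mult[symmetric] ev_fun_add)

lemma Ush_Un_swap: "Ush b u (\<lambda>l r. Ush b' v (F l r)) = Ush b' v (\<lambda>l' r'. Ush b u (\<lambda>l r. F l r l' r'))"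
proof (induction u arbitrary: F)
  case (Cons a u)
  have "Ush b u (\<lambda>l r. sgnp (ld a * wd l) * Ush b' v (F l (a # r)))
      = Ush b' v (\<lambda>l' r'. Ush b u (\<lambda>l r. sgnp (ld a * wd l) * F l (a # r) l' r'))"
    by (subst Ush_lin(3)[symmetric]) (rule Cons.IH)
  then show ?case by (simp add: Cons.IH Ush_lin)
qed simp

lemma Ush_free: "None \<notin> set u \<Longrightarrow> Ush b u B = Ush b' u B"
  by (induction u arbitrary: B) (auto simp: lsel_def rsel_def)

definition dWW :: "('b option list \<Rightarrow> 'b option list \<Rightarrow> 'k) \<Rightarrow> 'b option list \<Rightarrow> 'b option list \<Rightarrow> 'k" where
  "dWW B l r = dW l (\<lambda>l'. B l' r) + sgnp (wd l) * dW r (\<lambda>r'. B l r')"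

text \<open>
  The sum over the cuts of a word in front of one of its bars.
\<close>

primrec cuts :: "'b option list \<Rightarrow> ('b option list \<Rightarrow> 'b option list \<Rightarrow> 'k) \<Rightarrow> 'k" where
  "cuts [] H = 0"
| "cuts (x # u) H = (if x = None then H [] (x # u) else 0) + cuts u (\<lambda>U. H (x # U))"

lemma cuts_lin:
  "cuts u (\<lambda>l r. F l r + G l r) = cuts u F + cuts u G"
  "cuts u (\<lambda>l r. - F l r) = - cuts u F"
  "cuts u (\<lambda>l r. a * F l r) = a * cuts u F"
  "cuts u (\<lambda>l r. 0) = 0"
  by (induction u arbitrary: F G) (simp_all add: algebra_simps)

lemma cuts_diff: "cuts u (\<lambda>l r. F l r - G l r) = cuts u F - cuts u G"
  using cuts_lin(1)[of u F "\<lambda>l r. - G l r"] by (simp add: cuts_lin)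

lemma cuts_cong:
  "(\<And>U V. U @ None # V = u \<Longrightarrow> F U (None # V) = G U (None # V)) \<Longrightarrow> cuts u F = cuts u G"
proof (induction u arbitrary: F G)
  case (Cons x u)
  have "cuts u (\<lambda>U. F (x # U)) = cuts u (\<lambda>U. G (x # U))"
    by (rule Cons.IH, rule Cons.prems) simp
  then show ?case using Cons.prems[of "[]" u] by simp
qed simp

lemma cuts_append: "cuts (u @ v) H = cuts u (\<lambda>U V. H U (V @ v)) + cuts v (\<lambda>U V. H (u @ U) V)"
  by (induction u arbitrary: H) simp_all

lemma cuts_free [simp]: "None \<notin> set u \<Longrightarrow> cuts u H = 0"
  by (induction u arbitrary: H) auto

lemma cuts_dl: "dl x (\<lambda>v. cuts u (H v)) = cuts u (\<lambda>U V. dl x (\<lambda>v. H v U V))"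
proof (induction u arbitrary: H)
  case (Cons y u)
  show ?case by (cases y) (simp_all add: dl_lin Cons.IH)
qed (simp add: dl_lin)

text \<open>
  Differentiating a cut word differentiates both parts, except that the bar at the cut must not be
  deleted.  The correction is the sum of these excess terms.
\<close>

lemma dW_cs:
  "ok u \<Longrightarrow> dW u (\<lambda>z. cuts z H)
     = cuts u (\<lambda>U V. dW U (\<lambda>z. H z V) + sgnp (wd U) * dW V (\<lambda>z. H U z)) - cuts u (\<lambda>U V. sgnp (wd U) * H U (tl V))"
proof (induction u arbitrary: H)
  case (Cons x u)
  have x: "ok [x]" and u: "ok u" using Cons.prems by (auto simp: ok_def)
  show ?case
  proof (cases x)
    case None
    then show ?thesis
      by (simp add: Cons.IH[OF u] dW_lin cuts_lin cuts_diff algebra_simps sgnp_add)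
  next
    case (Some c)
    have "dl x (\<lambda>v. cuts (v @ u) H) = dl x (\<lambda>v. cuts u (\<lambda>U. H (v @ U)))"
      by (rule dl_cong[OF x]) (simp add: Some drv_def cuts_append)
    then show ?thesis using Some
      by (simp add: Cons.IH[OF u] dW_lin cuts_lin cuts_diff cuts_dl algebra_simps sgnp_add sgnp_diff)
  qed
qed simp


text \<open>
  One summand of the Alexander-Whitney diagonal.  If the word \<open>u\<close> is cut into \<open>U\<close> and \<open>V\<close>, bars of
  \<open>U\<close> belong to the left and bars of \<open>V\<close> to the right factor; the letters of \<open>V\<close> that go left
  constitute \<open>l2\<close>, the product \<open>a\<^sub>i\<^sub>+\<^sub>1...a\<^sub>k\<close>, which the cyclic bar construction moves to the front.
\<close>

definition HB :: "('b option list \<Rightarrow> 'b option list \<Rightarrow> 'k) \<Rightarrow> 'b option list \<Rightarrow> 'b option list \<Rightarrow> 'k" where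
  "HB B U V = Ush True U (\<lambda>l1 r1. Ush False V (\<lambda>l2 r2. sgnp (wd l2 * wd U) * B (l2 @ l1) (r1 @ r2)))"

definition Diag :: "('b option list \<Rightarrow> 'b option list \<Rightarrow> 'k) \<Rightarrow> 'b option list \<Rightarrow> 'k" where
  "Diag B u = HB B u [] + cuts u (HB B)"

lemma HB_lin: "HB (\<lambda>l r. F l r + G l r) = (\<lambda>U V. HB F U V + HB G U V)"
  by (simp add: HB_def[abs_def] distrib_left Ush_lin)

lemma Diag_lin: "Diag (\<lambda>l r. F l r + G l r) u = Diag F u + Diag G u"
  by (simp add: Diag_def HB_lin cuts_lin)

text \<open>
  Reindexes a sum over all cuts by the bar before the cut: if the value at a cut depends only on the
  word obtained by absorbing the last entry of the left part into the right part, then cutting at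
  one bar and absorbing amounts to cutting at the preceding bar and deleting it.
\<close>

lemma cut_shift:
  assumes "\<And>U V. None \<notin> set U \<Longrightarrow> L U V = 0"
    and "\<And>U w V. None \<notin> set w \<Longrightarrow> L (U @ None # w) V = K U (w @ V)"
  shows "L u [] + cuts u L = cuts u (\<lambda>U V. K U (tl V))"
  using assms
proof (induction "length u" arbitrary: u L K rule: less_induct)
  case less
  show ?case
  proof (cases u rule: word_cases)
    case 1
    then show ?thesis using less.prems(1) by simp
  next
    case (2 X w)
    have "(\<lambda>U V. L U (V @ None # w)) X [] + cuts X (\<lambda>U V. L U (V @ None # w))
        = cuts X (\<lambda>U V. (\<lambda>U V. K U (V @ None # w)) U (tl V))"
      by (rule less.hyps) (simp_all add: 2 less.prems)
    moreover have "cuts X (\<lambda>U V. K U (tl V @ None # w)) = cuts X (\<lambda>U V. K U (tl (V @ None # w)))"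
      by (rule cuts_cong) simp
    moreover have "L u [] = K X w" using less.prems(2)[of w X "[]"] 2 by simp
    ultimately show ?thesis by (simp add: 2 cuts_append algebra_simps)
  qed
qed

text \<open>
  The wrap-around term of the differential in the left and in the right tensor factor.
\<close>

definition LL :: "('b option list \<Rightarrow> 'b option list \<Rightarrow> 'k) \<Rightarrow> 'b option list \<Rightarrow> 'b option list \<Rightarrow> 'k" where
  "LL B l r = Lst l (\<lambda>l'. B l' r)"

definition LR :: "('b option list \<Rightarrow> 'b option list \<Rightarrow> 'k) \<Rightarrow> 'b option list \<Rightarrow> 'b option list \<Rightarrow> 'k" where
  "LR B l r = sgnp (wd l) * Lst r (\<lambda>r'. B l r')"

lemma Ush_None_True: "Ush True (None # w) B = Ush True w (\<lambda>l r. B (None # l) r)"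
  and Ush_None_False: "Ush False (None # w) B = Ush False w (\<lambda>l r. sgnp (wd l) * B l (None # r))"
  by simp_all

lemma HB_LL_free: "None \<notin> set U \<Longrightarrow> HB (LL B) U V = 0"
proof -
  assume U: "None \<notin> set U"
  have "HB (LL B) U V = Ush True U (\<lambda>l1 r1. Ush False V (\<lambda>l2 r2. 0))"
    unfolding HB_def by (intro Ush_cong) (use U in \<open>auto simp: un_def LL_def\<close>)
  then show ?thesis by (simp add: Ush_lin)
qed

lemma HB_LL: 
  assumes w: "None \<notin> set w"
  shows "HB (LL B) (U @ None # w) V = - sgnp (wd U) * HB B U (w @ V)"
proof -
  have "HB (LL B) (U @ None # w) V
    = Ush True U (\<lambda>l r. Ush True w (\<lambda>l' r'. Ush False V (\<lambda>l2 r2.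
         sgnp (wd r * (1 + wd l')) * (sgnp (wd l2 * (wd U + 1 + wd w)) * LL B (l2 @ l @ None # l') (r @ r' @ r2)))))"
    by (simp add: HB_def Ush_append Ush_lin add.assoc)
  also have "\<dots> = Ush True U (\<lambda>l r. Ush True w (\<lambda>l' r'. Ush False V (\<lambda>l2 r2.
         - sgnp (wd U) * (sgnp (wd r' * wd l2) * (sgnp ((wd l' + wd l2) * wd U) * B ((l' @ l2) @ l) (r @ r' @ r2))))))"
  proof (intro Ush_cong, goal_cases)
    case (1 l r l' r' l2 r2)
    then have *: "None \<notin> set l'" "wd U = wd l + wd r" "wd w = wd l' + wd r'" using w by (auto simp: un_def)
    show ?case using Lst_last[OF *(1), of "l2 @ l" "\<lambda>l. B l (r @ r' @ r2)"]
      by (simp add: LL_def *(2,3) sgn_norm)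
  qed
  also have "\<dots> = - sgnp (wd U) * HB B U (w @ V)"
    by (simp add: HB_def Ush_append Ush_lin Ush_free[OF w, where b = True and b' = False])
  finally show ?thesis .
qed

lemma HB_LR:
  assumes w: "None \<notin> set w"
  shows "HB (LR B) U (V @ None # w) = - sgnp ((wd w + 1) * wd (U @ V)) * HB B (w @ U) V"
proof -
  have "HB (LR B) U (V @ None # w)
    = Ush True U (\<lambda>l r. Ush False V (\<lambda>l2 r2. Ush False w (\<lambda>l' r'.
         sgnp (wd l') * (sgnp (wd r2 * wd l') * (sgnp ((wd l2 + wd l') * wd U) * LR B (l2 @ l' @ l) (r @ r2 @ None # r'))))))"
    by (simp add: HB_def Ush_append Ush_lin)
  also have "\<dots> = Ush True U (\<lambda>l r. Ush False V (\<lambda>l2 r2. Ush False w (\<lambda>l' r'.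
         - sgnp ((wd w + 1) * (wd U + wd V)) * (sgnp (wd r' * wd l) * (sgnp (wd l2 * (wd w + wd U)) * B (l2 @ l' @ l) ((r' @ r) @ r2))))))"
  proof (intro Ush_cong, goal_cases)
    case (1 l r l2 r2 l' r')
    then have *: "None \<notin> set r'" "wd U = wd l + wd r" "wd w = wd l' + wd r'" "wd V = wd l2 + wd r2"
      using w by (auto simp: un_def)
    show ?case using Lst_last[OF *(1), of "r @ r2" "B (l2 @ l' @ l)"]
      by (simp add: LR_def *(2,3,4) sgn_norm)
  qed
  also have "\<dots> = - sgnp ((wd w + 1) * wd (U @ V)) * HB B (w @ U) V"
    by (simp add: HB_def Ush_append Ush_lin Ush_free[OF w, where b = True and b' = False])
      (subst (2) Ush_Un_swap, subst Ush_Un_swap, simp add: Ush_lin)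
  finally show ?thesis .
qed

text \<open>
  The wrap-around terms of the left factor are exactly the excess terms of \<open>dW_cs\<close>.
\<close>

lemma Diag_LL: "Diag (LL B) u = - cuts u (\<lambda>U V. sgnp (wd U) * HB B U (tl V))"
  unfolding Diag_def cuts_lin(2)[symmetric]
  by (subst cut_shift[where K = "\<lambda>U V. - (sgnp (wd U) * HB B U V)"]) (simp_all add: HB_LL_free HB_LL)

text \<open>
  The wrap-around term of the right factor is that of the whole word, since the last bar always
  belongs to the right factor unless the right part is empty.
\<close>

lemma Diag_LR: "Diag (LR B) u = Lst u (Diag B)"
proof -
  have 0: "HB (LR B) U V = 0" if "None \<notin> set V" for U V
  proof -
    have "HB (LR B) U V = Ush True U (\<lambda>l1 r1. Ush False V (\<lambda>l2 r2. 0))"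
      unfolding HB_def by (intro Ush_cong) (use that in \<open>auto simp: un_def LR_def\<close>)
    then show ?thesis by (simp add: Ush_lin)
  qed
  show ?thesis
  proof (cases u rule: word_cases)
    case 1
    then show ?thesis by (simp add: Diag_def 0)
  next
    case (2 X w)
    have "cuts X (\<lambda>U V. HB (LR B) U (V @ None # w)) = cuts X (\<lambda>U V. - sgnp ((wd w + 1) * wd X) * HB B (w @ U) V)"
    proof (rule cuts_cong, goal_cases)
      case (1 U V)
      show ?case unfolding 1[symmetric] by (rule HB_LR[OF 2(2)])
    qed
    then show ?thesis using HB_LR[OF 2(2), of B X "[]"]
      by (simp add: Diag_def 2 0 cuts_append cuts_lin distrib_left)
  qed
qed

end

context cocommutative_setting
begin

text \<open>
  The shuffle diagonal commutes with the cobar differential on generators if and only if the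
  mixed terms \<open>s\<^sup>-\<^sup>1x \<otimes> s\<^sup>-\<^sup>1y\<close> cancel in pairs, which is cocommutativity.
\<close>

lemma Ush_dl: "ok [x] \<Longrightarrow> dl x (\<lambda>v. Ush b v B) = Ush b [x] (dWW B)"
proof (cases x)
  case (Some c)
  assume "ok [x]"
  then have c: "c \<in> gens C" using Some by simp
  let ?B = "\<lambda>x y. B [Some x] [Some y]"
  have "ev (\<lambda>(x, y). sgnp (gdeg C x) * (sgnp ((gdeg C x - 1) * (gdeg C y - 1)) * ?B y x)) (red_diag C c)
      = ev (\<lambda>(x, y). - (sgnp (gdeg C x) * ?B x y)) (red_diag C c)"
  proof (subst red_cocomm[OF c], rule ev_red_cong[OF c], goal_cases)
    case (1 x y)
    show ?case by (simp add: sgn_norm)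
  qed
  then show ?thesis
    by (simp add: Some dWW_def dl_def case_prod_unfold ev_fun_lin distrib_left)
qed (cases b; simp add: dWW_def)

lemma dW_Ush: "ok u \<Longrightarrow> dW u (\<lambda>z. Ush b z B) = Ush b u (dWW B)"
proof (induction u arbitrary: B)
  case (Cons x u)
  have x: "ok [x]" and u: "ok u" using Cons.prems by (auto simp: ok_def)
  let ?G = "\<lambda>l r. Ush b u (\<lambda>l' r'. sgnp (wd r * wd l') * B (l @ l') (r @ r'))"
  have "dW ([x] @ u) (\<lambda>z. Ush b z B) = dl x (\<lambda>z. Ush b (z @ u) B) + sgnp (ld x) * dW u (\<lambda>z. Ush b ([x] @ z) B)"
    by simp
  also have "dl x (\<lambda>z. Ush b (z @ u) B) = Ush b [x] (dWW ?G)"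
    unfolding Ush_append by (rule Ush_dl[OF x])
  also have "dW u (\<lambda>z. Ush b ([x] @ z) B)
      = Ush b [x] (\<lambda>l r. Ush b u (dWW (\<lambda>l' r'. sgnp (wd r * wd l') * B (l @ l') (r @ r'))))"
    unfolding Ush_append Ush_dW_swap[symmetric] Cons.IH[OF u] ..
  also have "Ush b [x] (dWW ?G) + sgnp (ld x) * \<dots>
     = Ush b [x] (\<lambda>l r. dWW ?G l r + sgnp (ld x) * Ush b u (dWW (\<lambda>l' r'. sgnp (wd r * wd l') * B (l @ l') (r @ r'))))"
    by (simp only: Ush_lin)
  also have "\<dots> = Ush b [x] (\<lambda>l r. Ush b u (\<lambda>l' r'. sgnp (wd r * wd l') * dWW B (l @ l') (r @ r')))"
  proof (intro Ush_cong, goal_cases)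
    case (1 l r)
    then have lr: "ld x = wd l + wd r" "ok l" "ok r" using x by (auto simp: un_def)
    have *: "dW r (\<lambda>r2. Ush b u (\<lambda>l' r'. sgnp (wd r2 * wd l') * B (l @ l') (r2 @ r')))
      = dW r (\<lambda>r2. Ush b u (\<lambda>l' r'. sgnp ((wd r - 1) * wd l') * B (l @ l') (r2 @ r')))"
      by (rule dW_cong[OF lr(3)]) (simp add: drv_def)
    have 2: "Ush b u (dWW (\<lambda>l' r'. sgnp (wd r * wd l') * B (l @ l') (r @ r')))
      = Ush b u (\<lambda>l' r'. sgnp (wd r * (wd l' - 1)) * dW l' (\<lambda>z. B (l @ z) (r @ r'))
            + sgnp (wd l') * (sgnp (wd r * wd l') * dW r' (\<lambda>z. B (l @ l') (r @ z))))"
    proof (rule Ush_cong, goal_cases)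
      case (1 l' r')
      have "dW l' (\<lambda>z. sgnp (wd r * wd z) * B (l @ z) (r @ r')) = dW l' (\<lambda>z. sgnp (wd r * (wd l' - 1)) * B (l @ z) (r @ r'))"
        by (rule dW_cong) (use 1 u in \<open>auto simp: un_def drv_def\<close>)
      then show ?case by (simp add: dWW_def dW_lin)
    qed
    have 3: "dWW ?G l r = Ush b u (\<lambda>l' r'. sgnp (wd r * wd l') * dW l (\<lambda>z. B (z @ l') (r @ r'))
            + sgnp (wd l) * (sgnp ((wd r - 1) * wd l') * dW r (\<lambda>z. B (l @ l') (z @ r'))))"
      unfolding dWW_def * by (simp only: Ush_dW_swap[symmetric] Ush_lin dW_lin)
    show ?case unfolding 2 3 unfolding Ush_lin(3)[symmetric] Ush_lin(1)[symmetric]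
      by (rule Ush_cong) (simp add: dWW_def dW_append lr sgn_norm)
  qed
  also have "\<dots> = Ush b ([x] @ u) (dWW B)" unfolding Ush_append ..
  finally show ?case by simp
qed (simp add: dWW_def)

lemma HB_dWW:
  assumes "ok U" "ok V"
  shows "dW U (\<lambda>z. HB B z V) + sgnp (wd U) * dW V (\<lambda>z. HB B U z) = HB (dWW B) U V"
proof -
  have "dW U (\<lambda>z. HB B z V) = dW U (\<lambda>z. Ush True z (\<lambda>l1 r1. Ush False V (\<lambda>l2 r2. sgnp (wd l2 * (wd U - 1)) * B (l2 @ l1) (r1 @ r2))))"
    unfolding HB_def by (rule dW_cong[OF assms(1)]) (simp add: drv_def)
  also have "\<dots> = Ush True U (\<lambda>l1 r1. Ush False V (\<lambda>l2 r2. sgnp (wd l2 * (wd U - 1)) *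
      (dW l1 (\<lambda>z. B (l2 @ z) (r1 @ r2)) + sgnp (wd l1) * dW r1 (\<lambda>z. B (l2 @ l1) (z @ r2)))))"
    unfolding dW_Ush[OF assms(1)] dWW_def Ush_dW_swap[symmetric] Ush_lin(3)[symmetric] Ush_lin(1)[symmetric] dW_lin
    by (simp add: algebra_simps)
  finally have 1: "dW U (\<lambda>z. HB B z V) = \<dots>" .
  have "dW V (\<lambda>z. HB B U z) = Ush True U (\<lambda>l1 r1. dW V (\<lambda>z. Ush False z (\<lambda>l2 r2. sgnp (wd l2 * wd U) * B (l2 @ l1) (r1 @ r2))))"
    unfolding HB_def Ush_dW_swap ..
  also have "\<dots> = Ush True U (\<lambda>l1 r1. Ush False V (\<lambda>l2 r2. sgnp ((wd l2 - 1) * wd U) * dW l2 (\<lambda>z. B (z @ l1) (r1 @ r2))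
       + sgnp (wd l2) * (sgnp (wd l2 * wd U) * dW r2 (\<lambda>z. B (l2 @ l1) (r1 @ z)))))"
    unfolding dW_Ush[OF assms(2)] dWW_def
  proof (intro Ush_cong, goal_cases)
    case (1 l1 r1 l2 r2)
    have "dW l2 (\<lambda>z. sgnp (wd z * wd U) * B (z @ l1) (r1 @ r2)) = dW l2 (\<lambda>z. sgnp ((wd l2 - 1) * wd U) * B (z @ l1) (r1 @ r2))"
      by (rule dW_cong) (use 1 assms in \<open>auto simp: un_def drv_def\<close>)
    then show ?case by (simp add: dW_lin)
  qed
  finally have 2: "dW V (\<lambda>z. HB B U z) = \<dots>" .
  show ?thesis unfolding 1 2 unfolding HB_def Ush_lin(3)[symmetric] Ush_lin(1)[symmetric]
  proof (intro Ush_cong, goal_cases)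
    case (1 l1 r1 l2 r2)
    then have "wd U = wd l1 + wd r1" by (simp add: un_def)
    then show ?case by (simp add: dWW_def dW_append sgn_norm)
  qed
qed

text \<open>
  The Alexander-Whitney diagonal is a chain map.  The derivation part \<open>dW\<close> is compatible with
  unshuffling each half; the excess terms at the cuts are the wrap-around terms on the left.
\<close>

theorem dQ_Diag:
  assumes u: "ok u"
  shows "dQ u (Diag B) = Diag (\<lambda>l r. dQ l (\<lambda>l'. B l' r) + sgnp (wd l) * dQ r (\<lambda>r'. B l r')) u"
proof -
  have "dW u (\<lambda>z. HB B z []) = HB (dWW B) u []"
    using HB_dWW[OF u, of "[]"] by simp
  moreover have "cuts u (\<lambda>U V. dW U (\<lambda>z. HB B z V) + sgnp (wd U) * dW V (\<lambda>z. HB B U z)) = cuts u (HB (dWW B))"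
  proof (rule cuts_cong, goal_cases)
    case (1 U V)
    show ?case by (rule HB_dWW) (use 1 u in auto)
  qed
  ultimately have "dW u (Diag B) = Diag (dWW B) u + Diag (LL B) u"
    by (simp add: Diag_def[abs_def] dW_lin dW_cs[OF u] Diag_LL[unfolded Diag_def])
  then have "dQ u (Diag B) = Diag (\<lambda>l r. dWW B l r + (LL B l r + LR B l r)) u"
    by (simp add: dQ_def Diag_lin Diag_LR)
  then show ?thesis by (simp add: dWW_def LL_def LR_def dQ_def algebra_simps)
qed

end


context cobar_setting
begin

section \<open>Words and the basis of the cyclic bar construction\<close>

definition encs :: "'b list list \<Rightarrow> 'b option list" where
  "encs ws = concat (map (\<lambda>w. None # map Some w) ws)"

definition enc :: "'b list \<times> 'b list list \<Rightarrow> 'b option list" where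
  "enc x = map Some (fst x) @ encs (snd x)"

primrec dec :: "'b option list \<Rightarrow> 'b list \<times> 'b list list" where
  "dec [] = ([], [])"
| "dec (x # u) = (case x of None \<Rightarrow> ([], fst (dec u) # snd (dec u)) | Some c \<Rightarrow> (c # fst (dec u), snd (dec u)))"

lemma encs_simps [simp]: "encs [] = []" "encs (w # ws) = None # map Some w @ encs ws" "encs (us @ vs) = encs us @ encs vs"
  by (simp_all add: encs_def)

lemma dec_Some_append [simp]: "dec (map Some a @ u) = (a @ fst (dec u), snd (dec u))"
  by (induction a) simp_all

lemma dec_encs [simp]: "dec (encs ws) = ([], ws)"
  by (induction ws) simp_all

lemma dec_enc [simp]: "dec (enc x) = x"
  by (simp add: enc_def)

lemma enc_dec [simp]: "enc (dec u) = u"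
  by (induction u) (simp_all add: enc_def split: option.splits)

lemma wd_map_Some [simp]: "wd (map Some a) = cobar_deg C a"
  by (simp add: wd_def cobar_deg_def comp_def)

lemma cobar_deg_simps [simp]: "cobar_deg C [] = 0" "cobar_deg C (c # a) = gdeg C c - 1 + cobar_deg C a"
  "cobar_deg C (a @ b) = cobar_deg C a + cobar_deg C b"
  by (simp_all add: cobar_deg_def)

lemma ok_map_Some [simp]: "ok (map Some a) \<longleftrightarrow> a \<in> lists Cb"
  by (auto simp: ok_def)

lemma None_notin_map_Some [simp]: "None \<notin> set (map Some a)"
  by auto

lemma free_word: "None \<notin> set u \<Longrightarrow> map Some (map the u) = u"
  by (induction u) auto

lemma dl_cobar: "dl (Some c) F = ev (\<lambda>z. F (map Some z)) (cobar_dif_gen C c)"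
  by (simp add: dl_def cobar_dif_gen_def ev_lin case_prod_unfold)

lemma dW_Some: "dW (map Some w) F = ev (\<lambda>z. F (map Some z)) (cobar_dif C w)"
proof (induction w arbitrary: F)
  case (Cons c w)
  show ?case
    by (simp add: Cons.IH dl_cobar cobar_dif_def sum.lessThan_Suc_shift ev_lin ev_sum sum_distrib_left
        sgnp_add mult.assoc del: sum.lessThan_Suc)
qed (simp add: cobar_dif_def)

lemma dW_ev: "dW w (\<lambda>z. ev (\<lambda>b. F b z) p) = ev (\<lambda>b. dW w (F b)) p"
  by (induction w arbitrary: F) (simp_all add: dl_ev ev_fun_add ev_fun_mult)

section \<open>The twisting element \<open>\<sigma>\<close>\<close>

lemma red_less: "x \<in> Cb \<Longrightarrow> y \<in> Cb \<Longrightarrow> gdeg C x + gdeg C y = gdeg C c \<Longrightarrow> gdeg C x < gdeg C c \<and> gdeg C y < gdeg C c"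
  using deg_Cb[of x] deg_Cb[of y] by auto

definition sig :: "'b \<Rightarrow> ('b option list \<Rightarrow> 'k) \<Rightarrow> 'k" where
  "sig c F = ev (\<lambda>ws. F (encs ws)) (sigma_C C c)"

definition sgi :: "nat \<Rightarrow> 'b \<Rightarrow> 'b list list \<Rightarrow>\<^sub>0 'k" where
  "sgi i c = lext (\<lambda>w. bv (map (\<lambda>x. [x]) w)) (red_diag_iter C i c)"

lemma lext_eq_0: "(\<And>x. x \<in> Poly_Mapping.keys p \<Longrightarrow> f x = 0) \<Longrightarrow> lext f p = (0 :: 'y \<Rightarrow>\<^sub>0 'a::comm_ring_1)"
  unfolding lext_def by (rule sum.neutral) (auto intro!: poly_mapping_eqI)

text \<open>
  All factors of a reduced diagonal have degree at least 2.  This makes the sum defining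
  \<open>sigma_C\<close> finite.
\<close>

lemma red_diag_iter_0: "c \<in> Cb \<Longrightarrow> gdeg C c < 2 * (int i + 1) \<Longrightarrow> red_diag_iter C i c = 0"
proof (induction i arbitrary: c)
  case 0
  then show ?case using deg_Cb[of c] by simp
next
  case (Suc i)
  show ?case unfolding red_diag_iter.simps
  proof (rule lext_eq_0, clarify)
    fix x y assume "(x, y) \<in> Poly_Mapping.keys (red_diag C c)"
    with red_keys Suc.prems have "x \<in> Cb" "y \<in> Cb" "gdeg C x + gdeg C y = gdeg C c" by blast+
    then have "red_diag_iter C i x = 0" using deg_Cb[of y] Suc.prems by (intro Suc.IH) auto
    then show "lext (\<lambda>w. bv (w @ [y])) (red_diag_iter C i x) = (0 :: 'b list \<Rightarrow>\<^sub>0 'k)" by simp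
  qed
qed

lemma ev_sigma:
  assumes "c \<in> Cb" "nat (gdeg C c) \<le> N"
  shows "ev G (sigma_C C c) = (\<Sum>i<N. ev G (sgi i c))"
proof -
  have "sigma_C C c = Sum_any (\<lambda>i. sgi i c)"
    using assms(1) by (simp add: sigma_C_def sgi_def)
  also have "\<dots> = (\<Sum>i<N. sgi i c)"
  proof (rule Sum_any.expand_superset)
    show "{i. sgi i c \<noteq> 0} \<subseteq> {..<N}"
    proof (rule, rule ccontr)
      fix i assume "i \<in> {i. sgi i c \<noteq> 0}" "i \<notin> {..<N}"
      moreover from this have "red_diag_iter C i c = 0" using assms by (intro red_diag_iter_0) auto
      ultimately show False by (simp add: sgi_def)
    qed
  qed simp
  finally show ?thesis by (simp add: ev_sum)
qed

lemma ev_sgi_Suc: "ev G (sgi (Suc i) c) = ev (\<lambda>(x, y). ev (\<lambda>ws. G (ws @ [[y]])) (sgi i x)) (red_diag C c)"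
  by (simp add: sgi_def ev_lin case_prod_unfold)

lemma sig_one [simp]: "sig one F = F []"
  by (simp add: sig_def sigma_C_def)

text \<open>
  Splitting off the last tensor factor of the iterated diagonals turns the sum over all iterations
  into a recursion over the coalgebra, which is the form used in all inductions.
\<close>

lemma sig_rec:
  assumes "c \<in> Cb"
  shows "sig c F = F [None, Some c] + ev (\<lambda>(x, y). sig x (\<lambda>z. F (z @ [None, Some y]))) (red_diag C c)"
proof -
  let ?N = "nat (gdeg C c)"
  have "sig c F = (\<Sum>i<Suc ?N. ev (\<lambda>ws. F (encs ws)) (sgi i c))"
    unfolding sig_def by (rule ev_sigma[OF assms]) simp
  also have "\<dots> = ev (\<lambda>ws. F (encs ws)) (sgi 0 c) + (\<Sum>i<?N. ev (\<lambda>ws. F (encs ws)) (sgi (Suc i) c))"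
    by (rule sum.lessThan_Suc_shift)
  also have "ev (\<lambda>ws. F (encs ws)) (sgi 0 c) = F [None, Some c]"
    by (simp add: sgi_def ev_lin)
  also have "(\<Sum>i<?N. ev (\<lambda>ws. F (encs ws)) (sgi (Suc i) c))
     = ev (\<lambda>(x, y). \<Sum>i<?N. ev (\<lambda>ws. F (encs ws @ [None, Some y])) (sgi i x)) (red_diag C c)"
    by (simp add: ev_sgi_Suc ev_fun_sum case_prod_unfold)
  also have "\<dots> = ev (\<lambda>(x, y). sig x (\<lambda>z. F (z @ [None, Some y]))) (red_diag C c)"
  proof (rule ev_red_cong, goal_cases)
    case (2 x y)
    then have "nat (gdeg C x) \<le> ?N" using red_less[of x y c] by (intro nat_mono) auto
    from ev_sigma[OF 2(1) this] show ?case by (simp add: sig_def)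
  qed (use assms in simp)
  finally show ?thesis .
qed

lemma sig_lin:
  "sig c (\<lambda>z. F z + G z) = sig c F + sig c G"
  "sig c (\<lambda>z. F z - G z) = sig c F - sig c G"
  "sig c (\<lambda>z. - F z) = - sig c F"
  "sig c (\<lambda>z. a * F z) = a * sig c F"
  "sig c (\<lambda>z. 0) = 0"
  by (simp_all add: sig_def ev_fun_lin)

lemma sig_mult_right: "sig c (\<lambda>z. F z * a) = sig c F * a"
  by (simp add: mult.commute[of _ a] sig_lin)

lemma sig_dW: "sig c (\<lambda>z. dW w (F z)) = dW w (\<lambda>y. sig c (\<lambda>z. F z y))"
  unfolding sig_def by (rule dW_ev[symmetric])

lemma sig_ev: "sig c (\<lambda>z. ev (F z) p) = ev (\<lambda>y. sig c (\<lambda>z. F z y)) p"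
  unfolding sig_def by (rule ev_swap)

text \<open>
  The words \<open>s c\<^sub>1 s c\<^sub>2 ... s c\<^sub>k\<close> in which \<open>\<sigma>_C\<close> takes its values.
\<close>

definition bars :: "'b list \<Rightarrow> 'b option list" where
  "bars cs = concat (map (\<lambda>c. [None, Some c]) cs)"

lemma bars_simps [simp]: "bars [] = []" "bars (c # cs) = None # Some c # bars cs" "bars (cs @ ds) = bars cs @ bars ds"
  by (simp_all add: bars_def)

text \<open>
  Both factors of a reduced diagonal have smaller degree, so that \<open>sig_rec\<close> is a well-founded recursion.
\<close>

lemma sig_induct [consumes 1, case_names step]:
  assumes "c \<in> Cb" "\<And>c. c \<in> Cb \<Longrightarrow> (\<And>x. x \<in> Cb \<Longrightarrow> gdeg C x < gdeg C c \<Longrightarrow> P x) \<Longrightarrow> P c"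
  shows "P c"
  using assms(1)
proof (induction "nat (gdeg C c)" arbitrary: c rule: less_induct)
  case less
  show ?case
  proof (rule assms(2)[OF less.prems])
    fix x assume "x \<in> Cb" "gdeg C x < gdeg C c"
    then show "P x" using deg_Cb[of x] by (intro less.hyps) auto
  qed
qed


lemma sig_cong:
  assumes "c \<in> gens C"
    "\<And>cs. set cs \<subseteq> Cb \<Longrightarrow> wd (bars cs) = gdeg C c \<Longrightarrow> F (bars cs) = G (bars cs)"
  shows "sig c F = sig c G"
proof (cases "c = one")
  case True
  then show ?thesis using assms(2)[of "[]"] coaug_gen by simp
next
  case False
  then have "c \<in> Cb" using assms(1) by simp
  then show ?thesis using assms(2)
  proof (induction c arbitrary: F G rule: sig_induct)
    case (step c)
    have "sig x (\<lambda>z. F (z @ [None, Some y])) = sig x (\<lambda>z. G (z @ [None, Some y]))"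
      if "x \<in> Cb" "y \<in> Cb" "gdeg C x + gdeg C y = gdeg C c" for x y
    proof (rule step.IH)
      show "x \<in> Cb" "gdeg C x < gdeg C c" using that red_less by auto
      fix cs assume "set cs \<subseteq> Cb" "wd (bars cs) = gdeg C x"
      then show "F (bars cs @ [None, Some y]) = G (bars cs @ [None, Some y])"
        using step.prems[of "cs @ [y]"] that by simp
    qed
    then have "ev (\<lambda>(x, y). sig x (\<lambda>z. F (z @ [None, Some y]))) (red_diag C c)
      = ev (\<lambda>(x, y). sig x (\<lambda>z. G (z @ [None, Some y]))) (red_diag C c)"
      using step.hyps by (intro ev_red_cong) auto
    then show ?case using step.prems[of "[c]"] step.hyps by (simp add: sig_rec)
  qed
qed

lemma ok_bars: "set cs \<subseteq> Cb \<Longrightarrow> ok (bars cs)"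
  by (induction cs) auto

text \<open>
  \<open>\<sigma>_C\<close> is a twisting element.  Deleting the bar in front of the \<open>i\<close>-th factor merges two neighbouring
  letters and cancels against the quadratic part of the cobar differential of a letter; only the
  deletion of the first bar has no partner.
\<close>

lemma sig_D:
  assumes "c \<in> Cb"
  shows "sig c (\<lambda>z. dW z F) = ev (\<lambda>b. sig b F) (gdif C c) + F [Some c]
           + ev (\<lambda>(x, y). sig y (\<lambda>z. F (Some x # z))) (red_diag C c)"
  using assms
proof (induction c arbitrary: F rule: sig_induct)
  case (step c)
  let ?R = "\<lambda>H. ev (\<lambda>(x, y). H x y) (red_diag C c)"
  let ?e = "\<lambda>y. [None, Some y]"
  have c: "c \<in> gens C" using step.hyps by simp
  \<comment> \<open>the differential of the last bar entry\<close>
  have last: "dW (z @ ?e y) F = dW z (\<lambda>z. F (z @ ?e y)) + sgnp (wd z) * (F (z @ [Some y])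
      + ev (\<lambda>b. F (z @ ?e b)) (gdif C y)
      - ev (\<lambda>(y', y''). sgnp (gdeg C y') * F (z @ [None, Some y', Some y''])) (red_diag C y))" for z y
    by (simp add: dW_append dl_def case_prod_unfold algebra_simps)
  have step1: "sig x (\<lambda>z. dW (z @ ?e y) F)
      = ev (\<lambda>b. sig b (\<lambda>z. F (z @ ?e y))) (gdif C x) + sgnp (gdeg C x) * ev (\<lambda>b. sig x (\<lambda>z. F (z @ ?e b))) (gdif C y)
        + (F (Some x # ?e y) + ev (\<lambda>(x', x''). sig x'' (\<lambda>z. F (Some x' # z @ ?e y))) (red_diag C x))
        + (sgnp (gdeg C x) * F [None, Some x, Some y]
           + ev (\<lambda>(x', x''). sgnp (gdeg C x') * (sgnp (gdeg C x'') * sig x' (\<lambda>z. F (z @ [None, Some x'', Some y])))) (red_diag C x))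
        - ev (\<lambda>(y', y''). sgnp (gdeg C x) * (sgnp (gdeg C y') * sig x (\<lambda>z. F (z @ [None, Some y', Some y''])))) (red_diag C y)"
    if xy: "x \<in> Cb" "y \<in> Cb" "gdeg C x + gdeg C y = gdeg C c" for x y
  proof -
    have xg: "x \<in> gens C" using xy by simp
    have s: "sig x (\<lambda>z. sgnp (wd z) * G z) = sgnp (gdeg C x) * sig x G" for G
      unfolding sig_lin(4)[symmetric] by (rule sig_cong) (use xy in auto)
    have "sig x (\<lambda>z. dW z (\<lambda>z. F (z @ ?e y))) = ev (\<lambda>b. sig b (\<lambda>z. F (z @ ?e y))) (gdif C x)
        + F (Some x # ?e y) + ev (\<lambda>(x', x''). sig x'' (\<lambda>z. F (Some x' # z @ ?e y))) (red_diag C x)"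
      by (subst step.IH) (use xy red_less in auto)
    moreover have "sgnp (gdeg C x) * sig x (\<lambda>z. F (z @ [Some y])) = sgnp (gdeg C x) * F [None, Some x, Some y]
           + ev (\<lambda>(x', x''). sgnp (gdeg C x') * (sgnp (gdeg C x'') * sig x' (\<lambda>z. F (z @ [None, Some x'', Some y])))) (red_diag C x)"
    proof -
      have "ev (\<lambda>(x', x''). sgnp (gdeg C x) * sig x' (\<lambda>z. F (z @ [None, Some x'', Some y]))) (red_diag C x)
        = ev (\<lambda>(x', x''). sgnp (gdeg C x') * (sgnp (gdeg C x'') * sig x' (\<lambda>z. F (z @ [None, Some x'', Some y])))) (red_diag C x)"
        by (rule ev_red_cong[OF xg]) (metis sgnp_add mult.assoc)
      then show ?thesis by (simp add: sig_rec[OF xy(1)] distrib_left case_prod_unfold ev_fun_mult)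
    qed
    ultimately show ?thesis unfolding last sig_lin(1) s
      by (simp add: sig_lin sig_ev case_prod_unfold ev_fun_mult algebra_simps)
  qed
  have "sig c (\<lambda>z. dW z F) = F [Some c] + ev (\<lambda>b. F (?e b)) (gdif C c) - ?R (\<lambda>x y. sgnp (gdeg C x) * F [None, Some x, Some y])
      + ?R (\<lambda>x y. sig x (\<lambda>z. dW (z @ ?e y) F))"
    by (simp add: sig_rec[OF step.hyps] last[of "[]", simplified])
  also have "?R (\<lambda>x y. sig x (\<lambda>z. dW (z @ ?e y) F)) =
       ?R (\<lambda>x y. ev (\<lambda>b. sig b (\<lambda>z. F (z @ ?e y))) (gdif C x) + sgnp (gdeg C x) * ev (\<lambda>b. sig x (\<lambda>z. F (z @ ?e b))) (gdif C y))
     + (?R (\<lambda>x y. F (Some x # ?e y)) + ?R (\<lambda>x y. ev (\<lambda>(x', x''). sig x'' (\<lambda>z. F (Some x' # z @ ?e y))) (red_diag C x)))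
     + (?R (\<lambda>x y. sgnp (gdeg C x) * F [None, Some x, Some y])
         + ?R (\<lambda>x y. ev (\<lambda>(x', x''). sgnp (gdeg C x') * (sgnp (gdeg C x'') * sig x' (\<lambda>z. F (z @ [None, Some x'', Some y])))) (red_diag C x)))
     - ?R (\<lambda>x y. ev (\<lambda>(y', y''). sgnp (gdeg C x) * (sgnp (gdeg C y') * sig x (\<lambda>z. F (z @ [None, Some y', Some y''])))) (red_diag C y))"
  proof -
    have "?R (\<lambda>x y. sig x (\<lambda>z. dW (z @ ?e y) F)) = ?R (\<lambda>x y. ev (\<lambda>b. sig b (\<lambda>z. F (z @ ?e y))) (gdif C x) + sgnp (gdeg C x) * ev (\<lambda>b. sig x (\<lambda>z. F (z @ ?e b))) (gdif C y)
        + (F (Some x # ?e y) + ev (\<lambda>(x', x''). sig x'' (\<lambda>z. F (Some x' # z @ ?e y))) (red_diag C x))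
        + (sgnp (gdeg C x) * F [None, Some x, Some y]
           + ev (\<lambda>(x', x''). sgnp (gdeg C x') * (sgnp (gdeg C x'') * sig x' (\<lambda>z. F (z @ [None, Some x'', Some y])))) (red_diag C x))
        - ev (\<lambda>(y', y''). sgnp (gdeg C x) * (sgnp (gdeg C y') * sig x (\<lambda>z. F (z @ [None, Some y', Some y''])))) (red_diag C y))"
      by (rule ev_red_cong[OF c]) (rule step1)
    then show ?thesis by (simp only: case_prod_unfold ev_fun_add ev_fun_diff)
  qed
  also have "?R (\<lambda>x y. ev (\<lambda>b. sig b (\<lambda>z. F (z @ ?e y))) (gdif C x) + sgnp (gdeg C x) * ev (\<lambda>b. sig x (\<lambda>z. F (z @ ?e b))) (gdif C y))
     = ev (\<lambda>b. sig b F) (gdif C c) - ev (\<lambda>b. F (?e b)) (gdif C c)"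
  proof -
    have "ev (\<lambda>b. sig b F) (gdif C c) = ev (\<lambda>b. F (?e b) + ev (\<lambda>(x, y). sig x (\<lambda>z. F (z @ ?e y))) (red_diag C b)) (gdif C c)"
      by (rule ev_dif_cong[OF c]) (simp add: sig_rec)
    then show ?thesis by (simp add: ev_fun_add red_dif[OF step.hyps])
  qed
  also have "?R (\<lambda>x y. ev (\<lambda>(x', x''). sig x'' (\<lambda>z. F (Some x' # z @ ?e y))) (red_diag C x))
     = ?R (\<lambda>x y. sig y (\<lambda>z. F (Some x # z))) - ?R (\<lambda>x y. F (Some x # ?e y))"
  proof -
    have "?R (\<lambda>x y. sig y (\<lambda>z. F (Some x # z))) = ?R (\<lambda>x y. F (Some x # ?e y) + ev (\<lambda>(y', y''). sig y' (\<lambda>z. F (Some x # z @ ?e y''))) (red_diag C y))"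
      by (rule ev_red_cong[OF c]) (simp add: sig_rec)
    then show ?thesis
      by (simp add: case_prod_unfold ev_fun_add red_coassoc[OF step.hyps, unfolded case_prod_unfold, of "\<lambda>x y w. sig y (\<lambda>z. F (Some x # z @ ?e w))"])
  qed
  also have "?R (\<lambda>x y. ev (\<lambda>(x', x''). sgnp (gdeg C x') * (sgnp (gdeg C x'') * sig x' (\<lambda>z. F (z @ [None, Some x'', Some y])))) (red_diag C x))
     = ?R (\<lambda>x y. ev (\<lambda>(y', y''). sgnp (gdeg C x) * (sgnp (gdeg C y') * sig x (\<lambda>z. F (z @ [None, Some y', Some y''])))) (red_diag C y))"
    by (rule red_coassoc[OF step.hyps])
  finally show ?case by (simp add: algebra_simps)
qed

section \<open>The inclusion is a morphism\<close>

definition nab :: "('b option list \<Rightarrow> 'k) \<Rightarrow> 'b \<times> 'b list \<Rightarrow> 'k" where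
  "nab F = (\<lambda>(c, a). sgnp (gdeg C c * cobar_deg C a) * sig c (\<lambda>z. F (map Some a @ z)))"

lemma ev_nabla: "ev f (nabla C x) = nab (\<lambda>u. f (dec u)) x"
  by (cases x) (simp add: nabla_def nab_def ev_lin sig_def)

text \<open>
  The wrap-around term brings the last tensor factor of \<open>\<sigma>_C\<close> to the front of the coefficient.
\<close>

lemma sig_Lst:
  assumes "c \<in> Cb"
  shows "sig c (\<lambda>z. Lst (map Some a @ z) F) = - (sgnp (gdeg C c * cobar_deg C a) * F (Some c # map Some a))
     - ev (\<lambda>(x, y). sgnp (gdeg C y * (cobar_deg C a + gdeg C x)) * sig x (\<lambda>z. F (Some y # map Some a @ z))) (red_diag C c)"
proof -
  have L: "Lst (map Some a @ z @ [None, Some y]) F = - sgnp (gdeg C y * (cobar_deg C a + wd z)) * F (Some y # map Some a @ z)" for z y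
    using Lst_last[of "[Some y]" "map Some a @ z" F] by simp
  have "sig c (\<lambda>z. Lst (map Some a @ z) F) = - (sgnp (gdeg C c * cobar_deg C a) * F (Some c # map Some a))
    + ev (\<lambda>(x, y). sig x (\<lambda>z. Lst (map Some a @ z @ [None, Some y]) F)) (red_diag C c)"
    using L[of "[]" c] by (simp add: sig_rec[OF assms])
  also have "ev (\<lambda>(x, y). sig x (\<lambda>z. Lst (map Some a @ z @ [None, Some y]) F)) (red_diag C c)
    = ev (\<lambda>(x, y). - (sgnp (gdeg C y * (cobar_deg C a + gdeg C x)) * sig x (\<lambda>z. F (Some y # map Some a @ z)))) (red_diag C c)"
    unfolding sig_lin(3,4)[symmetric] by (rule ev_red_cong) (use assms in \<open>auto simp: L intro!: sig_cong\<close>)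
  finally show ?thesis by (simp add: case_prod_unfold ev_fun_uminus)
qed

text \<open>
  \<open>\<nabla>\<close> is a chain map.  The first bar deletion in \<open>sig_D\<close> multiplies \<open>a\<close> from the right and the
  wrap-around term multiplies it from the left, which are the two twisting terms of \<open>\<delta>\<close>.
\<close>

lemma nab_dif:
  assumes c: "c \<in> gens C" and a: "a \<in> lists Cb"
  shows "nab (\<lambda>u. dQ u F) (c, a) = ev (nab F) (twisted_dif C (c, a))"
proof (cases "c = one")
  case True
  then show ?thesis using coaug_gen
    by (simp add: nab_def dQ_def twisted_dif_def ev_lin dW_Some)
next
  case False
  then have c': "c \<in> Cb" using c by simp
  let ?A = "map Some a"
  have okA: "ok ?A" using a by simp
  have 1: "sig c (\<lambda>z. dQ (?A @ z) F) = dW ?A (\<lambda>y. sig c (\<lambda>z. F (y @ z)))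
     + sgnp (cobar_deg C a) * (ev (\<lambda>b. sig b (\<lambda>z. F (?A @ z))) (gdif C c) + F (?A @ [Some c])
           + ev (\<lambda>(x, y). sig y (\<lambda>z. F (?A @ Some x # z))) (red_diag C c))
     + sig c (\<lambda>z. Lst (?A @ z) F)"
    by (simp add: dQ_def dW_append sig_lin sig_dW sig_D[OF c'])
  have 2: "dW ?A (\<lambda>y. sgnp (gdeg C c * wd y) * sig c (\<lambda>z. F (y @ z)))
     = sgnp (gdeg C c * (cobar_deg C a - 1)) * dW ?A (\<lambda>y. sig c (\<lambda>z. F (y @ z)))"
    unfolding dW_lin(4)[symmetric] by (rule dW_cong[OF okA]) (simp add: drv_def)
  have 3: "ev (\<lambda>z. sgnp (gdeg C c * cobar_deg C z) * sig c (\<lambda>y. F (map Some z @ y))) (cobar_dif C a)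
      = sgnp (gdeg C c * (cobar_deg C a - 1)) * dW ?A (\<lambda>y. sig c (\<lambda>z. F (y @ z)))"
    using 2 by (simp add: dW_Some)
  have 4: "ev (\<lambda>b. sgnp (gdeg C b * cobar_deg C a) * sig b (\<lambda>z. F (?A @ z))) (gdif C c)
     = sgnp ((gdeg C c - 1) * cobar_deg C a) * ev (\<lambda>b. sig b (\<lambda>z. F (?A @ z))) (gdif C c)"
    unfolding ev_fun_mult[symmetric] by (rule ev_dif_cong[OF c]) simp
  have 5: "ev (\<lambda>(x, y). sgnp (gdeg C x) * (sgnp (gdeg C x * (gdeg C y - 1 + cobar_deg C a)) * sig x (\<lambda>z. F (Some y # ?A @ z)))) (red_diag C c)
     = sgnp (gdeg C c * cobar_deg C a) * ev (\<lambda>(x, y). sgnp (gdeg C y * (cobar_deg C a + gdeg C x)) * sig x (\<lambda>z. F (Some y # ?A @ z))) (red_diag C c)"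
  proof -
    have e: "sgnp (gdeg C x) * (sgnp (gdeg C x * (gdeg C y - 1 + cobar_deg C a)) * v)
       = sgnp ((gdeg C x + gdeg C y) * cobar_deg C a) * (sgnp (gdeg C y * (cobar_deg C a + gdeg C x)) * v)" for x y and v :: 'k
      by (simp add: sgn_norm)
    show ?thesis unfolding ev_fun_mult[symmetric] case_prod_unfold
      by (rule ev_cong) (use red_keys[OF c] in \<open>auto simp: e\<close>)
  qed
  have 6: "ev (\<lambda>(x, y). sgnp ((cobar_deg C a + gdeg C y) * (gdeg C x - 1)) * (sgnp (gdeg C y * (cobar_deg C a + (gdeg C x - 1))) * sig y (\<lambda>z. F (?A @ Some x # z)))) (red_diag C c)
     = sgnp (gdeg C c * cobar_deg C a) * (sgnp (cobar_deg C a) * ev (\<lambda>(x, y). sig y (\<lambda>z. F (?A @ Some x # z))) (red_diag C c))"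
  proof -
    have e: "sgnp ((cobar_deg C a + gdeg C y) * (gdeg C x - 1)) * (sgnp (gdeg C y * (cobar_deg C a + (gdeg C x - 1))) * v)
       = sgnp ((gdeg C x + gdeg C y) * cobar_deg C a) * (sgnp (cobar_deg C a) * v)" for x y and v :: 'k
      by (simp add: sgn_norm)
    show ?thesis unfolding ev_fun_mult[symmetric] case_prod_unfold
      by (rule ev_cong) (use red_keys[OF c] in \<open>auto simp: e\<close>)
  qed
  have "ev (nab F) (twisted_dif C (c, a)) =
     sgnp ((gdeg C c - 1) * cobar_deg C a) * ev (\<lambda>b. sig b (\<lambda>z. F (?A @ z))) (gdif C c)
     + sgnp (gdeg C c) * (sgnp (gdeg C c * (cobar_deg C a - 1)) * dW ?A (\<lambda>y. sig c (\<lambda>z. F (y @ z))))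
     - F (Some c # ?A)
     - sgnp (gdeg C c * cobar_deg C a) * ev (\<lambda>(x, y). sgnp (gdeg C y * (cobar_deg C a + gdeg C x)) * sig x (\<lambda>z. F (Some y # ?A @ z))) (red_diag C c)
     + sgnp (cobar_deg C a * (gdeg C c - 1)) * F (?A @ [Some c])
     + sgnp (gdeg C c * cobar_deg C a) * (sgnp (cobar_deg C a) * ev (\<lambda>(x, y). sig y (\<lambda>z. F (?A @ Some x # z))) (red_diag C c))"
    using False coaug_gen
    by (simp add: twisted_dif_def ev_lin nab_def 3 4 5[symmetric, unfolded case_prod_unfold] 6[symmetric, unfolded case_prod_unfold] case_prod_unfold)
  then show ?thesis
    by (simp add: nab_def 1 sig_Lst[OF c'] sgn_norm)
qed

section \<open>Compatibility of the inclusion with the diagonals\<close>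

text \<open>
  Cutting \<open>\<sigma>_C(c)\<close> at all places is \<open>\<sigma>_C\<close> applied to both factors of the diagonal of \<open>c\<close>, because all
  ways of bracketing an iterated diagonal agree.  The cuts in front of the first bar and behind the
  last entry account for the terms \<open>1 \<otimes> c\<close> and \<open>c \<otimes> 1\<close>.
\<close>

lemma sig_cut:
  assumes "c \<in> gens C"
  shows "sig c (\<lambda>z. H z [] + cuts z H) = ev (\<lambda>(x, y). sig x (\<lambda>u. sig y (H u))) (codiag C c)"
proof (cases "c = one")
  case True
  then show ?thesis by (simp add: coaug_codiag)
next
  case False
  then have "c \<in> Cb" using assms by simp
  then show ?thesis
  proof (induction c arbitrary: H rule: sig_induct)
    case (step c)
    let ?e = "\<lambda>y. [None, Some y]"
    have c: "c \<in> gens C" using step.hyps by simp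
    have S: "sig x (\<lambda>z. H (z @ ?e y) [] + cuts (z @ ?e y) H)
       = sig x (\<lambda>z. H (z @ ?e y) [])
         + (sig x (\<lambda>z. H [] (z @ ?e y)) + sig x (\<lambda>z. H z (?e y)) + ev (\<lambda>(x', x''). sig x' (\<lambda>u. sig x'' (\<lambda>v. H u (v @ ?e y)))) (red_diag C x))"
      if "x \<in> Cb" "y \<in> Cb" "gdeg C x + gdeg C y = gdeg C c" for x y
    proof -
      have "sig x (\<lambda>z. H z ([] @ ?e y) + cuts z (\<lambda>U V. H U (V @ ?e y))) = ev (\<lambda>(x, y'). sig x (\<lambda>u. sig y' (\<lambda>v. H u (v @ ?e y)))) (codiag C x)"
        by (rule step.IH) (use that red_less in auto)
      then show ?thesis
        by (simp add: ev_codiag[OF that(1)] cuts_append sig_lin algebra_simps)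
    qed
    have "sig c (\<lambda>z. H z [] + cuts z H) = H (?e c) [] + H [] (?e c)
        + ev (\<lambda>(x, y). sig x (\<lambda>z. H (z @ ?e y) [] + cuts (z @ ?e y) H)) (red_diag C c)"
      by (simp add: sig_rec[OF step.hyps])
    also have "\<dots> = H (?e c) [] + H [] (?e c) + (ev (\<lambda>(x, y). sig x (\<lambda>z. H (z @ ?e y) [])) (red_diag C c)
        + ev (\<lambda>(x, y). sig x (\<lambda>z. H [] (z @ ?e y))) (red_diag C c)
        + (ev (\<lambda>(x, y). sig x (\<lambda>z. H z (?e y))) (red_diag C c)
        + ev (\<lambda>(x, y). ev (\<lambda>(x', x''). sig x' (\<lambda>u. sig x'' (\<lambda>v. H u (v @ ?e y)))) (red_diag C x)) (red_diag C c)))"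
    proof -
      have "ev (\<lambda>(x, y). sig x (\<lambda>z. H (z @ ?e y) [] + cuts (z @ ?e y) H)) (red_diag C c)
        = ev (\<lambda>(x, y). sig x (\<lambda>z. H (z @ ?e y) [])
         + (sig x (\<lambda>z. H [] (z @ ?e y)) + sig x (\<lambda>z. H z (?e y)) + ev (\<lambda>(x', x''). sig x' (\<lambda>u. sig x'' (\<lambda>v. H u (v @ ?e y)))) (red_diag C x))) (red_diag C c)"
        by (rule ev_red_cong[OF c]) (rule S)
      then show ?thesis by (simp only: case_prod_unfold ev_fun_add add.assoc)
    qed
    also have "ev (\<lambda>(x, y). sig x (\<lambda>z. H z (?e y))) (red_diag C c)
        + ev (\<lambda>(x, y). ev (\<lambda>(x', x''). sig x' (\<lambda>u. sig x'' (\<lambda>v. H u (v @ ?e y)))) (red_diag C x)) (red_diag C c)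
        = ev (\<lambda>(x, y). sig x (\<lambda>u. sig y (H u))) (red_diag C c)"
    proof -
      have "ev (\<lambda>(x, y). sig x (\<lambda>u. sig y (H u))) (red_diag C c)
         = ev (\<lambda>(x, y). sig x (\<lambda>z. H z (?e y)) + ev (\<lambda>(y', y''). sig x (\<lambda>u. sig y' (\<lambda>v. H u (v @ ?e y'')))) (red_diag C y)) (red_diag C c)"
        by (rule ev_red_cong[OF c]) (simp add: sig_rec sig_lin sig_ev case_prod_unfold)
      then show ?thesis
        by (simp add: red_coassoc[OF step.hyps, unfolded case_prod_unfold, of "\<lambda>x y w. sig x (\<lambda>u. sig y (\<lambda>v. H u (v @ ?e w)))"] case_prod_unfold ev_fun_add)
    qed
    finally show ?case
      by (simp add: ev_codiag[OF step.hyps] sig_rec[OF step.hyps])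
  qed
qed

lemma rdc_appendD: "rdc (u @ v) \<Longrightarrow> rdc v"
  by (induction u) auto

lemma Ush_True_bars:
  assumes "\<And>l r. \<not> rdc l \<Longrightarrow> B l r = 0"
  shows "Ush True (bars cs) B = B (bars cs) []"
  using assms
proof (induction cs arbitrary: B)
  case (Cons c cs)
  have "Ush True (bars cs) (\<lambda>l r. sgnp ((gdeg C c - 1) * wd l) * B (None # l) (Some c # r)) = 0"
    by (cases cs) (simp_all add: Cons.prems Ush_lin)
  moreover have "Ush True (bars cs) (\<lambda>l r. B (None # Some c # l) r) = B (None # Some c # bars cs) []"
    by (rule Cons.IH) (simp add: Cons.prems)
  ultimately show ?case by simp
qed simp

lemma Ush_False_bars:
  assumes "\<And>l r. \<not> rdc r \<Longrightarrow> B l r = 0"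
  shows "Ush False (bars cs) B = B [] (bars cs)"
  using assms
proof (induction cs arbitrary: B)
  case (Cons c cs)
  have "Ush False (bars cs) (\<lambda>l r. sgnp (gdeg C c - 1 + wd l) * B (Some c # l) (None # r)) = 0"
    by (cases cs) (simp_all add: Cons.prems Ush_lin)
  moreover have "Ush False (bars cs) (\<lambda>l r. sgnp ((gdeg C c - 1) * wd l) * (sgnp (wd l) * B l (None # Some c # r)))
      = B [] (None # Some c # bars cs)"
    by (subst Cons.IH) (simp_all add: Cons.prems)
  ultimately show ?case by simp
qed simp

lemma HB_bars:
  assumes B: "\<And>l r. \<not> rdc l \<Longrightarrow> B l r = 0" "\<And>l r. \<not> rdc r \<Longrightarrow> B l r = 0"
  shows "HB B (map Some a @ bars cs) (bars ds)
    = Ush True (map Some a) (\<lambda>l r. sgnp (wd r * wd (bars cs)) * B (l @ bars cs) (r @ bars ds))"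
proof -
  have B1: "B (u @ l) r = 0" if "\<not> rdc l" for u l r by (rule B(1)) (use that rdc_appendD in blast)
  have B2: "B l (u @ r) = 0" if "\<not> rdc r" for u l r by (rule B(2)) (use that rdc_appendD in blast)
  have 1: "Ush False (bars ds) (\<lambda>l2 r2. sgnp (wd l2 * n) * B (l2 @ l) (r @ r2)) = B l (r @ bars ds)" for l r n
    by (subst Ush_False_bars) (simp_all add: B2)
  have 2: "Ush True (bars cs) (\<lambda>l' r'. sgnp (n * wd l') * B (l @ l') ((r @ r') @ bars ds)) = sgnp (n * wd (bars cs)) * B (l @ bars cs) (r @ bars ds)" for l r n
    by (subst Ush_True_bars) (simp_all add: B1)
  show ?thesis unfolding HB_def 1 Ush_append 2 ..
qed


text \<open>
  The convolution product of forms on \<open>C \<otimes> \<Omega>C\<close> for the diagonal of \<open>C\<close> and the shuffle diagonal of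
  \<open>\<Omega>C\<close>.  The first sign interchanges \<open>y\<close> and \<open>l\<close>, the second one is that of \<open>f \<otimes> g\<close> on a pair.
\<close>

definition tmul :: "('b \<times> 'b list \<Rightarrow> 'k) \<Rightarrow> ('b \<times> 'b list \<Rightarrow> 'k) \<Rightarrow> 'b \<times> 'b list \<Rightarrow> 'k" where
  "tmul g h = (\<lambda>(c, a). ev (\<lambda>(x, y). Ush True (map Some a) (\<lambda>l r.
      sgnp (gdeg C y * wd l) * (sgnp ((gdeg C x + wd l) * (gdeg C y + wd r)) * (g (x, map the l) * h (y, map the r))))) (codiag C c))"

text \<open>
  \<open>\<nabla>\<close> is a morphism of coalgebras.  In \<open>\<sigma>_C\<close> each entry is a single letter, and moving this letter
  to the side where its bar is not would leave an empty entry.  Hence on the \<open>\<sigma>_C\<close> part only the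
  cuts survive (\<open>sig_cut\<close>), and only the letters of \<open>a\<close> are unshuffled.
\<close>

theorem nab_Diag:
  assumes c: "c \<in> gens C" and F: "\<And>u. \<not> rdc u \<Longrightarrow> F u = 0" and G: "\<And>u. \<not> rdc u \<Longrightarrow> G u = 0"
  shows "nab (Diag (\<lambda>l r. sgnp (wd l * wd r) * (F l * G r))) (c, a) = tmul (nab F) (nab G) (c, a)"
proof -
  let ?A = "map Some a" let ?B = "\<lambda>l r. sgnp (wd l * wd r) * (F l * G r)"
  have "sig c (\<lambda>z. Diag ?B (?A @ z)) = sig c (\<lambda>z. (\<lambda>U. HB ?B (?A @ U)) z [] + cuts z (\<lambda>U. HB ?B (?A @ U)))"
    by (simp add: Diag_def cuts_append)
  also have "\<dots> = ev (\<lambda>(x, y). sig x (\<lambda>u. sig y (\<lambda>v. HB ?B (?A @ u) v))) (codiag C c)"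
    by (rule sig_cut[OF c])
  also have "\<dots> = ev (\<lambda>(x, y). Ush True ?A (\<lambda>l r. sgnp (wd r * gdeg C x) * (sgnp ((wd l + gdeg C x) * (wd r + gdeg C y))
       * (sig x (\<lambda>u. F (l @ u)) * sig y (\<lambda>v. G (r @ v)))))) (codiag C c)"
  proof (intro ev_cong, clarify)
    fix x y assume "(x, y) \<in> Poly_Mapping.keys (codiag C c)"
    then have xy: "x \<in> gens C" "y \<in> gens C" using codiag_closed[OF c] by auto
    have "sig x (\<lambda>u. sig y (\<lambda>v. HB ?B (?A @ u) v)) = sig x (\<lambda>u. sig y (\<lambda>v. Ush True ?A (\<lambda>l r.
        sgnp (wd r * gdeg C x) * (sgnp ((wd l + gdeg C x) * (wd r + gdeg C y)) * (F (l @ u) * G (r @ v))))))"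
    proof (rule sig_cong[OF xy(1)], rule sig_cong[OF xy(2)])
      fix cs ds assume "wd (bars cs) = gdeg C x" "wd (bars ds) = gdeg C y"
      then show "HB ?B (?A @ bars cs) (bars ds) = Ush True ?A (\<lambda>l r.
        sgnp (wd r * gdeg C x) * (sgnp ((wd l + gdeg C x) * (wd r + gdeg C y)) * (F (l @ bars cs) * G (r @ bars ds))))"
        by (subst HB_bars) (simp_all add: F G)
    qed
    also have "\<dots> = Ush True ?A (\<lambda>l r. sig x (\<lambda>u. sig y (\<lambda>v. 
        sgnp (wd r * gdeg C x) * (sgnp ((wd l + gdeg C x) * (wd r + gdeg C y)) * (F (l @ u) * G (r @ v))))))"
      by (simp only: sig_def Ush_ev)
    also have "\<dots> = Ush True ?A (\<lambda>l r. sgnp (wd r * gdeg C x) * (sgnp ((wd l + gdeg C x) * (wd r + gdeg C y))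
       * (sig x (\<lambda>u. F (l @ u)) * sig y (\<lambda>v. G (r @ v)))))"
      by (simp only: sig_lin(4) sig_mult_right)
    finally show "sig x (\<lambda>u. sig y (\<lambda>v. HB ?B (?A @ u) v)) = \<dots>" .
  qed
  finally have *: "sig c (\<lambda>z. Diag ?B (?A @ z)) = \<dots>" .
  have "nab (Diag ?B) (c, a) = ev (\<lambda>(x, y). Ush True ?A (\<lambda>l r. sgnp (gdeg C c * cobar_deg C a) * (sgnp (wd r * gdeg C x) * (sgnp ((wd l + gdeg C x) * (wd r + gdeg C y))
       * (sig x (\<lambda>u. F (l @ u)) * sig y (\<lambda>v. G (r @ v))))))) (codiag C c)"
    unfolding nab_def prod.case * by (simp add: Ush_lin case_prod_unfold ev_fun_mult)
  also have "\<dots> = tmul (nab F) (nab G) (c, a)"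
    unfolding tmul_def prod.case
  proof (intro ev_cong, clarify)
    fix x y assume "(x, y) \<in> Poly_Mapping.keys (codiag C c)"
    then have xy: "gdeg C x + gdeg C y = gdeg C c" using codiag_closed[OF c] by auto
    show "Ush True ?A (\<lambda>l r. sgnp (gdeg C c * cobar_deg C a) * (sgnp (wd r * gdeg C x) * (sgnp ((wd l + gdeg C x) * (wd r + gdeg C y))
       * (sig x (\<lambda>u. F (l @ u)) * sig y (\<lambda>v. G (r @ v))))))
      = Ush True ?A (\<lambda>l r. sgnp (gdeg C y * wd l) * (sgnp ((gdeg C x + wd l) * (gdeg C y + wd r)) *
           (nab F (x, map the l) * nab G (y, map the r))))"
    proof (rule Ush_cong)
      fix l r assume "un True ?A l r"
      then have "None \<notin> set l" "None \<notin> set r" "cobar_deg C a = wd l + wd r"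
        by (simp_all add: un_def)
      then have lr: "map Some (map the l) = l" "map Some (map the r) = r" "cobar_deg C a = wd l + wd r"
        using free_word by blast+
      have "cobar_deg C (map the l) = wd l" "cobar_deg C (map the r) = wd r"
        using lr(1,2) wd_map_Some by metis+
      then show "sgnp (gdeg C c * cobar_deg C a) * (sgnp (wd r * gdeg C x) * (sgnp ((wd l + gdeg C x) * (wd r + gdeg C y))
         * (sig x (\<lambda>u. F (l @ u)) * sig y (\<lambda>v. G (r @ v)))))
        = sgnp (gdeg C y * wd l) * (sgnp ((gdeg C x + wd l) * (gdeg C y + wd r)) * (nab F (x, map the l) * nab G (y, map the r)))"
        unfolding nab_def prod.case lr xy[symmetric] by (simp add: sgn_norm)
    qed
  qed
  finally show ?thesis .
qed

end


context cobar_setting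
begin

section \<open>The retraction onto the twisted tensor product\<close>

abbreviation cd :: "'b list \<Rightarrow> int" where "cd \<equiv> cobar_deg C"

text \<open>
  The signed sum over the ways to split a word as \<open>x v z\<close> at a letter \<open>v\<close>; the prefix is collected at the
  end of \<open>a\<close>.
\<close>

primrec sp :: "'b list \<Rightarrow> ('b list \<Rightarrow> 'b \<Rightarrow> 'b list \<Rightarrow> 'k) \<Rightarrow> 'b list \<Rightarrow> 'k" where
  "sp [] K a = 0"
| "sp (v # w) K a = K a v w + sgnp (gdeg C v - 1) * sp w K (a @ [v])"

lemma sp_lin:
  "sp w (\<lambda>a v z. F a v z + G a v z) a = sp w F a + sp w G a"
  "sp w (\<lambda>a v z. - F a v z) a = - sp w F a"
  "sp w (\<lambda>a v z. s * F a v z) a = s * sp w F a"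
  "sp w (\<lambda>a v z. 0) a = 0"
  by (induction w arbitrary: a) (simp_all add: algebra_simps)

lemma sp_cong:
  "(\<And>u v z. w = u @ v # z \<Longrightarrow> F (a @ u) v z = G (a @ u) v z) \<Longrightarrow> sp w F a = sp w G a"
proof (induction w arbitrary: a)
  case (Cons x w)
  have "sp w F (a @ [x]) = sp w G (a @ [x])"
    by (rule Cons.IH) (use Cons.prems[of "x # _"] in simp)
  then show ?case using Cons.prems[of "[]" x w] by simp
qed simp

lemma sp_append: "sp (w1 @ w2) K a = sp w1 (\<lambda>a v w. K a v (w @ w2)) a + sgnp (cd w1) * sp w2 K (a @ w1)"
  by (induction w1 arbitrary: a) (simp_all add: sgnp_add sgnp_diff algebra_simps)

lemma sp_shift: "sp w K (b @ a) = sp w (\<lambda>a. K (b @ a)) a"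
  by (induction w arbitrary: a) simp_all

text \<open>
  The cyclic derivative: every letter \<open>v\<close> of the bar entry in turn becomes the factor in \<open>C\<close>, and the
  rest \<open>z a x\<close> is read cyclically from there.
\<close>

definition pw :: "'b list \<Rightarrow> ('b \<times> 'b list \<Rightarrow> 'k) \<Rightarrow> 'b list \<Rightarrow> 'k" where
  "pw w G = sp w (\<lambda>a v w. sgnp (cd a * (cd w + gdeg C v)) * G (v, w @ a))"

lemma pw_Nil [simp]: "pw [] G a = 0" by (simp add: pw_def)

lemma pw_Cons: "pw (v # w) G a = sgnp (cd a * (cd w + gdeg C v)) * G (v, w @ a) + sgnp (gdeg C v - 1) * pw w G (a @ [v])"
  by (simp add: pw_def)

lemma pw_append:
  "pw (w1 @ w2) G a = sgnp (cd w2 * (cd a + cd w1 + 1)) * pw w1 G (w2 @ a) + sgnp (cd w1) * pw w2 G (a @ w1)"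
proof -
  have "sp w1 (\<lambda>a v w. sgnp (cd a * (cd (w @ w2) + gdeg C v)) * G (v, (w @ w2) @ a)) a
    = sp w1 (\<lambda>a' v w. sgnp (cd w2 * (cd a + cd w1 + 1)) * (sgnp (cd (w2 @ a') * (cd w + gdeg C v)) * G (v, w @ w2 @ a'))) a"
    by (rule sp_cong) (simp add: sgn_norm)
  then show ?thesis by (simp add: pw_def sp_append sp_shift sp_lin)
qed

text \<open>
  The retraction \<open>\<pi>\<close> of the cyclic bar construction onto \<open>C \<otimes> \<Omega>C\<close>: the identity without
  bars, the cyclic derivative with one bar, and zero with more.
\<close>

definition piw :: "('b \<times> 'b list \<Rightarrow> 'k) \<Rightarrow> 'b option list \<Rightarrow> 'k" where
  "piw G u = (case snd (dec u) of [] \<Rightarrow> G (one, fst (dec u))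
     | w # ws \<Rightarrow> if ws = [] then pw w G (fst (dec u)) else 0)"

lemma dec_map_Some [simp]: "dec (map Some w) = (w, [])"
  using dec_Some_append[of w "[]"] by simp

text \<open>
  The differential of \<open>C \<otimes> \<Omega>C\<close> on forms.
\<close>

definition dT :: "('b \<times> 'b list \<Rightarrow> 'k) \<Rightarrow> 'b \<times> 'b list \<Rightarrow> 'k" where
  "dT G x = ev G (twisted_dif C x)"

lemma cobar_dif_cong:
  assumes "a \<in> lists Cb" "\<And>z. z \<in> lists Cb \<Longrightarrow> cd z = cd a - 1 \<Longrightarrow> F z = G z"
  shows "ev F (cobar_dif C a) = ev G (cobar_dif C a)"
proof -
  have "dW (map Some a) (\<lambda>z. F (map the z)) = dW (map Some a) (\<lambda>z. G (map the z))"
  proof (rule dW_cong)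
    fix z assume "drv (map Some a) z"
    then have z: "map Some (map the z) = z" "ok z" "wd z = cd a - 1" using free_word by (auto simp: drv_def)
    then show "F (map the z) = G (map the z)" using ok_map_Some wd_map_Some by (intro assms(2)) metis+
  qed (use assms in simp)
  then show ?thesis by (simp add: dW_Some comp_def)
qed

lemma dT_cong:
  assumes c: "c \<in> gens C" and a: "a \<in> lists Cb"
    and FG: "\<And>x b. x \<in> gens C \<Longrightarrow> b \<in> lists Cb \<Longrightarrow> gdeg C x + cd b = gdeg C c + cd a - 1 \<Longrightarrow> F (x, b) = G (x, b)"
  shows "dT F (c, a) = dT G (c, a)"
proof (cases "c = one")
  case True
  have "ev (\<lambda>z. F (one, z)) (cobar_dif C a) = ev (\<lambda>z. G (one, z)) (cobar_dif C a)"
    by (rule cobar_dif_cong[OF a]) (use True c in \<open>auto intro!: FG\<close>)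
  then show ?thesis by (simp add: dT_def twisted_dif_def True ev_lin)
next
  case False
  then have c': "c \<in> Cb" using c by simp
  have 1: "ev (\<lambda>z. F (c, z)) (cobar_dif C a) = ev (\<lambda>z. G (c, z)) (cobar_dif C a)"
    by (rule cobar_dif_cong[OF a]) (use c in \<open>auto intro!: FG\<close>)
  have 2: "ev (\<lambda>x. F (x, a)) (gdif C c) = ev (\<lambda>x. G (x, a)) (gdif C c)"
    by (rule ev_dif_cong[OF c]) (use a in \<open>auto intro!: FG\<close>)
  have 3: "ev (\<lambda>(x, y). sgnp (gdeg C x) * F (x, y # a)) (red_diag C c) = ev (\<lambda>(x, y). sgnp (gdeg C x) * G (x, y # a)) (red_diag C c)"
    by (rule ev_red_cong[OF c], rule arg_cong2[of _ _ _ _ "(*)", OF refl]) (use a in \<open>auto intro!: FG\<close>)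
  have 4: "ev (\<lambda>(x, y). sgnp ((cd a + gdeg C y) * (gdeg C x - 1)) * F (y, a @ [x])) (red_diag C c)
      = ev (\<lambda>(x, y). sgnp ((cd a + gdeg C y) * (gdeg C x - 1)) * G (y, a @ [x])) (red_diag C c)"
    by (rule ev_red_cong[OF c], rule arg_cong2[of _ _ _ _ "(*)", OF refl]) (use a in \<open>auto intro!: FG\<close>)
  have 5: "F (one, c # a) = G (one, c # a)" "F (one, a @ [c]) = G (one, a @ [c])"
    using c' a coaug_gen by (auto intro!: FG)
  show ?thesis using False 1 2 3 4 5
    by (simp add: dT_def twisted_dif_def ev_lin case_prod_unfold)
qed

abbreviation nbars :: "'b option list \<Rightarrow> nat" where "nbars u \<equiv> count_list u None"

lemma nbars_free: "None \<notin> set u \<Longrightarrow> nbars u = 0"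
  by simp

lemma length_dec: "length (snd (dec u)) = nbars u"
  by (induction u) (auto split: option.split)

lemma dl_cong_bars:
  assumes "\<And>z. (x = None \<longrightarrow> z = []) \<Longrightarrow> (x \<noteq> None \<longrightarrow> None \<notin> set z) \<Longrightarrow> F z = G z"
  shows "dl x F = dl x G"
  unfolding dl_def by (cases x) (auto simp: assms)

lemma dW_cong_bars:
  "(\<And>z. nbars u \<le> Suc (nbars z) \<Longrightarrow> F z = G z) \<Longrightarrow> dW u F = dW u G"
proof (induction u arbitrary: F G)
  case (Cons x u)
  have "dl x (\<lambda>z. F (z @ u)) = dl x (\<lambda>z. G (z @ u))"
    by (rule dl_cong_bars, rule Cons.prems) (auto simp: count_list_append)
  moreover have "dW u (\<lambda>z. F (x # z)) = dW u (\<lambda>z. G (x # z))"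
    by (rule Cons.IH, rule Cons.prems) auto
  ultimately show ?case by simp
qed simp

lemma piw_bars: "nbars u \<ge> 2 \<Longrightarrow> piw G u = 0"
  unfolding piw_def length_dec[symmetric] by (auto split: list.split)

lemma dQ_piw_bars: "nbars u \<ge> 3 \<Longrightarrow> dQ u (piw G) = 0"
proof -
  assume u: "nbars u \<ge> 3"
  have "dW u (piw G) = dW u (\<lambda>z. 0)" by (rule dW_cong_bars) (use u in \<open>auto intro: piw_bars\<close>)
  moreover have "Lst u (piw G) = 0"
  proof (cases u rule: word_cases)
    case (2 x w)
    then have "piw G (w @ x) = 0" using u by (intro piw_bars) (simp add: count_list_append)
    then show ?thesis using 2 by simp
  qed simp
  ultimately show ?thesis by (simp add: dQ_def dW_lin)
qed

lemma dQ_piw_2: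
  "dQ (map Some a @ None # map Some w1 @ None # map Some w2) (piw G) = 0"
proof -
  have "dW (map Some a @ None # map Some w1 @ None # map Some w2) (piw G) = sgnp (cd a) * pw w2 G (a @ w1)
      - sgnp (cd a) * (sgnp (cd w1) * pw (w1 @ w2) G a)"
    by (simp add: dW_append dW_Some piw_def algebra_simps)
  moreover have "Lst (map Some a @ None # map Some w1 @ None # map Some w2) (piw G)
     = - sgnp ((cd w2 + 1) * (cd a + cd w1 + 1)) * pw w1 G (w2 @ a)"
    using Lst_last[of "map Some w2" "map Some a @ None # map Some w1" "piw G"]
    by (simp add: piw_def algebra_simps)
  ultimately show ?thesis by (simp add: dQ_def pw_append sgn_norm)
qed

lemma dQ_piw_letter:
  assumes v: "v \<in> Cb" and a: "a \<in> lists Cb"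
  shows "dQ (map Some a @ [None, Some v]) (piw G) = sgnp (cd a * gdeg C v) * dT G (v, a)"
proof -
  have v': "v \<in> gens C" "v \<noteq> one" using v by auto
  have 1: "ev (\<lambda>z. sgnp (cd z * gdeg C v) * G (v, z)) (cobar_dif C a) = sgnp ((cd a - 1) * gdeg C v) * ev (\<lambda>z. G (v, z)) (cobar_dif C a)"
  proof -
    have "dW (map Some a) (\<lambda>z. sgnp (wd z * gdeg C v) * G (v, map the z)) = dW (map Some a) (\<lambda>z. sgnp ((cd a - 1) * gdeg C v) * G (v, map the z))"
      by (rule dW_cong) (use a in \<open>auto simp: drv_def\<close>)
    then show ?thesis by (simp add: dW_Some ev_fun_mult comp_def)
  qed
  have 2: "ev (\<lambda>x. sgnp (cd a * gdeg C x) * G (x, a)) (gdif C v) = sgnp (cd a * (gdeg C v - 1)) * ev (\<lambda>x. G (x, a)) (gdif C v)"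
    unfolding ev_fun_mult[symmetric] by (rule ev_dif_cong[OF v'(1)]) simp
  have 3: "ev (\<lambda>(x, y). sgnp (gdeg C x) * (sgnp (cd a * (gdeg C y - 1 + gdeg C x)) * G (x, y # a)
        + sgnp (gdeg C x - 1) * (sgnp ((cd a + (gdeg C x - 1)) * gdeg C y) * G (y, a @ [x])))) (red_diag C v)
     = sgnp (cd a * (gdeg C v - 1)) * (ev (\<lambda>(x, y). sgnp (gdeg C x) * G (x, y # a)) (red_diag C v)
        - ev (\<lambda>(x, y). sgnp ((cd a + gdeg C y) * (gdeg C x - 1)) * G (y, a @ [x])) (red_diag C v))"
  proof -
    have e: "sgnp (gdeg C x) * (sgnp (cd a * (gdeg C y - 1 + gdeg C x)) * G (x, y # a)
        + sgnp (gdeg C x - 1) * (sgnp ((cd a + (gdeg C x - 1)) * gdeg C y) * G (y, a @ [x])))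
      = sgnp (cd a * (gdeg C x + gdeg C y - 1)) * (sgnp (gdeg C x) * G (x, y # a) - sgnp ((cd a + gdeg C y) * (gdeg C x - 1)) * G (y, a @ [x]))" for x y
      by (simp add: sgn_norm)
    show ?thesis unfolding ev_fun_mult[symmetric] ev_fun_diff[symmetric] case_prod_unfold
      by (rule ev_cong) (use red_keys[OF v'(1)] e in force)
  qed
  have DW: "dW (map Some a @ [None, Some v]) (piw G) = sgnp ((cd a - 1) * gdeg C v) * ev (\<lambda>z. G (v, z)) (cobar_dif C a)
     + sgnp (cd a) * (G (one, a @ [v]) - (sgnp (cd a * (gdeg C v - 1)) * (ev (\<lambda>(x, y). sgnp (gdeg C x) * G (x, y # a)) (red_diag C v)
        - ev (\<lambda>(x, y). sgnp ((cd a + gdeg C y) * (gdeg C x - 1)) * G (y, a @ [x])) (red_diag C v))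
        - sgnp (cd a * (gdeg C v - 1)) * ev (\<lambda>x. G (x, a)) (gdif C v)))"
    unfolding 1[symmetric] 2[symmetric] 3[symmetric]
    by (simp add: dW_append dW_Some piw_def dl_def pw_Cons) (simp add: algebra_simps)
  have LS: "Lst (map Some a @ [None, Some v]) (piw G) = - sgnp (gdeg C v * cd a) * G (one, v # a)"
    using Lst_last[of "[Some v]" "map Some a" "piw G"] by (simp add: piw_def)
  have DT: "dT G (v, a) = ev (\<lambda>x. G (x, a)) (gdif C v) + sgnp (gdeg C v) * ev (\<lambda>z. G (v, z)) (cobar_dif C a)
      - G (one, v # a) - ev (\<lambda>(x, y). sgnp (gdeg C x) * G (x, y # a)) (red_diag C v)
      + sgnp (cd a * (gdeg C v - 1)) * G (one, a @ [v])
      + ev (\<lambda>(x, y). sgnp ((cd a + gdeg C y) * (gdeg C x - 1)) * G (y, a @ [x])) (red_diag C v)"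
    using v'(2) by (simp add: dT_def twisted_dif_def ev_lin case_prod_unfold)
  show ?thesis unfolding dQ_def DW LS DT by (simp add: sgn_norm)
qed

text \<open>
  Checking compatibility on one bar entry \<open>w\<close> directly would be tedious.  Instead, \<open>R = dQ(piw G)\<close>
  vanishes on words with two bars, and \<open>dQ R = 0\<close>; on such words this says that \<open>R\<close> is a cyclic
  derivation in \<open>w\<close>, so that it is enough to know it for a single letter.
\<close>

lemma dQ_piw_1:
  "a \<in> lists Cb \<Longrightarrow> w \<in> lists Cb \<Longrightarrow> dQ (map Some a @ None # map Some w) (piw G) = pw w (dT G) a"
proof (induction w arbitrary: a)
  case Nil
  show ?case using Lst_last[of "[]" "map Some a" "piw G"]
    by (simp add: dQ_def dW_append dW_Some piw_def)
next
  case (Cons v w)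
  let ?R = "\<lambda>u. dQ u (piw G)"
  let ?u = "map Some a @ None # Some v # None # map Some w"
  have v: "v \<in> Cb" "w \<in> lists Cb" using Cons.prems by auto
  have R0: "?R (map Some a @ None # map Some w1 @ None # map Some w2) = 0" for a w1 w2
    by (rule dQ_piw_2)
  have "0 = dQ ?u ?R"
    using dQ_dQ[of ?u "piw G"] Cons.prems by auto
  also have "\<dots> = sgnp (cd a) * ?R (map Some (a @ [v]) @ None # map Some w)
       - sgnp (cd a + (gdeg C v - 1)) * ?R (map Some a @ None # map Some (v # w))
       - sgnp ((cd w + 1) * (cd a + gdeg C v)) * ?R (map Some (w @ a) @ [None, Some v])"
  proof -
    have "dW ?u ?R = sgnp (cd a) * ?R (map Some (a @ [v]) @ None # map Some w)
       - sgnp (cd a + (gdeg C v - 1)) * ?R (map Some a @ None # map Some (v # w))"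
      using R0[of _ "[v]" w] R0[of a "[v]"] R0[of a _ w]
      by (simp add: dW_append dW_Some dl_cobar sgn_norm)
    moreover have "Lst ?u ?R = - sgnp ((cd w + 1) * (cd a + gdeg C v)) * ?R (map Some (w @ a) @ [None, Some v])"
      using Lst_last[of "map Some w" "map Some a @ [None, Some v]" ?R] by simp
    ultimately show ?thesis by (simp add: dQ_def)
  qed
  also have "?R (map Some (a @ [v]) @ None # map Some w) = pw w (dT G) (a @ [v])"
    by (rule Cons.IH) (use Cons.prems in auto)
  also have "?R (map Some (w @ a) @ [None, Some v]) = sgnp (cd (w @ a) * gdeg C v) * dT G (v, w @ a)"
    by (rule dQ_piw_letter) (use Cons.prems in auto)
  finally have "sgnp (cd a + (gdeg C v - 1)) * ?R (map Some a @ None # map Some (v # w))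
    = sgnp (cd a) * pw w (dT G) (a @ [v]) - sgnp ((cd w + 1) * (cd a + gdeg C v)) * (sgnp (cd (w @ a) * gdeg C v) * dT G (v, w @ a))"
    by (simp add: algebra_simps)
  then have "sgnp (cd a + (gdeg C v - 1)) * (sgnp (cd a + (gdeg C v - 1)) * ?R (map Some a @ None # map Some (v # w)))
    = sgnp (cd a + (gdeg C v - 1)) * (sgnp (cd a) * pw w (dT G) (a @ [v]) - sgnp ((cd w + 1) * (cd a + gdeg C v)) * (sgnp (cd (w @ a) * gdeg C v) * dT G (v, w @ a)))"
    by simp
  then show ?case unfolding sgnp_cancel pw_Cons by (simp only:) (simp add: sgn_norm)
qed

theorem dQ_piw:
  assumes "ok u"
  shows "dQ u (piw G) = piw (dT G) u"
proof -
  obtain a ws where u: "u = map Some a @ encs ws" by (metis enc_dec enc_def)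
  show ?thesis
  proof (cases ws)
    case Nil
    then show ?thesis using u by (simp add: dQ_def piw_def dW_Some dT_def twisted_dif_def ev_lin)
  next
    case (Cons w ws')
    show ?thesis
    proof (cases ws')
      case Nil
      then show ?thesis using dQ_piw_1[of a w G] assms by (simp add: u Cons piw_def)
    next
      case (Cons w' ws'')
      have "dQ u (piw G) = 0"
      proof (cases ws'')
        case Nil
        then show ?thesis using dQ_piw_2[of a w w' G] by (simp add: u Cons \<open>ws = _\<close>)
      qed (intro dQ_piw_bars, simp add: u Cons \<open>ws = _\<close> count_list_append)
      then show ?thesis by (simp add: piw_def u Cons \<open>ws = _\<close>)
    qed
  qed
qed

text \<open>
  \<open>\<pi> \<circ> \<nabla>\<close> is the identity: of \<open>\<sigma>_C(c)\<close> only the term with one bar is seen by \<open>\<pi>\<close>.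
\<close>

lemma nab_piw:
  assumes "c \<in> gens C"
  shows "nab (piw G) (c, a) = G (c, a)"
proof (cases "c = one")
  case True
  then show ?thesis using coaug_gen by (simp add: nab_def piw_def)
next
  case False
  then have c: "c \<in> Cb" using assms by simp
  have "sig x (\<lambda>z. piw G (map Some a @ z @ [None, Some y])) = 0" if "x \<in> Cb" for x y
  proof -
    have "sig x (\<lambda>z. piw G (map Some a @ z @ [None, Some y])) = sig x (\<lambda>z. 0)"
    proof (rule sig_cong)
      fix cs assume "wd (bars cs) = gdeg C x"
      then have "cs \<noteq> []" using deg_Cb[OF that] by auto
      then obtain d ds where "cs = d # ds" by (cases cs) auto
      then show "piw G (map Some a @ bars cs @ [None, Some y]) = 0"
        by (intro piw_bars) (simp add: count_list_append)
    qed (use that in simp)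
    then show ?thesis by (simp add: sig_lin)
  qed
  then have "ev (\<lambda>(x, y). sig x (\<lambda>z. piw G (map Some a @ z @ [None, Some y]))) (red_diag C c) = ev (\<lambda>(x, y). 0) (red_diag C c)"
    using assms by (intro ev_red_cong) auto
  moreover have "piw G (map Some a @ [None, Some c]) = sgnp (cd a * gdeg C c) * G (c, a)"
    by (simp add: piw_def pw_Cons)
  ultimately show ?thesis by (simp add: nab_def sig_rec[OF c] case_prod_unfold sgn_norm)
qed

section \<open>The contracting homotopy\<close>

text \<open>
  The homotopy splits the first bar entry \<open>x v z\<close> into the one-letter entry \<open>v\<close> and the nonempty
  rest \<open>z\<close>, while \<open>x\<close> moves to the coefficient.
\<close>

definition hw :: "'b list \<Rightarrow> ('b option list \<Rightarrow> 'k) \<Rightarrow> 'b list \<Rightarrow> 'b option list \<Rightarrow> 'k" where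
  "hw w F a Y = sp w (\<lambda>a v w. if w = [] then 0 else
     sgnp (cd a + (gdeg C v - 1)) * F (map Some a @ None # Some v # None # map Some w @ Y)) a"

definition hQ :: "('b option list \<Rightarrow> 'k) \<Rightarrow> 'b option list \<Rightarrow> 'k" where
  "hQ F u = (case snd (dec u) of [] \<Rightarrow> 0 | w # ws \<Rightarrow> hw w F (fst (dec u)) (encs ws))"

text \<open>
  \<open>d0W\<close> and \<open>d0Q\<close> keep of the differential only the terms that delete a bar.  This is the cyclic bar
  differential of the tensor algebra without its internal differential.
\<close>

primrec d0W :: "'b option list \<Rightarrow> ('b option list \<Rightarrow> 'k) \<Rightarrow> 'k" where
  "d0W [] F = 0"
| "d0W (x # u) F = (if x = None then F u else 0) + sgnp (ld x) * d0W u (\<lambda>z. F (x # z))"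

definition d0Q :: "'b option list \<Rightarrow> ('b option list \<Rightarrow> 'k) \<Rightarrow> 'k" where
  "d0Q u F = d0W u F + Lst u F"

lemma d0W_lin:
  "d0W u (\<lambda>z. F z + G z) = d0W u F + d0W u G"
  "d0W u (\<lambda>z. - F z) = - d0W u F"
  "d0W u (\<lambda>z. s * F z) = s * d0W u F"
  "d0W u (\<lambda>z. 0) = 0"
  by (induction u arbitrary: F G) (simp_all add: algebra_simps)

lemma d0W_append: "d0W (u @ v) F = d0W u (\<lambda>z. F (z @ v)) + sgnp (wd u) * d0W v (\<lambda>z. F (u @ z))"
  by (induction u arbitrary: F) (simp_all add: sgnp_add algebra_simps)

lemma d0W_Some [simp]: "d0W (map Some a) F = 0"
  by (induction a arbitrary: F) simp_all

lemma sp_d0W: "sp w (\<lambda>a v z. d0W u (F a v z)) a = d0W u (\<lambda>y. sp w (\<lambda>a v z. F a v z y) a)"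
  by (induction w arbitrary: a) (simp_all add: d0W_lin)

text \<open>
  The part of \<open>\<nabla>\<close> that preserves the internal degree: the words \<open>a\<close> and \<open>a s c\<close>.
\<close>

definition iota :: "('b option list \<Rightarrow> 'k) \<Rightarrow> 'b \<times> 'b list \<Rightarrow> 'k" where
  "iota F = (\<lambda>(c, a). if c = one then F (map Some a) else sgnp (gdeg C c * cd a) * F (map Some a @ [None, Some c]))"

lemma hw_1:
  "w \<noteq> [] \<Longrightarrow> w \<in> lists Cb \<Longrightarrow> hw w (\<lambda>z. d0Q z F) a [] = pw w (iota F) a - F (map Some a @ None # map Some w)"
proof (induction w arbitrary: a)
  case (Cons v w)
  show ?case
  proof (cases "w = []")
    case True
    then show ?thesis using Cons.prems by (simp add: hw_def pw_Cons iota_def sgn_norm)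
  next
    case False
    have IH: "hw w (\<lambda>z. d0Q z F) (a @ [v]) [] = pw w (iota F) (a @ [v]) - F (map Some (a @ [v]) @ None # map Some w)"
      by (rule Cons.IH) (use Cons.prems False in auto)
    have "d0Q (map Some a @ None # Some v # None # map Some w) F
       = sgnp (cd a) * F (map Some a @ Some v # None # map Some w) - sgnp (cd a + (gdeg C v - 1)) * F (map Some a @ None # Some v # map Some w)
         - sgnp ((cd w + 1) * (cd a + gdeg C v)) * F (map Some w @ map Some a @ [None, Some v])"
      using Lst_last[of "map Some w" "map Some a @ [None, Some v]" F]
      by (simp add: d0Q_def d0W_append sgn_norm)
    then have "hw (v # w) (\<lambda>z. d0Q z F) a [] = sgnp (cd a + (gdeg C v - 1)) * (sgnp (cd a) * F (map Some a @ Some v # None # map Some w) - sgnp (cd a + (gdeg C v - 1)) * F (map Some a @ None # Some v # map Some w)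
         - sgnp ((cd w + 1) * (cd a + gdeg C v)) * F (map Some w @ map Some a @ [None, Some v]))
       + sgnp (gdeg C v - 1) * (pw w (iota F) (a @ [v]) - F (map Some (a @ [v]) @ None # map Some w))"
      using False by (simp add: hw_def IH[unfolded hw_def, simplified])
    then show ?thesis using Cons.prems by (simp add: pw_Cons iota_def sgn_norm)
  qed
qed simp

lemma sp_telescope:
  "w \<noteq> [] \<Longrightarrow> sp w (\<lambda>a v w. if w = [] then 0 else sgnp (gdeg C v - 1) * F (a @ [v]) w - F a (v # w)) a
    = sp w (\<lambda>a v w. if w = [] then F a [v] else 0) a - F a w"
proof (induction w arbitrary: a)
  case (Cons v w)
  then show ?case by (cases "w = []") (simp_all add: right_diff_distrib)
qed simp

lemma hw_append:
  assumes "w2 \<noteq> []"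
  shows "hw (w @ w2) F a Y = hw w F a (map Some w2 @ Y)
     + sgnp (cd a + cd w) * sp w (\<lambda>a v w. if w = [] then F (map Some a @ None # Some v # None # map Some w2 @ Y) else 0) a
     + sgnp (cd w) * hw w2 F (a @ w) Y"
proof -
  have "sp w (\<lambda>a v w. if w @ w2 = [] then 0 else sgnp (cd a + (gdeg C v - 1)) * F (map Some a @ None # Some v # None # map Some (w @ w2) @ Y)) a
    = sp w (\<lambda>a' v w'. (if w' = [] then 0 else sgnp (cd a' + (gdeg C v - 1)) * F (map Some a' @ None # Some v # None # map Some w' @ map Some w2 @ Y))
       + sgnp (cd a + cd w) * (if w' = [] then F (map Some a' @ None # Some v # None # map Some w2 @ Y) else 0)) a"
    by (rule sp_cong) (use assms in \<open>auto simp: add.assoc\<close>)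
  then show ?thesis unfolding hw_def sp_append by (simp only: sp_lin)
qed

lemma hw_2:
  assumes "w \<noteq> []"
    and Y: "Y = Yh @ None # map Some wk"
  shows "hw w (\<lambda>z. d0Q z F) a Y = sp w (\<lambda>a v w. if w = [] then F (map Some a @ None # Some v # Y) else 0) a
     - F (map Some a @ None # map Some w @ Y)
     + sgnp (cd a + cd w) * d0W Y (\<lambda>z. hw w F a z)
     + sgnp ((cd wk + 1) * (cd a + 1 + cd w + wd Yh)) * hw w F (wk @ a) Yh"
proof -
  have L: "Lst (X @ Y) F = - sgnp ((cd wk + 1) * (wd X + wd Yh)) * F (map Some wk @ X @ Yh)" for X
    using Lst_last[of "map Some wk" "X @ Yh" F] by (simp add: Y)
  have "hw w (\<lambda>z. d0Q z F) a Y = sp w (\<lambda>a' v w'.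
      (if w' = [] then 0 else sgnp (gdeg C v - 1) * F (map Some (a' @ [v]) @ None # map Some w' @ Y) - F (map Some a' @ None # map Some (v # w') @ Y))
      + (sgnp (cd a + cd w) * d0W Y (\<lambda>z. if w' = [] then 0 else sgnp (cd a' + (gdeg C v - 1)) * F (map Some a' @ None # Some v # None # map Some w' @ z))
      + sgnp ((cd wk + 1) * (cd a + 1 + cd w + wd Yh)) * (if w' = [] then 0 else
          sgnp (cd (wk @ a') + (gdeg C v - 1)) * F (map Some (wk @ a') @ None # Some v # None # map Some w' @ Yh)))) a"
    unfolding hw_def
  proof (rule sp_cong)
    fix u v z assume w: "w = u @ v # z"
    show "(if z = [] then 0 else sgnp (cd (a @ u) + (gdeg C v - 1)) * d0Q (map Some (a @ u) @ None # Some v # None # map Some z @ Y) F)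
     = (if z = [] then 0 else sgnp (gdeg C v - 1) * F (map Some ((a @ u) @ [v]) @ None # map Some z @ Y) - F (map Some (a @ u) @ None # map Some (v # z) @ Y))
      + (sgnp (cd a + cd w) * d0W Y (\<lambda>y. if z = [] then 0 else sgnp (cd (a @ u) + (gdeg C v - 1)) * F (map Some (a @ u) @ None # Some v # None # map Some z @ y))
      + sgnp ((cd wk + 1) * (cd a + 1 + cd w + wd Yh)) * (if z = [] then 0 else
          sgnp (cd (wk @ a @ u) + (gdeg C v - 1)) * F (map Some (wk @ a @ u) @ None # Some v # None # map Some z @ Yh)))"
    proof (cases "z = []")
      case False
      have E: "d0Q (map Some (a @ u) @ None # Some v # None # map Some z @ Y) F
        = sgnp (cd (a @ u)) * F (map Some (a @ u) @ Some v # None # map Some z @ Y)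
          - sgnp (cd (a @ u) + (gdeg C v - 1)) * F (map Some (a @ u) @ None # Some v # map Some z @ Y)
          + sgnp (cd (a @ u) + (gdeg C v - 1) + cd z) * d0W Y (\<lambda>y. F (map Some (a @ u) @ None # Some v # None # map Some z @ y))
          - sgnp ((cd wk + 1) * (cd (a @ u) + (gdeg C v - 1) + cd z + wd Yh)) * F (map Some (wk @ a @ u) @ None # Some v # None # map Some z @ Yh)"
        using L[of "map Some (a @ u) @ None # Some v # None # map Some z"]
        unfolding d0Q_def by (simp add: d0W_append sgn_norm)
      show ?thesis unfolding E using False by (simp add: d0W_lin w sgn_norm)
    qed (simp add: d0W_lin)
  qed
  also have "\<dots> = sp w (\<lambda>a v w. if w = [] then F (map Some a @ None # Some v # Y) else 0) a - F (map Some a @ None # map Some w @ Y)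
     + (sgnp (cd a + cd w) * d0W Y (\<lambda>z. hw w F a z)
     + sgnp ((cd wk + 1) * (cd a + 1 + cd w + wd Yh)) * hw w F (wk @ a) Yh)"
    unfolding sp_lin sp_d0W hw_def sp_shift
    by (subst sp_telescope[OF assms(1), of "\<lambda>a w. F (map Some a @ None # map Some w @ Y)"]) (simp cong: if_cong)
  finally show ?thesis by (simp add: add.assoc)
qed

text \<open>
  The homotopy contracts the cyclic bar complex of a tensor algebra onto its part with at most one
  bar and one-letter entries.
\<close>

theorem homotopy:
  assumes "ok u" "rdc u"
  shows "d0Q u (hQ F) + hQ (\<lambda>z. d0Q z F) u = piw (iota F) u - F u"
proof -
  obtain a ws where u: "u = map Some a @ encs ws" by (metis enc_dec enc_def)
  show ?thesis
  proof (cases ws)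
    case Nil
    then show ?thesis using u by (simp add: d0Q_def hQ_def piw_def iota_def)
  next
    case (Cons w ws')
    note ws = this
    have rdc_Some: "rdc (map Some a @ v) = rdc v" for a v by (induction a) simp_all
    have w: "w \<noteq> []"
      using assms(2) by (cases w; cases ws') (auto simp: u Cons rdc_Some)
    show ?thesis
    proof (cases ws')
      case Nil
      have "d0Q u (hQ F) = 0"
        using Lst_last[of "map Some w" "map Some a" "hQ F"] by (simp add: u ws Nil d0Q_def d0W_append hQ_def)
      moreover have "hQ (\<lambda>z. d0Q z F) u = pw w (iota F) a - F u"
        using hw_1[OF w, of F a] assms(1) by (simp add: u ws Nil hQ_def)
      ultimately show ?thesis by (simp add: piw_def u ws Nil)
    next
      case (Cons w2 ws2)
      have w2: "w2 \<noteq> []"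
        using assms(2) by (cases w2; cases ws2) (auto simp: u ws Cons rdc_Some)
      obtain ys wk where ys: "w2 # ws2 = ys @ [wk]" by (metis rev_exhaust list.discI)
      let ?A = "map Some a" and ?W = "map Some w" and ?W2 = "map Some w2" and ?Y2 = "encs ws2"
      let ?Y = "encs (w2 # ws2)"
      have Y: "?Y = encs ys @ None # map Some wk" unfolding ys by simp
      have hq: "hQ F (?A @ None # ?W @ None # z) = hw w F a (None # z)" for z
        using enc_dec[of z] by (simp add: hQ_def enc_def)
      have hq': "hQ F (?A @ None # ?W @ ?W2 @ ?Y2) = hw (w @ w2) F a ?Y2"
        "hQ F (?A @ ?W @ None # ?W2 @ ?Y2) = hw w2 F (a @ w) ?Y2"
        by (simp_all add: hQ_def)
      have hq'': "hQ F (map Some wk @ ?A @ None # ?W @ encs ys) = hw w F (wk @ a) (encs ys)"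
        by (simp add: hQ_def)
      have L: "Lst u (hQ F) = - sgnp ((cd wk + 1) * (cd a + 1 + cd w + wd (encs ys))) * hw w F (wk @ a) (encs ys)"
        using Lst_last[of "map Some wk" "?A @ None # ?W @ encs ys" "hQ F"]
        by (simp add: u ws Cons Y[simplified] hq'' algebra_simps)
      have 1: "d0Q u (hQ F) = sgnp (cd a) * hw w2 F (a @ w) ?Y2
          - sgnp (cd a + cd w) * (hw (w @ w2) F a ?Y2 - sgnp (cd w2) * d0W ?Y2 (\<lambda>z. hw w F a (None # ?W2 @ z)))
          - sgnp ((cd wk + 1) * (cd a + 1 + cd w + wd (encs ys))) * hw w F (wk @ a) (encs ys)"
        unfolding d0Q_def L by (simp add: u ws Cons d0W_append hq hq' sgnp_add algebra_simps)
      have 2: "d0W ?Y (\<lambda>z. hw w F a z) = hw w F a (?W2 @ ?Y2) - sgnp (cd w2) * d0W ?Y2 (\<lambda>z. hw w F a (None # ?W2 @ z))"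
        by (simp add: d0W_append)
      have 3: "hQ (\<lambda>z. d0Q z F) u = hw w (\<lambda>z. d0Q z F) a ?Y"
        by (simp add: u ws Cons hQ_def)
      have 4: "F u = F (?A @ None # ?W @ ?Y)" by (simp add: u ws Cons)
      have 5: "piw (iota F) u = 0" by (simp add: u ws Cons piw_def)
      show ?thesis unfolding 1 3 4 5 unfolding hw_2[OF w Y] unfolding 2 hw_append[OF w2]
        by (simp add: sgn_norm cong: if_cong)
    qed
  qed
qed


section \<open>The inclusion is a quasi-isomorphism on duals\<close>

text \<open>
  The internal degree does not count the bars.  Deleting a bar preserves it, while the differential
  of a letter lowers it by one.
\<close>

definition ideg :: "'b option list \<Rightarrow> int" where
  "ideg u = (\<Sum>x\<leftarrow>u. case x of None \<Rightarrow> 0 | Some c \<Rightarrow> gdeg C c - 1)"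

lemma ideg_simps [simp]: "ideg [] = 0" "ideg (None # u) = ideg u" "ideg (Some c # u) = gdeg C c - 1 + ideg u"
  "ideg (u @ v) = ideg u + ideg v" "ideg (map Some a) = cd a"
  by (simp_all add: ideg_def cobar_deg_def comp_def)

lemma ideg_wd: "wd u = ideg u + int (nbars u)"
  by (induction u) (auto simp: ideg_def ld_def split: option.split)

lemma ideg_nonneg: "ok u \<Longrightarrow> 0 \<le> ideg u"
proof (induction u)
  case (Cons x u)
  then show ?case using deg_Cb by (cases x) fastforce+
qed simp

lemma dW_filtered:
  assumes "ok u" "\<And>z. ok z \<Longrightarrow> ideg z < ideg u \<Longrightarrow> F z = 0"
  shows "dW u F = d0W u F"
  using assms
proof (induction u arbitrary: F)
  case (Cons x u)
  have x: "ok [x]" and u: "ok u" using Cons.prems(1) by (auto simp: ok_def)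
  have "dW u (\<lambda>z. F (x # z)) = d0W u (\<lambda>z. F (x # z))"
    by (rule Cons.IH[OF u], rule Cons.prems(2)) (use x in \<open>cases x; simp\<close>)+
  moreover have "dl x (\<lambda>z. F (z @ u)) = 0" if "x \<noteq> None"
  proof -
    have "dl x (\<lambda>z. F (z @ u)) = dl x (\<lambda>z. 0)"
    proof (rule dl_cong[OF x])
      fix z assume z: "drv [x] z"
      then have "ideg z < ideg [x]" using that x nbars_free[of z] ideg_wd[of z]
        by (cases x) (auto simp: drv_def)
      then show "F (z @ u) = 0" using z u
        by (intro Cons.prems(2)) (cases x; simp add: drv_def)+
    qed
    then show ?thesis by (simp add: dl_lin)
  qed
  ultimately show ?case by (cases x) simp_all
qed simp

lemma dQ_filtered:
  assumes "ok u" "\<And>z. ok z \<Longrightarrow> ideg z < ideg u \<Longrightarrow> F z = 0"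
  shows "dQ u F = d0Q u F"
  by (simp add: dQ_def d0Q_def dW_filtered[OF assms])

text \<open>
  The words on which the homotopy evaluates a form.
\<close>

definition hrel :: "'b option list \<Rightarrow> 'b option list \<Rightarrow> bool" where
  "hrel u z \<longleftrightarrow> (ok z \<longleftrightarrow> ok u) \<and> (rdc z \<longrightarrow> rdc u) \<and> ideg z = ideg u \<and> wd z = wd u + 1"

lemma rdc_Some: "rdc (map Some a @ v) = rdc v"
  by (induction a) simp_all

lemma hQ_cong:
  assumes "\<And>z. hrel u z \<Longrightarrow> F z = G z"
  shows "hQ F u = hQ G u"
proof -
  obtain a ws where u: "u = map Some a @ encs ws" by (metis enc_dec enc_def)
  show ?thesis
  proof (cases ws)
    case (Cons w ws')
    have "hw w F a (encs ws') = hw w G a (encs ws')"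
      unfolding hw_def
    proof (rule sp_cong)
      fix x v z assume w: "w = x @ v # z"
      have "F (map Some (a @ x) @ None # Some v # None # map Some z @ encs ws')
          = G (map Some (a @ x) @ None # Some v # None # map Some z @ encs ws')" if "z \<noteq> []"
      proof (rule assms)
        have "rdc (map Some z @ encs ws') = rdc (encs ws')" for z by (rule rdc_Some)
        then show "hrel u (map Some (a @ x) @ None # Some v # None # map Some z @ encs ws')"
          using that w by (auto simp: hrel_def u Cons rdc_Some simp del: map_append) (cases x; simp)
      qed
      then show "(if z = [] then 0 else sgnp (cd (a @ x) + (gdeg C v - 1)) * F (map Some (a @ x) @ None # Some v # None # map Some z @ encs ws'))
        = (if z = [] then 0 else sgnp (cd (a @ x) + (gdeg C v - 1)) * G (map Some (a @ x) @ None # Some v # None # map Some z @ encs ws'))"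
        by simp
    qed
    then show ?thesis by (simp add: hQ_def u Cons)
  qed (simp add: hQ_def u)
qed

lemma hQ_0 [simp]: "hQ (\<lambda>z. 0) u = 0"
  by (simp add: hQ_def hw_def sp_lin split: list.split cong: if_cong)

text \<open>
  All entries of the words in \<open>\<sigma>_C\<close> have one letter and cannot be split further.
\<close>

lemma nab_hQ: "c \<in> gens C \<Longrightarrow> nab (hQ F) (c, a) = 0"
proof -
  assume c: "c \<in> gens C"
  have "sig c (\<lambda>z. hQ F (map Some a @ z)) = sig c (\<lambda>z. 0)"
  proof (rule sig_cong[OF c])
    fix ds
    have "\<exists>ws. bars ds = encs ws \<and> (\<forall>w\<in>set ws. length w = 1)"
    proof (induction ds)
      case (Cons d ds)
      then obtain ws where "bars ds = encs ws" "\<forall>w\<in>set ws. length w = 1" by blast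
      then show ?case by (intro exI[of _ "[d] # ws"]) simp
    qed (intro exI[of _ "[]"], simp)
    then obtain ws where ws: "bars ds = encs ws" "\<forall>w\<in>set ws. length w = 1" by blast
    show "hQ F (map Some a @ bars ds) = 0"
      by (cases ws; cases "hd ws") (use ws in \<open>auto simp: hQ_def hw_def length_Suc_conv\<close>)
  qed
  then show ?thesis by (simp add: nab_def sig_lin)
qed

lemma nab_filtered:
  assumes c: "c \<in> gens C" and a: "a \<in> lists Cb"
    and F: "\<And>z. ok z \<Longrightarrow> ideg z < cd a + gdeg C c - 1 \<Longrightarrow> F z = 0"
  shows "nab F (c, a) = iota F (c, a)"
proof (cases "c = one")
  case True
  then show ?thesis using coaug_gen by (simp add: nab_def iota_def)
next
  case False
  then have c': "c \<in> Cb" using c by simp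
  have "sig x (\<lambda>z. F (map Some a @ z @ [None, Some y])) = 0"
    if xy: "x \<in> Cb" "y \<in> Cb" "gdeg C x + gdeg C y = gdeg C c" for x y
  proof -
    have "sig x (\<lambda>z. F (map Some a @ z @ [None, Some y])) = sig x (\<lambda>z. 0)"
    proof (rule sig_cong)
      fix ds assume ds: "set ds \<subseteq> Cb" "wd (bars ds) = gdeg C x"
      then have "ds \<noteq> []" using deg_Cb[OF xy(1)] by auto
      then have "nbars (bars ds) > 0" by (cases ds) auto
      then show "F (map Some a @ bars ds @ [None, Some y]) = 0"
        using ideg_wd[of "bars ds"] ds a xy ok_bars[OF ds(1)] by (intro F) auto
    qed (use xy in simp)
    then show ?thesis by (simp add: sig_lin)
  qed
  then have "ev (\<lambda>(x, y). sig x (\<lambda>z. F (map Some a @ z @ [None, Some y]))) (red_diag C c) = ev (\<lambda>(x, y). 0) (red_diag C c)"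
    using c by (intro ev_red_cong) auto
  then show ?thesis using False by (simp add: nab_def iota_def sig_rec[OF c'] case_prod_unfold)
qed

lemma piw_cong:
  assumes "ok u" "\<And>c a. c \<in> gens C \<Longrightarrow> a \<in> lists Cb \<Longrightarrow> (c = one \<and> cd a = ideg u \<or> c \<noteq> one \<and> cd a + gdeg C c - 1 = ideg u) \<Longrightarrow> F (c, a) = G (c, a)"
  shows "piw F u = piw G u"
proof -
  obtain a ws where u: "u = map Some a @ encs ws" by (metis enc_dec enc_def)
  show ?thesis
  proof (cases ws)
    case Nil
    then show ?thesis using assms coaug_gen by (simp add: piw_def u)
  next
    case (Cons w ws')
    have "pw w F a = pw w G a" if "ws' = []"
      unfolding pw_def
    proof (rule sp_cong, rule arg_cong2[of _ _ _ _ "(*)", OF refl])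
      fix x v z assume w: "w = x @ v # z"
      show "F (v, z @ a @ x) = G (v, z @ a @ x)"
        by (rule assms(2)) (use assms(1) w that in \<open>auto simp: u Cons\<close>)
    qed
    then show ?thesis by (simp add: piw_def u Cons)
  qed
qed

text \<open>
  If \<open>F\<close> is supported in internal degrees at least \<open>n\<close>, then in degree \<open>n\<close> only the bar deletions of the
  differential contribute, and there the homotopy formula shows that adding \<open>dQ(hQ F)\<close> kills \<open>F\<close>.
\<close>

lemma exact_step:
  assumes F0: "\<And>z. \<not> (ok z \<and> rdc z) \<Longrightarrow> F z = 0"
    and cyc: "\<And>u. ok u \<Longrightarrow> dQ u F = 0"
    and nabF: "\<And>c a. c \<in> gens C \<Longrightarrow> a \<in> lists Cb \<Longrightarrow> nab F (c, a) = 0"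
    and low: "\<And>z. ideg z < n \<Longrightarrow> F z = 0"
    and u: "ok u" "rdc u" "ideg u \<le> n"
  shows "F u + dQ u (hQ F) = 0"
proof -
  have low': "hQ F z = 0" if "ok z" "ideg z < ideg u" for z
  proof -
    have "hQ F z = hQ (\<lambda>z. 0) z" by (rule hQ_cong) (use that u low in \<open>auto simp: hrel_def\<close>)
    then show ?thesis by simp
  qed
  have "hQ (\<lambda>z. d0Q z F) u = hQ (\<lambda>z. 0) u"
  proof (rule hQ_cong)
    fix z assume z: "hrel u z"
    then have "ok z" using u by (simp add: hrel_def)
    moreover have "dQ z F = d0Q z F" by (rule dQ_filtered) (use z u low in \<open>auto simp: hrel_def\<close>)
    ultimately show "d0Q z F = 0" using cyc by simp
  qed
  then have "d0Q u (hQ F) = piw (iota F) u - F u"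
    using homotopy[OF u(1,2), of F] by simp
  moreover have "dQ u (hQ F) = d0Q u (hQ F)" by (rule dQ_filtered) (use u low' in auto)
  moreover have "piw (iota F) u = piw (\<lambda>x. 0) u"
  proof (rule piw_cong[OF u(1)])
    fix c a assume *: "c \<in> gens C" "a \<in> lists Cb" "c = one \<and> cd a = ideg u \<or> c \<noteq> one \<and> cd a + gdeg C c - 1 = ideg u"
    have "nab F (c, a) = iota F (c, a)"
    proof (cases "c = one")
      case True
      then show ?thesis using coaug_gen by (simp add: nab_def iota_def)
    next
      case False
      then show ?thesis using * u low by (intro nab_filtered) auto
    qed
    then show "iota F (c, a) = 0" using nabF * by simp
  qed
  moreover have "piw (\<lambda>x. 0) u = 0" by (simp add: piw_def pw_def sp_lin split: list.split)
  ultimately show ?thesis by simp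
qed

lemma exact_filtered:
  assumes "\<And>z. \<not> (ok z \<and> rdc z) \<Longrightarrow> F z = 0"
    and "\<And>u. ok u \<Longrightarrow> dQ u F = 0"
    and "\<And>c a. c \<in> gens C \<Longrightarrow> a \<in> lists Cb \<Longrightarrow> nab F (c, a) = 0"
    and "\<And>z. F z \<noteq> 0 \<Longrightarrow> wd z \<in> S"
    and "\<And>z. z \<in> {z. ok z \<and> F z \<noteq> 0} \<Longrightarrow> N - int m < ideg z"
    and "\<And>n. n \<in> S \<Longrightarrow> n \<le> N"
  shows "\<exists>G. (\<forall>z. \<not> (ok z \<and> rdc z) \<longrightarrow> G z = 0) \<and> (\<forall>z. G z \<noteq> 0 \<longrightarrow> wd z + 1 \<in> S) \<and> (\<forall>u. ok u \<longrightarrow> dQ u G = F u)"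
  using assms(1-5)
proof (induction m arbitrary: F)
  case 0
  have "F z = 0" for z
  proof (rule ccontr)
    assume z: "F z \<noteq> 0"
    then have "ok z" using "0.prems"(1) by blast
    then have "N < ideg z" "wd z \<in> S" using z "0.prems"(4,5) by auto
    then show False using assms(6)[of "wd z"] ideg_wd[of z] by simp
  qed
  then show ?case by (intro exI[of _ "\<lambda>z. 0"]) (simp add: dQ_lin)
next
  case (Suc m)
  have hQ_off: "hQ F z = 0" if "\<not> (ok z \<and> rdc z)" for z
  proof -
    have "hQ F z = hQ (\<lambda>z. 0) z" by (rule hQ_cong, rule Suc.prems(1)) (use that in \<open>auto simp: hrel_def\<close>)
    then show ?thesis by simp
  qed
  have hQ_S: "wd z + 1 \<in> S" if "hQ F z \<noteq> 0" for z
  proof (rule ccontr)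
    assume "wd z + 1 \<notin> S"
    then have "F y = 0" if "hrel z y" for y using Suc.prems(4)[of y] that by (auto simp: hrel_def)
    then have "hQ F z = hQ (\<lambda>z. 0) z" by (intro hQ_cong) simp
    with that show False by simp
  qed
  define F' where "F' u = (if ok u then F u + dQ u (hQ F) else 0)" for u
  have "\<exists>G. (\<forall>z. \<not> (ok z \<and> rdc z) \<longrightarrow> G z = 0) \<and> (\<forall>z. G z \<noteq> 0 \<longrightarrow> wd z + 1 \<in> S) \<and> (\<forall>u. ok u \<longrightarrow> dQ u G = F' u)"
  proof (rule Suc.IH)
    fix z assume "\<not> (ok z \<and> rdc z)"
    then show "F' z = 0" using Suc.prems(1) dQ_not_rdc[of "hQ F" z] hQ_off by (auto simp: F'_def)
  next
    fix u assume u: "ok u"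
    have "dQ u F' = dQ u (\<lambda>z. F z + dQ z (hQ F))" by (rule dQ_cong[OF u]) (simp add: F'_def)
    then show "dQ u F' = 0" by (simp add: dQ_lin Suc.prems(2) dQ_dQ u)
  next
    fix c a assume c: "c \<in> gens C" and a: "a \<in> lists Cb"
    have "sig c (\<lambda>z. F' (map Some a @ z)) = sig c (\<lambda>z. F (map Some a @ z) + dQ (map Some a @ z) (hQ F))"
      by (rule sig_cong[OF c]) (use a ok_bars in \<open>auto simp: F'_def\<close>)
    then have "nab F' (c, a) = nab F (c, a) + nab (\<lambda>z. dQ z (hQ F)) (c, a)"
      by (simp add: nab_def sig_lin distrib_left)
    also have "nab (\<lambda>z. dQ z (hQ F)) (c, a) = dT (\<lambda>x. 0) (c, a)"
      unfolding nab_dif[OF c a] dT_def[symmetric] by (rule dT_cong[OF c a]) (simp add: nab_hQ)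

    finally show "nab F' (c, a) = 0" using Suc.prems(3)[OF c a] by (simp add: dT_def)
  next
    fix z assume "F' z \<noteq> 0"
    then have z: "ok z" "F z \<noteq> 0 \<or> dQ z (hQ F) \<noteq> 0" by (auto simp: F'_def split: if_splits)
    show "wd z \<in> S"
    proof (rule ccontr)
      assume n: "wd z \<notin> S"
      then have "dQ z (hQ F) = dQ z (\<lambda>z. 0)" by (intro dQ_cong z) (use hQ_S in force)
      then show False using z(2) n Suc.prems(4) by (auto simp: dQ_lin)
    qed
  next
    fix z assume z: "z \<in> {z. ok z \<and> F' z \<noteq> 0}"
    show "N - int m < ideg z"
    proof (rule ccontr)
      assume n: "\<not> N - int m < ideg z"
      have "F' z = 0"
      proof (cases "rdc z")
        case True
        have "F z + dQ z (hQ F) = 0"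
        proof (rule exact_step[where n = "N - int m"])
          fix y assume "ideg y < N - int m"
          then show "F y = 0" using Suc.prems(1)[of y] Suc.prems(5)[of y] by fastforce
        qed (use Suc.prems z n True in auto)
        then show ?thesis by (simp add: F'_def)
      next
        case False
        then show ?thesis using Suc.prems(1) dQ_not_rdc[of "hQ F" z] hQ_off by (auto simp: F'_def)
      qed
      then show False using z by simp
    qed
  qed
  then obtain G where G: "\<And>z. \<not> (ok z \<and> rdc z) \<Longrightarrow> G z = 0" "\<And>z. G z \<noteq> 0 \<Longrightarrow> wd z + 1 \<in> S" "\<And>u. ok u \<Longrightarrow> dQ u G = F' u"
    by blast
  show ?case
  proof (intro exI[of _ "\<lambda>z. G z - hQ F z"] conjI allI impI)
    fix z assume "\<not> (ok z \<and> rdc z)"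
    then show "G z - hQ F z = 0" using G(1) hQ_off by simp
  next
    fix z assume "G z - hQ F z \<noteq> 0"
    then show "wd z + 1 \<in> S" using G(2)[of z] hQ_S[of z] by (cases "G z = 0") auto
  next
    fix u assume "ok u"
    then show "dQ u (\<lambda>z. G z - hQ F z) = F u" by (simp add: dQ_lin G(3) F'_def)
  qed
qed

text \<open>
  Injectivity of \<open>\<nabla>\<^sup>\<or>\<close> in cohomology: a cocycle that vanishes on the image of \<open>\<nabla>\<close> is a coboundary.
  Repeated corrections push its support to higher internal degrees; since the internal degree is
  bounded by the total degree, finitely many of them suffice.  The set \<open>S\<close> records the total
  degrees, because forms in the graded dual live in finitely many.
\<close>

theorem exact:
  assumes "\<And>z. \<not> (ok z \<and> rdc z) \<Longrightarrow> F z = 0" "\<And>u. ok u \<Longrightarrow> dQ u F = 0"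
    and "\<And>c a. c \<in> gens C \<Longrightarrow> a \<in> lists Cb \<Longrightarrow> nab F (c, a) = 0"
    and "finite S" "\<And>z. F z \<noteq> 0 \<Longrightarrow> wd z \<in> S"
  shows "\<exists>G. (\<forall>z. \<not> (ok z \<and> rdc z) \<longrightarrow> G z = 0) \<and> (\<forall>z. G z \<noteq> 0 \<longrightarrow> wd z + 1 \<in> S) \<and> (\<forall>u. ok u \<longrightarrow> dQ u G = F u)"
proof (cases "S = {}")
  case True
  then have "F z = 0" for z using assms(5) by blast
  then show ?thesis by (intro exI[of _ "\<lambda>z. 0"]) (simp add: dQ_lin)
next
  case False
  show ?thesis
  proof (rule exact_filtered[OF assms(1,2,3,5), where N = "Max S" and m = "nat (Max S + 1)"])
    fix z assume z: "z \<in> {z. ok z \<and> F z \<noteq> 0}"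
    then have "wd z \<le> Max S" "0 \<le> ideg z" using assms(4,5) ideg_nonneg by auto
    \<comment> \<open>the number of corrections: internal degrees lie between 0 and the largest total degree\<close>
    then show "Max S - int (nat (Max S + 1)) < ideg z" using ideg_wd[of z] by auto
  qed (use assms(4) in auto)
qed

end


section \<open>Multilinear evaluation\<close>

text \<open>
  The value of a function of several variables, extended multilinearly, on a list of elements.
\<close>

primrec evs :: "('x \<Rightarrow>\<^sub>0 'k) list \<Rightarrow> ('x list \<Rightarrow> 'k) \<Rightarrow> 'k::comm_ring_1" where
  "evs [] F = F []"
| "evs (p # ps) F = ev (\<lambda>x. evs ps (\<lambda>xs. F (x # xs))) p"

lemma evs_cong: "(\<And>xs. length xs = length ps \<Longrightarrow> F xs = G xs) \<Longrightarrow> evs ps F = evs ps G"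
proof (induction ps arbitrary: F G)
  case (Cons p ps)
  show ?case unfolding evs.simps by (intro ev_cong Cons.IH Cons.prems) simp
qed simp

lemma evs_append: "evs (ps @ qs) F = evs ps (\<lambda>xs. evs qs (\<lambda>ys. F (xs @ ys)))"
  by (induction ps arbitrary: F) simp_all

lemma evs_bv [simp]: "evs (map bv ws) F = F ws"
  by (induction ws arbitrary: F) simp_all

lemma evs_sum: "evs ps (\<lambda>xs. \<Sum>i\<in>S. F i xs) = (\<Sum>i\<in>S. evs ps (F i))"
  by (induction ps arbitrary: F) (simp_all add: ev_fun_sum)

lemma evs_mult: "evs ps (\<lambda>xs. a * F xs) = a * evs ps F"
  by (induction ps arbitrary: F) (simp_all add: ev_fun_mult)

lemma ev_bar_word: "ev F (bar_word A ps) = evs ps (\<lambda>xs. if aunit A \<in> set xs then 0 else F xs)"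
proof (induction ps arbitrary: F)
  case (Cons p ps)
  show ?case
    unfolding bar_word.simps ev_lext evs.simps
  proof (rule ev_cong)
    fix x
    show "ev F (if x = aunit A then 0 else lext (\<lambda>w. bv (x # w)) (bar_word A ps))
      = evs ps (\<lambda>xs. if aunit A \<in> set (x # xs) then 0 else F (x # xs))"
    proof (cases "x = aunit A")
      case True
      then show ?thesis using evs_mult[of ps 0 "\<lambda>_. 0"] by simp
    next
      case False
      then show ?thesis by (simp add: ev_lext Cons.IH eq_commute[of x])
    qed
  qed
qed simp

lemma ev_cchain:
  assumes "\<And>a xs. aunit A \<in> set xs \<Longrightarrow> F (a, xs) = 0"
  shows "ev F (cchain A p ps) = ev (\<lambda>a. evs ps (\<lambda>xs. F (a, xs))) p"
  unfolding cchain_def ev_tens ev_bar_word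
  by (intro ev_cong evs_cong) (simp add: assms)

context cobar_setting
begin

abbreviation "K \<equiv> cobar C"
abbreviation "Q \<equiv> cyclic (cobar C)"

lemma K_simps [simp]: "gens K = lists Cb" "gdeg K = cobar_deg C" "gdif K = cobar_dif C" "aunit K = []"
  "amul K v w = bv (v @ w)"
  by (simp_all add: cobar_def)

lemma bar_deg_K [simp]: "bar_deg K ws = wd (encs ws)"
  by (induction ws) (simp_all add: bar_deg_def)

lemma gdeg_Q [simp]: "gdeg Q x = wd (enc x)"
  by (simp add: cyclic_def enc_def split: prod.split)

lemma rdc_map_Some [simp]: "rdc (map Some w)"
  using rdc_Some[of w "[]"] by simp

lemma not_rdc_encs: "[] \<in> set ws \<Longrightarrow> \<not> rdc (encs ws)"
proof (induction ws)
  case (Cons w ws)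
  then show ?case by (cases w; cases ws) (auto simp: rdc_Some)
qed simp

lemma gens_Q: "x \<in> gens Q \<longleftrightarrow> ok (enc x) \<and> rdc (enc x)"
proof -
  have "ok (encs ws) \<longleftrightarrow> set ws \<subseteq> lists Cb" for ws by (induction ws) auto
  moreover have "rdc (encs ws) \<longleftrightarrow> [] \<notin> set ws" for ws
  proof (induction ws)
    case (Cons w ws)
    then show ?case by (cases w; cases ws) (auto simp: rdc_Some)
  qed simp
  ultimately show ?thesis by (cases x) (auto simp: cyclic_def enc_def rdc_Some)
qed

lemma not_rdc_enc: "[] \<in> set ws \<Longrightarrow> \<not> rdc (enc (a, ws))"
  by (simp add: enc_def rdc_Some not_rdc_encs)

lemma dW_encs: "dW (encs ws) F = (\<Sum>i<length ws. sgnp (wd (encs (take i ws))) *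
     (F (encs (take i ws) @ map Some (ws ! i) @ encs (drop (Suc i) ws))
      - dW (map Some (ws ! i)) (\<lambda>z. F (encs (take i ws) @ None # z @ encs (drop (Suc i) ws)))))"
proof (induction ws arbitrary: F)
  case (Cons w ws)
  show ?case
    by (simp add: sum.lessThan_Suc_shift dW_append Cons.IH sum_distrib_left sum_negf[symmetric] sgn_norm del: sum.lessThan_Suc)
qed simp

lemma cuts_encs: "cuts (encs ws) H = (\<Sum>i<length ws. H (encs (take i ws)) (encs (drop i ws)))"
proof (induction ws arbitrary: H)
  case (Cons w ws)
  show ?case
    by (simp add: sum.lessThan_Suc_shift cuts_append Cons.IH del: sum.lessThan_Suc)
qed simp

text \<open>
  The identification of the cyclic bar differential with the differential on words.  Forms on the
  reduced complex vanish on degenerate words, as the assumption on \<open>f\<close> demands.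
\<close>

lemma ev_cyclic_dif:
  assumes f: "\<And>a ws. [] \<in> set ws \<Longrightarrow> f (a, ws) = 0"
  shows "ev f (cyclic_dif K (a, ws)) = dQ (enc (a, ws)) (\<lambda>u. f (dec u))"
proof -
  let ?k = "length ws" and ?A = "map Some a" and ?F = "\<lambda>u. f (dec u)"
  let ?eps = "\<lambda>i. cd a + wd (encs (take i ws))"
  have cc: "ev f (cchain K p ps) = ev (\<lambda>a. evs ps (\<lambda>xs. f (a, xs))) p" for p ps
    by (rule ev_cchain) (simp add: f)
  have d: "dec (encs us @ u) = ([], us @ [])" if "u = []" for us u using that by simp
  have e1: "fst (dec (encs us @ None # u)) = []" "snd (dec (encs us @ None # u)) = us @ fst (dec u) # snd (dec u)" for us u
    by (induction us) simp_all
  have t1: "ev f (cchain K (bv a) (take i (map bv ws) @ [cobar_dif C (ws ! i)] @ drop (i + 1) (map bv ws)))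
     = dW (map Some (ws ! i)) (\<lambda>z. ?F (?A @ encs (take i ws) @ None # z @ encs (drop (Suc i) ws)))" for i
    by (simp add: cc take_map drop_map evs_append dW_Some e1)
  have merge: "dec (encs us @ map Some w @ encs vs) = (if us = [] then (w, vs) else ([], butlast us @ (last us @ w) # vs))" for us w vs
  proof (cases us rule: rev_cases)
    case (snoc us' u)
    then show ?thesis using e1[of us' "map Some u @ map Some w @ encs vs"] by (simp add: prod_eq_iff)
  qed simp
  have A: "dW ?A (\<lambda>z. ?F (z @ encs ws)) = ev f (cchain K (gdif K a) (map bv ws))"
    by (simp add: cc dW_Some)
  show ?thesis
  proof (cases "?k = 0")
    case True
    then show ?thesis using A by (simp add: cyclic_dif_def dQ_def enc_def ev_lin)
  next
    case False
    then obtain ws' wk where ws: "ws = ws' @ [wk]" by (cases ws rule: rev_cases) auto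
    let ?M = "\<lambda>i. ?F (?A @ encs (take i ws) @ map Some (ws ! i) @ encs (drop (Suc i) ws))"
    have L: "Lst (enc (a, ws)) ?F = - sgnp ((cd wk + 1) * (cd a + wd (encs ws'))) * f (wk @ a, ws')"
      using Lst_last[of "map Some wk" "?A @ encs ws'" ?F] by (simp add: enc_def ws)
    have "(\<Sum>i<?k. sgnp (?eps i) * ?M i) = sgnp (cd a) * ?M 0 + (\<Sum>i\<in>{1..<?k}. sgnp (?eps i) * ?M i)"
      using False by (simp add: lessThan_atLeast0 sum.atLeast_Suc_lessThan)
    also have "?M 0 = ev f (cchain K (amul K a (ws ! 0)) (drop 1 (map bv ws)))"
      by (simp add: cc drop_map merge)
    also have "(\<Sum>i\<in>{1..<?k}. sgnp (?eps i) * ?M i) = (\<Sum>i\<in>{1..<?k}. sgnp (?eps i) * 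
        ev f (cchain K (bv a) (take (i - 1) (map bv ws) @ [amul K (ws ! (i - 1)) (ws ! i)] @ drop (i + 1) (map bv ws))))"
    proof (rule sum.cong[OF refl])
      fix i assume "i \<in> {1..<?k}"
      then have i: "i \<ge> 1" "i < ?k" by auto
      have "?M i = f (a, take (i - 1) ws @ (ws ! (i - 1) @ ws ! i) # drop (Suc i) ws)"
        using i False by (simp add: merge butlast_take last_conv_nth min_def)
      then show "sgnp (?eps i) * ?M i = sgnp (?eps i) * 
        ev f (cchain K (bv a) (take (i - 1) (map bv ws) @ [amul K (ws ! (i - 1)) (ws ! i)] @ drop (i + 1) (map bv ws)))"
        by (simp add: cc take_map drop_map evs_append)
    qed
    finally have S: "(\<Sum>i<?k. sgnp (?eps i) * ?M i) = sgnp (cd a) * ev f (cchain K (amul K a (ws ! 0)) (drop 1 (map bv ws)))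
      + (\<Sum>i\<in>{1..<?k}. sgnp (?eps i) * 
        ev f (cchain K (bv a) (take (i - 1) (map bv ws) @ [amul K (ws ! (i - 1)) (ws ! i)] @ drop (i + 1) (map bv ws))))" .
    have "dW (enc (a, ws)) ?F = ev f (cchain K (gdif K a) (map bv ws))
       + (\<Sum>i<?k. sgnp (?eps i) * ?M i) + (\<Sum>i<?k. - sgnp (?eps i) * ev f (cchain K (bv a) (take i (map bv ws) @ [gdif K (ws ! i)] @ drop (i + 1) (map bv ws))))"
      unfolding enc_def fst_conv snd_conv dW_append A dW_encs sum_distrib_left sum.distrib[symmetric] K_simps t1
      by (simp add: sgnp_add algebra_simps sum_subtractf sum_negf)
    moreover have "ev f (cchain K (amul K wk a) (take (?k - 1) (map bv ws))) = f (wk @ a, ws')"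
      by (simp add: cc ws take_map)
    ultimately show ?thesis unfolding dQ_def L S using False
      by (simp add: cyclic_dif_def Let_def ev_lin ev_sum ws)
  qed
qed

lemma dual_Q_zero: "f \<in> dgcar (dual_cx Q) \<Longrightarrow> \<not> (ok u \<and> rdc u) \<Longrightarrow> f (dec u) = 0"
proof -
  assume f: "f \<in> dgcar (dual_cx Q)" and u: "\<not> (ok u \<and> rdc u)"
  have "dec u \<notin> gens Q" using u by (simp add: gens_Q)
  moreover have "\<forall>x. x \<notin> gens Q \<longrightarrow> f x = 0" using f unfolding dual_cx_def by simp
  ultimately show "f (dec u) = 0" by blast
qed

lemma dual_Q_dif:
  assumes f: "f \<in> dgcar (dual_cx Q)" and u: "ok u"
  shows "dgdif (dual_cx Q) f (dec u) = sgnp (wd u) * dQ u (\<lambda>u. f (dec u))"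
proof (cases "rdc u")
  case True
  have "f (a, ws) = 0" if "[] \<in> set ws" for a ws
    using dual_Q_zero[OF f, of "enc (a, ws)"] not_rdc_enc[OF that] by simp
  then have "ev f (cyclic_dif K (dec u)) = dQ u (\<lambda>u. f (dec u))"
    using ev_cyclic_dif[of f "fst (dec u)" "snd (dec u)"] by simp
  then show ?thesis using True u by (simp add: dual_cx_def gens_Q sgn_norm) (simp add: cyclic_def)
next
  case False
  then show ?thesis using dQ_not_rdc[of "\<lambda>u. f (dec u)" u] dual_Q_zero[OF f]
    by (simp add: dual_cx_def gens_Q)
qed

section \<open>The cup product on words\<close>

text \<open>
  Multiplicativity of the shuffle diagonal: on a word in letters it is the sum over all
  unshuffles.
\<close>

lemma Ush_Some: "Ush b (map Some w) B = ev (\<lambda>(l, r). B (map Some l) (map Some r)) (shuffle_diag C w)"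
proof (induction w arbitrary: B rule: rev_induct)
  case Nil
  show ?case by (simp add: shuffle_diag_def aprod_def tens_dga_def)
next
  case (snoc c w)
  have "shuffle_diag C (w @ [c]) = amult (tens_dga K K) (shuffle_diag C w) (bv ([c], []) + bv ([], [c]))"
    by (simp add: shuffle_diag_def aprod_def)
  then have "ev (\<lambda>(l, r). B (map Some l) (map Some r)) (shuffle_diag C (w @ [c]))
     = ev (\<lambda>(l, r). sgnp (cd r * (gdeg C c - 1)) * B (map Some (l @ [c])) (map Some r) + B (map Some l) (map Some (r @ [c]))) (shuffle_diag C w)"
    by (simp add: amult_def ev_lin tens_dga_def case_prod_unfold)
  then show ?case
    by (simp add: Ush_append snoc.IH)
qed

lemma HB_alt: "HB B U V = Ush True U (\<lambda>l1 r1. Ush False V (\<lambda>l2 r2. sgnp (wd l2 * (wd l1 + wd r1)) * B (l2 @ l1) (r1 @ r2)))"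
  unfolding HB_def by (rule Ush_cong) (simp add: un_def)

text \<open>
  The degree lists of the Alexander-Whitney sign for the entries before (\<open>kT\<close>) and behind (\<open>kD\<close>) the
  cut.
\<close>

abbreviation kT :: "('b list \<times> 'b list) list \<Rightarrow> (nat \<times> int) list" where
  "kT xs \<equiv> concat (map (\<lambda>(a, b). [(Suc 0, 1), (Suc 0, cd a), (2, cd b)]) xs)"

abbreviation kD :: "('b list \<times> 'b list) list \<Rightarrow> (nat \<times> int) list" where
  "kD xs \<equiv> concat (map (\<lambda>(a, b). [(2, 1), (0, cd a), (2, cd b)]) xs)"

lemma kT_sums:
  "sum_list (map snd (filter (\<lambda>u. fst u = 0) (kT xs))) = 0"
  "sum_list (map snd (filter (\<lambda>u. fst u < 2) (kT xs))) = wd (encs (map fst xs))"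
  by (induction xs) auto

lemma kD_sums:
  "sum_list (map snd (filter (\<lambda>u. fst u = 0) (kD xs))) = cd (concat (map fst xs))"
  "sum_list (map snd (filter (\<lambda>u. fst u < 2) (kD xs))) = cd (concat (map fst xs))"
  by (induction xs) auto

lemma Ush_True_encs: "Ush True (encs ws) B = evs (map (shuffle_diag C) ws) (\<lambda>xs.
    sgnp (koszul (kT xs)) * B (encs (map fst xs)) (map Some (concat (map snd xs))))"
proof (induction ws arbitrary: B)
  case (Cons w ws)
  show ?case
    unfolding encs_simps Ush_None_True Ush_append Ush_Some Cons.IH list.map evs.simps
    by (intro ev_cong) (auto simp: kT_sums sum_list_const_mult sgnp_add mult.assoc mult.left_commute intro!: evs_cong)
qed simp

lemma Ush_False_encs: "Ush False (encs ws) B = evs (map (shuffle_diag C) ws) (\<lambda>xs.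
    sgnp (koszul (kD xs)) * B (map Some (concat (map fst xs))) (encs (map snd xs)))"
proof (induction ws arbitrary: B)
  case (Cons w ws)
  show ?case
    unfolding encs_simps Ush_None_False Ush_append Ush_Some Cons.IH list.map evs.simps
    by (intro ev_cong) (auto simp: kD_sums sum_list_const_mult sgnp_add mult.assoc mult.left_commute intro!: evs_cong)
qed simp

lemma amult_bv: "amult K (bv v) (bv w) = bv (v @ w)"
  by (rule ev_eqI) (simp add: amult_def ev_lin)

lemma aprod_bv: "aprod K (map bv ws) = bv (concat ws)"
proof (induction ws rule: rev_induct)
  case (snoc w ws)
  then show ?case by (simp add: aprod_def amult_bv)
qed (simp add: aprod_def)

lemma AW_sign_eq: "sgnp (AW_sign K K p q (xs @ ys) (length xs)) = sgnp (koszul (kT xs)) * sgnp (koszul (kD ys))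
   * sgnp (cd q * wd (encs (map fst xs))) * sgnp (cd (concat (map fst ys)) * (cd p + wd (encs (map fst xs)) + cd q + cd (concat (map snd xs))))"
proof -
  have X: "(\<Sum>t\<leftarrow>kT xs. snd t * sum_list (map snd (filter (\<lambda>u. fst u < fst t) (kD ys))))
     = (wd (encs (map fst xs)) + cd (concat (map snd xs))) * cd (concat (map fst ys))"
    by (induction xs) (auto simp: kD_sums algebra_simps)
  show ?thesis
    by (simp add: AW_sign_def koszul_append kT_sums kD_sums sum_list_const_mult X) (simp add: sgn_norm)
qed

text \<open>
  The cup product on words: the shuffle diagonal of each bar entry, followed by the
  Alexander-Whitney map, is the cut-and-unshuffle diagonal \<open>Diag\<close>.
\<close>

lemma cup_Diag:
  assumes f: "f \<in> dgcar (dual_cx Q)" and g: "g \<in> dgcar (dual_cx Q)" and x: "x \<in> gens Q"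
  shows "cup K (shuffle_diag C) f g x = Diag (\<lambda>l r. sgnp (wd l * wd r) * (f (dec l) * g (dec r))) (enc x)"
proof -
  obtain a ws where xw: "x = (a, ws)" by (cases x)
  let ?B = "\<lambda>l r. sgnp (wd l * wd r) * (f (dec l) * g (dec r))"
  let ?S = "shuffle_diag C" and ?k = "length ws"
  have f0: "f (a, ws) = 0" and g0: "g (a, ws) = 0" if "[] \<in> set ws" for a ws
    using dual_Q_zero[OF f, of "enc (a, ws)"] dual_Q_zero[OF g, of "enc (a, ws)"] not_rdc_enc[OF that] by simp_all
  have ft: "form_tens Q f g (v, w) = ?B (enc v) (enc w)" for v w
    by (simp add: form_tens_def mult.commute)
  define T where "T = (\<lambda>i p q xs ys. sgnp (AW_sign K K p q (xs @ ys) i) *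
     ?B (enc (concat (map fst ys) @ p, map fst xs)) (enc (q @ concat (map snd xs), map snd ys)))"
  have cc: "ev (form_tens Q f g) (tens (cchain K (bv l) (map bv us)) (cchain K (bv r) (map bv vs))) = ?B (enc (l, us)) (enc (r, vs))" for l us r vs
  proof -
    have "ev (\<lambda>y. form_tens Q f g (x, y)) (cchain K (bv r) (map bv vs)) = form_tens Q f g (x, (r, vs))" for x
      by (subst ev_cchain) (auto simp: form_tens_def g0 split: prod.split)
    moreover have "ev (\<lambda>x. form_tens Q f g (x, (r, vs))) (cchain K (bv l) (map bv us)) = form_tens Q f g ((l, us), (r, vs))"
      by (subst ev_cchain) (auto simp: form_tens_def f0 split: prod.split)
    ultimately show ?thesis by (simp only: ev_tens ft)
  qed
  have AWe: "ev (form_tens Q f g) (AW K K ((p, q), xs)) = (\<Sum>i\<le>length xs. T i p q (take i xs) (drop i xs))" for p q xs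
  proof -
    have m: "take i (map (bv \<circ> fst) xs) = map bv (map fst (take i xs))" "drop i (map (bv \<circ> fst) xs) = map bv (map fst (drop i xs))"
      "take i (map (bv \<circ> snd) xs) = map bv (map snd (take i xs))" "drop i (map (bv \<circ> snd) xs) = map bv (map snd (drop i xs))" for i
      by (simp_all add: take_map drop_map)
    show ?thesis
      unfolding AW_def prod.case Let_def ev_sum ev_scl m aprod_bv amult_bv cc T_def append_take_drop_id ..
  qed
  have AW0: "ev (form_tens Q f g) (AW K K (pq, xs)) = 0" if "([], []) \<in> set xs" for pq xs
  proof -
    obtain p q where pq: "pq = (p, q)" by (cases pq)
    have "T i p q (take i xs) (drop i xs) = 0" for i
    proof -
      have "([], []) \<in> set (take i xs) \<or> ([], []) \<in> set (drop i xs)"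
        using that by (metis append_take_drop_id set_append Un_iff)
      then have "[] \<in> set (map fst (take i xs)) \<or> [] \<in> set (map snd (drop i xs))" by force
      then have "f (concat (map fst (drop i xs)) @ p, map fst (take i xs)) = 0 \<or> g (q @ concat (map snd (take i xs)), map snd (drop i xs)) = 0"
        using f0 g0 by blast
      then show ?thesis by (auto simp: T_def)
    qed
    then show ?thesis unfolding pq AWe by simp
  qed
  have "cup K ?S f g x = ev (\<lambda>pq. evs (map ?S ws) (\<lambda>xs. ev (form_tens Q f g) (AW K K (pq, xs)))) (?S a)"
    using x unfolding cup_def cyclic_diag_def cyclic_map_def ev_lext xw prod.case
    by (simp only: if_True, subst ev_cchain) (auto simp: tens_dga_def AW0)
  also have "\<dots> = ev (\<lambda>(p, q). \<Sum>i\<le>?k. evs (map ?S ws) (\<lambda>xs. T i p q (take i xs) (drop i xs))) (?S a)"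
  proof (intro ev_cong, clarify)
    fix p q
    have "evs (map ?S ws) (\<lambda>xs. ev (form_tens Q f g) (AW K K ((p, q), xs)))
      = evs (map ?S ws) (\<lambda>xs. \<Sum>i\<le>?k. T i p q (take i xs) (drop i xs))"
      unfolding AWe by (rule evs_cong) simp
    then show "evs (map ?S ws) (\<lambda>xs. ev (form_tens Q f g) (AW K K ((p, q), xs)))
      = (\<Sum>i\<le>?k. evs (map ?S ws) (\<lambda>xs. T i p q (take i xs) (drop i xs)))"
      unfolding evs_sum .
  qed
  also have "\<dots> = (\<Sum>i\<le>?k. ev (\<lambda>(p, q). evs (map ?S ws) (\<lambda>xs. T i p q (take i xs) (drop i xs))) (?S a))"
    by (simp add: case_prod_unfold ev_fun_sum)
  also have "\<dots> = (\<Sum>i\<le>?k. HB ?B (map Some a @ encs (take i ws)) (encs (drop i ws)))"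
  proof (rule sum.cong[OF refl])
    fix i assume "i \<in> {..?k}"
    then have i: "i \<le> ?k" by simp
    have "HB ?B (map Some a @ encs (take i ws)) (encs (drop i ws))
      = ev (\<lambda>(p, q). evs (map ?S (take i ws)) (\<lambda>xs. evs (map ?S (drop i ws)) (\<lambda>ys. T i p q xs ys))) (?S a)"
      unfolding HB_alt Ush_append Ush_Some Ush_True_encs Ush_False_encs
    proof (intro ev_cong, clarify, intro evs_cong, unfold evs_mult[symmetric], intro evs_cong)
      fix p q and xs ys :: "('b list \<times> 'b list) list" assume "length xs = length (map ?S (take i ws))"
      then have li: "length xs = i" using i by simp
      show "sgnp (koszul (kT xs)) * (sgnp (wd (map Some q) * wd (encs (map fst xs))) * (sgnp (koszul (kD ys)) *
         (sgnp (wd (map Some (concat (map fst ys))) * (wd (map Some p @ encs (map fst xs)) + wd (map Some q @ map Some (concat (map snd xs))))) *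
         ?B (map Some (concat (map fst ys)) @ map Some p @ encs (map fst xs)) ((map Some q @ map Some (concat (map snd xs))) @ encs (map snd ys)))))
        = T i p q xs ys"
        unfolding T_def li[symmetric] AW_sign_eq by (simp add: enc_def mult.assoc add.assoc)
    qed
    also have "\<dots> = ev (\<lambda>(p, q). evs (map ?S ws) (\<lambda>xs. T i p q (take i xs) (drop i xs))) (?S a)"
    proof (intro ev_cong, clarify)
      fix p q
      have "evs (map ?S (take i ws @ drop i ws)) (\<lambda>xs. T i p q (take i xs) (drop i xs))
        = evs (map ?S (take i ws)) (\<lambda>xs. evs (map ?S (drop i ws)) (\<lambda>ys. T i p q xs ys))"
        unfolding map_append evs_append by (intro evs_cong) (use i in simp)
      then show "evs (map ?S (take i ws)) (\<lambda>xs. evs (map ?S (drop i ws)) (\<lambda>ys. T i p q xs ys))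
        = evs (map ?S ws) (\<lambda>xs. T i p q (take i xs) (drop i xs))" by simp
    qed
    finally show "ev (\<lambda>(p, q). evs (map ?S ws) (\<lambda>xs. T i p q (take i xs) (drop i xs))) (?S a)
       = HB ?B (map Some a @ encs (take i ws)) (encs (drop i ws))" by simp
  qed
  also have "\<dots> = Diag ?B (enc x)"
    by (simp add: Diag_def xw enc_def cuts_append cuts_encs lessThan_Suc_atMost[symmetric] add.commute)
  finally show ?thesis .
qed

end


context cobar_setting
begin

section \<open>The comparison map is diagonal\<close>

text \<open>
  The exponent of the Koszul sign in \<open>\<Phi>\<close>, together with the signs in \<open>\<Theta>\<close>; \<open>d\<close> is the degree of what
  stands to the left of the word.
\<close>

primrec qx :: "int \<Rightarrow> 'b list \<Rightarrow> int" where
  "qx d [] = 0"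
| "qx d (x # xs) = (gdeg C x - 1) * (d + 1) + qx (d + (gdeg C x - 1)) xs"

lemma qx_append: "qx d (xs @ ys) = qx d xs + qx (d + cd xs) ys"
  by (induction xs arbitrary: d) (simp_all add: add.assoc)

lemma qx_shift: "qx (d + n) xs = qx d xs + n * cd xs"
proof (induction xs arbitrary: d)
  case (Cons x xs)
  have "d + n + (gdeg C x - 1) = (d + (gdeg C x - 1)) + n" by simp
  then show ?case using Cons.IH[of "d + (gdeg C x - 1)"] by (simp add: algebra_simps)
qed simp

lemma qx_sum: "qx d xs = (\<Sum>j<length xs. (gdeg C (xs ! j) - 1) * (d + 1 + cd (take j xs)))"
proof (induction xs arbitrary: d)
  case (Cons x xs)
  show ?case by (simp add: Cons.IH sum.lessThan_Suc_shift algebra_simps del: sum.lessThan_Suc)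
qed simp

definition eT :: "'b \<times> 'b list \<Rightarrow> 'k" where
  "eT = (\<lambda>(c, a). sgnp (qx (gdeg C c) a))"

lemma eT_simp [simp]: "eT (c, a) = sgnp (qx (gdeg C c) a)"
  by (simp add: eT_def)

lemma eT_self: "eT x * eT x = 1" "eT x * (eT x * z) = z"
  by (cases x; simp add: sgn_norm)+

lemma koszul_sorted: "sorted (map fst L) \<Longrightarrow> koszul L = 0"
proof (induction L)
  case (Cons t L)
  then have "filter (\<lambda>u. fst u < fst t) L = []" by (auto simp: filter_empty_conv not_less)
  then show ?case using Cons by simp
qed simp

lemma sgnp_sum: "finite I \<Longrightarrow> (sgnp (\<Sum>i\<in>I. f i) :: 'k) = (\<Prod>i\<in>I. sgnp (f i))"
  by (induction I rule: finite_induct) (simp_all add: sgnp_add)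

lemma PhiTheta_basis_eq: "PhiTheta_basis C y x = (if y = x then eT x else 0)"
proof -
  obtain b bs c cs where y: "y = (b, bs)" and x: "x = (c, cs)" by (cases y; cases x)
  let ?n = "length bs"
  show ?thesis
  proof (cases "y = x")
    case False
    show ?thesis
    proof (cases "length cs = ?n \<and> cs \<noteq> bs")
      case True
      then obtain i where "i < ?n" "cs ! i \<noteq> bs ! i" by (auto simp: list_eq_iff_nth_eq)
      then have "(\<Prod>i<?n. Theta C (bs ! i) (cs ! i)) = 0"
        by (intro prod_zero bexI[of _ i]) (simp_all add: Theta_def)
      then have "PhiTheta_basis C y x = 0" unfolding PhiTheta_basis_def x y prod.case by simp
      then show ?thesis using \<open>y \<noteq> x\<close> by simp
    next
      case F: False
      then have "length cs \<noteq> ?n \<or> c \<noteq> b" using False x y by auto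
      then have "PhiTheta_basis C y x = 0" unfolding PhiTheta_basis_def x y prod.case by (elim disjE) simp_all
      then show ?thesis using False by simp
    qed
  next
    case True
    let ?L1 = "map (\<lambda>i. (Suc i, 1 - gdeg C (bs ! i))) [0..<?n]"
    let ?L2 = "map (\<lambda>i. (Suc i, gdeg C (bs ! i) - 1)) [0..<?n]"
    have "sorted (map Suc [0..<m])" for m by (induction m) (auto simp: sorted_append)
    then have s: "koszul ?L1 = 0" "koszul ?L2 = 0" by (auto intro!: koszul_sorted simp: comp_def)
    have f: "(\<Sum>u\<leftarrow>filter (\<lambda>u. fst u < Suc j) (map (\<lambda>i. (Suc i, gdeg C (bs ! i) - 1)) [0..<?n]). n * snd u) = n * cd (take j bs)" if "j < ?n" for n j
    proof -
      have "[0..<?n] = [0..<j] @ [j..<?n]" using that upt_add_eq_append[of 0 j "?n - j"] by simp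
      then have "filter (\<lambda>u. fst u < Suc j) (map (\<lambda>i. (Suc i, gdeg C (bs ! i) - 1)) [0..<?n]) = map (\<lambda>i. (Suc i, gdeg C (bs ! i) - 1)) [0..<j]"
        by (simp add: filter_empty_conv filter_id_conv)
      moreover have "take j bs = map (\<lambda>i. bs ! i) [0..<j]" using that by (intro nth_equalityI) auto
      ultimately show ?thesis by (simp add: cobar_deg_def comp_def sum_list_const_mult)
    qed
    have X: "(\<Sum>t\<leftarrow>?L1. \<Sum>u\<leftarrow>filter (\<lambda>u. fst u < fst t) ((0, gdeg C b) # ?L2). snd t * snd u)
      = (\<Sum>j<?n. (1 - gdeg C (bs ! j)) * (gdeg C b + cd (take j bs)))"
      by (simp add: comp_def interv_sum_list_conv_sum_set_nat atLeast0LessThan distrib_left)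
         (rule sum.cong, simp_all add: f)
    have "koszul ([(0, - gdeg C b)] @ ?L1 @ [(0, gdeg C b)] @ ?L2) = (\<Sum>j<?n. (1 - gdeg C (bs ! j)) * (gdeg C b + cd (take j bs)))"
      using X by (simp add: koszul_append s)
    then have "PhiTheta_basis C y x = (\<Prod>j<?n. sgnp ((1 - gdeg C (bs ! j)) * (gdeg C b + cd (take j bs)))) * (\<Prod>j<?n. sgnp (1 - gdeg C (bs ! j)))"
      using True by (simp add: PhiTheta_basis_def x y Theta_def sgnp_sum)
    also have "\<dots> = eT x"
      using True by (simp add: x y qx_sum sgnp_sum prod.distrib[symmetric])
        (rule prod.cong, simp_all add: sgn_norm)
    finally show ?thesis using True by simp
  qed
qed

text \<open>
  The dual basis is mapped to the dual basis up to sign.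
\<close>

lemma PhiTheta_eq: "PhiTheta C p x = Poly_Mapping.lookup p x * eT x"
proof -
  have "PhiTheta C p x = ev (\<lambda>y. eT x * (if y = x then 1 else 0)) p"
    unfolding PhiTheta_def by (rule ev_cong) (simp add: PhiTheta_basis_eq)
  then show ?thesis by (simp only: ev_fun_mult lookup_eq_ev mult.commute)
qed

section \<open>The comparison map commutes with the differentials\<close>

abbreviation "T \<equiv> twisted C"
abbreviation "DA \<equiv> dual_dga C"
abbreviation "lk \<equiv> Poly_Mapping.lookup"

lemma T_simps [simp]: "gens T = gens C \<times> lists Cb" "gdif T = twisted_dif C" "gdeg T (c, a) = gdeg C c + cd a"
  by (simp_all add: twisted_def)

end

locale finite_type_setting = cobar_setting C for C :: "('b, 'k::comm_ring_1) free_dgc" +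
  assumes ft: "finite_type C"
begin

lemma fin: "finite {x \<in> gens C. gdeg C x = n}"
  using ft by (simp add: finite_type_def)

lemma DA_simps [simp]: "gens DA = gens C" "gdeg DA b = - gdeg C b" "aunit DA = one"
  by (simp_all add: dual_dga_def)

lemma lk_sum: "lk (sum f S) x = (\<Sum>i\<in>S. lk (f i) x)"
  by (induction S rule: infinite_finite_induct) (simp_all add: lookup_add)

lemma lk_gdif_DA: "lk (gdif DA b) x = (if x \<in> gens C \<and> gdeg C x = gdeg C b + 1 then - sgnp (gdeg C b) * lk (gdif C x) b else 0)"
  unfolding dual_dga_def by (simp add: lk_sum lookup_single when_def fin sum.delta')

lemma lk_amul_DA: "lk (amul DA b c) x = (if x \<in> gens C \<and> gdeg C x = gdeg C b + gdeg C c then sgnp (gdeg C c * gdeg C b) * lk (codiag C x) (b, c) else 0)"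
  unfolding dual_dga_def by (simp add: lk_sum lookup_single when_def fin sum.delta')

lemma lk_gdif: "c \<in> gens C \<Longrightarrow> lk (gdif C c) b \<noteq> 0 \<Longrightarrow> b \<in> Cb \<and> gdeg C b = gdeg C c - 1"
  using dif_Cb[of c b] by (simp add: in_keys_iff)

lemma lk_codiag: "c \<in> gens C \<Longrightarrow> lk (codiag C c) (x, y) \<noteq> 0 \<Longrightarrow> x \<in> gens C \<and> y \<in> gens C \<and> gdeg C x + gdeg C y = gdeg C c"
  using codiag_closed[of c x y] by (simp add: in_keys_iff)

lemma lk_red: "c \<in> gens C \<Longrightarrow> lk (red_diag C c) (x, y) = (if x = one \<or> y = one then 0 else lk (codiag C c) (x, y))"
proof (cases "x = one \<or> y = one")
  case True
  have "lk (red_diag C c) (x, y) = ev (\<lambda>z. 0) (codiag C c)"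
    unfolding lookup_eq_ev ev_red by (rule ev_cong) (use True in auto)
  then show ?thesis using True by simp
next
  case False
  then show ?thesis unfolding lookup_eq_ev ev_red by (auto intro!: ev_cong)
qed

lemma lk_bv: "lk (bv x) y = (if x = y then 1 else 0)"
  by (simp add: bv_def lookup_single when_def)

lemma lk_codiag_one: "lk (codiag C one) (x, y) = (if x = one \<and> y = one then 1 else 0)"
  by (auto simp: coaug_codiag lk_bv)

lemma lk_codiag_Cb: "c \<in> Cb \<Longrightarrow> lk (codiag C c) (x, y) = (if x = one \<and> y = c then 1 else 0) + (if x = c \<and> y = one then 1 else 0) + lk (red_diag C c) (x, y)"
  unfolding lookup_eq_ev by (subst ev_codiag) auto

lemma lk_bar_word_Nil: "lk (bar_word A []) xs = (if xs = [] then 1 else 0)"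
  by (auto simp: lk_bv)

lemma lk_bar_word_Cons:
  "lk (bar_word A (p # ps)) xs = (case xs of [] \<Rightarrow> 0 | x # xs' \<Rightarrow> if x = aunit A then 0 else lk p x * lk (bar_word A ps) xs')"
proof -
  have "lk (bar_word A (p # ps)) xs = ev (\<lambda>x. if x = aunit A then 0 else ev (\<lambda>w. if x # w = xs then 1 else 0) (bar_word A ps)) p"
    unfolding lookup_eq_ev bar_word.simps ev_lext by (intro ev_cong) (simp add: ev_lext)
  also have "\<dots> = (case xs of [] \<Rightarrow> 0 | x # xs' \<Rightarrow> if x = aunit A then 0 else lk p x * lk (bar_word A ps) xs')"
  proof (cases xs)
    case Nil
    have "ev (\<lambda>y. if y = aunit A then 0 else ev (\<lambda>w. if y # w = xs then 1 else 0) (bar_word A ps)) p = ev (\<lambda>y. 0) p"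
      by (rule ev_cong) (simp add: Nil)
    then show ?thesis by (simp add: Nil)
  next
    case (Cons x xs')
    have "ev (\<lambda>y. if y = aunit A then 0 else ev (\<lambda>w. if y # w = xs then 1 else 0) (bar_word A ps)) p
      = ev (\<lambda>y. (if x = aunit A then 0 else lk (bar_word A ps) xs') * (if y = x then 1 else 0)) p"
      unfolding lookup_eq_ev by (intro ev_cong) (simp add: Cons)
    then show ?thesis by (simp only: ev_fun_mult lookup_eq_ev[of p x, symmetric] Cons list.case) simp
  qed
  finally show ?thesis .
qed

lemma lk_bar_word_bv_append:
  "one \<notin> set us \<Longrightarrow> lk (bar_word DA (map bv us @ ps)) xs
     = (if \<exists>zs. xs = us @ zs then lk (bar_word DA ps) (drop (length us) xs) else 0)"
proof (induction us arbitrary: xs)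
  case (Cons u us)
  then show ?case by (cases xs) (auto simp: lk_bar_word_Cons lk_bv simp del: bar_word.simps)
qed simp

lemma lk_bar_word_bv: "one \<notin> set us \<Longrightarrow> lk (bar_word DA (map bv us)) xs = (if xs = us then 1 else 0)"
  using lk_bar_word_bv_append[of us "[]" xs] by (auto simp: lk_bar_word_Nil simp del: bar_word.simps)

lemma lk_bar_word_1:
  assumes "one \<notin> set us" "one \<notin> set vs"
  shows "lk (bar_word DA (map bv us @ [p] @ map bv vs)) xs
    = (if \<exists>x. x \<noteq> one \<and> xs = us @ x # vs then lk p (xs ! length us) else 0)"
  unfolding lk_bar_word_bv_append[OF assms(1)]
  by (auto simp: lk_bar_word_Cons lk_bar_word_bv[OF assms(2)] split: list.split simp del: bar_word.simps)


lemma term_dif: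
  assumes x: "x \<in> gens C"
  shows "sgnp (qx d (us @ x # vs)) * (- sgnp (d + cd us) * lk (gdif DA w) x)
    = - (sgnp (d + cd (us @ x # vs)) * sgnp (qx d (us @ w # vs)) * (sgnp d * (sgnp (cd us) * lk (gdif C x) w)))"
proof (cases "lk (gdif C x) w = 0")
  case True
  then show ?thesis by (simp add: lk_gdif_DA)
next
  case False
  then have w: "gdeg C x = gdeg C w + 1" using lk_gdif[OF x] by simp
  have "qx (d + cd us + gdeg C w) vs = qx (d + cd us + (gdeg C w - 1)) vs + cd vs"
    using qx_shift[of "d + cd us + (gdeg C w - 1)" 1 vs] by (simp add: algebra_simps)
  then show ?thesis using x by (simp add: w lk_gdif_DA qx_append) (simp add: sgn_norm)
qed

lemma term_mul:
  assumes x: "x \<in> gens C" "w1 \<noteq> one" "w2 \<noteq> one"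
  shows "sgnp (qx d (us @ x # vs)) * (sgnp (d + cd (us @ [w1])) * lk (amul DA w1 w2) x)
    = sgnp (d + cd (us @ x # vs)) * sgnp (qx d (us @ w1 # w2 # vs)) * (sgnp d * (sgnp (cd us) * (sgnp (gdeg C w1) * lk (red_diag C x) (w1, w2))))"
proof (cases "lk (codiag C x) (w1, w2) = 0")
  case True
  then show ?thesis using assms by (simp add: lk_amul_DA lk_red)
next
  case False
  then have w: "gdeg C x = gdeg C w1 + gdeg C w2" using lk_codiag[OF x(1)] by simp
  have "qx (d + cd us + (gdeg C w1 + gdeg C w2 - 1)) vs = qx (d + cd us + (gdeg C w1 - 1) + (gdeg C w2 - 1)) vs + cd vs"
    using qx_shift[of "d + cd us + (gdeg C w1 - 1) + (gdeg C w2 - 1)" 1 vs] by (simp add: algebra_simps)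
  then show ?thesis using assms by (simp add: w lk_amul_DA lk_red qx_append) (simp add: sgn_norm)
qed

lemma term_left:
  assumes c: "c \<in> gens C"
  shows "sgnp (qx (gdeg C c) cs) * (sgnp (gdeg C b) * lk (amul DA b w) c)
    = - (sgnp (gdeg C c + cd cs) * sgnp (qx (gdeg C b) (w # cs)) * (sgnp (gdeg C b) * lk (codiag C c) (b, w)))"
proof (cases "lk (codiag C c) (b, w) = 0")
  case True
  then show ?thesis by (simp add: lk_amul_DA)
next
  case False
  then have w: "gdeg C c = gdeg C b + gdeg C w" using lk_codiag[OF c] by simp
  have "qx (gdeg C b + gdeg C w) cs = qx (gdeg C b + (gdeg C w - 1)) cs + cd cs"
    using qx_shift[of "gdeg C b + (gdeg C w - 1)" 1 cs] by (simp add: algebra_simps)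
  then show ?thesis using c by (simp add: w lk_amul_DA) (simp add: sgn_norm)
qed

lemma term_right:
  assumes c: "c \<in> gens C"
  shows "sgnp (qx (gdeg C c) cs) * (sgnp ((gdeg C w - 1) * (gdeg C b + cd cs)) * lk (amul DA w b) c)
    = - (sgnp (gdeg C c + cd cs) * sgnp (qx (gdeg C b) (cs @ [w])) * (sgnp ((cd cs + gdeg C b) * (gdeg C w - 1)) * lk (codiag C c) (w, b)))"
proof (cases "lk (codiag C c) (w, b) = 0")
  case True
  then show ?thesis by (simp add: lk_amul_DA)
next
  case False
  then have w: "gdeg C c = gdeg C b + gdeg C w" using lk_codiag[OF c False] by simp
  show ?thesis using c by (simp add: w lk_amul_DA qx_append qx_shift) (simp add: sgn_norm)
qed

text \<open>
  The matrix of the Hochschild differential of \<open>C\<^sup>\<or>\<close> is up to sign the transpose of that of \<open>\<delta>\<close>.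
  The internal terms correspond to \<open>d\<^sub>C\<close>, the products of neighbouring entries to the reduced
  diagonal in the cobar differential, and the products with the coefficient to the twisting terms.
\<close>

lemma dif_transpose:
  assumes y: "(b, bs) \<in> gens (cyclic DA)" and x: "(c, cs) \<in> gens T"
  shows "eT (c, cs) * lk (cyclic_dif DA (b, bs)) (c, cs)
    = sgnp (gdeg C c + cd cs) * eT (b, bs) * lk (twisted_dif C (c, cs)) (b, bs)"
proof -
  have b: "b \<in> gens C" and bs: "set bs \<subseteq> Cb" and n1: "one \<notin> set bs" using y by (auto simp: cyclic_def)
  have c: "c \<in> gens C" and cs: "set cs \<subseteq> Cb" using x by auto
  let ?k = "length bs" and ?l = "length cs"
  have bd: "bar_deg DA us = - cd us" for us by (induction us) (simp_all add: bar_deg_def)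
  have tk: "take i (map bv bs) = map bv (take i bs)" "drop i (map bv bs) = map bv (drop i bs)" for i by (simp_all add: take_map drop_map)
  have nt: "one \<notin> set (take i bs)" "one \<notin> set (drop i bs)" for i using n1 by (auto dest: in_set_takeD in_set_dropD)
  have cch: "lk (cchain DA p ps) (c, cs) = lk p c * lk (bar_word DA ps) cs" for p ps by (simp add: cchain_def lookup_tens)
  \<comment> \<open>the terms of the cyclic differential\<close>
  define D0 where "D0 = (if cs = bs then lk (gdif DA b) c else 0)"
  define D1 where "D1 = (\<lambda>i. (if c = b \<and> (\<exists>x. x \<noteq> one \<and> cs = take i bs @ x # drop (Suc i) bs) then lk (gdif DA (bs ! i)) (cs ! i) else 0))"
  define M0 where "M0 = (if cs = drop 1 bs then lk (amul DA b (bs ! 0)) c else 0)"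
  define M1 where "M1 = (\<lambda>i. (if c = b \<and> (\<exists>x. x \<noteq> one \<and> cs = take i bs @ x # drop (Suc (Suc i)) bs) then lk (amul DA (bs ! i) (bs ! Suc i)) (cs ! i) else 0))"
  define MZ where "MZ = (if cs = take (?k - 1) bs then lk (amul DA (bs ! (?k - 1)) b) c else 0)"
  have L: "lk (cyclic_dif DA (b, bs)) (c, cs) = D0 + (\<Sum>i<?k. - sgnp (gdeg C b + cd (take i bs)) * D1 i)
     + (if ?k = 0 then 0 else sgnp (gdeg C b) * M0 + (\<Sum>i<?k - 1. sgnp (gdeg C b + cd (take (Suc i) bs)) * M1 i)
        - sgnp ((gdeg C (bs ! (?k - 1)) - 1) * (gdeg C b + cd (take (?k - 1) bs))) * MZ)"
  proof -
    let ?vs = "map bv bs" and ?eps = "\<lambda>i. gdeg DA b + bar_deg DA (take i bs)"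
    have S: "(\<Sum>i\<in>{1..<?k}. f i) = (\<Sum>i<?k - 1. f (Suc i))" for f :: "nat \<Rightarrow> 'k"
      by (rule sum.reindex_bij_witness[of _ Suc "\<lambda>i. i - 1"]) auto
    have D0': "lk (cchain DA (gdif DA b) ?vs) (c, cs) = D0"
      by (simp add: cch lk_bar_word_bv[OF n1] D0_def)
    have D1': "(\<Sum>i<?k. - sgnp (?eps i) * lk (cchain DA (bv b) (take i ?vs @ [gdif DA (bs ! i)] @ drop (i + 1) ?vs)) (c, cs))
       = (\<Sum>i<?k. - sgnp (gdeg C b + cd (take i bs)) * D1 i)"
    proof (rule sum.cong[OF refl])
      fix i assume "i \<in> {..<?k}"
      then have i: "length (take i bs) = i" by simp
      show "- sgnp (?eps i) * lk (cchain DA (bv b) (take i ?vs @ [gdif DA (bs ! i)] @ drop (i + 1) ?vs)) (c, cs)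
        = - sgnp (gdeg C b + cd (take i bs)) * D1 i"
        unfolding cch tk lk_bar_word_1[OF nt] i bd DA_simps D1_def lk_bv by (auto simp: sgnp_add sgnp_diff sgnp_uminus)
    qed
    have M0': "lk (cchain DA (amul DA b (bs ! 0)) (drop 1 ?vs)) (c, cs) = M0"
      by (simp only: cch tk lk_bar_word_bv[OF nt(2)] M0_def) simp
    have M1': "(\<Sum>i\<in>{1..<?k}. sgnp (?eps i) * lk (cchain DA (bv b) (take (i - 1) ?vs @ [amul DA (bs ! (i - 1)) (bs ! i)] @ drop (i + 1) ?vs)) (c, cs))
       = (\<Sum>i<?k - 1. sgnp (gdeg C b + cd (take (Suc i) bs)) * M1 i)"
      unfolding S
    proof (rule sum.cong[OF refl])
      fix i assume "i \<in> {..<?k - 1}"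
      then have i: "length (take i bs) = i" "Suc i - 1 = i" "Suc i + 1 = Suc (Suc i)" by simp_all
      show "sgnp (?eps (Suc i)) * lk (cchain DA (bv b) (take (Suc i - 1) ?vs @ [amul DA (bs ! (Suc i - 1)) (bs ! Suc i)] @ drop (Suc i + 1) ?vs)) (c, cs)
        = sgnp (gdeg C b + cd (take (Suc i) bs)) * M1 i"
        unfolding i(2,3) cch tk lk_bar_word_1[OF nt] i(1) bd DA_simps M1_def lk_bv by (auto simp: sgnp_add sgnp_diff sgnp_uminus)
    qed
    have MZ': "lk (cchain DA (amul DA (bs ! (?k - 1)) b) (take (?k - 1) ?vs)) (c, cs) = MZ"
      by (simp only: cch tk lk_bar_word_bv[OF nt(1)] MZ_def) simp
    have C: "lk (cyclic_dif DA (b, bs)) (c, cs) = lk (cchain DA (gdif DA b) ?vs) (c, cs)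
       + (\<Sum>i<?k. - sgnp (?eps i) * lk (cchain DA (bv b) (take i ?vs @ [gdif DA (bs ! i)] @ drop (i + 1) ?vs)) (c, cs))
       + (if ?k = 0 then 0 else sgnp (gdeg DA b) * lk (cchain DA (amul DA b (bs ! 0)) (drop 1 ?vs)) (c, cs)
           + (\<Sum>i\<in>{1..<?k}. sgnp (?eps i) * lk (cchain DA (bv b) (take (i - 1) ?vs @ [amul DA (bs ! (i - 1)) (bs ! i)] @ drop (i + 1) ?vs)) (c, cs))
           + - sgnp ((gdeg DA (bs ! (?k - 1)) + 1) * ?eps (?k - 1)) * lk (cchain DA (amul DA (bs ! (?k - 1)) b) (take (?k - 1) ?vs)) (c, cs))"
      unfolding cyclic_dif_def prod.case Let_def
      by (cases "?k = 0") (simp_all only: lookup_add lk_sum lookup_scl lookup_zero if_True if_False simp_thms)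
    have e: "sgnp ((gdeg DA (bs ! (?k - 1)) + 1) * ?eps (?k - 1)) = (sgnp ((gdeg C (bs ! (?k - 1)) - 1) * (gdeg C b + cd (take (?k - 1) bs))) :: 'k)"
      unfolding bd DA_simps by (rule sgnp_cong) (simp add: algebra_simps)
    show ?thesis unfolding C unfolding D0' D1' M0' M1' MZ' unfolding e unfolding DA_simps sgnp_uminus by simp
  qed
  \<comment> \<open>the terms of the twisted differential\<close>
  define R1 where "R1 = (\<lambda>i. if b = c \<and> (\<exists>x. bs = take i cs @ x # drop (Suc i) cs) then lk (gdif C (cs ! i)) (bs ! i) else 0)"
  define R2 where "R2 = (\<lambda>i. if b = c \<and> (\<exists>x y. bs = take i cs @ x # y # drop (Suc i) cs) then sgnp (gdeg C (bs ! i)) * lk (red_diag C (cs ! i)) (bs ! i, bs ! Suc i) else 0)"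
  define R0 where "R0 = (if bs = cs then lk (gdif C c) b else 0)"
  define Z0 where "Z0 = (if ?k \<noteq> 0 \<and> drop 1 bs = cs then lk (codiag C c) (b, bs ! 0) else 0)"
  define ZL where "ZL = (if ?k \<noteq> 0 \<and> take (?k - 1) bs = cs then lk (codiag C c) (bs ! (?k - 1), b) else 0)"
  have R: "lk (twisted_dif C (c, cs)) (b, bs) = R0 - sgnp (gdeg C b) * Z0 + sgnp ((cd cs + gdeg C b) * (gdeg C (bs ! (?k - 1)) - 1)) * ZL
      + sgnp (gdeg C c) * ((\<Sum>i<?l. sgnp (cd (take i cs)) * R2 i) - (\<Sum>i<?l. sgnp (cd (take i cs)) * R1 i))"
  proof -
    have cob: "(if b = c then lk (cobar_dif C cs) bs else 0) = (\<Sum>i<?l. sgnp (cd (take i cs)) * R2 i) - (\<Sum>i<?l. sgnp (cd (take i cs)) * R1 i)"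
    proof (cases "b = c")
      case True
      have "lk (cobar_dif C cs) bs = (\<Sum>i<?l. sgnp (cd (take i cs)) * (R2 i - R1 i))"
        unfolding cobar_dif_def lk_sum lookup_scl
      proof (rule sum.cong[OF refl], rule arg_cong2[of _ _ _ _ "(*)", OF refl])
        fix i assume "i \<in> {..<?l}"
        then have i: "i < ?l" "length (take i cs) = i" by auto
        then have ci: "cs ! i \<in> gens C" using cs nth_mem by blast
        have 1: "ev (\<lambda>x. if take i cs @ x # drop (Suc i) cs = bs then 1 else 0) (gdif C (cs ! i)) = R1 i"
        proof (cases "\<exists>x. bs = take i cs @ x # drop (Suc i) cs")
          case T: True
          then obtain x where x: "bs = take i cs @ x # drop (Suc i) cs" by blast
          then have "bs ! i = x" using i by (simp add: nth_append)
          then show ?thesis using T True x unfolding R1_def lookup_eq_ev by (auto intro!: ev_cong)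
        next
          case False
          then have "ev (\<lambda>x. if take i cs @ x # drop (Suc i) cs = bs then 1 else 0) (gdif C (cs ! i)) = ev (\<lambda>x. 0 :: 'k) (gdif C (cs ! i))"
            by (intro ev_cong) auto
          then show ?thesis using False by (simp add: R1_def)
        qed
        have 2: "ev (\<lambda>(x, y). sgnp (gdeg C x) * (if take i cs @ x # y # drop (Suc i) cs = bs then 1 else 0)) (red_diag C (cs ! i)) = R2 i"
        proof (cases "\<exists>x y. bs = take i cs @ x # y # drop (Suc i) cs")
          case T: True
          then obtain x y where x: "bs = take i cs @ x # y # drop (Suc i) cs" by blast
          then have "bs ! i = x" "bs ! Suc i = y" using i by (simp_all add: nth_append)
          moreover have "ev (\<lambda>(x', y'). sgnp (gdeg C x') * (if take i cs @ x' # y' # drop (Suc i) cs = bs then 1 else 0)) (red_diag C (cs ! i))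
            = ev (\<lambda>z. sgnp (gdeg C x) * (if z = (x, y) then 1 else 0)) (red_diag C (cs ! i))"
            by (rule ev_cong) (auto simp: x split: if_splits)
          ultimately show ?thesis using T True x unfolding R2_def lookup_eq_ev ev_fun_mult by auto
        next
          case False
          then have "ev (\<lambda>(x, y). sgnp (gdeg C x) * (if take i cs @ x # y # drop (Suc i) cs = bs then 1 else 0)) (red_diag C (cs ! i)) = ev (\<lambda>x. 0 :: 'k) (red_diag C (cs ! i))"
            by (intro ev_cong) auto
          then show ?thesis using False by (simp add: R2_def)
        qed
        show "lk (lext (\<lambda>u. bv (take i cs @ u @ drop (i + 1) cs)) (cobar_dif_gen C (cs ! i))) bs = R2 i - R1 i"
          unfolding lookup_eq_ev ev_lext ev_bv cobar_dif_gen_def 1[symmetric] 2[symmetric]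
          by (simp add: ev_lin case_prod_unfold)
      qed
      then show ?thesis using True by (simp add: right_diff_distrib sum_subtractf)
    qed (simp add: R1_def R2_def)
    have t: "lk (tens (bv c) (cobar_dif C cs)) (b, bs) = (if b = c then lk (cobar_dif C cs) bs else 0)"
      by (simp add: lookup_tens lk_bv)
    show ?thesis
    proof (cases "c = one")
      case True
      have nz: "bs ! i \<noteq> one" if "i < ?k" for i using n1 nth_mem[OF that] by metis
      have "Z0 = 0" "ZL = 0" using nz[of 0] nz[of "?k - 1"] by (auto simp: Z0_def ZL_def True lk_codiag_one)
      moreover have "R0 = 0" by (simp add: R0_def True coaug_dif)
      ultimately show ?thesis using t[unfolded cob] coaug_gen by (simp add: twisted_dif_def True)
    next
      case False
      then have c': "c \<in> Cb" using c by simp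
      have z0: "lk (bv (one, [c] @ cs)) (b, bs) + lk (lext (\<lambda>(x, y). scl (sgnp (gdeg C x)) (bv (x, [y] @ cs))) (red_diag C c)) (b, bs) = sgnp (gdeg C b) * Z0"
      proof (cases "?k \<noteq> 0 \<and> drop 1 bs = cs")
        case T: True
        then obtain y where y: "bs = y # cs" by (cases bs) auto
        have "lk (lext (\<lambda>(x, y). scl (sgnp (gdeg C x)) (bv (x, [y] @ cs))) (red_diag C c)) (b, bs)
           = ev (\<lambda>z. sgnp (gdeg C b) * (if z = (b, y) then 1 else 0)) (red_diag C c)"
          unfolding lookup_eq_ev ev_lext by (rule ev_cong) (auto simp: ev_lin y split: if_splits)
        also have "\<dots> = sgnp (gdeg C b) * lk (red_diag C c) (b, y)"
          unfolding ev_fun_mult lookup_eq_ev ..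
        finally have E: "lk (lext (\<lambda>(x, y). scl (sgnp (gdeg C x)) (bv (x, [y] @ cs))) (red_diag C c)) (b, bs) = \<dots>" .
        have "y \<noteq> one" using n1 y by auto
        then have "lk (bv (one, [c] @ cs)) (b, bs) = (if one = b \<and> y = c then 1 else (0 :: 'k))"
          "Z0 = (if one = b \<and> y = c then 1 else 0) + lk (red_diag C c) (b, y)"
          by (auto simp: Z0_def lk_codiag_Cb[OF c'] lk_bv y)
        then show ?thesis unfolding E using coaug_gen by (auto simp: distrib_left)
      next
        case F: False
        have "lk (lext (\<lambda>(x, y). scl (sgnp (gdeg C x)) (bv (x, [y] @ cs))) (red_diag C c)) (b, bs) = ev (\<lambda>z. 0) (red_diag C c)"
          unfolding lookup_eq_ev ev_lext by (rule ev_cong) (use F in \<open>auto simp: ev_lin\<close>)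
        then show ?thesis using F by (auto simp: Z0_def lk_bv)
      qed
      have zl: "sgnp (cd cs * (gdeg C c - 1)) * lk (bv (one, cs @ [c])) (b, bs)
         + lk (lext (\<lambda>(x, y). scl (sgnp ((cd cs + gdeg C y) * (gdeg C x - 1))) (bv (y, cs @ [x]))) (red_diag C c)) (b, bs)
         = sgnp ((cd cs + gdeg C b) * (gdeg C (bs ! (?k - 1)) - 1)) * ZL"
      proof (cases "?k \<noteq> 0 \<and> take (?k - 1) bs = cs")
        case T: True
        then obtain y where y: "bs = cs @ [y]" by (cases bs rule: rev_cases) auto
        have "lk (lext (\<lambda>(x, y). scl (sgnp ((cd cs + gdeg C y) * (gdeg C x - 1))) (bv (y, cs @ [x]))) (red_diag C c)) (b, bs)
           = ev (\<lambda>z. sgnp ((cd cs + gdeg C b) * (gdeg C y - 1)) * (if z = (y, b) then 1 else 0)) (red_diag C c)"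
          unfolding lookup_eq_ev ev_lext by (rule ev_cong) (auto simp: ev_lin y split: if_splits)
        also have "\<dots> = sgnp ((cd cs + gdeg C b) * (gdeg C y - 1)) * lk (red_diag C c) (y, b)"
          unfolding ev_fun_mult lookup_eq_ev ..
        finally have E: "lk (lext (\<lambda>(x, y). scl (sgnp ((cd cs + gdeg C y) * (gdeg C x - 1))) (bv (y, cs @ [x]))) (red_diag C c)) (b, bs) = \<dots>" .
        have "y \<noteq> one" using n1 y by auto
        then have "lk (bv (one, cs @ [c])) (b, bs) = (if one = b \<and> y = c then 1 else (0 :: 'k))"
          "ZL = (if one = b \<and> y = c then 1 else 0) + lk (red_diag C c) (y, b)"
          by (auto simp: ZL_def lk_codiag_Cb[OF c'] lk_bv y)
        then show ?thesis unfolding E using coaug_gen by (auto simp: y distrib_left)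
      next
        case F: False
        have "lk (lext (\<lambda>(x, y). scl (sgnp ((cd cs + gdeg C y) * (gdeg C x - 1))) (bv (y, cs @ [x]))) (red_diag C c)) (b, bs) = ev (\<lambda>z. 0) (red_diag C c)"
          unfolding lookup_eq_ev ev_lext by (rule ev_cong) (use F in \<open>auto simp: ev_lin\<close>)
        then show ?thesis using F by (auto simp: ZL_def lk_bv)
      qed
      have r0: "lk (tens (gdif C c) (bv cs)) (b, bs) = R0"
        by (simp add: lookup_tens lk_bv R0_def)
      show ?thesis unfolding cob[symmetric] t[symmetric] z0[symmetric] zl[symmetric] r0[symmetric]
        using False by (simp add: twisted_dif_def lookup_add lookup_minus)
    qed
  qed
  have csn: "one \<notin> set cs" using cs by auto
  let ?e = "sgnp (gdeg C c + cd cs) * eT (b, bs)"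
  have alpha: "eT (c, cs) * D0 = ?e * R0"
  proof (cases "bs = cs \<and> lk (gdif C c) b \<noteq> 0")
    case True
    then have "gdeg C c = gdeg C b + 1" using lk_gdif[OF c] by simp
    then show ?thesis using True c by (simp add: D0_def R0_def lk_gdif_DA qx_shift) (simp add: sgn_norm)
  next
    case False
    then show ?thesis by (auto simp: D0_def R0_def lk_gdif_DA)
  qed
  have beta: "eT (c, cs) * (\<Sum>i<?k. - sgnp (gdeg C b + cd (take i bs)) * D1 i)
      = - (?e * (sgnp (gdeg C c) * (\<Sum>i<?l. sgnp (cd (take i cs)) * R1 i)))"
  proof (cases "?k = ?l \<and> b = c")
    case T: True
    have "eT (c, cs) * (- sgnp (gdeg C b + cd (take i bs)) * D1 i) = - (?e * (sgnp (gdeg C c) * (sgnp (cd (take i cs)) * R1 i)))" if i: "i < ?k" for i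
    proof (cases "\<exists>x. bs = take i cs @ x # drop (Suc i) cs")
      case True
      then obtain w where w: "bs = take i cs @ w # drop (Suc i) cs" by blast
      define us vs x where "us = take i cs" and "vs = drop (Suc i) cs" and "x = cs ! i"
      have cs': "cs = us @ x # vs" using i T unfolding us_def vs_def x_def by (simp add: id_take_nth_drop[symmetric])
      have bs': "bs = us @ w # vs" using w by (simp add: us_def vs_def)
      have i': "i = length us" using i T by (simp add: us_def)
      have x: "x \<in> gens C" "x \<noteq> one" using cs cs' by auto
      have "D1 i = lk (gdif DA w) x" "R1 i = lk (gdif C x) w"
        using x T by (simp_all add: D1_def R1_def cs' bs' i' nth_append)
      then show ?thesis using term_dif[OF x(1), of "gdeg C b" us vs w] T
        by (simp add: cs' bs' i' mult.assoc)
    next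
      case False
      have "D1 i = 0"
      proof (rule ccontr)
        assume "D1 i \<noteq> 0"
        then obtain x where x: "cs = take i bs @ x # drop (Suc i) bs" by (auto simp: D1_def split: if_splits)
        have "bs = take i cs @ bs ! i # drop (Suc i) cs" unfolding x using i by (simp add: id_take_nth_drop[symmetric])
        then show False using False by blast
      qed
      then show ?thesis using False by (simp add: R1_def)
    qed
    then show ?thesis using T by (simp add: sum_distrib_left sum_negf[symmetric] del: sum_negf)
  next
    case False
    have "D1 i = 0" if "i < ?k" for i
    proof (rule ccontr)
      assume D: "D1 i \<noteq> 0"
      then obtain x where x: "cs = take i bs @ x # drop (Suc i) bs" "b = c" by (auto simp: D1_def split: if_splits)
      then have "?l = ?k" using that by simp
      then show False using False x by simp
    qed
    moreover have "R1 i = 0" if "i < ?l" for i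
    proof (rule ccontr)
      assume D: "R1 i \<noteq> 0"
      then obtain x where x: "bs = take i cs @ x # drop (Suc i) cs" "b = c" by (auto simp: R1_def split: if_splits)
      then have "?l = ?k" using that by simp
      then show False using False x by simp
    qed
    ultimately show ?thesis by simp
  qed
  have gamma: "eT (c, cs) * (if ?k = 0 then 0 else (\<Sum>i<?k - 1. sgnp (gdeg C b + cd (take (Suc i) bs)) * M1 i))
      = ?e * (sgnp (gdeg C c) * (\<Sum>i<?l. sgnp (cd (take i cs)) * R2 i))"
  proof (cases "?k = Suc ?l \<and> b = c")
    case T: True
    have "eT (c, cs) * (sgnp (gdeg C b + cd (take (Suc i) bs)) * M1 i) = ?e * (sgnp (gdeg C c) * (sgnp (cd (take i cs)) * R2 i))" if i: "i < ?l" for i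
    proof (cases "\<exists>x y. bs = take i cs @ x # y # drop (Suc i) cs")
      case True
      then obtain w1 w2 where w: "bs = take i cs @ w1 # w2 # drop (Suc i) cs" by blast
      define us vs x where "us = take i cs" and "vs = drop (Suc i) cs" and "x = cs ! i"
      have cs': "cs = us @ x # vs" using i T unfolding us_def vs_def x_def by (simp add: id_take_nth_drop[symmetric])
      have bs': "bs = us @ w1 # w2 # vs" using w by (simp add: us_def vs_def)
      have i': "i = length us" using i T by (simp add: us_def)
      have x: "x \<in> gens C" "x \<noteq> one" using cs cs' by auto
      have w12: "w1 \<noteq> one" "w2 \<noteq> one" using n1 bs' by auto
      have "M1 i = lk (amul DA w1 w2) x" "R2 i = sgnp (gdeg C w1) * lk (red_diag C x) (w1, w2)"
        using x T by (simp_all add: M1_def R2_def cs' bs' i' nth_append)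
      then show ?thesis using term_mul[OF x(1) w12, of "gdeg C b" us vs] T
        by (simp add: cs' bs' i' mult.assoc)
    next
      case False
      have "M1 i = 0"
      proof (rule ccontr)
        assume "M1 i \<noteq> 0"
        then obtain x where x: "cs = take i bs @ x # drop (Suc (Suc i)) bs" by (auto simp: M1_def split: if_splits)
        have "bs = take i cs @ bs ! i # bs ! Suc i # drop (Suc i) cs" unfolding x using i T
          by (simp add: Cons_nth_drop_Suc)
        then show False using False by blast
      qed
      then show ?thesis using False by (simp add: R2_def)
    qed
    then show ?thesis using T by (simp add: sum_distrib_left)
  next
    case False
    have "M1 i = 0" if "i < ?k - 1" for i
    proof (rule ccontr)
      assume D: "M1 i \<noteq> 0"
      then obtain x where x: "cs = take i bs @ x # drop (Suc (Suc i)) bs" "b = c" by (auto simp: M1_def split: if_splits)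
      then have "?k = Suc ?l" using that by simp
      then show False using False x by simp
    qed
    moreover have "R2 i = 0" if "i < ?l" for i
    proof (rule ccontr)
      assume D: "R2 i \<noteq> 0"
      then obtain x y where x: "bs = take i cs @ x # y # drop (Suc i) cs" "b = c" by (auto simp: R2_def split: if_splits)
      then have "?k = Suc ?l" using that by simp
      then show False using False x by simp
    qed
    ultimately show ?thesis by simp
  qed
  have delta: "eT (c, cs) * (if ?k = 0 then 0 else sgnp (gdeg C b) * M0) = - (?e * (sgnp (gdeg C b) * Z0))"
  proof (cases "?k \<noteq> 0 \<and> drop 1 bs = cs")
    case True
    then obtain w where "bs = w # cs" by (cases bs) auto
    then show ?thesis using term_left[OF c, of cs b w] by (simp add: M0_def Z0_def)
  qed (auto simp: M0_def Z0_def)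
  have zeta: "eT (c, cs) * (if ?k = 0 then 0 else sgnp ((gdeg C (bs ! (?k - 1)) - 1) * (gdeg C b + cd (take (?k - 1) bs))) * MZ)
     = - (?e * (sgnp ((cd cs + gdeg C b) * (gdeg C (bs ! (?k - 1)) - 1)) * ZL))"
  proof (cases "?k \<noteq> 0 \<and> take (?k - 1) bs = cs")
    case True
    then obtain w where "bs = cs @ [w]" by (cases bs rule: rev_cases) auto
    then show ?thesis using term_right[OF c, of cs w b] by (simp add: MZ_def ZL_def)
  qed (auto simp: MZ_def ZL_def)
  have "eT (c, cs) * lk (cyclic_dif DA (b, bs)) (c, cs) = eT (c, cs) * D0 + eT (c, cs) * (\<Sum>i<?k. - sgnp (gdeg C b + cd (take i bs)) * D1 i)
    + eT (c, cs) * (if ?k = 0 then 0 else sgnp (gdeg C b) * M0)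
    + eT (c, cs) * (if ?k = 0 then 0 else (\<Sum>i<?k - 1. sgnp (gdeg C b + cd (take (Suc i) bs)) * M1 i))
    - eT (c, cs) * (if ?k = 0 then 0 else sgnp ((gdeg C (bs ! (?k - 1)) - 1) * (gdeg C b + cd (take (?k - 1) bs))) * MZ)"
    unfolding L by (simp add: distrib_left right_diff_distrib)
  also have "\<dots> = ?e * lk (twisted_dif C (c, cs)) (b, bs)"
    unfolding alpha beta gamma delta zeta R by (simp add: algebra_simps)
  finally show ?thesis .
qed

end


section \<open>Shuffles of words\<close>

lemma koszul_Suc: "koszul (map (\<lambda>i. (Suc (f i), g i)) is) = koszul (map (\<lambda>i. (f i, g i)) is)"
proof (induction "is")
  case (Cons i "is")
  have "(\<Sum>u\<leftarrow>filter (\<lambda>u. fst u < Suc (f i)) (map (\<lambda>i. (Suc (f i), g i)) is). g i * snd u)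
      = (\<Sum>u\<leftarrow>filter (\<lambda>u. fst u < f i) (map (\<lambda>i. (f i, g i)) is). g i * snd u)"
    by (simp add: filter_map comp_def)
  then show ?case using Cons by simp
qed simp

lemma koszul_insert:
  "\<forall>t\<in>set L1. fst t > 0 \<Longrightarrow> koszul (L1 @ (0, x) # L2) = koszul (L1 @ L2) + (\<Sum>t\<leftarrow>L1. snd t * x)"
  by (induction L1) simp_all

text \<open>
  The increasing bijection of the naturals onto the complement of \<open>j\<close>.
\<close>

definition skip :: "nat \<Rightarrow> nat \<Rightarrow> nat" where
  "skip j i = (if i < j then i else Suc i)"

text \<open>
  The permutation of \<open>{..n}\<close> that moves position \<open>j\<close> to the front and acts on the others as \<open>\<tau>\<close>.
\<close>

definition ins_perm :: "nat \<Rightarrow> nat \<Rightarrow> (nat \<Rightarrow> nat) \<Rightarrow> nat \<Rightarrow> nat" where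
  "ins_perm n j \<tau> i = (if i = j then 0 else if i \<le> n then Suc (\<tau> (if i < j then i else i - 1)) else i)"

lemma ins_perm_skip: "i < n \<Longrightarrow> ins_perm n j \<tau> (skip j i) = Suc (\<tau> i)"
  by (auto simp: ins_perm_def skip_def)

lemma ins_perm_at [simp]: "ins_perm n j \<tau> j = 0"
  by (simp add: ins_perm_def)

lemma skip_surj: "i \<le> n \<Longrightarrow> j \<le> n \<Longrightarrow> i \<noteq> j \<Longrightarrow> \<exists>k<n. i = skip j k"
  by (intro exI[of _ "if i < j then i else i - 1"]) (auto simp: skip_def)

lemma skip_le: "i < n \<Longrightarrow> j \<le> n \<Longrightarrow> skip j i \<le> n \<and> skip j i \<noteq> j"
  by (auto simp: skip_def)

lemma ins_perm_permutes:
  assumes \<tau>: "\<tau> permutes {..<n}" and j: "j \<le> n"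
  shows "ins_perm n j \<tau> permutes {..<Suc n}"
proof (rule bij_imp_permutes)
  have lt: "\<tau> i < n" if "i < n" for i using permutes_in_image[OF \<tau>, of i] that by simp
  have inj: "inj_on (ins_perm n j \<tau>) {..<Suc n}"
  proof (rule inj_onI)
    fix x y assume xy: "x \<in> {..<Suc n}" "y \<in> {..<Suc n}" "ins_perm n j \<tau> x = ins_perm n j \<tau> y"
    show "x = y"
    proof (cases "x = j \<or> y = j")
      case True
      then show ?thesis using xy by (auto simp: ins_perm_def split: if_splits)
    next
      case False
      then obtain k l where "k < n" "l < n" "x = skip j k" "y = skip j l" using skip_surj j xy by (metis lessThan_iff less_Suc_eq_le)
      then show ?thesis using xy(3) permutes_inj[OF \<tau>] by (auto simp: ins_perm_skip dest: injD)
    qed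
  qed
  have "ins_perm n j \<tau> ` {..<Suc n} \<subseteq> {..<Suc n}"
  proof
    fix y assume "y \<in> ins_perm n j \<tau> ` {..<Suc n}"
    then obtain x where x: "x \<le> n" "y = ins_perm n j \<tau> x" by (auto simp: less_Suc_eq_le)
    show "y \<in> {..<Suc n}"
    proof (cases "x = j")
      case False
      then obtain k where "k < n" "x = skip j k" using skip_surj j x by blast
      then show ?thesis using lt x by (simp add: ins_perm_skip)
    qed (simp add: x)
  qed
  then show "bij_betw (ins_perm n j \<tau>) {..<Suc n} {..<Suc n}"
    using inj by (simp add: bij_betw_def endo_inj_surj)
qed (use j in \<open>auto simp: ins_perm_def\<close>)

lemma permutes_ins_perm:
  assumes \<sigma>: "\<sigma> permutes {..<Suc n}" and j: "j \<le> n" "\<sigma> j = 0"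
  shows "\<exists>\<tau>. \<tau> permutes {..<n} \<and> \<sigma> = ins_perm n j \<tau>"
proof -
  define \<tau> where "\<tau> i = (if i < n then \<sigma> (skip j i) - 1 else i)" for i
  have pos: "\<sigma> i > 0" if "i \<noteq> j" for i using permutes_inj[OF \<sigma>] j that by (metis gr0I injD)
  have s: "\<sigma> (skip j i) = Suc (\<tau> i)" if "i < n" for i
    using pos[of "skip j i"] skip_le[OF that j(1)] that by (simp add: \<tau>_def)
  have "\<sigma> i = ins_perm n j \<tau> i" for i
  proof (cases "i = j \<or> i > n")
    case True
    then show ?thesis using j permutes_not_in[OF \<sigma>, of i] by (auto simp: ins_perm_def)
  next
    case False
    then obtain k where "k < n" "i = skip j k" using skip_surj j by (metis not_less)
    then show ?thesis by (simp add: s ins_perm_skip)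
  qed
  moreover have "\<tau> permutes {..<n}"
  proof (rule bij_imp_permutes)
    have "inj_on \<tau> {..<n}"
    proof (rule inj_onI)
      fix x y assume xy: "x \<in> {..<n}" "y \<in> {..<n}" "\<tau> x = \<tau> y"
      then have "\<sigma> (skip j x) = \<sigma> (skip j y)" by (simp add: s)
      then have "skip j x = skip j y" using permutes_inj[OF \<sigma>] by (rule injD[rotated])
      then show "x = y" by (auto simp: skip_def split: if_splits)
    qed
    moreover have "\<tau> ` {..<n} \<subseteq> {..<n}"
    proof
      fix y assume "y \<in> \<tau> ` {..<n}"
      then obtain x where x: "x < n" "y = \<tau> x" by auto
      have "\<sigma> (skip j x) < Suc n" using permutes_in_image[OF \<sigma>, of "skip j x"] skip_le[OF x(1) j(1)] by simp
      then show "y \<in> {..<n}" using s[OF x(1)] x by simp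
    qed
    ultimately show "bij_betw \<tau> {..<n} {..<n}" by (simp add: bij_betw_def endo_inj_surj)
  qed (simp add: \<tau>_def)
  ultimately show ?thesis by blast
qed

lemma inv_ins_perm:
  assumes \<tau>: "\<tau> permutes {..<n}" and j: "j \<le> n"
  shows "inv_into UNIV (ins_perm n j \<tau>) 0 = j" "m < n \<Longrightarrow> inv_into UNIV (ins_perm n j \<tau>) (Suc m) = skip j (inv_into UNIV \<tau> m)"
proof -
  have i: "inj (ins_perm n j \<tau>)" using ins_perm_permutes[OF assms] by (rule permutes_inj)
  show "inv_into UNIV (ins_perm n j \<tau>) 0 = j" by (rule inv_f_eq[OF i]) simp
  assume m: "m < n"
  have "inv_into UNIV \<tau> m < n" using permutes_in_image[OF permutes_inv[OF \<tau>], of m] m by simp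
  then show "inv_into UNIV (ins_perm n j \<tau>) (Suc m) = skip j (inv_into UNIV \<tau> m)"
    by (intro inv_f_eq[OF i]) (simp add: ins_perm_skip permutes_inverses[OF \<tau>])
qed

definition sw_term :: "('x, 'k::comm_ring_1, 'e) free_complex_scheme \<Rightarrow> 'x list \<Rightarrow> (nat \<Rightarrow> nat) \<Rightarrow> 'x list \<Rightarrow>\<^sub>0 'k" where
  "sw_term X vs \<sigma> = scl (sgnp (koszul (map (\<lambda>i. (\<sigma> i, gdeg X (vs ! i) + 1)) [0..<length vs])))
            (bv (map (\<lambda>i. vs ! (inv_into UNIV \<sigma> i)) [0..<length vs]))"

lemma shuffle_word_alt: "shuffle_word X xs ys = (\<Sum>\<sigma>\<in>shuffles_perm (length xs) (length ys). sw_term X (xs @ ys) \<sigma>)"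
  by (simp add: shuffle_word_def sw_term_def Let_def)

lemma ev_sw_term_ins:
  assumes \<tau>: "\<tau> permutes {..<length (us @ vs)}"
  shows "ev F (sw_term X (us @ v # vs) (ins_perm (length (us @ vs)) (length us) \<tau>))
    = sgnp ((gdeg X v + 1) * bar_deg X us) * ev (\<lambda>w. F (v # w)) (sw_term X (us @ vs) \<tau>)"
proof -
  let ?n = "length (us @ vs)" and ?j = "length us" and ?\<sigma> = "ins_perm (length (us @ vs)) (length us) \<tau>"
  let ?V = "us @ v # vs"
  have at: "?V ! skip ?j i = (us @ vs) ! i" if "i < ?n" for i
    using that by (auto simp: skip_def nth_append Suc_diff_le)
  have w: "map (\<lambda>i. ?V ! (inv_into UNIV ?\<sigma> i)) [0..<length ?V] = v # map (\<lambda>i. (us @ vs) ! (inv_into UNIV \<tau> i)) [0..<?n]"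
  proof -
    have u: "[0..<length ?V] = 0 # map Suc [0..<?n]" by (simp add: map_Suc_upt upt_conv_Cons del: upt_Suc)
    have lt: "inv_into UNIV \<tau> i < ?n" if "i < ?n" for i using permutes_in_image[OF permutes_inv[OF \<tau>], of i] that by simp
    have "map (\<lambda>i. ?V ! (inv_into UNIV ?\<sigma> i)) [0..<length ?V] = ?V ! (inv_into UNIV ?\<sigma> 0) # map (\<lambda>i. ?V ! (inv_into UNIV ?\<sigma> (Suc i))) [0..<?n]"
      unfolding u by (simp add: comp_def)
    also have "\<dots> = v # map (\<lambda>i. (us @ vs) ! (inv_into UNIV \<tau> i)) [0..<?n]"
    proof -
      have "?V ! (inv_into UNIV ?\<sigma> (Suc i)) = (us @ vs) ! (inv_into UNIV \<tau> i)" if "i < ?n" for i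
        using inv_ins_perm(2)[OF \<tau>, of ?j i] at[OF lt[OF that]] that by simp
      then have "map (\<lambda>i. ?V ! (inv_into UNIV ?\<sigma> (Suc i))) [0..<?n] = map (\<lambda>i. (us @ vs) ! (inv_into UNIV \<tau> i)) [0..<?n]"
        by (intro map_cong) auto
      moreover have "?V ! (inv_into UNIV ?\<sigma> 0) = v" using inv_ins_perm(1)[OF \<tau>, of ?j] by simp
      ultimately show ?thesis by (simp only:)
    qed
    finally show ?thesis .
  qed
  let ?g = "\<lambda>i. gdeg X (?V ! i) + 1" and ?h = "\<lambda>i. gdeg X ((us @ vs) ! i) + 1"
  have k: "koszul (map (\<lambda>i. (?\<sigma> i, ?g i)) [0..<length ?V]) = koszul (map (\<lambda>i. (\<tau> i, ?h i)) [0..<?n]) + (gdeg X v + 1) * bar_deg X us"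
  proof -
    let ?L1 = "map (\<lambda>i. (?\<sigma> i, ?g i)) [0..<?j]" and ?L2 = "map (\<lambda>i. (?\<sigma> i, ?g i)) [Suc ?j..<length ?V]"
    have u: "[0..<length ?V] = [0..<?j] @ ?j # [Suc ?j..<length ?V]"
      using upt_add_eq_append[of 0 ?j "Suc (length vs)"] upt_conv_Cons[of ?j "length ?V"] by (simp del: upt_Suc)
    have L1: "?L1 = map (\<lambda>i. (Suc (\<tau> i), ?h i)) [0..<?j]"
    proof (rule map_cong[OF refl])
      fix i assume "i \<in> set [0..<?j]"
      then have "i < ?n" "skip ?j i = i" by (auto simp: skip_def)
      then show "(?\<sigma> i, ?g i) = (Suc (\<tau> i), ?h i)" using ins_perm_skip[of i ?n ?j \<tau>] at[of i] by simp
    qed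
    have L2: "?L2 = map (\<lambda>i. (Suc (\<tau> i), ?h i)) [?j..<?n]"
    proof -
      have "?L2 = map (\<lambda>i. (?\<sigma> (Suc i), ?g (Suc i))) [?j..<?n]"
        by (simp add: map_Suc_upt[symmetric] comp_def del: upt_Suc)
      also have "\<dots> = map (\<lambda>i. (Suc (\<tau> i), ?h i)) [?j..<?n]"
      proof (rule map_cong[OF refl])
        fix i assume "i \<in> set [?j..<?n]"
        then have "i < ?n" "skip ?j i = Suc i" by (auto simp: skip_def)
        then show "(?\<sigma> (Suc i), ?g (Suc i)) = (Suc (\<tau> i), ?h i)" using ins_perm_skip[of i ?n ?j \<tau>] at[of i] by simp
      qed
      finally show ?thesis .
    qed
    have "koszul (map (\<lambda>i. (?\<sigma> i, ?g i)) [0..<length ?V]) = koszul (?L1 @ (0, gdeg X v + 1) # ?L2)"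
      unfolding u by simp
    also have "\<dots> = koszul (?L1 @ ?L2) + (\<Sum>t\<leftarrow>?L1. snd t * (gdeg X v + 1))"
      by (rule koszul_insert) (unfold L1, auto)
    also have "?L1 @ ?L2 = map (\<lambda>i. (Suc (\<tau> i), ?h i)) [0..<?n]"
      unfolding L1 L2 map_append[symmetric] by (simp add: upt_add_eq_append[symmetric])
    also have "(\<Sum>t\<leftarrow>?L1. snd t * (gdeg X v + 1)) = (gdeg X v + 1) * bar_deg X us"
    proof -
      have h: "map ?h [0..<?j] = map (\<lambda>x. gdeg X x + 1) us" by (rule nth_equalityI) (simp_all add: nth_append)
      have "(\<Sum>t\<leftarrow>?L1. snd t * (gdeg X v + 1)) = (\<Sum>x\<leftarrow>map ?h [0..<?j]. x * (gdeg X v + 1))"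
        unfolding L1 by (simp add: comp_def)
      then show ?thesis unfolding h by (simp add: bar_deg_def sum_list_mult_const comp_def mult.commute)
    qed
    finally show ?thesis by (simp add: koszul_Suc)
  qed
  show ?thesis unfolding sw_term_def k w ev_scl ev_bv by (simp add: sgnp_add ac_simps)
qed

lemma shuffle_word_Nil: "shuffle_word X [] [] = bv []"
proof -
  have "shuffles_perm 0 0 = {id}" by (auto simp: shuffles_perm_def)
  then show ?thesis by (simp add: shuffle_word_alt sw_term_def)
qed

lemma shuffles_perm_0: "\<sigma> \<in> shuffles_perm p q \<Longrightarrow> 0 < p + q \<Longrightarrow> \<exists>j. \<sigma> j = 0 \<and> (j = 0 \<and> 0 < p \<or> j = p \<and> 0 < q)"
proof -
  assume s: "\<sigma> \<in> shuffles_perm p q" and n: "0 < p + q"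
  then have p: "\<sigma> permutes {..<p + q}" and m: "strict_mono_on {..<p} \<sigma>" "strict_mono_on {p..<p + q} \<sigma>"
    by (auto simp: shuffles_perm_def)
  define j where "j = inv_into UNIV \<sigma> 0"
  have j: "\<sigma> j = 0" "j < p + q"
    using permutes_inverses[OF p] permutes_in_image[OF permutes_inv[OF p], of 0] n by (auto simp: j_def)
  have "j = 0 \<or> j = p"
  proof (rule ccontr)
    assume "\<not> (j = 0 \<or> j = p)"
    then have "\<sigma> 0 < \<sigma> j \<or> \<sigma> p < \<sigma> j"
      using j strict_mono_onD[OF m(1), of 0 j] strict_mono_onD[OF m(2), of p j] by fastforce
    then show False using j by simp
  qed
  then show ?thesis using j by (intro exI[of _ j]) auto
qed

lemma ins_perm_shuffle_left:
  assumes "\<tau> permutes {..<p + q}"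
  shows "ins_perm (p + q) 0 \<tau> \<in> shuffles_perm (Suc p) q \<longleftrightarrow> \<tau> \<in> shuffles_perm p q"
proof -
  have s: "ins_perm (p + q) 0 \<tau> (Suc i) = Suc (\<tau> i)" if "i < p + q" for i
    using ins_perm_skip[OF that, of 0 \<tau>] by (simp add: skip_def)
  have "strict_mono_on {..<Suc p} (ins_perm (p + q) 0 \<tau>) \<longleftrightarrow> strict_mono_on {..<p} \<tau>"
  proof
    assume m: "strict_mono_on {..<Suc p} (ins_perm (p + q) 0 \<tau>)"
    show "strict_mono_on {..<p} \<tau>"
    proof (rule strict_mono_onI)
      fix x y assume xy: "x \<in> {..<p}" "y \<in> {..<p}" "x < y"
      then show "\<tau> x < \<tau> y" using strict_mono_onD[OF m, of "Suc x" "Suc y"] by (simp add: s)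
    qed
  next
    assume m: "strict_mono_on {..<p} \<tau>"
    show "strict_mono_on {..<Suc p} (ins_perm (p + q) 0 \<tau>)"
    proof (rule strict_mono_onI)
      fix x y assume xy: "x \<in> {..<Suc p}" "y \<in> {..<Suc p}" "x < y"
      then obtain y' where y': "y = Suc y'" by (cases y) auto
      show "ins_perm (p + q) 0 \<tau> x < ins_perm (p + q) 0 \<tau> y"
        using xy y' strict_mono_onD[OF m, of "x - 1" y'] by (cases x) (auto simp: s)
    qed
  qed
  moreover have "strict_mono_on {Suc p..<Suc p + q} (ins_perm (p + q) 0 \<tau>) \<longleftrightarrow> strict_mono_on {p..<p + q} \<tau>"
  proof
    assume m: "strict_mono_on {Suc p..<Suc p + q} (ins_perm (p + q) 0 \<tau>)"
    show "strict_mono_on {p..<p + q} \<tau>"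
    proof (rule strict_mono_onI)
      fix x y assume xy: "x \<in> {p..<p + q}" "y \<in> {p..<p + q}" "x < y"
      then show "\<tau> x < \<tau> y" using strict_mono_onD[OF m, of "Suc x" "Suc y"] by (simp add: s)
    qed
  next
    assume m: "strict_mono_on {p..<p + q} \<tau>"
    show "strict_mono_on {Suc p..<Suc p + q} (ins_perm (p + q) 0 \<tau>)"
    proof (rule strict_mono_onI)
      fix x y assume xy: "x \<in> {Suc p..<Suc p + q}" "y \<in> {Suc p..<Suc p + q}" "x < y"
      then obtain x' y' where y': "x = Suc x'" "y = Suc y'" by (cases x; cases y) auto
      show "ins_perm (p + q) 0 \<tau> x < ins_perm (p + q) 0 \<tau> y"
        using xy y' strict_mono_onD[OF m, of x' y'] by (auto simp: s)
    qed
  qed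
  ultimately show ?thesis using assms ins_perm_permutes[OF assms, of 0] by (simp add: shuffles_perm_def)
qed

lemma ins_perm_shuffle_right:
  assumes "\<tau> permutes {..<p + q}"
  shows "ins_perm (p + q) p \<tau> \<in> shuffles_perm p (Suc q) \<longleftrightarrow> \<tau> \<in> shuffles_perm p q"
proof -
  have s: "ins_perm (p + q) p \<tau> i = Suc (\<tau> i)" if "i < p" for i
    using ins_perm_skip[of i "p + q" p \<tau>] that by (simp add: skip_def)
  have s': "ins_perm (p + q) p \<tau> (Suc i) = Suc (\<tau> i)" if "p \<le> i" "i < p + q" for i
    using ins_perm_skip[of i "p + q" p \<tau>] that by (simp add: skip_def)
  have "strict_mono_on {..<p} (ins_perm (p + q) p \<tau>) \<longleftrightarrow> strict_mono_on {..<p} \<tau>"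
    by (auto simp: strict_mono_on_def s)
  moreover have "strict_mono_on {p..<p + Suc q} (ins_perm (p + q) p \<tau>) \<longleftrightarrow> strict_mono_on {p..<p + q} \<tau>"
  proof
    assume m: "strict_mono_on {p..<p + Suc q} (ins_perm (p + q) p \<tau>)"
    show "strict_mono_on {p..<p + q} \<tau>"
    proof (rule strict_mono_onI)
      fix x y assume xy: "x \<in> {p..<p + q}" "y \<in> {p..<p + q}" "x < y"
      then show "\<tau> x < \<tau> y" using strict_mono_onD[OF m, of "Suc x" "Suc y"] by (simp add: s')
    qed
  next
    assume m: "strict_mono_on {p..<p + q} \<tau>"
    show "strict_mono_on {p..<p + Suc q} (ins_perm (p + q) p \<tau>)"
    proof (rule strict_mono_onI)
      fix x y assume xy: "x \<in> {p..<p + Suc q}" "y \<in> {p..<p + Suc q}" "x < y"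
      then obtain y' where y': "y = Suc y'" by (cases y) auto
      show "ins_perm (p + q) p \<tau> x < ins_perm (p + q) p \<tau> y"
      proof (cases "x = p")
        case True
        then show ?thesis using xy y' by (simp add: s')
      next
        case False
        then obtain x' where "x = Suc x'" using xy by (cases x) auto
        then show ?thesis using False xy y' strict_mono_onD[OF m, of x' y'] by (auto simp: s')
      qed
    qed
  qed
  ultimately show ?thesis using assms ins_perm_permutes[OF assms, of p] by (simp add: shuffles_perm_def)
qed

lemma ins_perm_inj:
  assumes "\<tau> permutes {..<n}" "\<tau>' permutes {..<n}" "ins_perm n j \<tau> = ins_perm n j \<tau>'"
  shows "\<tau> = \<tau>'"
proof
  fix i show "\<tau> i = \<tau>' i"
  proof (cases "i < n")
    case True
    then show ?thesis using ins_perm_skip[OF True, of j \<tau>] ins_perm_skip[OF True, of j \<tau>'] assms(3) by simp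
  next
    case False
    then show ?thesis using assms permutes_not_in by (metis lessThan_iff)
  qed
qed

lemma sum_shuffles_ins:
  assumes j: "j \<le> n" and S: "\<And>\<tau>. \<tau> permutes {..<n} \<Longrightarrow> ins_perm n j \<tau> \<in> S \<longleftrightarrow> \<tau> \<in> S'"
    and S': "\<And>\<tau>. \<tau> \<in> S' \<Longrightarrow> \<tau> permutes {..<n}" and perm: "\<And>\<sigma>. \<sigma> \<in> S \<Longrightarrow> \<sigma> permutes {..<Suc n}"
  shows "(\<Sum>\<sigma>\<in>{\<sigma> \<in> S. \<sigma> j = 0}. f \<sigma>) = (\<Sum>\<tau>\<in>S'. f (ins_perm n j \<tau>))"
proof (rule sum.reindex_cong[of "ins_perm n j"])
  show "inj_on (ins_perm n j) S'" by (rule inj_onI) (use ins_perm_inj S' in blast)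
  show "{\<sigma> \<in> S. \<sigma> j = 0} = ins_perm n j ` S'"
  proof (intro equalityI subsetI)
    fix \<sigma> assume \<sigma>: "\<sigma> \<in> {\<sigma> \<in> S. \<sigma> j = 0}"
    then obtain \<tau> where "\<tau> permutes {..<n}" "\<sigma> = ins_perm n j \<tau>" using permutes_ins_perm[OF perm j] by blast
    then show "\<sigma> \<in> ins_perm n j ` S'" using \<sigma> S by blast
  next
    fix \<sigma> assume "\<sigma> \<in> ins_perm n j ` S'"
    then show "\<sigma> \<in> {\<sigma> \<in> S. \<sigma> j = 0}" using S S' by auto
  qed
qed simp

lemma finite_shuffles_perm: "finite (shuffles_perm p q)"
  by (rule finite_subset[OF _ finite_permutations[of "{..<p + q}"]]) (auto simp: shuffles_perm_def)

text \<open>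
  Shuffles are sorted by the word from which the first letter is taken.  This recursion replaces the
  sum over permutations in everything that follows.
\<close>

lemma ev_shuffle_word:
  assumes "xs \<noteq> [] \<or> ys \<noteq> []"
  shows "ev F (shuffle_word X xs ys) =
     (case xs of [] \<Rightarrow> 0 | x # xs' \<Rightarrow> ev (\<lambda>w. F (x # w)) (shuffle_word X xs' ys))
   + (case ys of [] \<Rightarrow> 0 | y # ys' \<Rightarrow> sgnp ((gdeg X y + 1) * bar_deg X xs) * ev (\<lambda>w. F (y # w)) (shuffle_word X xs ys'))"
proof -
  let ?p = "length xs" and ?q = "length ys"
  let ?S = "shuffles_perm ?p ?q" and ?f = "\<lambda>\<sigma>. ev F (sw_term X (xs @ ys) \<sigma>)"
  let ?A = "{\<sigma> \<in> ?S. \<sigma> 0 = 0 \<and> 0 < ?p}" and ?B = "{\<sigma> \<in> ?S. \<sigma> ?p = 0 \<and> 0 < ?q}"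
  have perm: "\<sigma> permutes {..<p + q}" if "\<sigma> \<in> shuffles_perm p q" for \<sigma> p q using that by (simp add: shuffles_perm_def)
  have "?S \<subseteq> ?A \<union> ?B"
  proof
    fix \<sigma> assume s: "\<sigma> \<in> ?S"
    obtain j where "\<sigma> j = 0" "j = 0 \<and> 0 < ?p \<or> j = ?p \<and> 0 < ?q" using shuffles_perm_0[OF s] assms by auto
    then show "\<sigma> \<in> ?A \<union> ?B" using s by auto
  qed
  then have "?S = ?A \<union> ?B" by auto
  moreover have "?A \<inter> ?B = {}"
  proof (rule equals0I)
    fix \<sigma> assume s: "\<sigma> \<in> ?A \<inter> ?B"
    then have "inj \<sigma>" using permutes_inj perm by blast
    then have "0 = ?p" using s by (intro injD[of \<sigma> 0 ?p]) auto
    then show False using s by auto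
  qed
  moreover have "finite ?A" "finite ?B" using finite_shuffles_perm[of ?p ?q] by auto
  ultimately have "sum ?f ?S = sum ?f ?A + sum ?f ?B" using sum.union_disjoint[of ?A ?B ?f] by simp
  then have "ev F (shuffle_word X xs ys) = sum ?f ?A + sum ?f ?B"
    unfolding shuffle_word_alt ev_sum .
  also have "sum ?f ?A = (case xs of [] \<Rightarrow> 0 | x # xs' \<Rightarrow> ev (\<lambda>w. F (x # w)) (shuffle_word X xs' ys))"
  proof (cases xs)
    case (Cons x xs')
    let ?n = "length xs' + ?q"
    have "sum ?f {\<sigma> \<in> ?S. \<sigma> 0 = 0} = (\<Sum>\<tau>\<in>shuffles_perm (length xs') ?q. ?f (ins_perm ?n 0 \<tau>))"
    proof (rule sum_shuffles_ins)
      show "\<sigma> permutes {..<Suc ?n}" if "\<sigma> \<in> ?S" for \<sigma> using perm[OF that] by (simp add: Cons)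
      show "ins_perm ?n 0 \<tau> \<in> ?S \<longleftrightarrow> \<tau> \<in> shuffles_perm (length xs') ?q" if "\<tau> permutes {..<?n}" for \<tau>
        using ins_perm_shuffle_left[OF that] by (simp add: Cons)
    qed (use perm in auto)
    also have "\<dots> = (\<Sum>\<tau>\<in>shuffles_perm (length xs') ?q. ev (\<lambda>w. F (x # w)) (sw_term X (xs' @ ys) \<tau>))"
    proof (rule sum.cong[OF refl])
      fix \<tau> assume "\<tau> \<in> shuffles_perm (length xs') ?q"
      then show "?f (ins_perm ?n 0 \<tau>) = ev (\<lambda>w. F (x # w)) (sw_term X (xs' @ ys) \<tau>)"
        using ev_sw_term_ins[of \<tau> "[]" "xs' @ ys" F X x] perm by (simp add: Cons bar_deg_def)
    qed
    finally show ?thesis by (simp add: Cons shuffle_word_alt ev_sum)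
  qed simp
  also have "sum ?f ?B = (case ys of [] \<Rightarrow> 0 | y # ys' \<Rightarrow> sgnp ((gdeg X y + 1) * bar_deg X xs) * ev (\<lambda>w. F (y # w)) (shuffle_word X xs ys'))"
  proof (cases ys)
    case (Cons y ys')
    let ?n = "?p + length ys'"
    have "sum ?f {\<sigma> \<in> ?S. \<sigma> ?p = 0} = (\<Sum>\<tau>\<in>shuffles_perm ?p (length ys'). ?f (ins_perm ?n ?p \<tau>))"
    proof (rule sum_shuffles_ins)
      show "\<sigma> permutes {..<Suc ?n}" if "\<sigma> \<in> ?S" for \<sigma> using perm[OF that] by (simp add: Cons)
      show "ins_perm ?n ?p \<tau> \<in> ?S \<longleftrightarrow> \<tau> \<in> shuffles_perm ?p (length ys')" if "\<tau> permutes {..<?n}" for \<tau>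
        using ins_perm_shuffle_right[OF that] by (simp add: Cons)
    qed (use perm in auto)
    also have "\<dots> = (\<Sum>\<tau>\<in>shuffles_perm ?p (length ys'). sgnp ((gdeg X y + 1) * bar_deg X xs) * ev (\<lambda>w. F (y # w)) (sw_term X (xs @ ys') \<tau>))"
    proof (rule sum.cong[OF refl])
      fix \<tau> assume "\<tau> \<in> shuffles_perm ?p (length ys')"
      then show "?f (ins_perm ?n ?p \<tau>) = sgnp ((gdeg X y + 1) * bar_deg X xs) * ev (\<lambda>w. F (y # w)) (sw_term X (xs @ ys') \<tau>)"
        using ev_sw_term_ins[of \<tau> xs ys' F X y] perm by (simp add: Cons)
    qed
    finally show ?thesis by (simp add: Cons shuffle_word_alt ev_sum sum_distrib_left)
  qed simp
  finally show ?thesis .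
qed


locale comparison_setting = cocommutative_setting C + finite_type_setting C
  for C :: "('b, 'k::comm_ring_1) free_dgc"
begin

section \<open>The shuffle diagonal\<close>

abbreviation "Sh \<equiv> shuffle_diag C"

lemma ev_Sh: "ev F (Sh a) = Ush True (map Some a) (\<lambda>l r. F (map the l, map the r))"
  by (simp add: Ush_Some comp_def case_prod_unfold)

lemma Sh_Nil [simp]: "ev F (Sh []) = F ([], [])"
  by (simp add: ev_Sh)

text \<open>
  The recursion of the shuffle diagonal in the first letter, dual to \<open>ev_shuffle_word\<close>.
\<close>

lemma Sh_Cons: "ev F (Sh (z # a)) = ev (\<lambda>(l, r). F (z # l, r) + sgnp ((gdeg C z - 1) * cd l) * F (l, z # r)) (Sh a)"
proof -
  have "Ush True (map Some a) (\<lambda>l r. sgnp ((gdeg C z - 1) * wd l) * F (map the l, z # map the r))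
    = Ush True (map Some a) (\<lambda>l r. sgnp ((gdeg C z - 1) * cd (map the l)) * F (map the l, z # map the r))"
  proof (rule Ush_cong)
    fix l r assume "un True (map Some a) l r"
    then have "map Some (map the l) = l" by (intro free_word) (simp add: un_def)
    then have "wd l = cd (map the l)" by (metis wd_map_Some)
    then show "sgnp ((gdeg C z - 1) * wd l) * F (map the l, z # map the r) = sgnp ((gdeg C z - 1) * cd (map the l)) * F (map the l, z # map the r)"
      by simp
  qed
  then show ?thesis by (simp add: ev_Sh Ush_lin)
qed

text \<open>
  What is true of every pair of words in the shuffle diagonal of \<open>a\<close>.  The last conjunct is the
  identity of Koszul exponents behind the multiplicativity of \<open>\<Phi>\<close>.
\<close>

definition shr :: "'b list \<Rightarrow> 'b list \<Rightarrow> 'b list \<Rightarrow> bool" where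
  "shr a l r \<longleftrightarrow> cd l + cd r = cd a \<and> (a \<in> lists Cb \<longleftrightarrow> l \<in> lists Cb \<and> r \<in> lists Cb)
     \<and> qx 0 a = qx 0 l + qx 0 r + cd l * cd r"

lemma qx_0: "qx d xs = qx 0 xs + d * cd xs"
  using qx_shift[of 0 d xs] by simp

lemma Sh_cong: "(\<And>l r. shr a l r \<Longrightarrow> F (l, r) = G (l, r)) \<Longrightarrow> ev F (Sh a) = ev G (Sh a)"
proof (induction a arbitrary: F G)
  case (Cons z a)
  show ?case unfolding Sh_Cons
  proof (rule Cons.IH, unfold prod.case, rule arg_cong2[of _ _ _ _ "(+)"])
    fix l r assume s: "shr a l r"
    then have a: "cd a = cd l + cd r" "qx 0 a = qx 0 l + qx 0 r + cd l * cd r" by (simp_all add: shr_def)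
    show "F (z # l, r) = G (z # l, r)"
      by (rule Cons.prems) (use s a in \<open>auto simp: shr_def qx_0[of "gdeg C z - 1"] algebra_simps\<close>)
    have "F (l, z # r) = G (l, z # r)"
      by (rule Cons.prems) (use s a in \<open>auto simp: shr_def qx_0[of "gdeg C z - 1"] algebra_simps\<close>)
    then show "sgnp ((gdeg C z - 1) * cd l) * F (l, z # r) = sgnp ((gdeg C z - 1) * cd l) * G (l, z # r)" by simp
  qed
qed (simp add: shr_def)

lemma Sh_swap: "ev (\<lambda>(l, r). F l r) (Sh a) = ev (\<lambda>(l, r). sgnp (cd l * cd r) * F r l) (Sh a)"
proof (induction a arbitrary: F)
  case (Cons z a)
  show ?case unfolding Sh_Cons prod.case
    by (subst Cons.IH) (simp add: sgn_norm)
qed simp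

lemma Sh_coassoc:
  "ev (\<lambda>(l, r). ev (\<lambda>(l1, l2). F l1 l2 r) (Sh l)) (Sh a) = ev (\<lambda>(l, r). ev (\<lambda>(r1, r2). F l r1 r2) (Sh r)) (Sh a)"
proof (induction a arbitrary: F)
  case (Cons z a)
  let ?e = "gdeg C z - 1"
  let ?G = "\<lambda>l1 l2 r. F (z # l1) l2 r + sgnp (?e * cd l1) * F l1 (z # l2) r + sgnp (?e * (cd l1 + cd l2)) * F l1 l2 (z # r)"
  have "ev (\<lambda>(l, r). ev (\<lambda>(l1, l2). F l1 l2 r) (Sh l)) (Sh (z # a)) = ev (\<lambda>(l, r). ev (\<lambda>(l1, l2). ?G l1 l2 r) (Sh l)) (Sh a)"
    unfolding Sh_Cons prod.case
  proof (intro ev_cong, clarify)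
    fix l r
    have "ev (\<lambda>(l1, l2). sgnp (?e * (cd l1 + cd l2)) * F l1 l2 (z # r)) (Sh l) = ev (\<lambda>(l1, l2). sgnp (?e * cd l) * F l1 l2 (z # r)) (Sh l)"
      by (rule Sh_cong) (simp add: shr_def)
    then show "ev (\<lambda>(l', ra). F (z # l') ra r + sgnp (?e * cd l') * F l' (z # ra) r) (Sh l) + sgnp (?e * cd l) * ev (\<lambda>(l1, l2). F l1 l2 (z # r)) (Sh l)
       = ev (\<lambda>(l1, l2). ?G l1 l2 r) (Sh l)"
      by (simp add: case_prod_unfold ev_fun_add ev_fun_mult)
  qed
  also have "\<dots> = ev (\<lambda>(l, r). ev (\<lambda>(r1, r2). ?G l r1 r2) (Sh r)) (Sh a)" by (rule Cons.IH)
  also have "\<dots> = ev (\<lambda>(l, r). ev (\<lambda>(r1, r2). F l r1 r2) (Sh r)) (Sh (z # a))"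
    unfolding Sh_Cons prod.case
    by (intro ev_cong) (auto simp: case_prod_unfold ev_fun_add ev_fun_mult sgnp_add distrib_left mult.assoc)
  finally show ?case .
qed simp

lemma Sh_counit: "ev (\<lambda>(l, r). if l = [] then F r else 0) (Sh a) = F a" "ev (\<lambda>(l, r). if r = [] then F l else 0) (Sh a) = F a"
  by (induction a arbitrary: F) (auto simp: Sh_Cons if_distrib[of "(*) _"] cong: if_cong)

lemma codiag_coassoc:
  assumes "c \<in> gens C"
  shows "ev (\<lambda>(x, y). ev (\<lambda>(x1, x2). F x1 x2 y) (codiag C x)) (codiag C c) = ev (\<lambda>(x, y). ev (\<lambda>(y1, y2). F x y1 y2) (codiag C y)) (codiag C c)"
  using arg_cong[OF coassoc[OF assms], of "ev (\<lambda>(x, y, z). F x y z)"] by (simp add: ev_lext case_prod_unfold)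

lemma codiag_swap:
  assumes "c \<in> gens C"
  shows "ev (\<lambda>(x, y). F x y) (codiag C c) = ev (\<lambda>(x, y). sgnp (gdeg C x * gdeg C y) * F y x) (codiag C c)"
proof -
  have "codiag C c = lext (\<lambda>(x, y). scl (sgnp (gdeg C x * gdeg C y)) (bv (y, x))) (codiag C c)"
    using cocomm assms by (simp add: cocommutative_def)
  then have "ev (\<lambda>(x, y). F x y) (codiag C c) = ev (\<lambda>(x, y). F x y) (lext (\<lambda>(x, y). scl (sgnp (gdeg C x * gdeg C y)) (bv (y, x))) (codiag C c))"
    by simp
  then show ?thesis by (simp add: ev_lin case_prod_unfold)
qed

lemma codiag_cong:
  assumes "c \<in> gens C" "\<And>x y. x \<in> gens C \<Longrightarrow> y \<in> gens C \<Longrightarrow> gdeg C x + gdeg C y = gdeg C c \<Longrightarrow> F (x, y) = G (x, y)"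
  shows "ev F (codiag C c) = ev G (codiag C c)"
proof (intro ev_cong, clarify)
  fix x y assume "(x, y) \<in> Poly_Mapping.keys (codiag C c)"
  from codiag_closed[OF assms(1) this] show "F (x, y) = G (x, y)" by (intro assms(2)) auto
qed

section \<open>The product on the dual of the twisted tensor product\<close>

lemma tmul_eq: "tmul g h (c, a) = ev (\<lambda>(x, y). ev (\<lambda>(l, r). sgnp (gdeg C y * cd l) *
    (sgnp ((gdeg C x + cd l) * (gdeg C y + cd r)) * (g (x, l) * h (y, r)))) (Sh a)) (codiag C c)"
  by (simp add: tmul_def Ush_Some comp_def case_prod_unfold)

lemma tmul_cong:
  assumes c: "c \<in> gens C" and a: "a \<in> lists Cb"
    and gh: "\<And>x l. x \<in> gens C \<Longrightarrow> l \<in> lists Cb \<Longrightarrow> g (x, l) = g' (x, l)" "\<And>x l. x \<in> gens C \<Longrightarrow> l \<in> lists Cb \<Longrightarrow> h (x, l) = h' (x, l)"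
  shows "tmul g h (c, a) = tmul g' h' (c, a)"
  unfolding tmul_eq by (intro codiag_cong[OF c], unfold prod.case, intro Sh_cong) (use a gh in \<open>auto simp: shr_def\<close>)

text \<open>
  Cocommutativity of both diagonals exchanges the factors; the sign of \<open>f \<otimes> g\<close> on a pair is thereby
  absorbed.
\<close>

lemma tmul_swap:
  assumes c: "c \<in> gens C"
  shows "tmul g h (c, a) = ev (\<lambda>(x, y). ev (\<lambda>(l, r). sgnp (gdeg C y * cd l) * (h (x, l) * g (y, r))) (Sh a)) (codiag C c)"
proof -
  have e: "sgnp (x * y) * (sgnp (l * r) * (sgnp (x * r) * (sgnp ((y + r) * (x + l)) * (g' * h')))) = sgnp (y * l) * (h' * g')" for x y l r :: int and g' h' :: 'k
    by (simp add: sgn_norm)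
  show ?thesis
    unfolding tmul_eq
    by (subst codiag_swap[OF c], subst Sh_swap) (simp only: case_prod_unfold ev_fun_mult[symmetric] e fst_conv snd_conv)
qed

lemma tmul_assoc:
  assumes c: "c \<in> gens C"
  shows "tmul (tmul f g) h (c, a) = tmul f (tmul g h) (c, a)"
proof -
  let ?F = "\<lambda>x1 x2 y l1 l2 r. sgnp (gdeg C y * (cd l1 + cd l2)) * (sgnp ((gdeg C x1 + gdeg C x2 + cd l1 + cd l2) * (gdeg C y + cd r))
      * (sgnp (gdeg C x2 * cd l1) * (sgnp ((gdeg C x1 + cd l1) * (gdeg C x2 + cd l2)) * (f (x1, l1) * (g (x2, l2) * h (y, r))))))"
  have "tmul (tmul f g) h (c, a) = ev (\<lambda>(x, y). ev (\<lambda>(l, r). ev (\<lambda>(x1, x2). ev (\<lambda>(l1, l2). ?F x1 x2 y l1 l2 r) (Sh l)) (codiag C x)) (Sh a)) (codiag C c)"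
    unfolding tmul_eq
  proof (intro codiag_cong[OF c], unfold prod.case, intro Sh_cong, unfold prod.case)
    fix x y l r assume x: "x \<in> gens C"
    have "ev (\<lambda>(x1, x2). ev (\<lambda>(l1, l2). ?F x1 x2 y l1 l2 r) (Sh l)) (codiag C x)
      = ev (\<lambda>(x1, x2). ev (\<lambda>(l1, l2). sgnp (gdeg C y * cd l) * (sgnp ((gdeg C x + cd l) * (gdeg C y + cd r)) * (h (y, r) *
         (sgnp (gdeg C x2 * cd l1) * (sgnp ((gdeg C x1 + cd l1) * (gdeg C x2 + cd l2)) * (f (x1, l1) * g (x2, l2))))))) (Sh l)) (codiag C x)"
    proof (intro codiag_cong[OF x], unfold prod.case, intro Sh_cong, unfold prod.case)
      fix x1 x2 l1 l2 assume xl: "gdeg C x1 + gdeg C x2 = gdeg C x" "shr l l1 l2"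
      have l: "cd l = cd l1 + cd l2" using xl by (simp add: shr_def)
      show "?F x1 x2 y l1 l2 r = sgnp (gdeg C y * cd l) * (sgnp ((gdeg C x + cd l) * (gdeg C y + cd r)) * (h (y, r) *
         (sgnp (gdeg C x2 * cd l1) * (sgnp ((gdeg C x1 + cd l1) * (gdeg C x2 + cd l2)) * (f (x1, l1) * g (x2, l2))))))"
        unfolding l xl(1)[symmetric] by (simp add: add.assoc mult.assoc mult.left_commute)
    qed
    then show "sgnp (gdeg C y * cd l) * (sgnp ((gdeg C x + cd l) * (gdeg C y + cd r)) *
         (ev (\<lambda>(x, y). ev (\<lambda>(l, r). sgnp (gdeg C y * cd l) * (sgnp ((gdeg C x + cd l) * (gdeg C y + cd r)) * (f (x, l) * g (y, r)))) (Sh l)) (codiag C x) * h (y, r)))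
      = ev (\<lambda>(x1, x2). ev (\<lambda>(l1, l2). ?F x1 x2 y l1 l2 r) (Sh l)) (codiag C x)"
      by (simp add: case_prod_unfold ev_fun_mult mult.commute)
  qed
  also have "\<dots> = ev (\<lambda>(x, y). ev (\<lambda>(x1, x2). ev (\<lambda>(l, r). ev (\<lambda>(l1, l2). ?F x1 x2 y l1 l2 r) (Sh l)) (Sh a)) (codiag C x)) (codiag C c)"
    unfolding case_prod_unfold by (subst ev_swap) (rule refl)
  also have "\<dots> = ev (\<lambda>(x1, y). ev (\<lambda>(x2, y). ev (\<lambda>(l, r). ev (\<lambda>(l1, l2). ?F x1 x2 y l1 l2 r) (Sh l)) (Sh a)) (codiag C y)) (codiag C c)"
    by (rule codiag_coassoc[OF c])
  also have "\<dots> = ev (\<lambda>(x1, y). ev (\<lambda>(x2, y). ev (\<lambda>(l1, r). ev (\<lambda>(l2, r). ?F x1 x2 y l1 l2 r) (Sh r)) (Sh a)) (codiag C y)) (codiag C c)"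
    unfolding Sh_coassoc ..
  also have "\<dots> = ev (\<lambda>(x1, y). ev (\<lambda>(l1, r). ev (\<lambda>(x2, y). ev (\<lambda>(l2, r). ?F x1 x2 y l1 l2 r) (Sh r)) (codiag C y)) (Sh a)) (codiag C c)"
    unfolding case_prod_unfold by (subst (2) ev_swap) (rule refl)
  also have "\<dots> = tmul f (tmul g h) (c, a)"
    unfolding tmul_eq
  proof (intro codiag_cong[OF c], unfold prod.case, intro Sh_cong, unfold prod.case)
    fix x y l r assume y: "y \<in> gens C"
    have "ev (\<lambda>(x2, y). ev (\<lambda>(l2, r). ?F x x2 y l l2 r) (Sh r)) (codiag C y)
      = ev (\<lambda>(x2, y'). ev (\<lambda>(l2, r'). sgnp (gdeg C y * cd l) * (sgnp ((gdeg C x + cd l) * (gdeg C y + cd r)) * (f (x, l) *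
         (sgnp (gdeg C y' * cd l2) * (sgnp ((gdeg C x2 + cd l2) * (gdeg C y' + cd r')) * (g (x2, l2) * h (y', r'))))))) (Sh r)) (codiag C y)"
    proof (intro codiag_cong[OF y], unfold prod.case, intro Sh_cong, unfold prod.case)
      fix x2 y' l2 r' assume xl: "gdeg C x2 + gdeg C y' = gdeg C y" "shr r l2 r'"
      have l: "cd r = cd l2 + cd r'" using xl by (simp add: shr_def)
      show "?F x x2 y' l l2 r' = sgnp (gdeg C y * cd l) * (sgnp ((gdeg C x + cd l) * (gdeg C y + cd r)) * (f (x, l) *
         (sgnp (gdeg C y' * cd l2) * (sgnp ((gdeg C x2 + cd l2) * (gdeg C y' + cd r')) * (g (x2, l2) * h (y', r'))))))"
        unfolding l xl(1)[symmetric] by (simp add: sgn_norm)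
    qed
    then show "ev (\<lambda>(x2, y). ev (\<lambda>(l2, r). ?F x x2 y l l2 r) (Sh r)) (codiag C y)
      = sgnp (gdeg C y * cd l) * (sgnp ((gdeg C x + cd l) * (gdeg C y + cd r)) *
         (f (x, l) * ev (\<lambda>(x, y). ev (\<lambda>(l, r). sgnp (gdeg C y * cd l) * (sgnp ((gdeg C x + cd l) * (gdeg C y + cd r)) * (g (x, l) * h (y, r)))) (Sh r)) (codiag C y)))"
      by (simp add: case_prod_unfold ev_fun_mult)
  qed
  finally show ?thesis .
qed

definition uT :: "'b \<times> 'b list \<Rightarrow> 'k" where
  "uT x = (if x = (one, []) then 1 else 0)"

lemma tmul_unit:
  assumes c: "c \<in> gens C"
  shows "tmul uT h (c, a) = h (c, a)" "tmul h uT (c, a) = h (c, a)"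
proof -
  have "tmul uT h (c, a) = ev (\<lambda>(x, y). if x = one then ev (\<lambda>(l, r). if l = [] then h (y, r) else 0) (Sh a) else 0) (codiag C c)"
    unfolding tmul_eq
  proof (unfold case_prod_unfold, rule ev_cong)
    fix p
    show "ev (\<lambda>q. sgnp (gdeg C (snd p) * cd (fst q)) * (sgnp ((gdeg C (fst p) + cd (fst q)) * (gdeg C (snd p) + cd (snd q))) * (uT (fst p, fst q) * h (snd p, snd q)))) (Sh a)
      = (if fst p = one then ev (\<lambda>q. if fst q = [] then h (snd p, snd q) else 0) (Sh a) else 0)"
    proof (cases "fst p = one")
      case True
      then show ?thesis using coaug_gen by (auto simp: uT_def intro!: ev_cong)
    qed (simp add: uT_def)
  qed
  then show "tmul uT h (c, a) = h (c, a)" by (simp add: Sh_counit ev_counit_left[OF c])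
  have "tmul h uT (c, a) = ev (\<lambda>(x, y). if y = one then ev (\<lambda>(l, r). if r = [] then h (x, l) else 0) (Sh a) else 0) (codiag C c)"
    unfolding tmul_eq
  proof (unfold case_prod_unfold, rule ev_cong)
    fix p
    show "ev (\<lambda>q. sgnp (gdeg C (snd p) * cd (fst q)) * (sgnp ((gdeg C (fst p) + cd (fst q)) * (gdeg C (snd p) + cd (snd q))) * (h (fst p, fst q) * uT (snd p, snd q)))) (Sh a)
      = (if snd p = one then ev (\<lambda>q. if snd q = [] then h (fst p, fst q) else 0) (Sh a) else 0)"
    proof (cases "snd p = one")
      case True
      then show ?thesis using coaug_gen by (auto simp: uT_def intro!: ev_cong)
    qed (simp add: uT_def)
  qed
  then show "tmul h uT (c, a) = h (c, a)" by (simp add: Sh_counit ev_counit_right[OF c])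
qed

section \<open>The comparison map is multiplicative\<close>

text \<open>
  The shuffle product and the shuffle diagonal are transposes of each other.
\<close>

lemma lk_shuffle_word: "lk (shuffle_word DA xs ys) zs = lk (Sh zs) (xs, ys)"
proof (induction zs arbitrary: xs ys)
  case Nil
  show ?case
  proof (cases "xs = [] \<and> ys = []")
    case True
    then show ?thesis by (simp add: shuffle_word_Nil lk_bv lookup_eq_ev[of "Sh []"])
  next
    case False
    then have "lk (shuffle_word DA xs ys) [] = 0"
      unfolding lookup_eq_ev by (subst ev_shuffle_word) (auto split: list.split)
    then show ?thesis using False by (auto simp: lookup_eq_ev[of "Sh []"])
  qed
next
  case (Cons z zs)
  have bd: "bar_deg DA us = - cd us" for us by (induction us) (simp_all add: bar_deg_def)
  have s: "sgnp ((1 - n) * - m) = (sgnp ((n - 1) * m) :: 'k)" "sgnp (- ((1 - n) * m)) = (sgnp ((n - 1) * m) :: 'k)" for n m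
    by (rule sgnp_cong, simp add: algebra_simps)+
  have hd: "ev (\<lambda>w. if x # w = z # zs then 1 else 0) p = (if x = z then lk p zs else 0)" for x and p :: "'b list \<Rightarrow>\<^sub>0 'k"
    by (auto simp: lookup_eq_ev)
  have L: "lk (shuffle_word DA xs ys) (z # zs)
    = (case xs of [] \<Rightarrow> 0 | x # xs' \<Rightarrow> if x = z then lk (shuffle_word DA xs' ys) zs else 0)
    + (case ys of [] \<Rightarrow> 0 | y # ys' \<Rightarrow> sgnp ((gdeg C y - 1) * cd xs) * (if y = z then lk (shuffle_word DA xs ys') zs else 0))"
  proof (cases "xs = [] \<and> ys = []")
    case True
    then show ?thesis by (simp add: shuffle_word_Nil lk_bv)
  next
    case False
    then show ?thesis unfolding lookup_eq_ev[of _ "z # zs"] ev_shuffle_word[of xs ys, OF False[unfolded de_Morgan_conj]] hd bd s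
      by (simp add: s bd split: list.split)
  qed
  have "lk (Sh (z # zs)) (xs, ys) = ev (\<lambda>p. (case xs of [] \<Rightarrow> 0 | x # xs' \<Rightarrow> (if x = z then 1 else 0) * (if p = (xs', ys) then 1 else 0))
      + (case ys of [] \<Rightarrow> 0 | y # ys' \<Rightarrow> sgnp ((gdeg C y - 1) * cd xs) * (if y = z then 1 else 0) * (if p = (xs, ys') then 1 else 0))) (Sh zs)"
    unfolding lookup_eq_ev Sh_Cons by (intro ev_cong) (auto split: list.split if_splits)
  also have "\<dots> = (case xs of [] \<Rightarrow> 0 | x # xs' \<Rightarrow> (if x = z then 1 else 0) * lk (Sh zs) (xs', ys))
      + (case ys of [] \<Rightarrow> 0 | y # ys' \<Rightarrow> sgnp ((gdeg C y - 1) * cd xs) * (if y = z then 1 else 0) * lk (Sh zs) (xs, ys'))"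
    unfolding ev_fun_add
    by (intro arg_cong2[of _ _ _ _ "(+)"]; cases xs; cases ys) (simp_all only: list.case ev_fun_mult ev_fun_0 lookup_eq_ev)
  also have "\<dots> = lk (shuffle_word DA xs ys) (z # zs)"
    unfolding L Cons.IH by (cases xs; cases ys) auto
  finally show ?case ..
qed

lemma ev_swap2: "ev (\<lambda>u. ev (\<lambda>v. ev (\<lambda>z. F u v z) p) S) D = ev (\<lambda>z. ev (\<lambda>u. ev (\<lambda>v. F u v z) S) D) p"
proof -
  have "ev (\<lambda>v. ev (\<lambda>z. F u v z) p) S = ev (\<lambda>z. ev (\<lambda>v. F u v z) S) p" for u by (rule ev_swap)
  then show ?thesis by (simp only:) (rule ev_swap)
qed

text \<open>
  Evaluates a product of two coefficient functions through a pair of diagonals by summing over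
  the entries of \<open>p\<close> and \<open>q\<close> instead.
\<close>

lemma lookup_exchange:
  fixes D :: "('u \<times> 'v) \<Rightarrow>\<^sub>0 'k" and S :: "('m \<times> 'n) \<Rightarrow>\<^sub>0 'k"
  shows "ev (\<lambda>(x, y). ev (\<lambda>(l, r). H x y l r * (lk p (x, l) * lk q (y, r))) S) D
    = ev (\<lambda>(x, l). ev (\<lambda>(y, r). H x y l r * (lk D (x, y) * lk S (l, r))) q) p"
proof -
  let ?\<delta> = "\<lambda>z z'. if z = z' then 1 else (0 :: 'k)"
  have prod: "a * (lk p u * lk q v) = ev (\<lambda>z. ev (\<lambda>w. a * (?\<delta> z u * ?\<delta> w v)) q) p" for a u v
  proof -
    have "ev (\<lambda>w. a * (?\<delta> z u * ?\<delta> w v)) q = (a * lk q v) * ?\<delta> z u" for z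
      unfolding lookup_eq_ev ev_fun_mult by (simp add: ac_simps)
    then show ?thesis by (simp only: ev_fun_mult lookup_eq_ev[of p]) (simp only: ac_simps)
  qed
  have "ev (\<lambda>(x, y). ev (\<lambda>(l, r). H x y l r * (lk p (x, l) * lk q (y, r))) S) D
     = ev (\<lambda>(x, y). ev (\<lambda>(l, r). ev (\<lambda>z. ev (\<lambda>w. H x y l r * (?\<delta> z (x, l) * ?\<delta> w (y, r))) q) p) S) D"
    unfolding prod ..
  also have "\<dots> = ev (\<lambda>z. ev (\<lambda>w. ev (\<lambda>(x, y). ev (\<lambda>(l, r). H x y l r * (?\<delta> z (x, l) * ?\<delta> w (y, r))) S) D) q) p"
    unfolding case_prod_unfold by (subst ev_swap2, subst ev_swap2) (rule refl)
  also have "\<dots> = ev (\<lambda>(x, l). ev (\<lambda>(y, r). H x y l r * (lk D (x, y) * lk S (l, r))) q) p"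
  proof (intro ev_cong, clarify, intro ev_cong, clarify)
    fix x l y r
    have "ev (\<lambda>(x', y'). ev (\<lambda>(l', r'). H x' y' l' r' * (?\<delta> (x, l) (x', l') * ?\<delta> (y, r) (y', r'))) S) D
      = ev (\<lambda>z. (H x y l r * lk S (l, r)) * ?\<delta> z (x, y)) D"
    proof (intro ev_cong, clarify)
      fix x' y'
      have "ev (\<lambda>(l', r'). H x' y' l' r' * (?\<delta> (x, l) (x', l') * ?\<delta> (y, r) (y', r'))) S
        = ev (\<lambda>w. (H x y l r * ?\<delta> (x', y') (x, y)) * ?\<delta> w (l, r)) S"
        by (intro ev_cong) (auto split: if_splits)
      then show "ev (\<lambda>(l', r'). H x' y' l' r' * (?\<delta> (x, l) (x', l') * ?\<delta> (y, r) (y', r'))) S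
         = H x y l r * lk S (l, r) * ?\<delta> (x', y') (x, y)"
        by (simp only: ev_fun_mult lookup_eq_ev[of S]) simp
    qed
    then show "ev (\<lambda>(x', y'). ev (\<lambda>(l', r'). H x' y' l' r' * (?\<delta> (x, l) (x', l') * ?\<delta> (y, r) (y', r'))) S) D
      = H x y l r * (lk D (x, y) * lk S (l, r))"
      by (simp only: ev_fun_mult lookup_eq_ev[of D, symmetric]) simp
  qed
  finally show ?thesis .
qed

text \<open>
  Both products have the same structure constants, as the product of \<open>C\<^sup>\<or>\<close> is the transpose of the
  diagonal of \<open>C\<close>, and the signs agree by \<open>shr\<close>.
\<close>

theorem PhiTheta_mult:
  assumes c: "c \<in> gens C"
  shows "PhiTheta C (shuffle_mult DA p q) (c, cs) = tmul (PhiTheta C p) (PhiTheta C q) (c, cs)"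
proof -
  have bd: "bar_deg DA us = - cd us" for us by (induction us) (simp_all add: bar_deg_def)
  have "PhiTheta C (shuffle_mult DA p q) (c, cs)
     = ev (\<lambda>(x, l). ev (\<lambda>(y, r). (eT (c, cs) * (sgnp (gdeg C y * cd l) * sgnp (gdeg C y * gdeg C x))) * (lk (codiag C c) (x, y) * lk (Sh cs) (l, r))) q) p"
  proof -
    have "lk (amul DA x y) c = sgnp (gdeg C y * gdeg C x) * lk (codiag C c) (x, y)" for x y
      using lk_codiag[OF c, of x y] c by (cases "lk (codiag C c) (x, y) = 0") (auto simp: lk_amul_DA)
    then show ?thesis
      unfolding PhiTheta_eq shuffle_mult_def lookup_lext ev_tens case_prod_unfold
      by (simp add: bd lookup_tens lk_shuffle_word ev_fun_mult[symmetric] mult.commute mult.left_commute)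
  qed
  also have "\<dots> = ev (\<lambda>(x, y). ev (\<lambda>(l, r). (eT (c, cs) * (sgnp (gdeg C y * cd l) * sgnp (gdeg C y * gdeg C x))) * (lk p (x, l) * lk q (y, r))) (Sh cs)) (codiag C c)"
    by (rule lookup_exchange[symmetric])
  also have "\<dots> = tmul (PhiTheta C p) (PhiTheta C q) (c, cs)"
    unfolding tmul_eq
  proof (intro codiag_cong[OF c], unfold prod.case, intro Sh_cong, unfold prod.case)
    fix x y l r assume xy: "gdeg C x + gdeg C y = gdeg C c" and s: "shr cs l r"
    have cs: "cd cs = cd l + cd r" "qx 0 cs = qx 0 l + qx 0 r + cd l * cd r" using s by (simp_all add: shr_def)
    show "eT (c, cs) * (sgnp (gdeg C y * cd l) * sgnp (gdeg C y * gdeg C x)) * (lk p (x, l) * lk q (y, r))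
      = sgnp (gdeg C y * cd l) * (sgnp ((gdeg C x + cd l) * (gdeg C y + cd r)) * (PhiTheta C p (x, l) * PhiTheta C q (y, r)))"
      unfolding PhiTheta_eq eT_simp qx_0[of "gdeg C x + gdeg C y"] qx_0[of "gdeg C x"] qx_0[of "gdeg C y"] cs xy[symmetric] by (simp add: sgn_norm)
  qed
  finally show ?thesis .
qed

end


section \<open>Algebras up to homology\<close>

text \<open>
  The complexes below are graded modules whose addition is that of the type; \<open>homologous\<close> makes the
  algebra on classes a calculus of congruences on cycles.
\<close>

definition boundaries :: "('k, 'm::ab_group_add) dgmod \<Rightarrow> 'm set" where
  "boundaries M = dgdif M ` dgcar M"

definition homologous :: "('k, 'm::ab_group_add) dgmod \<Rightarrow> 'm \<Rightarrow> 'm \<Rightarrow> bool" where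
  "homologous M x y \<longleftrightarrow> x - y \<in> boundaries M"

text \<open>
  A complex that is the direct sum of its homogeneous parts, with the projections \<open>pr\<close> as part of the
  data.
\<close>

locale graded_complex =
  fixes M :: "('k::comm_ring_1, 'm::ab_group_add) dgmod" and pr :: "int \<Rightarrow> 'm \<Rightarrow> 'm"
  assumes car_0: "0 \<in> dgcar M"
    and car_add: "x \<in> dgcar M \<Longrightarrow> y \<in> dgcar M \<Longrightarrow> x + y \<in> dgcar M"
    and car_scl: "x \<in> dgcar M \<Longrightarrow> dgscl M a x \<in> dgcar M"
    and scl_1: "dgscl M 1 x = x"
    and scl_scl: "dgscl M a (dgscl M b x) = dgscl M (a * b) x"
    and scl_add_left: "dgscl M (a + b) x = dgscl M a x + dgscl M b x"
    and scl_add_right: "dgscl M a (x + y) = dgscl M a x + dgscl M a y"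
    and dif_car: "x \<in> dgcar M \<Longrightarrow> dgdif M x \<in> dgcar M"
    and dif_add: "dgdif M (x + y) = dgdif M x + dgdif M y"
    and dif_scl: "dgdif M (dgscl M a x) = dgscl M a (dgdif M x)"
    and dif_dif: "x \<in> dgcar M \<Longrightarrow> dgdif M (dgdif M x) = 0"
    and comp_0: "0 \<in> dgcomp M n"
    and comp_add: "x \<in> dgcomp M n \<Longrightarrow> y \<in> dgcomp M n \<Longrightarrow> x + y \<in> dgcomp M n"
    and comp_scl: "x \<in> dgcomp M n \<Longrightarrow> dgscl M a x \<in> dgcomp M n"
    and comp_car: "x \<in> dgcomp M n \<Longrightarrow> x \<in> dgcar M"
    and pr_comp: "x \<in> dgcar M \<Longrightarrow> pr n x \<in> dgcomp M n"
    and pr_finite: "x \<in> dgcar M \<Longrightarrow> finite {n. pr n x \<noteq> 0}"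
    and pr_sum: "x \<in> dgcar M \<Longrightarrow> (\<Sum>n | pr n x \<noteq> 0. pr n x) = x"
    and pr_add: "pr n (x + y) = pr n x + pr n y"
    and pr_same: "x \<in> dgcomp M n \<Longrightarrow> pr n x = x"
    and pr_other: "x \<in> dgcomp M m \<Longrightarrow> m \<noteq> n \<Longrightarrow> pr n x = 0"
    and pr_dif: "x \<in> dgcar M \<Longrightarrow> pr n (dgdif M x) = dgdif M (pr (n + 1) x)"
begin

abbreviation "cycles \<equiv> dgcycles M"

lemma scl_0 [simp]: "dgscl M 0 x = 0" using scl_add_left[of 0 0 x] by simp
lemma scl_m1: "dgscl M (-1) x = - x" using scl_add_left[of "-1" 1 x] scl_1[of x] by (simp add: eq_neg_iff_add_eq_0)
lemma scl_zero [simp]: "dgscl M a 0 = 0" using scl_add_right[of a 0 0] by simp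
lemma scl_uminus: "dgscl M a (- x) = - dgscl M a x"
  using scl_add_right[of a "- x" x] by (simp add: eq_neg_iff_add_eq_0)
lemma scl_diff: "dgscl M a (x - y) = dgscl M a x - dgscl M a y"
  using scl_add_right[of a x "- y"] by (simp add: scl_uminus)
lemma car_uminus: "x \<in> dgcar M \<Longrightarrow> - x \<in> dgcar M" using car_scl[of x "-1"] by (simp add: scl_m1)
lemma comp_uminus: "x \<in> dgcomp M n \<Longrightarrow> - x \<in> dgcomp M n" using comp_scl[of x n "-1"] by (simp add: scl_m1)
lemma dif_0 [simp]: "dgdif M 0 = 0" using dif_add[of 0 0] by simp
lemma dif_uminus: "dgdif M (- x) = - dgdif M x" using dif_add[of "- x" x] by (simp add: eq_neg_iff_add_eq_0)
lemma pr_0 [simp]: "pr n 0 = 0" using pr_add[of n 0 0] by simp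
lemma pr_uminus: "pr n (- x) = - pr n x" using pr_add[of n "- x" x] by (simp add: eq_neg_iff_add_eq_0)
lemma pr_diff: "pr n (x - y) = pr n x - pr n y" using pr_add[of n x "- y"] by (simp add: pr_uminus)
lemma pr_setsum: "pr n (sum f A) = (\<Sum>i\<in>A. pr n (f i))"
  by (induction A rule: infinite_finite_induct) (simp_all add: pr_add)

lemma bd_0: "0 \<in> boundaries M" unfolding boundaries_def using car_0 by (intro image_eqI[of _ _ 0]) auto
lemma bd_add: "x \<in> boundaries M \<Longrightarrow> y \<in> boundaries M \<Longrightarrow> x + y \<in> boundaries M"
  unfolding boundaries_def using car_add by (auto simp: dif_add[symmetric])
lemma bd_scl: "x \<in> boundaries M \<Longrightarrow> dgscl M a x \<in> boundaries M"
  unfolding boundaries_def using car_scl by (auto simp: dif_scl[symmetric])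
lemma bd_uminus: "x \<in> boundaries M \<Longrightarrow> - x \<in> boundaries M" using bd_scl[of x "-1"] by (simp add: scl_m1)
lemma bd_cycle: "x \<in> boundaries M \<Longrightarrow> x \<in> cycles"
  by (auto simp: boundaries_def dgcycles_def dif_car dif_dif)
lemma bd_pr: "x \<in> boundaries M \<Longrightarrow> pr n x \<in> boundaries M"
  unfolding boundaries_def by (auto simp: pr_dif intro!: imageI comp_car pr_comp)

lemma cyc_car: "x \<in> cycles \<Longrightarrow> x \<in> dgcar M" by (simp add: dgcycles_def)
lemma cyc_0: "0 \<in> cycles" by (simp add: dgcycles_def car_0)
lemma cyc_add: "x \<in> cycles \<Longrightarrow> y \<in> cycles \<Longrightarrow> x + y \<in> cycles" by (simp add: dgcycles_def car_add dif_add)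
lemma cyc_scl: "x \<in> cycles \<Longrightarrow> dgscl M a x \<in> cycles" by (simp add: dgcycles_def car_scl dif_scl)
lemma cyc_uminus: "x \<in> cycles \<Longrightarrow> - x \<in> cycles" by (simp add: dgcycles_def car_uminus dif_uminus)
lemma cyc_diff: "x \<in> cycles \<Longrightarrow> y \<in> cycles \<Longrightarrow> x - y \<in> cycles" using cyc_add[of x "- y"] cyc_uminus by simp
lemma cyc_pr: "x \<in> cycles \<Longrightarrow> pr n x \<in> cycles"
  using pr_dif[of x "n - 1"] by (simp add: dgcycles_def comp_car[OF pr_comp])
abbreviation "heq \<equiv> homologous M"

lemma heq_refl [simp]: "heq x x" by (simp add: homologous_def bd_0)
lemma heq_sym: "heq x y \<Longrightarrow> heq y x" unfolding homologous_def using bd_uminus by fastforce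
lemma heq_trans: "heq x y \<Longrightarrow> heq y z \<Longrightarrow> heq x z" unfolding homologous_def using bd_add[of "x - y" "y - z"] by simp
lemma heq_add: "heq x x' \<Longrightarrow> heq y y' \<Longrightarrow> heq (x + y) (x' + y')"
  unfolding homologous_def using bd_add[of "x - x'" "y - y'"] by (simp add: algebra_simps)
lemma heq_scl: "heq x x' \<Longrightarrow> heq (dgscl M a x) (dgscl M a x')"
  unfolding homologous_def using bd_scl[of "x - x'" a] by (simp add: scl_diff)
lemma heq_pr: "heq x x' \<Longrightarrow> heq (pr n x) (pr n x')"
  unfolding homologous_def using bd_pr[of "x - x'" n] by (simp add: pr_diff)
lemma heq_cyc: "heq x y \<Longrightarrow> y \<in> cycles \<Longrightarrow> x \<in> cycles"
  unfolding homologous_def using cyc_add[of "x - y" y] bd_cycle by simp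
lemma heq_sum: "(\<And>i. i \<in> A \<Longrightarrow> heq (f i) (g i)) \<Longrightarrow> heq (sum f A) (sum g A)"
  by (induction A rule: infinite_finite_induct) (simp_all add: heq_add)

abbreviation "cls \<equiv> hclass M"

lemma cls_mem: "y \<in> cls x \<longleftrightarrow> heq y x"
  unfolding hclass_def homologous_def boundaries_def[symmetric] by (force simp: algebra_simps)

lemma cls_eq [simp]: "cls x = cls y \<longleftrightarrow> heq x y"
proof
  show "cls x = cls y \<Longrightarrow> heq x y" using cls_mem[of x x] by (simp add: cls_mem)
  show "heq x y \<Longrightarrow> cls x = cls y"
    by (rule Set.set_eqI, unfold cls_mem) (blast intro: heq_trans heq_sym)
qed

text \<open>
  The operations on classes in \<^const>\<open>homology_algebra\<close> are unions over representatives.  If all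
  representatives give the same class, the union is that class.
\<close>

lemma cls_induced:
  assumes "\<And>x'. heq x' x \<Longrightarrow> f x' = S"
  shows "(\<Union>x'\<in>cls x. f x') = S"
proof -
  have "(\<Union>x'\<in>cls x. f x') = (\<Union>x'\<in>cls x. S)" using assms by (auto simp: cls_mem)
  moreover have "x \<in> cls x" by (simp add: cls_mem)
  ultimately show ?thesis by (metis UN_constant emptyE)
qed

end

text \<open>
  A product of cycles for which all axioms of a commutative graded algebra hold up to boundaries.
  Stating the axioms only up to boundaries lets the structure be pulled back along a
  quasi-isomorphism.
\<close>

locale homology_product = graded_complex M pr
  for M :: "('k::comm_ring_1, 'm::ab_group_add) dgmod" and pr :: "int \<Rightarrow> 'm \<Rightarrow> 'm" +
  fixes m :: "'m \<Rightarrow> 'm \<Rightarrow> 'm" and e :: 'm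
  assumes m_cyc: "x \<in> cycles \<Longrightarrow> y \<in> cycles \<Longrightarrow> m x y \<in> cycles"
    and m_cong: "x \<in> cycles \<Longrightarrow> x' \<in> cycles \<Longrightarrow> y \<in> cycles \<Longrightarrow> y' \<in> cycles \<Longrightarrow> heq x x' \<Longrightarrow> heq y y'
      \<Longrightarrow> heq (m x y) (m x' y')"
    and m_assoc: "x \<in> cycles \<Longrightarrow> y \<in> cycles \<Longrightarrow> z \<in> cycles \<Longrightarrow> heq (m (m x y) z) (m x (m y z))"
    and m_distl: "x \<in> cycles \<Longrightarrow> y \<in> cycles \<Longrightarrow> z \<in> cycles \<Longrightarrow> heq (m (x + y) z) (m x z + m y z)"
    and m_distr: "x \<in> cycles \<Longrightarrow> y \<in> cycles \<Longrightarrow> z \<in> cycles \<Longrightarrow> heq (m z (x + y)) (m z x + m z y)"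
    and m_scll: "x \<in> cycles \<Longrightarrow> y \<in> cycles \<Longrightarrow> heq (m (dgscl M a x) y) (dgscl M a (m x y))"
    and m_sclr: "x \<in> cycles \<Longrightarrow> y \<in> cycles \<Longrightarrow> heq (m x (dgscl M a y)) (dgscl M a (m x y))"
    and e_cyc: "e \<in> cycles"
    and e_comp: "e \<in> dgcomp M 0"
    and m_el: "x \<in> cycles \<Longrightarrow> heq (m e x) x"
    and m_er: "x \<in> cycles \<Longrightarrow> heq (m x e) x"
    and m_comp: "x \<in> cycles \<Longrightarrow> y \<in> cycles \<Longrightarrow> x \<in> dgcomp M i \<Longrightarrow> y \<in> dgcomp M j \<Longrightarrow> m x y \<in> dgcomp M (i + j)"
    and m_comm: "x \<in> cycles \<Longrightarrow> y \<in> cycles \<Longrightarrow> x \<in> dgcomp M i \<Longrightarrow> y \<in> dgcomp M j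
      \<Longrightarrow> heq (m x y) (dgscl M (sgnp (i * j)) (m y x))"
begin

abbreviation "H \<equiv> homology_algebra M m e"

lemma H_car: "carrier H = cls ` cycles" by (simp add: homology_algebra_def homology_def)
lemma H_grade: "hgrade H n = cls ` (cycles \<inter> dgcomp M n)" by (simp add: homology_algebra_def)
lemma H_zero: "\<zero>\<^bsub>H\<^esub> = cls 0" by (simp add: homology_algebra_def)
lemma H_one: "\<one>\<^bsub>H\<^esub> = cls e" by (simp add: homology_algebra_def)

lemma H_add: "cls x \<oplus>\<^bsub>H\<^esub> cls y = cls (x + y)"
proof -
  have "cls x \<oplus>\<^bsub>H\<^esub> cls y = (\<Union>x'\<in>cls x. \<Union>y'\<in>cls y. cls (x' + y'))" by (simp add: homology_algebra_def)
  also have "\<dots> = cls (x + y)" by (intro cls_induced) (simp add: heq_add)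
  finally show ?thesis .
qed

lemma H_mult: "x \<in> cycles \<Longrightarrow> y \<in> cycles \<Longrightarrow> cls x \<otimes>\<^bsub>H\<^esub> cls y = cls (m x y)"
proof -
  assume xy: "x \<in> cycles" "y \<in> cycles"
  have "cls x \<otimes>\<^bsub>H\<^esub> cls y = (\<Union>x'\<in>cls x. \<Union>y'\<in>cls y. cls (m x' y'))" by (simp add: homology_algebra_def)
  also have "\<dots> = cls (m x y)"
  proof (intro cls_induced)
    fix x' y' assume "heq x' x" "heq y' y"
    then show "cls (m x' y') = cls (m x y)" using xy heq_cyc[of x' x] heq_cyc[of y' y] by (simp add: m_cong)
  qed
  finally show ?thesis .
qed

lemma H_scl: "a \<odot>\<^bsub>H\<^esub> cls x = cls (dgscl M a x)"
proof -
  have "a \<odot>\<^bsub>H\<^esub> cls x = (\<Union>x'\<in>cls x. cls (dgscl M a x'))" by (simp add: homology_algebra_def)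
  also have "\<dots> = cls (dgscl M a x)" by (intro cls_induced) (simp add: heq_scl)
  finally show ?thesis .
qed

lemmas H_simps = H_car H_zero H_one H_add H_mult H_scl

lemma H_abelian_group: "abelian_group H"
proof (rule abelian_groupI)
  fix x assume "x \<in> carrier H"
  then obtain z where z: "z \<in> cycles" "x = cls z" by (auto simp: H_car)
  then show "\<exists>y\<in>carrier H. y \<oplus>\<^bsub>H\<^esub> x = \<zero>\<^bsub>H\<^esub>"
    by (intro bexI[of _ "cls (- z)"]) (auto simp: H_simps cyc_uminus intro!: imageI)
qed (auto simp: H_simps cyc_add cyc_0 ac_simps simp del: cls_eq)

lemma H_monoid: "monoid H"
  by (rule monoidI) (auto simp: H_simps m_cyc e_cyc m_assoc m_el m_er intro!: imageI del: equalityI)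

lemma H_ring: "ring H"
proof (rule ringI[OF H_abelian_group H_monoid])
qed (auto simp: H_simps m_cyc cyc_add m_distl m_distr del: equalityI)

lemma H_module: "module (cring_class_ops :: 'k ring) H"
  by (rule moduleI[OF cring_class H_abelian_group])
    (auto simp: H_simps cyc_scl class_simps scl_add_left scl_add_right scl_scl scl_1)

lemma H_finsum: "finite A \<Longrightarrow> (\<And>n. n \<in> A \<Longrightarrow> w n \<in> cycles) \<Longrightarrow> finsum H (\<lambda>n. cls (w n)) A = cls (sum w A)"
proof -
  interpret abelian_group H by (rule H_abelian_group)
  show "finite A \<Longrightarrow> (\<And>n. n \<in> A \<Longrightarrow> w n \<in> cycles) \<Longrightarrow> finsum H (\<lambda>n. cls (w n)) A = cls (sum w A)"
  proof (induction A rule: finite_induct)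
    case (insert i A)
    have "finsum H (\<lambda>n. cls (w n)) (insert i A) = cls (w i) \<oplus>\<^bsub>H\<^esub> finsum H (\<lambda>n. cls (w n)) A"
      by (rule finsum_insert) (use insert in \<open>auto simp: H_car\<close>)
    then show ?case using insert by (simp add: H_add)
  qed (simp add: finsum_empty H_zero)
qed

text \<open>
  The homogeneous components of a class are the classes of the projections of a representative,
  because the projections map boundaries to boundaries.
\<close>

lemma H_decomposition:
  assumes "x \<in> carrier H"
  shows "\<exists>!c. (\<forall>n. c n \<in> hgrade H n) \<and> finite {n. c n \<noteq> \<zero>\<^bsub>H\<^esub>} \<and> x = finsum H c {n. c n \<noteq> \<zero>\<^bsub>H\<^esub>}"
proof -
  obtain z where z: "z \<in> cycles" "x = cls z" using assms by (auto simp: H_car)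
  show ?thesis
  proof (rule ex1I[of _ "\<lambda>n. cls (pr n z)"], intro conjI allI)
    let ?A = "{n. cls (pr n z) \<noteq> \<zero>\<^bsub>H\<^esub>}"
    have A: "?A \<subseteq> {n. pr n z \<noteq> 0}" by (auto simp: H_zero)
    have fin: "finite {n. pr n z \<noteq> 0}" by (rule pr_finite[OF cyc_car[OF z(1)]])
    show "finite ?A" using A fin by (rule finite_subset)
    show "cls (pr n z) \<in> hgrade H n" for n using z cyc_pr pr_comp cyc_car by (auto simp: H_grade)
    have "heq z (sum (\<lambda>n. pr n z) ?A)"
    proof -
      have "z = (\<Sum>n\<in>{n. pr n z \<noteq> 0} - ?A. pr n z) + (\<Sum>n\<in>?A. pr n z)"
        using sum.subset_diff[OF A fin, of "\<lambda>n. pr n z"] pr_sum[OF cyc_car[OF z(1)]] by simp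
      moreover have "heq (\<Sum>n\<in>{n. pr n z \<noteq> 0} - ?A. pr n z) (\<Sum>n\<in>{n. pr n z \<noteq> 0} - ?A. 0)"
        by (rule heq_sum) (auto simp: H_zero)
      ultimately show ?thesis
        using heq_add[of "\<Sum>n\<in>{n. pr n z \<noteq> 0} - ?A. pr n z" 0 "\<Sum>n\<in>?A. pr n z" "\<Sum>n\<in>?A. pr n z"] by simp
    qed
    then show "x = finsum H (\<lambda>n. cls (pr n z)) ?A"
      using H_finsum[OF \<open>finite ?A\<close>, of "\<lambda>n. pr n z"] z cyc_pr by simp
  next
    fix c assume c: "(\<forall>n. c n \<in> hgrade H n) \<and> finite {n. c n \<noteq> \<zero>\<^bsub>H\<^esub>} \<and> x = finsum H c {n. c n \<noteq> \<zero>\<^bsub>H\<^esub>}"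
    let ?A = "{n. c n \<noteq> \<zero>\<^bsub>H\<^esub>}"
    have "\<forall>n. \<exists>w. w \<in> cycles \<and> w \<in> dgcomp M n \<and> c n = cls w" using c by (auto simp: H_grade)
    then obtain w where w: "\<And>n. w n \<in> cycles" "\<And>n. w n \<in> dgcomp M n" "c = (\<lambda>n. cls (w n))"
      by (metis ext)
    have "cls z = cls (sum w ?A)" using c z H_finsum[of ?A w] w by metis
    then have hz: "heq (pr k z) (pr k (sum w ?A))" for k by (intro heq_pr) simp
    have "c k = cls (pr k z)" for k
    proof (cases "k \<in> ?A")
      case True
      have "pr k (sum w ?A) = (\<Sum>n\<in>?A. if k = n then w k else 0)"
        unfolding pr_setsum by (rule sum.cong) (auto simp: pr_same[OF w(2)] pr_other[OF w(2)])
      also have "\<dots> = w k" using True c by (subst sum.delta') auto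
      finally show ?thesis using hz[of k] heq_sym w(3) by simp
    next
      case False
      have "pr k (sum w ?A) = (\<Sum>n\<in>?A. 0)"
        unfolding pr_setsum
      proof (rule sum.cong[OF refl])
        fix n assume "n \<in> ?A"
        then have "n \<noteq> k" using False by blast
        then show "pr k (w n) = 0" by (rule pr_other[OF w(2)])
      qed
      then show ?thesis using hz[of k] False heq_sym by (simp add: H_zero)
    qed
    then show "c = (\<lambda>n. cls (pr n z))" by (rule ext)
  qed
qed

theorem homology_commutative_graded_algebra: "commutative_graded_algebra H"
proof -
  interpret G: abelian_group H by (rule H_abelian_group)
  have neg: "\<ominus>\<^bsub>H\<^esub> cls x = cls (- x)" if "x \<in> cycles" for x
    using that by (intro G.minus_equality) (auto simp: H_simps cyc_uminus intro!: imageI)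
  have "submodule (hgrade H n) (cring_class_ops :: 'k ring) H" for n
    by (rule module.submoduleI[OF H_module])
      (auto simp: H_grade H_simps neg cyc_0 cyc_add cyc_scl cyc_uminus comp_0 comp_add comp_scl comp_uminus intro!: imageI)
  then show ?thesis
    unfolding commutative_graded_algebra_def
    using H_ring H_module H_decomposition
    by (auto simp: H_grade H_simps m_scll m_sclr cyc_scl m_cyc e_cyc e_comp m_comp m_comm intro!: imageI)
qed

end

lemma (in graded_complex) homology_map_cls:
  assumes N: "graded_complex N prN" and \<phi>: "chain_map M N \<phi>" and z: "z \<in> dgcar M"
  shows "homology_map M N \<phi> (cls z) = hclass N (\<phi> z)"
proof -
  interpret N: graded_complex N prN by (rule N)
  show ?thesis unfolding homology_map_def
  proof (rule cls_induced)
    fix x assume "heq x z"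
    then obtain b where b: "b \<in> dgcar M" "x = z + dgdif M b"
      unfolding homologous_def boundaries_def by (auto simp: algebra_simps)
    have "\<phi> x = \<phi> z + dgdif N (\<phi> b)" "\<phi> b \<in> dgcar N"
      using \<phi> b z dif_car unfolding chain_map_def by auto
    then show "hclass N (\<phi> x) = hclass N (\<phi> z)"
      by (simp add: homologous_def boundaries_def)
  qed
qed

text \<open>
  A chain map that is bijective in homology and multiplicative on cycles pulls the algebra axioms
  back from \<open>N\<close> to \<open>M\<close>: cycles of \<open>M\<close> are homologous if and only if their images are.
\<close>

locale homology_comparison =
  M: graded_complex M prM + N: homology_product N prN mN eN
  for M :: "('k::comm_ring_1, 'm::ab_group_add) dgmod" and prM
    and N :: "('k, 'n::ab_group_add) dgmod" and prN mN eN +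
  fixes \<phi> :: "'m \<Rightarrow> 'n" and mM :: "'m \<Rightarrow> 'm \<Rightarrow> 'm" and eM :: 'm
  assumes chain: "chain_map M N \<phi>"
    and inj: "x \<in> M.cycles \<Longrightarrow> \<phi> x \<in> boundaries N \<Longrightarrow> x \<in> boundaries M"
    and surj: "z \<in> N.cycles \<Longrightarrow> \<exists>x\<in>M.cycles. homologous N (\<phi> x) z"
    and surj_comp: "z \<in> N.cycles \<Longrightarrow> z \<in> dgcomp N n \<Longrightarrow> \<exists>x\<in>M.cycles. x \<in> dgcomp M n \<and> homologous N (\<phi> x) z"
    and mM_cyc: "x \<in> M.cycles \<Longrightarrow> y \<in> M.cycles \<Longrightarrow> mM x y \<in> M.cycles"
    and mM_comp: "x \<in> M.cycles \<Longrightarrow> y \<in> M.cycles \<Longrightarrow> x \<in> dgcomp M i \<Longrightarrow> y \<in> dgcomp M j \<Longrightarrow> mM x y \<in> dgcomp M (i + j)"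
    and \<phi>_mult: "x \<in> M.cycles \<Longrightarrow> y \<in> M.cycles \<Longrightarrow> \<phi> (mM x y) = mN (\<phi> x) (\<phi> y)"
    and eM_cyc: "eM \<in> M.cycles"
    and eM_comp: "eM \<in> dgcomp M 0"
    and \<phi>_one: "\<phi> eM = eN"
begin

lemma \<phi>_simps:
  "x \<in> M.cycles \<Longrightarrow> y \<in> M.cycles \<Longrightarrow> \<phi> (x + y) = \<phi> x + \<phi> y"
  "x \<in> M.cycles \<Longrightarrow> \<phi> (dgscl M a x) = dgscl N a (\<phi> x)"
  using chain M.cyc_car unfolding chain_map_def by auto

lemma \<phi>_cyc: "x \<in> M.cycles \<Longrightarrow> \<phi> x \<in> N.cycles"
proof -
  assume x: "x \<in> M.cycles"
  have z: "\<phi> 0 = 0" using \<phi>_simps(2)[OF M.cyc_0, of 0] by simp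
  show "\<phi> x \<in> N.cycles" using x chain unfolding chain_map_def dgcycles_def by (auto simp: z)
qed

lemma \<phi>_comp: "x \<in> dgcomp M n \<Longrightarrow> \<phi> x \<in> dgcomp N n"
  using chain unfolding chain_map_def by auto

lemma \<phi>_diff: "x \<in> M.cycles \<Longrightarrow> y \<in> M.cycles \<Longrightarrow> \<phi> (x - y) = \<phi> x - \<phi> y"
  using \<phi>_simps(1)[of "x - y" y] M.cyc_diff[of x y] by simp

lemma heq_iff: "x \<in> M.cycles \<Longrightarrow> y \<in> M.cycles \<Longrightarrow> M.heq x y \<longleftrightarrow> N.heq (\<phi> x) (\<phi> y)"
proof
  assume xy: "x \<in> M.cycles" "y \<in> M.cycles"
  { assume "M.heq x y"
    then obtain b where b: "b \<in> dgcar M" "x - y = dgdif M b" by (auto simp: homologous_def boundaries_def)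
    then have "\<phi> x - \<phi> y = dgdif N (\<phi> b)" "\<phi> b \<in> dgcar N"
      using chain \<phi>_diff[OF xy] unfolding chain_map_def by auto
    then show "N.heq (\<phi> x) (\<phi> y)" by (auto simp: homologous_def boundaries_def) }
  { assume "N.heq (\<phi> x) (\<phi> y)"
    then have "\<phi> (x - y) \<in> boundaries N" by (simp add: homologous_def \<phi>_diff xy)
    then show "M.heq x y" using inj M.cyc_diff xy by (simp add: homologous_def) }
qed

sublocale P: homology_product M prM mM eM
proof
  fix x x' y y' assume a: "x \<in> M.cycles" "x' \<in> M.cycles" "y \<in> M.cycles" "y' \<in> M.cycles" "M.heq x x'" "M.heq y y'"
  then show "M.heq (mM x y) (mM x' y')" using N.m_cong by (simp add: heq_iff mM_cyc \<phi>_mult \<phi>_cyc)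
next
  show "M.heq (mM x y) (dgscl M (sgnp (i * j)) (mM y x))"
    if "x \<in> M.cycles" "y \<in> M.cycles" "x \<in> dgcomp M i" "y \<in> dgcomp M j" for x y i j
    using that N.m_comm[of "\<phi> x" "\<phi> y" i j]
    by (simp add: heq_iff mM_cyc M.cyc_scl \<phi>_mult \<phi>_cyc \<phi>_comp \<phi>_simps)
qed (simp_all add: heq_iff mM_cyc mM_comp eM_cyc eM_comp M.cyc_add M.cyc_scl \<phi>_mult \<phi>_one \<phi>_cyc \<phi>_simps
      N.m_assoc N.m_distl N.m_distr N.m_scll N.m_sclr N.m_el N.m_er)

lemma map_cls: "x \<in> M.cycles \<Longrightarrow> homology_map M N \<phi> (M.cls x) = N.cls (\<phi> x)"
  by (rule M.homology_map_cls[OF N.graded_complex_axioms chain M.cyc_car])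

theorem homology_iso: "graded_algebra_iso P.H N.H (homology_map M N \<phi>)"
  unfolding graded_algebra_iso_def
proof (intro conjI ballI allI ring_iso_memI)
  show "bij_betw (homology_map M N \<phi>) (carrier P.H) (carrier N.H)"
    unfolding bij_betw_def
  proof
    show "inj_on (homology_map M N \<phi>) (carrier P.H)"
      by (auto simp: inj_on_def P.H_car map_cls heq_iff)
    show "homology_map M N \<phi> ` carrier P.H = carrier N.H"
    proof (intro equalityI subsetI)
      fix S assume "S \<in> carrier N.H"
      then obtain z where "z \<in> N.cycles" "S = N.cls z" by (auto simp: N.H_car)
      moreover from this obtain x where "x \<in> M.cycles" "N.heq (\<phi> x) z" using surj by blast
      ultimately show "S \<in> homology_map M N \<phi> ` carrier P.H"
        by (intro image_eqI[of _ _ "M.cls x"]) (auto simp: P.H_car map_cls intro: N.heq_sym)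
    qed (auto simp: P.H_car N.H_car map_cls \<phi>_cyc)
  qed
  fix n
  show "homology_map M N \<phi> ` hgrade P.H n = hgrade N.H n"
  proof (intro equalityI subsetI)
    fix S assume "S \<in> hgrade N.H n"
    then obtain z where "z \<in> N.cycles" "z \<in> dgcomp N n" "S = N.cls z" by (auto simp: N.H_grade)
    moreover from this obtain x where "x \<in> M.cycles" "x \<in> dgcomp M n" "N.heq (\<phi> x) z" using surj_comp by blast
    ultimately show "S \<in> homology_map M N \<phi> ` hgrade P.H n"
      by (intro image_eqI[of _ _ "M.cls x"]) (auto simp: P.H_grade map_cls intro: N.heq_sym)
  qed (auto simp: P.H_grade N.H_grade map_cls \<phi>_cyc \<phi>_comp intro!: imageI)
qed (auto simp: P.H_simps N.H_simps map_cls \<phi>_cyc \<phi>_simps \<phi>_mult \<phi>_one M.cyc_add M.cyc_scl mM_cyc eM_cyc)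

lemma homology_bij: "bij_betw (homology_map M N \<phi>) (homology M) (homology N)"
  using homology_iso unfolding graded_algebra_iso_def ring_iso_def
  by (auto simp: homology_algebra_def)

end

text \<open>
  The comparison isomorphism has the form of a composite of one isomorphism with the inverse of
  another.
\<close>

lemma graded_algebra_iso_compose_inverse:
  assumes f: "graded_algebra_iso A B f" and g: "graded_algebra_iso A' B g" and A': "ring A'"
    and grade: "\<And>n. hgrade A' n \<subseteq> carrier A'"
    and smult: "\<And>a x. x \<in> carrier A' \<Longrightarrow> a \<odot>\<^bsub>A'\<^esub> x \<in> carrier A'"
  shows "graded_algebra_iso A A' (inv_into (carrier A') g \<circ> f)"
proof -
  have f': "f \<in> ring_iso A B" and g': "g \<in> ring_iso A' B" using f g by (auto simp: graded_algebra_iso_def)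
  let ?i = "inv_into (carrier A') g"
  have g_inj: "inj_on g (carrier A')" and g_im: "g ` carrier A' = carrier B"
    using g' by (auto simp: ring_iso_def bij_betw_def)
  have fc: "f x \<in> carrier B" if "x \<in> carrier A" for x using ring_iso_memE(1)[OF f' that] .
  have inv: "?i (g y) = y" if "y \<in> carrier A'" for y using inv_into_f_f[OF g_inj that] .
  have "?i \<circ> f \<in> ring_iso A A'" by (rule ring_iso_set_trans[OF f' ring_iso_set_sym[OF A' g']])
  moreover have "(?i \<circ> f) (a \<odot>\<^bsub>A\<^esub> x) = a \<odot>\<^bsub>A'\<^esub> (?i \<circ> f) x" if x: "x \<in> carrier A" for a x
  proof -
    have "f x \<in> g ` carrier A'" unfolding g_im by (rule fc[OF x])
    then obtain y where y: "y \<in> carrier A'" "g y = f x" by auto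
    have "f (a \<odot>\<^bsub>A\<^esub> x) = a \<odot>\<^bsub>B\<^esub> g y" using f x y by (simp add: graded_algebra_iso_def)
    also have "\<dots> = g (a \<odot>\<^bsub>A'\<^esub> y)" using g y by (simp add: graded_algebra_iso_def)
    finally show ?thesis using y inv smult by (simp flip: y(2))
  qed
  moreover have "(?i \<circ> f) ` hgrade A n = hgrade A' n" for n
  proof -
    have "f ` hgrade A n = g ` hgrade A' n" using f g by (simp add: graded_algebra_iso_def)
    then have "(?i \<circ> f) ` hgrade A n = ?i ` g ` hgrade A' n" by (simp only: image_comp[symmetric])
    also have "\<dots> = hgrade A' n" using grade[of n] inv by force
    finally show ?thesis .
  qed
  ultimately show ?thesis unfolding graded_algebra_iso_def by blast
qed


section \<open>Graded duals and free complexes\<close>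

definition dual_pr :: "('x, 'k::comm_ring_1, 'e) free_complex_scheme \<Rightarrow> int \<Rightarrow> ('x \<Rightarrow> 'k) \<Rightarrow> 'x \<Rightarrow> 'k" where
  "dual_pr X n f x = (if gdeg X x = - n then f x else 0)"

definition free_pr :: "('x, 'k::comm_ring_1, 'e) free_complex_scheme \<Rightarrow> int \<Rightarrow> ('x \<Rightarrow>\<^sub>0 'k) \<Rightarrow> 'x \<Rightarrow>\<^sub>0 'k" where
  "free_pr X n = lext (\<lambda>x. if gdeg X x = n then bv x else 0)"

lemma dual_simps:
  "f \<in> dgcar (dual_cx X) \<longleftrightarrow> (\<forall>x. x \<notin> gens X \<longrightarrow> f x = 0) \<and> finite (gdeg X ` {x. f x \<noteq> 0})"
  "f \<in> dgcomp (dual_cx X) n \<longleftrightarrow> (\<forall>x. f x \<noteq> 0 \<longrightarrow> x \<in> gens X \<and> gdeg X x = - n)"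
  "dgscl (dual_cx X) a f x = a * f x"
  "dgdif (dual_cx X) f x = (if x \<in> gens X then sgnp (gdeg X x) * ev f (gdif X x) else 0)"
  by (simp_all add: dual_cx_def sgn_norm)

lemma dual_car_supp:
  assumes S: "finite S" and f: "\<And>x. f x \<noteq> 0 \<Longrightarrow> x \<in> gens X \<and> gdeg X x \<in> S"
  shows "f \<in> dgcar (dual_cx X)"
proof -
  have "gdeg X ` {x. f x \<noteq> 0} \<subseteq> S" using f by auto
  then have "finite (gdeg X ` {x. f x \<noteq> 0})" using S by (rule finite_subset)
  then show ?thesis using f by (auto simp: dual_simps)
qed

lemma dual_supp:
  assumes "f \<in> dgcar (dual_cx X)"
  obtains S where "finite S" "\<forall>x. f x \<noteq> 0 \<longrightarrow> x \<in> gens X \<and> gdeg X x \<in> S"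
proof (rule that)
  show "finite (gdeg X ` {x. f x \<noteq> 0})" using assms by (simp add: dual_simps)
  show "\<forall>x. f x \<noteq> 0 \<longrightarrow> x \<in> gens X \<and> gdeg X x \<in> gdeg X ` {x. f x \<noteq> 0}" using assms by (auto simp: dual_simps)
qed

lemma dual_product_car:
  assumes f: "f \<in> dgcar (dual_cx X)" and g: "g \<in> dgcar (dual_cx X)"
    and h: "\<And>x. h x \<noteq> 0 \<Longrightarrow> x \<in> gens X \<and> (\<exists>y z. f y \<noteq> 0 \<and> g z \<noteq> 0 \<and> gdeg X y + gdeg X z = gdeg X x)"
  shows "h \<in> dgcar (dual_cx X)"
proof -
  obtain S where S: "finite S" "\<forall>x. f x \<noteq> 0 \<longrightarrow> x \<in> gens X \<and> gdeg X x \<in> S" using dual_supp[OF f] .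
  obtain S' where S': "finite S'" "\<forall>x. g x \<noteq> 0 \<longrightarrow> x \<in> gens X \<and> gdeg X x \<in> S'" using dual_supp[OF g] .
  have "finite ((\<lambda>(i, j). i + j) ` (S \<times> S'))" using S S' by simp
  moreover have "x \<in> gens X \<and> gdeg X x \<in> (\<lambda>(i, j). i + j) ` (S \<times> S')" if x: "h x \<noteq> 0" for x
  proof -
    obtain y z where "f y \<noteq> 0" "g z \<noteq> 0" and e: "gdeg X y + gdeg X z = gdeg X x" using h[OF x] by blast
    then have "(gdeg X y, gdeg X z) \<in> S \<times> S'" using S S' by blast
    then have "(\<lambda>(i, j). i + j) (gdeg X y, gdeg X z) \<in> (\<lambda>(i, j). i + j) ` (S \<times> S')" by (rule imageI)
    then show ?thesis using h[OF x] e by simp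
  qed
  ultimately show ?thesis by (rule dual_car_supp)
qed

lemma dual_product_comp:
  assumes f: "f \<in> dgcomp (dual_cx X) i" and g: "g \<in> dgcomp (dual_cx X) j"
    and h: "\<And>x. h x \<noteq> 0 \<Longrightarrow> x \<in> gens X \<and> (\<exists>y z. f y \<noteq> 0 \<and> g z \<noteq> 0 \<and> gdeg X y + gdeg X z = gdeg X x)"
  shows "h \<in> dgcomp (dual_cx X) (i + j)"
  unfolding dual_simps
proof (intro allI impI)
  fix x assume x: "h x \<noteq> 0"
  then obtain y z where "f y \<noteq> 0" "g z \<noteq> 0" "gdeg X y + gdeg X z = gdeg X x" using h by blast
  moreover from this have "gdeg X y = - i" "gdeg X z = - j" using f g by (auto simp: dual_simps)
  ultimately show "x \<in> gens X \<and> gdeg X x = - (i + j)" using h[OF x] by simp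
qed

lemma sum_apply: "(\<Sum>i\<in>A. f i) x = (\<Sum>i\<in>A. f i x)" for f :: "'i \<Rightarrow> 'x \<Rightarrow> 'k::comm_ring_1"
  by (induction A rule: infinite_finite_induct) simp_all

text \<open>
  The first assumption says that the differential at \<open>x\<close> only sees basis elements one degree below
  \<open>x\<close>, without reference to coefficients.
\<close>

lemma dual_graded_complex:
  fixes X :: "('x, 'k::comm_ring_1, 'e) free_complex_scheme"
  assumes loc: "\<And>x f g. x \<in> gens X \<Longrightarrow> f \<in> dgcar (dual_cx X) \<Longrightarrow> g \<in> dgcar (dual_cx X) \<Longrightarrow>
      (\<And>y. y \<in> gens X \<Longrightarrow> gdeg X y = gdeg X x - 1 \<Longrightarrow> f y = g y) \<Longrightarrow> ev f (gdif X x) = ev g (gdif X x)"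
    and dd: "\<And>f x. f \<in> dgcar (dual_cx X) \<Longrightarrow> dgdif (dual_cx X) f \<in> dgcar (dual_cx X) \<Longrightarrow> x \<in> gens X \<Longrightarrow> dgdif (dual_cx X) (dgdif (dual_cx X) f) x = 0"
  shows "graded_complex (dual_cx X) (dual_pr X)"
proof
  let ?M = "dual_cx X"
  have pc: "dual_pr X n f \<in> dgcomp ?M n" if "f \<in> dgcar ?M" for n f
    using that by (auto simp: dual_simps dual_pr_def split: if_splits)
  have cc: "f \<in> dgcar ?M" if "f \<in> dgcomp ?M n" for f n
    by (rule dual_car_supp[of "{- n}"]) (use that in \<open>auto simp: dual_simps\<close>)
  show z: "0 \<in> dgcar ?M" by (rule dual_car_supp[of "{}"]) auto
  show "f + g \<in> dgcar ?M" if f: "f \<in> dgcar ?M" and g: "g \<in> dgcar ?M" for f g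
  proof -
    obtain S where S: "finite S" "\<forall>x. f x \<noteq> 0 \<longrightarrow> x \<in> gens X \<and> gdeg X x \<in> S" using dual_supp[OF f] .
    obtain S' where S': "finite S'" "\<forall>x. g x \<noteq> 0 \<longrightarrow> x \<in> gens X \<and> gdeg X x \<in> S'" using dual_supp[OF g] .
    show ?thesis
    proof (rule dual_car_supp[of "S \<union> S'"])
      fix x assume "(f + g) x \<noteq> 0"
      then have "f x \<noteq> 0 \<or> g x \<noteq> 0" by auto
      then show "x \<in> gens X \<and> gdeg X x \<in> S \<union> S'" using S S' by blast
    qed (use S S' in simp)
  qed
  show "dgscl ?M a f \<in> dgcar ?M" if f: "f \<in> dgcar ?M" for a f
  proof -
    obtain S where S: "finite S" "\<forall>x. f x \<noteq> 0 \<longrightarrow> x \<in> gens X \<and> gdeg X x \<in> S" using dual_supp[OF f] .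
    show ?thesis
    proof (rule dual_car_supp[OF S(1)])
      fix x assume "dgscl ?M a f x \<noteq> 0"
      then have "f x \<noteq> 0" by (auto simp: dual_simps)
      then show "x \<in> gens X \<and> gdeg X x \<in> S" using S(2) by blast
    qed
  qed
  have dc: "dgdif ?M f \<in> dgcar ?M" if f: "f \<in> dgcar ?M" for f
  proof -
    obtain S where S: "finite S" "\<forall>x. f x \<noteq> 0 \<longrightarrow> x \<in> gens X \<and> gdeg X x \<in> S" using dual_supp[OF f] .
    show ?thesis
    proof (rule dual_car_supp[of "(\<lambda>n. n + 1) ` S"])
      fix x assume x: "dgdif ?M f x \<noteq> 0"
      then have xg: "x \<in> gens X" by (auto simp: dual_simps split: if_splits)
      have "\<exists>y. gdeg X y = gdeg X x - 1 \<and> f y \<noteq> 0"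
      proof (rule ccontr)
        assume n: "\<not> (\<exists>y. gdeg X y = gdeg X x - 1 \<and> f y \<noteq> 0)"
        have "ev f (gdif X x) = ev (0 :: 'x \<Rightarrow> 'k) (gdif X x)"
          by (rule loc[OF xg f z]) (use n in auto)
        then have "ev f (gdif X x) = 0" by (simp add: ev_def)
        then show False using x xg by (simp add: dual_simps)
      qed
      then obtain y where "gdeg X y = gdeg X x - 1" "gdeg X y \<in> S" using S by blast
      then show "x \<in> gens X \<and> gdeg X x \<in> (\<lambda>n. n + 1) ` S" using xg by (auto intro!: image_eqI[of _ _ "gdeg X y"])
    qed (use S in simp)
  qed
  show "dgdif ?M f \<in> dgcar ?M" if "f \<in> dgcar ?M" for f by (rule dc[OF that])
  show "dual_pr X n f \<in> dgcomp ?M n" if "f \<in> dgcar ?M" for n f by (rule pc[OF that])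
  show "f \<in> dgcar ?M" if "f \<in> dgcomp ?M n" for f n by (rule cc[OF that])
  have supp: "finite {n. dual_pr X n f \<noteq> 0}" if f: "f \<in> dgcar ?M" for f
  proof -
    obtain S where S: "finite S" "\<forall>x. f x \<noteq> 0 \<longrightarrow> x \<in> gens X \<and> gdeg X x \<in> S" using dual_supp[OF f] .
    have "{n. dual_pr X n f \<noteq> 0} \<subseteq> uminus ` S"
    proof
      fix n assume "n \<in> {n. dual_pr X n f \<noteq> 0}"
      then obtain x where "dual_pr X n f x \<noteq> 0" by (auto simp: fun_eq_iff)
      then have "gdeg X x = - n" "gdeg X x \<in> S" using S by (auto simp: dual_pr_def split: if_splits)
      then show "n \<in> uminus ` S" by (auto intro!: image_eqI[of _ _ "gdeg X x"])
    qed
    then show ?thesis using S(1) by (auto intro: finite_subset)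
  qed
  show "finite {n. dual_pr X n f \<noteq> 0}" if "f \<in> dgcar ?M" for f by (rule supp[OF that])
  show "(\<Sum>n | dual_pr X n f \<noteq> 0. dual_pr X n f) = f" if f: "f \<in> dgcar ?M" for f
  proof
    fix x
    have "(\<Sum>n | dual_pr X n f \<noteq> 0. dual_pr X n f) x = (\<Sum>n | dual_pr X n f \<noteq> 0. if n = - gdeg X x then f x else 0)"
      unfolding sum_apply by (intro sum.cong) (auto simp: dual_pr_def)
    also have "\<dots> = (if dual_pr X (- gdeg X x) f \<noteq> 0 then f x else 0)"
      using supp[OF f] by (subst sum.delta) auto
    also have "\<dots> = f x"
    proof (cases "f x = 0")
      case False
      then have "dual_pr X (- gdeg X x) f x \<noteq> 0" by (simp add: dual_pr_def)
      then show ?thesis by (metis zero_fun_def)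
    qed simp
    finally show "(\<Sum>n | dual_pr X n f \<noteq> 0. dual_pr X n f) x = f x" .
  qed
  show "dual_pr X n (dgdif ?M f) = dgdif ?M (dual_pr X (n + 1) f)" if f: "f \<in> dgcar ?M" for n f
  proof
    fix x
    have p: "dual_pr X (n + 1) f \<in> dgcar ?M" by (rule cc[OF pc[OF f]])
    show "dual_pr X n (dgdif ?M f) x = dgdif ?M (dual_pr X (n + 1) f) x"
    proof (cases "x \<in> gens X")
      case x: True
      show ?thesis
      proof (cases "gdeg X x = - n")
        case True
        have "ev f (gdif X x) = ev (dual_pr X (n + 1) f) (gdif X x)"
          by (rule loc[OF x f p]) (use True in \<open>simp add: dual_pr_def\<close>)
        then show ?thesis using True x by (simp add: dual_simps dual_pr_def[of _ n])
      next
        case False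
        have "ev (dual_pr X (n + 1) f) (gdif X x) = ev (0 :: 'x \<Rightarrow> 'k) (gdif X x)"
          by (rule loc[OF x p z]) (use False in \<open>simp add: dual_pr_def\<close>)
        then show ?thesis using False x by (simp add: dual_simps dual_pr_def[of _ n] ev_def[of 0])
      qed
    qed (simp add: dual_simps dual_pr_def)
  qed
  show "dgdif ?M (dgdif ?M f) = 0" if "f \<in> dgcar ?M" for f
  proof
    fix x show "dgdif ?M (dgdif ?M f) x = 0 x"
      using dd[OF that dc[OF that], of x] by (cases "x \<in> gens X") (simp_all add: dual_simps)
  qed
  show "f + g \<in> dgcomp ?M n" if f: "f \<in> dgcomp ?M n" and g: "g \<in> dgcomp ?M n" for f g n
    unfolding dual_simps
  proof (intro allI impI)
    fix x assume "(f + g) x \<noteq> 0"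
    then have "f x \<noteq> 0 \<or> g x \<noteq> 0" by auto
    then show "x \<in> gens X \<and> gdeg X x = - n" using f g by (auto simp: dual_simps)
  qed
  show "dgscl ?M a f \<in> dgcomp ?M n" if f: "f \<in> dgcomp ?M n" for a f n
    unfolding dual_simps
  proof (intro allI impI)
    fix x assume "a * f x \<noteq> 0"
    then have "f x \<noteq> 0" by (auto simp: dual_simps)
    then show "x \<in> gens X \<and> gdeg X x = - n" using f by (auto simp: dual_simps)
  qed
  show "dgdif ?M (f + g) = dgdif ?M f + dgdif ?M g" for f g
    by (rule ext) (simp add: dual_simps plus_fun_def ev_fun_add distrib_left)
  show "dgdif ?M (dgscl ?M a f) = dgscl ?M a (dgdif ?M f)" for a f
    by (rule ext) (simp add: dual_cx_def ev_fun_mult mult.left_commute)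
  show "dual_pr X n f = f" if "f \<in> dgcomp ?M n" for f n
    by (rule ext) (use that in \<open>auto simp: dual_simps dual_pr_def\<close>)
  show "dual_pr X n f = 0" if "f \<in> dgcomp ?M m" "m \<noteq> n" for f m n
    by (rule ext) (use that in \<open>auto simp: dual_simps dual_pr_def\<close>)
qed (auto simp: dual_cx_def dual_pr_def fun_eq_iff algebra_simps)

lemma free_pr_lookup: "Poly_Mapping.lookup (free_pr X n p) x = (if gdeg X x = n then Poly_Mapping.lookup p x else 0)"
proof -
  have "Poly_Mapping.lookup (free_pr X n p) x = ev (\<lambda>y. (if gdeg X x = n then 1 else 0) * (if y = x then 1 else 0)) p"
    unfolding free_pr_def lookup_lext by (rule ev_cong) (auto simp: bv_def lookup_single)
  then show ?thesis by (simp only: ev_fun_mult lookup_eq_ev[symmetric]) simp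
qed

lemma free_graded_complex:
  fixes X :: "('x, 'k::comm_ring_1, 'e) free_complex_scheme"
  assumes cl: "\<And>x y. x \<in> gens X \<Longrightarrow> y \<in> Poly_Mapping.keys (gdif X x) \<Longrightarrow> y \<in> gens X \<and> gdeg X y = gdeg X x - 1"
    and dd: "\<And>p. Poly_Mapping.keys p \<subseteq> gens X \<Longrightarrow> lext (gdif X) (lext (gdif X) p) = 0"
  shows "graded_complex (free_cx X) (free_pr X)"
proof
  let ?M = "free_cx X"
  have car: "p \<in> dgcar ?M \<longleftrightarrow> Poly_Mapping.keys p \<subseteq> gens X" for p by (simp add: free_cx_def)
  have comp: "p \<in> dgcomp ?M n \<longleftrightarrow> Poly_Mapping.keys p \<subseteq> {x \<in> gens X. gdeg X x = n}" for p n by (simp add: free_cx_def)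
  have scl: "dgscl ?M = scl" and dif: "dgdif ?M = lext (gdif X)" by (simp_all add: free_cx_def)
  have ks: "Poly_Mapping.keys (scl a p) \<subseteq> Poly_Mapping.keys p" for a p by (auto simp: in_keys_iff)
  show "p + q \<in> dgcar ?M" if "p \<in> dgcar ?M" "q \<in> dgcar ?M" for p q
    using that keys_add[of p q] by (auto simp: car)
  show "p + q \<in> dgcomp ?M n" if "p \<in> dgcomp ?M n" "q \<in> dgcomp ?M n" for p q n
    using that Poly_Mapping.keys_add[of p q] by (fastforce simp: comp)
  show "dgdif ?M p \<in> dgcar ?M" if "p \<in> dgcar ?M" for p
    using that cl keys_lext by (fastforce simp: car dif)
  have kp: "Poly_Mapping.keys (free_pr X n p) = {x \<in> Poly_Mapping.keys p. gdeg X x = n}" for n p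
    by (auto simp: in_keys_iff free_pr_lookup split: if_splits)
  show fin: "finite {n. free_pr X n p \<noteq> 0}" for p
  proof (rule finite_subset)
    show "{n. free_pr X n p \<noteq> 0} \<subseteq> gdeg X ` Poly_Mapping.keys p"
      using kp by (auto simp: keys_eq_empty[symmetric] simp del: keys_eq_empty)
  qed simp
  show "(\<Sum>n | free_pr X n p \<noteq> 0. free_pr X n p) = p" for p
  proof (rule poly_mapping_eqI)
    fix x
    have "Poly_Mapping.lookup (\<Sum>n | free_pr X n p \<noteq> 0. free_pr X n p) x = (\<Sum>n | free_pr X n p \<noteq> 0. if n = gdeg X x then Poly_Mapping.lookup p x else 0)"
      unfolding lookup_sum by (intro sum.cong) (auto simp: free_pr_lookup)
    also have "\<dots> = (if free_pr X (gdeg X x) p \<noteq> 0 then Poly_Mapping.lookup p x else 0)"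
      using fin by (subst sum.delta) auto
    also have "\<dots> = Poly_Mapping.lookup p x"
      using free_pr_lookup[of X "gdeg X x" p x] by auto
    finally show "Poly_Mapping.lookup (\<Sum>n | free_pr X n p \<noteq> 0. free_pr X n p) x = Poly_Mapping.lookup p x" .
  qed
  show "free_pr X n p = p" if "p \<in> dgcomp ?M n" for n p
    by (rule poly_mapping_eqI) (use that in \<open>auto simp: free_pr_lookup comp in_keys_iff\<close>)
  show "free_pr X n p = 0" if "p \<in> dgcomp ?M m" "m \<noteq> n" for n m p
    by (rule poly_mapping_eqI) (use that in \<open>auto simp: free_pr_lookup comp in_keys_iff\<close>)
  show "free_pr X n (dgdif ?M p) = dgdif ?M (free_pr X (n + 1) p)" if p: "p \<in> dgcar ?M" for n p
  proof (rule ev_eqI)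
    fix f
    have "ev f (free_pr X n (dgdif ?M p)) = ev (\<lambda>x. ev (\<lambda>y. ev f (if gdeg X y = n then bv y else 0)) (gdif X x)) p"
      by (simp add: free_pr_def dif ev_lext)
    also have "\<dots> = ev (\<lambda>x. ev (\<lambda>y. ev f (gdif X y)) (if gdeg X x = n + 1 then bv x else 0)) p"
    proof (rule ev_cong)
      fix x assume "x \<in> Poly_Mapping.keys p"
      then have x: "x \<in> gens X" using p by (auto simp: car)
      have "ev (\<lambda>y. ev f (if gdeg X y = n then bv y else 0)) (gdif X x) = ev (\<lambda>y. if gdeg X x = n + 1 then f y else 0) (gdif X x)"
        by (rule ev_cong) (use cl[OF x] in \<open>auto simp: ev_bv\<close>)
      then show "ev (\<lambda>y. ev f (if gdeg X y = n then bv y else 0)) (gdif X x) = ev (\<lambda>y. ev f (gdif X y)) (if gdeg X x = n + 1 then bv x else 0)"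
        by (simp add: ev_bv)
    qed
    also have "\<dots> = ev f (dgdif ?M (free_pr X (n + 1) p))"
      by (simp add: free_pr_def dif ev_lext)
    finally show "ev f (free_pr X n (dgdif ?M p)) = ev f (dgdif ?M (free_pr X (n + 1) p))" .
  qed
  show "dgdif ?M (dgdif ?M p) = 0" if "p \<in> dgcar ?M" for p using dd that by (simp add: car dif)
  show "dgscl ?M 1 p = p" for p by (rule poly_mapping_eqI) (simp add: scl)
  show "dgscl ?M a (dgscl ?M b p) = dgscl ?M (a * b) p" for a b p by (rule poly_mapping_eqI) (simp add: scl mult.assoc)
  show "dgscl ?M (a + b) p = dgscl ?M a p + dgscl ?M b p" for a b p
    by (rule poly_mapping_eqI) (simp add: scl lookup_add distrib_right)
  show "dgscl ?M a (p + q) = dgscl ?M a p + dgscl ?M a q" for a p q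
    by (rule poly_mapping_eqI) (simp add: scl lookup_add distrib_left)
  show "free_pr X n (p + q) = free_pr X n p + free_pr X n q" for n p q by (simp add: free_pr_def lext_add)
  show "dgdif ?M (p + q) = dgdif ?M p + dgdif ?M q" for p q by (simp add: dif lext_add)
  show "dgdif ?M (dgscl ?M a p) = dgscl ?M a (dgdif ?M p)" for a p by (simp add: dif scl lext_scl)
  show "dgscl ?M a p \<in> dgcar ?M" if "p \<in> dgcar ?M" for a p using that ks[of a p] by (auto simp: car scl)
  show "dgscl ?M a p \<in> dgcomp ?M n" if "p \<in> dgcomp ?M n" for a p n using that ks[of a p] by (auto simp: comp scl)
  show "free_pr X n p \<in> dgcomp ?M n" if "p \<in> dgcar ?M" for n p using that by (auto simp: comp car kp)
  show "p \<in> dgcar ?M" if "p \<in> dgcomp ?M n" for n p using that by (auto simp: comp car)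
qed (simp_all add: free_cx_def)

section \<open>The convolution product of linear forms\<close>

context comparison_setting
begin

lemma HB_cong:
  assumes "ok U" "ok V" "\<And>l r. ok l \<Longrightarrow> ok r \<Longrightarrow> wd l + wd r = wd U + wd V \<Longrightarrow> B l r = B' l r"
  shows "HB B U V = HB B' U V"
  unfolding HB_def
proof (intro Ush_cong)
  fix l1 r1 l2 r2 assume "un True U l1 r1" "un False V l2 r2"
  then show "sgnp (wd l2 * wd U) * B (l2 @ l1) (r1 @ r2) = sgnp (wd l2 * wd U) * B' (l2 @ l1) (r1 @ r2)"
    using assms(1,2) assms(3)[of "l2 @ l1" "r1 @ r2"] by (auto simp: un_def)
qed

lemma Diag_cong:
  assumes "ok u" "\<And>l r. ok l \<Longrightarrow> ok r \<Longrightarrow> wd l + wd r = wd u \<Longrightarrow> B l r = B' l r"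
  shows "Diag B u = Diag B' u"
proof -
  have "cuts u (HB B) = cuts u (HB B')"
    by (intro cuts_cong HB_cong) (use assms in auto)
  moreover have "HB B u [] = HB B' u []" by (intro HB_cong) (use assms in auto)
  ultimately show ?thesis by (simp add: Diag_def)
qed

lemma Ush_True_not_rdc: "\<not> rdc U \<Longrightarrow> (\<And>l r. \<not> rdc l \<Longrightarrow> F l r = 0) \<Longrightarrow> Ush True U F = 0"
  by (erule not_rdc_cases) (simp_all add: Ush_append Ush_lin)

lemma Ush_False_not_rdc: "\<not> rdc U \<Longrightarrow> (\<And>l r. \<not> rdc r \<Longrightarrow> F l r = 0) \<Longrightarrow> Ush False U F = 0"
  by (erule not_rdc_cases) (simp_all add: Ush_append Ush_lin)

lemma rdc_cut: "rdc U \<Longrightarrow> rdc (None # V) \<Longrightarrow> rdc (U @ None # V)"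
  by (induction U) auto

text \<open>
  A degenerate word stays degenerate in one of the factors: an empty entry lies in one of the two
  parts of a cut, or it is the last entry of the left or right part.
\<close>

lemma Diag_not_rdc:
  assumes B: "\<And>l r. \<not> rdc l \<or> \<not> rdc r \<Longrightarrow> B l r = 0" and u: "\<not> rdc u"
  shows "Diag B u = 0"
proof -
  have HB0: "HB B U V = 0" if "\<not> rdc U \<or> \<not> rdc V" for U V
  proof (cases "rdc U")
    case False
    then show ?thesis unfolding HB_def
    proof (rule Ush_True_not_rdc)
      fix l1 r1 assume "\<not> rdc l1"
      then have "B (l2 @ l1) r = 0" for l2 r using B rdc_appendD by blast
      then show "Ush False V (\<lambda>l2 r2. sgnp (wd l2 * wd U) * B (l2 @ l1) (r1 @ r2)) = 0" by (simp add: Ush_lin)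
    qed
  next
    case True
    have "Ush False V (\<lambda>l2 r2. sgnp (wd l2 * wd U) * B (l2 @ l1) (r1 @ r2)) = 0" for l1 r1
    proof (rule Ush_False_not_rdc)
      fix l2 r2 assume "\<not> rdc r2"
      then have "\<not> rdc (r1 @ r2)" using rdc_appendD by blast
      then have "B (l2 @ l1) (r1 @ r2) = 0" using B by blast
      then show "sgnp (wd l2 * wd U) * B (l2 @ l1) (r1 @ r2) = 0" by (simp only: mult_zero_right)
    qed (use True that in blast)
    then show ?thesis by (simp add: HB_def Ush_lin)
  qed
  have "cuts u (HB B) = cuts u (\<lambda>U V. 0)"
  proof (rule cuts_cong)
    fix U V assume "U @ None # V = u"
    then show "HB B U (None # V) = 0" using u rdc_cut HB0 by blast
  qed
  then show ?thesis using HB0[of u "[]"] u by (simp add: Diag_def cuts_lin)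
qed

text \<open>
  The cup product of forms, as functions on all words.
\<close>

definition cnv :: "('b option list \<Rightarrow> 'k) \<Rightarrow> ('b option list \<Rightarrow> 'k) \<Rightarrow> 'b option list \<Rightarrow> 'k" where
  "cnv F G = Diag (\<lambda>l r. sgnp (wd l * wd r) * (F l * G r))"

lemma cnv_cong:
  assumes "ok u" "\<And>l r. ok l \<Longrightarrow> ok r \<Longrightarrow> wd l + wd r = wd u \<Longrightarrow> F l * G r = F' l * G' r"
  shows "cnv F G u = cnv F' G' u"
  unfolding cnv_def by (rule Diag_cong) (use assms in auto)

lemma Diag_0: "Diag (\<lambda>l r. 0) u = 0"
  by (simp add: Diag_def HB_def[abs_def] Ush_lin cuts_lin)

lemma cnv_0: "(\<And>l r. ok l \<Longrightarrow> ok r \<Longrightarrow> wd l + wd r = wd u \<Longrightarrow> F l * G r = 0) \<Longrightarrow> ok u \<Longrightarrow> cnv F G u = 0"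
  using cnv_cong[of u F G "\<lambda>l. 0" "\<lambda>r. 0"] by (simp add: cnv_def Diag_0)

text \<open>
  The Leibniz rule for the cup product.  The factor \<open>sgnp (wd r)\<close> appears on the right form because \<open>dQ\<close>
  is not normalised by the sign of the differential of the dual complex.
\<close>

lemma dQ_cnv:
  assumes u: "ok u"
  shows "dQ u (cnv F G) = cnv (\<lambda>l. dQ l F) (\<lambda>r. sgnp (wd r) * G r) u + cnv F (\<lambda>r. dQ r G) u"
proof -
  let ?B = "\<lambda>l r. sgnp (wd l * wd r) * (F l * G r)"
  have "dQ u (cnv F G) = Diag (\<lambda>l r. dQ l (\<lambda>l'. ?B l' r) + sgnp (wd l) * dQ r (\<lambda>r'. ?B l r')) u"
    unfolding cnv_def by (rule dQ_Diag[OF u])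
  also have "\<dots> = Diag (\<lambda>l r. sgnp (wd l * wd r) * (dQ l F * (sgnp (wd r) * G r)) + sgnp (wd l * wd r) * (F l * dQ r G)) u"
  proof (rule Diag_cong[OF u], rule arg_cong2[of _ _ _ _ "(+)"])
    fix l r :: "'b option list" assume l: "ok l" and r: "ok r"
    have "dQ l (\<lambda>l'. ?B l' r) = dQ l (\<lambda>l'. (sgnp (wd l * wd r) * sgnp (wd r) * G r) * F l')"
    proof (rule dQ_cong[OF l])
      fix z assume w: "wd z = wd l - 1"
      show "?B z r = (sgnp (wd l * wd r) * sgnp (wd r) * G r) * F z" unfolding w by (simp add: sgn_norm)
    qed
    then show "dQ l (\<lambda>l'. ?B l' r) = sgnp (wd l * wd r) * (dQ l F * (sgnp (wd r) * G r))"
      unfolding dQ_lin(4) by (simp only: ac_simps)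
    have "dQ r (\<lambda>r'. ?B l r') = dQ r (\<lambda>r'. (sgnp (wd l * wd r) * sgnp (wd l) * F l) * G r')"
    proof (rule dQ_cong[OF r])
      fix z assume w: "wd z = wd r - 1"
      show "?B l z = (sgnp (wd l * wd r) * sgnp (wd l) * F l) * G z" unfolding w by (simp add: sgn_norm)
    qed
    then show "sgnp (wd l) * dQ r (\<lambda>r'. ?B l r') = sgnp (wd l * wd r) * (F l * dQ r G)"
      unfolding dQ_lin(4) by (simp add: sgn_norm)
  qed
  finally show ?thesis by (simp add: cnv_def Diag_lin)
qed

lemma nab_cong:
  assumes c: "c \<in> gens C" and a: "a \<in> lists Cb"
    and F: "\<And>u. ok u \<Longrightarrow> wd u = gdeg C c + cd a \<Longrightarrow> F u = G u"
  shows "nab F (c, a) = nab G (c, a)"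
proof -
  have "sig c (\<lambda>z. F (map Some a @ z)) = sig c (\<lambda>z. G (map Some a @ z))"
    by (rule sig_cong[OF c], rule F) (use a ok_bars in auto)
  then show ?thesis by (simp add: nab_def)
qed

lemma nab_lin:
  "nab (\<lambda>u. F u + G u) x = nab F x + nab G x"
  "nab (\<lambda>u. b * F u) x = b * nab F x"
  "nab (\<lambda>u. 0) x = 0"
  by (cases x; simp add: nab_def sig_lin algebra_simps)+

lemma piw_cong_deg:
  assumes "ok u" "\<And>c a. c \<in> gens C \<Longrightarrow> a \<in> lists Cb \<Longrightarrow> gdeg C c + cd a = wd u \<Longrightarrow> F (c, a) = G (c, a)"
  shows "piw F u = piw G u"
proof -
  obtain a ws where u: "u = map Some a @ encs ws" by (metis enc_dec enc_def)
  show ?thesis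
  proof (cases ws)
    case Nil
    then show ?thesis using assms coaug_gen by (simp add: piw_def u)
  next
    case (Cons w ws')
    have "pw w F a = pw w G a" if "ws' = []"
      unfolding pw_def
    proof (rule sp_cong, rule arg_cong2[of _ _ _ _ "(*)", OF refl])
      fix x v z assume w: "w = x @ v # z"
      show "F (v, z @ a @ x) = G (v, z @ a @ x)"
        by (rule assms(2)) (use assms(1) w that in \<open>auto simp: u Cons\<close>)
    qed
    then show ?thesis by (simp add: piw_def u Cons)
  qed
qed

lemma piw_not_rdc: "\<not> rdc u \<Longrightarrow> piw G u = 0"
proof -
  assume r: "\<not> rdc u"
  obtain a ws where u: "u = map Some a @ encs ws" by (metis enc_dec enc_def)
  show "piw G u = 0"
  proof (cases ws)
    case Nil
    then show ?thesis using r by (simp add: u)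
  next
    case (Cons w ws')
    show ?thesis
    proof (cases "ws' = [] \<and> w \<noteq> []")
      case True
      then have "rdc u" by (cases w) (auto simp: u Cons rdc_Some)
      then show ?thesis using r by simp
    qed (auto simp: piw_def u Cons)
  qed
qed

section \<open>The Leibniz rule on the twisted tensor product\<close>

lemma tmul_cong_deg:
  assumes c: "c \<in> gens C" and a: "a \<in> lists Cb"
    and gh: "\<And>x l y r. x \<in> gens C \<Longrightarrow> l \<in> lists Cb \<Longrightarrow> y \<in> gens C \<Longrightarrow> r \<in> lists Cb
      \<Longrightarrow> gdeg C x + cd l + (gdeg C y + cd r) = gdeg C c + cd a \<Longrightarrow> g (x, l) * h (y, r) = g' (x, l) * h' (y, r)"
  shows "tmul g h (c, a) = tmul g' h' (c, a)"
  unfolding tmul_eq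
  by (intro codiag_cong[OF c], unfold prod.case, intro Sh_cong) (use a gh in \<open>auto simp: shr_def\<close>)

lemma tmul_lin:
  "tmul (\<lambda>z. g z + g' z) h x = tmul g h x + tmul g' h x"
  "tmul g (\<lambda>z. h z + h' z) x = tmul g h x + tmul g h' x"
  "tmul (\<lambda>z. b * g z) h x = b * tmul g h x"
  "tmul g (\<lambda>z. b * h z) x = b * tmul g h x"
  "tmul (\<lambda>z. 0) h x = 0" "tmul g (\<lambda>z. 0) x = 0"
  by (cases x; simp add: tmul_eq case_prod_unfold distrib_left distrib_right ev_fun_add mult.assoc
      mult.left_commute[of _ b] ev_fun_mult)+

text \<open>
  The Leibniz rule on \<open>C \<otimes> \<Omega>C\<close>.  The forms \<open>f\<close> and \<open>g\<close> are restrictions along \<open>\<nabla>\<close> of their lifts along \<open>\<pi>\<close>,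
  for which it is \<open>dQ_cnv\<close>; and \<open>\<nabla>\<close> respects differentials and diagonals.
\<close>

lemma dT_tmul:
  assumes c: "c \<in> gens C" and a: "a \<in> lists Cb"
  shows "dT (tmul f g) (c, a) = tmul (dT f) (\<lambda>x. sgnp (gdeg T x) * g x) (c, a) + tmul f (dT g) (c, a)"
proof -
  let ?F = "piw f" and ?G = "piw g"
  have rF: "?F u = 0" "?G u = 0" if "\<not> rdc u" for u using piw_not_rdc[OF that] by auto
  have nF: "nab ?F (x, l) = f (x, l)" "nab ?G (x, l) = g (x, l)" if "x \<in> gens C" for x l
    using nab_piw[OF that] by auto
  have "dT (tmul f g) (c, a) = dT (nab (cnv ?F ?G)) (c, a)"
  proof (rule dT_cong[OF c a])
    fix x b assume x: "x \<in> gens C" "b \<in> lists Cb"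
    have "nab (cnv ?F ?G) (x, b) = tmul (nab ?F) (nab ?G) (x, b)"
      unfolding cnv_def by (rule nab_Diag[OF x(1) rF])
    also have "\<dots> = tmul f g (x, b)" by (rule tmul_cong[OF x]) (simp_all add: nF)
    finally show "tmul f g (x, b) = nab (cnv ?F ?G) (x, b)" ..
  qed
  also have "\<dots> = nab (\<lambda>u. dQ u (cnv ?F ?G)) (c, a)" unfolding nab_dif[OF c a] dT_def ..
  also have "\<dots> = nab (\<lambda>u. cnv (\<lambda>l. dQ l ?F) (\<lambda>r. sgnp (wd r) * ?G r) u + cnv ?F (\<lambda>r. dQ r ?G) u) (c, a)"
    by (rule nab_cong[OF c a]) (simp add: dQ_cnv)
  also have "\<dots> = tmul (nab (\<lambda>l. dQ l ?F)) (nab (\<lambda>r. sgnp (wd r) * ?G r)) (c, a) + tmul (nab ?F) (nab (\<lambda>r. dQ r ?G)) (c, a)"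
    unfolding nab_lin cnv_def
    by (intro arg_cong2[of _ _ _ _ "(+)"] nab_Diag[OF c] dQ_not_rdc) (simp_all add: rF)
  also have "tmul (nab (\<lambda>l. dQ l ?F)) (nab (\<lambda>r. sgnp (wd r) * ?G r)) (c, a) = tmul (dT f) (\<lambda>x. sgnp (gdeg T x) * g x) (c, a)"
  proof (rule tmul_cong[OF c a])
    fix x l assume x: "x \<in> gens C" "l \<in> lists Cb"
    show "nab (\<lambda>l. dQ l ?F) (x, l) = dT f (x, l)"
      unfolding nab_dif[OF x] dT_def[symmetric] by (rule dT_cong[OF x]) (simp add: nF)
    have "nab (\<lambda>r. sgnp (wd r) * ?G r) (x, l) = nab (\<lambda>r. sgnp (gdeg T (x, l)) * ?G r) (x, l)"
      by (rule nab_cong[OF x]) simp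
    then show "nab (\<lambda>r. sgnp (wd r) * ?G r) (x, l) = sgnp (gdeg T (x, l)) * g (x, l)"
      by (simp add: nab_lin nF x)
  qed
  also have "tmul (nab ?F) (nab (\<lambda>r. dQ r ?G)) (c, a) = tmul f (dT g) (c, a)"
  proof (rule tmul_cong[OF c a])
    fix x l assume x: "x \<in> gens C" "l \<in> lists Cb"
    show "nab ?F (x, l) = f (x, l)" by (rule nF[OF x(1)])
    show "nab (\<lambda>l. dQ l ?G) (x, l) = dT g (x, l)"
      unfolding nab_dif[OF x] dT_def[symmetric] by (rule dT_cong[OF x]) (simp add: nF)
  qed
  finally show ?thesis .
qed

text \<open>
  Inherited from the words in the same way as \<open>dT_tmul\<close>.
\<close>

lemma dT_dT:
  assumes c: "c \<in> gens C" and a: "a \<in> lists Cb"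
  shows "dT (dT f) (c, a) = 0"
proof -
  have "dT (dT f) (c, a) = dT (nab (\<lambda>u. dQ u (piw f))) (c, a)"
  proof (rule dT_cong[OF c a])
    fix x b assume x: "x \<in> gens C" "b \<in> lists Cb"
    show "dT f (x, b) = nab (\<lambda>u. dQ u (piw f)) (x, b)"
      unfolding nab_dif[OF x] dT_def[symmetric] by (rule dT_cong[OF x]) (simp add: nab_piw)
  qed
  also have "\<dots> = nab (\<lambda>u. dQ u (\<lambda>z. dQ z (piw f))) (c, a)" unfolding nab_dif[OF c a] dT_def ..
  also have "\<dots> = nab (\<lambda>u. 0) (c, a)" by (rule nab_cong[OF c a]) (simp add: dQ_dQ)
  finally show ?thesis by (simp add: nab_lin)
qed

abbreviation "TD \<equiv> dual_cx T"

lemma TD_dif: "x \<in> gens T \<Longrightarrow> dgdif TD f x = sgnp (gdeg T x) * dT f x"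
  by (simp add: dual_simps dT_def)

lemma TD_graded: "graded_complex TD (dual_pr T)"
proof (rule dual_graded_complex)
  fix x f g assume x: "x \<in> gens T" and "f \<in> dgcar TD" "g \<in> dgcar TD"
    and fg: "\<And>y. y \<in> gens T \<Longrightarrow> gdeg T y = gdeg T x - 1 \<Longrightarrow> f y = g y"
  obtain c a where ca: "x = (c, a)" "c \<in> gens C" "a \<in> lists Cb" using x by auto
  have "dT f (c, a) = dT g (c, a)" by (rule dT_cong[OF ca(2,3)]) (use fg ca in auto)
  then show "ev f (gdif T x) = ev g (gdif T x)" by (simp add: dT_def ca)
next
  fix f x assume x: "x \<in> gens T"
  obtain c a where ca: "x = (c, a)" "c \<in> gens C" "a \<in> lists Cb" using x by auto
  have "dT (dgdif TD f) (c, a) = dT (\<lambda>z. (- sgnp (gdeg T (c, a))) * dT f z) (c, a)"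
  proof (rule dT_cong[OF ca(2,3)])
    fix y b assume y: "y \<in> gens C" "b \<in> lists Cb" "gdeg C y + cd b = gdeg C c + cd a - 1"
    have "dgdif TD f (y, b) = sgnp (gdeg C y + cd b) * dT f (y, b)" using y(1,2) by (simp add: TD_dif)
    then show "dgdif TD f (y, b) = (- sgnp (gdeg T (c, a))) * dT f (y, b)" unfolding y(3) by (simp add: sgn_norm)
  qed
  also have "\<dots> = (- sgnp (gdeg T (c, a))) * dT (dT f) (c, a)" unfolding dT_def[of "\<lambda>z. _ * _ z"] dT_def[of "dT f"] by (rule ev_fun_mult)
  finally show "dgdif TD (dgdif TD f) x = 0" using x by (simp add: TD_dif dT_dT[OF ca(2,3)] ca(1))
qed

definition tprod :: "('b \<times> 'b list \<Rightarrow> 'k) \<Rightarrow> ('b \<times> 'b list \<Rightarrow> 'k) \<Rightarrow> 'b \<times> 'b list \<Rightarrow> 'k" where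
  "tprod g h x = (if x \<in> gens T then tmul g h x else 0)"

text \<open>
  The sign of the Leibniz rule in the dual, where \<open>f\<close> has degree minus that of its argument.
\<close>

definition tau :: "('b \<times> 'b list \<Rightarrow> 'k) \<Rightarrow> 'b \<times> 'b list \<Rightarrow> 'k" where
  "tau f x = sgnp (gdeg T x) * f x"

lemma tprod_supp:
  assumes "tprod g h x \<noteq> 0"
  shows "x \<in> gens T \<and> (\<exists>y z. g y \<noteq> 0 \<and> h z \<noteq> 0 \<and> gdeg T y + gdeg T z = gdeg T x)"
proof -
  obtain c a where ca: "x = (c, a)" "c \<in> gens C" "a \<in> lists Cb" using assms by (auto simp: tprod_def split: if_splits)
  have "\<exists>y z. g y \<noteq> 0 \<and> h z \<noteq> 0 \<and> gdeg T y + gdeg T z = gdeg T x"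
  proof (rule ccontr)
    assume n: "\<not> (\<exists>y z. g y \<noteq> 0 \<and> h z \<noteq> 0 \<and> gdeg T y + gdeg T z = gdeg T x)"
    have "tmul g h (c, a) = tmul (\<lambda>z. 0) (\<lambda>z. 0) (c, a)"
    proof (rule tmul_cong_deg[OF ca(2,3)])
      fix x' l y r assume "gdeg C x' + cd l + (gdeg C y + cd r) = gdeg C c + cd a"
      then have "gdeg T (x', l) + gdeg T (y, r) = gdeg T x" by (simp add: ca)
      then have "g (x', l) = 0 \<or> h (y, r) = 0" using n by blast
      then show "g (x', l) * h (y, r) = 0 * 0" by auto
    qed
    then show False using assms by (simp add: tprod_def ca tmul_lin)
  qed
  then show ?thesis using ca by simp
qed

lemma tprod_car: "f \<in> dgcar TD \<Longrightarrow> g \<in> dgcar TD \<Longrightarrow> tprod f g \<in> dgcar TD"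
  by (rule dual_product_car[of f _ g]) (simp_all only: tprod_supp simp_thms)

lemma tprod_leibniz: "dgdif TD (tprod f g) = tprod (dgdif TD f) g + tprod (tau f) (dgdif TD g)"
proof
  fix x show "dgdif TD (tprod f g) x = (tprod (dgdif TD f) g + tprod (tau f) (dgdif TD g)) x"
  proof (cases "x \<in> gens T")
    case True
    then obtain c a where ca: "x = (c, a)" "c \<in> gens C" "a \<in> lists Cb" by auto
    have "dT (tprod f g) (c, a) = dT (tmul f g) (c, a)"
      by (rule dT_cong[OF ca(2,3)]) (simp add: tprod_def)
    then have "dgdif TD (tprod f g) x = sgnp (gdeg T x) * tmul (dT f) (\<lambda>x. sgnp (gdeg T x) * g x) (c, a) + sgnp (gdeg T x) * tmul f (dT g) (c, a)"
      using True by (simp add: TD_dif ca(1) dT_tmul[OF ca(2,3)] distrib_left)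
    also have "sgnp (gdeg T x) * tmul (dT f) (\<lambda>x. sgnp (gdeg T x) * g x) (c, a) = tmul (dgdif TD f) g (c, a)"
      unfolding tmul_lin(3)[symmetric]
    proof (rule tmul_cong_deg[OF ca(2,3)])
      fix x' l y r assume *: "x' \<in> gens C" "l \<in> lists Cb" "gdeg C x' + cd l + (gdeg C y + cd r) = gdeg C c + cd a"
      have d: "gdeg T x = (gdeg C x' + cd l) + (gdeg C y + cd r)" using * by (simp add: ca)
      show "sgnp (gdeg T x) * dT f (x', l) * (sgnp (gdeg T (y, r)) * g (y, r)) = dgdif TD f (x', l) * g (y, r)"
        unfolding d using *(1,2) by (simp add: TD_dif sgn_norm)
    qed
    also have "sgnp (gdeg T x) * tmul f (dT g) (c, a) = tmul (tau f) (dgdif TD g) (c, a)"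
      unfolding tmul_lin(3)[symmetric]
    proof (rule tmul_cong_deg[OF ca(2,3)])
      fix x' l y r assume *: "y \<in> gens C" "r \<in> lists Cb" "gdeg C x' + cd l + (gdeg C y + cd r) = gdeg C c + cd a"
      have d: "gdeg T x = (gdeg C x' + cd l) + (gdeg C y + cd r)" using * by (simp add: ca)
      show "sgnp (gdeg T x) * f (x', l) * dT g (y, r) = tau f (x', l) * dgdif TD g (y, r)"
        unfolding d using *(1,2) by (simp add: TD_dif tau_def sgn_norm)
    qed
    finally have e: "dgdif TD (tprod f g) x = tmul (dgdif TD f) g (c, a) + tmul (tau f) (dgdif TD g) (c, a)" .
    have "tprod p q x = tmul p q (c, a)" for p q using True ca by (simp add: tprod_def)
    then show ?thesis unfolding e by simp
  qed (simp add: dual_simps tprod_def)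
qed

end


lemma dual_map_car:
  assumes f: "f \<in> dgcar (dual_cx X)"
    and h: "\<And>x. h x \<noteq> 0 \<Longrightarrow> x \<in> gens Y \<and> (\<exists>y. f y \<noteq> 0 \<and> gdeg X y = gdeg Y x)"
  shows "h \<in> dgcar (dual_cx Y)"
proof -
  obtain S where S: "finite S" "\<forall>x. f x \<noteq> 0 \<longrightarrow> x \<in> gens X \<and> gdeg X x \<in> S" using dual_supp[OF f] .
  show ?thesis by (rule dual_car_supp[OF S(1)]) (use S(2) h in metis)
qed

lemma dual_map_comp:
  assumes f: "f \<in> dgcomp (dual_cx X) n"
    and h: "\<And>x. h x \<noteq> 0 \<Longrightarrow> x \<in> gens Y \<and> (\<exists>y. f y \<noteq> 0 \<and> gdeg X y = gdeg Y x)"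
  shows "h \<in> dgcomp (dual_cx Y) n"
  using f h unfolding dual_simps by metis

text \<open>
  Both sides are the pairing of \<open>p\<close> and \<open>q\<close> weighted by \<open>h\<close>.
\<close>

lemma ev_exchange:
  "ev (\<lambda>y. Poly_Mapping.lookup q y * h y) p = ev (\<lambda>y. Poly_Mapping.lookup p y * h y) q"
proof -
  have e: "Poly_Mapping.lookup q y * h y = ev (\<lambda>z. if z = y then h z else 0) q" for y q
    by (simp add: ev_def if_distrib[of "(*) _"] sum.delta in_keys_iff cong: if_cong)
  have e': "Poly_Mapping.lookup p y * h y = ev (\<lambda>z. if y = z then h y else 0) p" for y
    unfolding e by (rule ev_cong) auto
  show ?thesis unfolding e[of q] e' by (rule ev_swap)
qed

lemma dual_off: "f \<in> dgcar (dual_cx X) \<Longrightarrow> x \<notin> gens X \<Longrightarrow> f x = 0"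
  unfolding dual_simps by blast

context comparison_setting
begin

lemma tprod_lin:
  "tprod (f + g) h = tprod f h + tprod g h"
  "tprod f (g + h) = tprod f g + tprod f h"
  "tprod (dgscl TD a f) g = dgscl TD a (tprod f g)"
  "tprod f (dgscl TD a g) = dgscl TD a (tprod f g)"
  "tprod 0 g = 0" "tprod f 0 = 0"
  by (rule ext; simp add: tprod_def plus_fun_def zero_fun_def dual_cx_def tmul_lin)+

lemma tprod_diff:
  "tprod (f - g) h = tprod f h - tprod g h" "tprod f (g - h) = tprod f g - tprod f h"
  using tprod_lin(1)[of "f - g" g h] tprod_lin(2)[of f "g - h" h] by simp_all

text \<open>
  The counit of the cyclic bar construction on words; it is the unit of the cup product.
\<close>

definition uQ :: "'b option list \<Rightarrow> 'k" where
  "uQ u = (if u = [] then 1 else 0)"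

lemma dQ_uQ: "dQ u uQ = 0"
proof (cases "rdc u")
  case False
  show ?thesis by (rule dQ_not_rdc[OF _ False]) (auto simp: uQ_def)
next
  case r: True
  have d: "dl x (\<lambda>v. uQ (v @ w)) = 0" if "x \<noteq> None" for x w
    using that by (cases x) (simp_all add: dl_def uQ_def case_prod_unfold)
  have W: "dW u uQ = 0"
  proof (cases u)
    case (Cons x w)
    have "dW w (\<lambda>v. uQ (x # v)) = 0" by (simp add: uQ_def dW_lin)
    moreover have "dl x (\<lambda>v. uQ (v @ w)) = 0"
    proof (cases x)
      case None
      then have "w \<noteq> []" using r Cons by simp
      then show ?thesis by (simp add: dl_def uQ_def None)
    qed (simp add: d)
    ultimately show ?thesis by (simp add: Cons)
  qed simp
  have "Lst u uQ = 0"
  proof (cases u rule: word_cases)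
    case (2 x w)
    then have "w @ x \<noteq> []" using r by (cases x) auto
    then show ?thesis using 2 by (simp add: uQ_def)
  qed (simp add: Lst_def dropWhile_eq_Nil_conv)
  then show ?thesis using W by (simp add: dQ_def)
qed

lemma nab_uQ: "c \<in> gens C \<Longrightarrow> nab uQ (c, a) = uT (c, a)"
proof (cases "c = one")
  case True
  then show ?thesis using coaug_gen by (simp add: nab_def uQ_def uT_def)
next
  case False
  moreover assume "c \<in> gens C"
  ultimately have "sig c (\<lambda>z. uQ (map Some a @ z)) = 0" by (simp add: sig_rec uQ_def sig_lin case_prod_unfold)
  then show ?thesis using False by (simp add: nab_def uT_def)
qed

lemma dT_uT: "c \<in> gens C \<Longrightarrow> a \<in> lists Cb \<Longrightarrow> dT uT (c, a) = 0"
proof -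
  assume c: "c \<in> gens C" and a: "a \<in> lists Cb"
  have "dT uT (c, a) = dT (nab uQ) (c, a)" by (rule dT_cong[OF c a]) (simp add: nab_uQ)
  also have "\<dots> = nab (\<lambda>u. dQ u uQ) (c, a)" unfolding nab_dif[OF c a] dT_def ..
  finally show ?thesis by (simp add: dQ_uQ nab_lin)
qed

lemma TD_cycle: "f \<in> dgcycles TD \<Longrightarrow> c \<in> gens C \<Longrightarrow> a \<in> lists Cb \<Longrightarrow> dT f (c, a) = 0"
proof -
  assume f: "f \<in> dgcycles TD" and c: "c \<in> gens C" "a \<in> lists Cb"
  then have "sgnp (gdeg T (c, a)) * (sgnp (gdeg T (c, a)) * dT f (c, a)) = 0"
    using TD_dif[of "(c, a)" f] by (simp add: dgcycles_def)
  then show "dT f (c, a) = 0" by (simp add: sgn_norm)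
qed

lemma TD_cycleI: "f \<in> dgcar TD \<Longrightarrow> (\<And>c a. c \<in> gens C \<Longrightarrow> a \<in> lists Cb \<Longrightarrow> dT f (c, a) = 0) \<Longrightarrow> f \<in> dgcycles TD"
  unfolding dgcycles_def by (auto simp: dual_simps dT_def fun_eq_iff)

lemma tau_tau [simp]: "tau (tau f) = f"
  by (rule ext) (simp add: tau_def sgn_norm)

lemma tau_car: "f \<in> dgcar TD \<Longrightarrow> tau f \<in> dgcar TD"
proof (rule dual_map_car[of f T])
  fix x assume f: "f \<in> dgcar TD" and "tau f x \<noteq> 0"
  then have "f x \<noteq> 0" by (auto simp: tau_def)
  then show "x \<in> gens T \<and> (\<exists>y. f y \<noteq> 0 \<and> gdeg T y = gdeg T x)" using dual_off[OF f, of x] by blast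
qed

lemma tau_cycle: "f \<in> dgcycles TD \<Longrightarrow> tau f \<in> dgcycles TD"
proof (rule TD_cycleI)
  assume f: "f \<in> dgcycles TD"
  then show "tau f \<in> dgcar TD" by (simp add: dgcycles_def tau_car)
  fix c a assume ca: "c \<in> gens C" "a \<in> lists Cb"
  have "dT (tau f) (c, a) = dT (\<lambda>z. sgnp (gdeg C c + cd a - 1) * f z) (c, a)"
  proof (rule dT_cong[OF ca])
    fix x b assume d: "gdeg C x + cd b = gdeg C c + cd a - 1"
    show "tau f (x, b) = sgnp (gdeg C c + cd a - 1) * f (x, b)" unfolding d[symmetric] by (simp add: tau_def)
  qed
  also have "\<dots> = sgnp (gdeg C c + cd a - 1) * dT f (c, a)" unfolding dT_def by (rule ev_fun_mult)
  finally show "dT (tau f) (c, a) = 0" using TD_cycle[OF f ca] by simp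
qed

text \<open>
  The dual of \<open>C \<otimes> \<Omega>C\<close> is a commutative differential graded algebra.
\<close>

theorem TD_product: "homology_product TD (dual_pr T) tprod uT"
proof -
  interpret G: graded_complex TD "dual_pr T" by (rule TD_graded)
  have d0: "dgdif TD f = 0" "f \<in> dgcar TD" if "f \<in> dgcycles TD" for f using that by (auto simp: dgcycles_def)
  have idl: "tprod b y \<in> boundaries TD" if b: "b \<in> boundaries TD" and y: "y \<in> dgcycles TD" for b y
  proof -
    obtain b' where b': "b' \<in> dgcar TD" "b = dgdif TD b'" using b unfolding boundaries_def by blast
    have "tprod b y = dgdif TD (tprod b' y)" using d0[OF y] b' by (simp add: tprod_leibniz tprod_lin)
    then show ?thesis using tprod_car[OF b'(1) d0(2)[OF y]] by (auto simp: boundaries_def)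
  qed
  have idr: "tprod y b \<in> boundaries TD" if b: "b \<in> boundaries TD" and y: "y \<in> dgcycles TD" for b y
  proof -
    obtain b' where b': "b' \<in> dgcar TD" "b = dgdif TD b'" using b unfolding boundaries_def by blast
    have "tprod y b = dgdif TD (tprod (tau y) b')" using d0[OF tau_cycle[OF y]] b' by (simp add: tprod_leibniz tprod_lin)
    then show ?thesis using tprod_car[OF d0(2)[OF tau_cycle[OF y]] b'(1)] by (auto simp: boundaries_def)
  qed
  have off: "f x = 0" if "f \<in> dgcycles TD" "x \<notin> gens T" for f x using that(1) by (intro dual_off[OF _ that(2)]) (simp add: dgcycles_def)
  show ?thesis
  proof
    fix x x' y y' assume c: "x \<in> dgcycles TD" "x' \<in> dgcycles TD" "y \<in> dgcycles TD" "y' \<in> dgcycles TD"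
      and h: "homologous TD x x'" "homologous TD y y'"
    have "tprod x y - tprod x' y' = tprod (x - x') y + tprod x' (y - y')" by (simp add: tprod_diff)
    then show "homologous TD (tprod x y) (tprod x' y')"
      using G.bd_add[OF idl[of "x - x'" y] idr[of "y - y'" x']] c h by (simp add: homologous_def)
  next
    fix x y z
    have "tprod (tprod x y) z = tprod x (tprod y z)"
    proof
      fix w show "tprod (tprod x y) z w = tprod x (tprod y z) w"
      proof (cases "w \<in> gens T")
        case True
        then obtain c a where w: "w = (c, a)" "c \<in> gens C" "a \<in> lists Cb" by auto
        have "tmul (tprod x y) z (c, a) = tmul (tmul x y) z (c, a)"
          by (rule tmul_cong[OF w(2,3)]) (simp_all add: tprod_def)
        also have "\<dots> = tmul x (tmul y z) (c, a)" by (rule tmul_assoc[OF w(2)])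
        also have "\<dots> = tmul x (tprod y z) (c, a)"
          by (rule tmul_cong[OF w(2,3)]) (simp_all add: tprod_def)
        finally show ?thesis using True w(1) by (simp add: tprod_def)
      qed (simp add: tprod_def)
    qed
    then show "homologous TD (tprod (tprod x y) z) (tprod x (tprod y z))" by simp
  next
    fix x y assume "x \<in> dgcycles TD" "y \<in> dgcycles TD"
    then show "tprod x y \<in> dgcycles TD"
      using tprod_car[of x y] by (simp add: dgcycles_def tprod_leibniz tprod_lin)
  next
    show c: "uT \<in> dgcomp TD 0" using coaug_gen by (simp add: dual_simps uT_def)
    show "uT \<in> dgcycles TD" by (rule TD_cycleI[OF G.comp_car[OF c] dT_uT])
  next
    fix x assume x: "x \<in> dgcycles TD"
    have "tprod uT x = x"
      by (rule ext) (use off[OF x] in \<open>auto simp: tprod_def tmul_unit\<close>)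
    then show "homologous TD (tprod uT x) x" by simp
    have "tprod x uT = x"
      by (rule ext) (use off[OF x] in \<open>auto simp: tprod_def tmul_unit\<close>)
    then show "homologous TD (tprod x uT) x" by simp
  next
    fix x y i j assume xy: "x \<in> dgcomp TD i" "y \<in> dgcomp TD j"
    show "tprod x y \<in> dgcomp TD (i + j)" by (rule dual_product_comp[OF xy tprod_supp])
    have "tprod x y = dgscl TD (sgnp (i * j)) (tprod y x)"
    proof
      fix w show "tprod x y w = dgscl TD (sgnp (i * j)) (tprod y x) w"
      proof (cases "w \<in> gens T")
        case True
        then obtain c a where w: "w = (c, a)" "c \<in> gens C" "a \<in> lists Cb" by auto
        have s: "y (p, l) * x (q, r) = sgnp (i * j) * (sgnp ((gdeg C p + cd l) * (gdeg C q + cd r)) * (y (p, l) * x (q, r)))" for p l q r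
        proof (cases "y (p, l) = 0 \<or> x (q, r) = 0")
          case False
          then have "gdeg C p + cd l = - j" "gdeg C q + cd r = - i" using xy by (auto simp: dual_simps)
          then have "(gdeg C p + cd l) * (gdeg C q + cd r) = i * j" by simp
          then show ?thesis by (simp only: sgn_norm)
        qed auto
        have "tmul x y (c, a) = ev (\<lambda>(p, q). ev (\<lambda>(l, r). sgnp (i * j) * (sgnp (gdeg C q * cd l) * (sgnp ((gdeg C p + cd l) * (gdeg C q + cd r)) * (y (p, l) * x (q, r))))) (Sh a)) (codiag C c)"
          unfolding tmul_swap[OF w(2)]
        proof (intro ev_cong, clarify, intro ev_cong, clarify)
          fix p q l r
          show "sgnp (gdeg C q * cd l) * (y (p, l) * x (q, r)) = sgnp (i * j) * (sgnp (gdeg C q * cd l) * (sgnp ((gdeg C p + cd l) * (gdeg C q + cd r)) * (y (p, l) * x (q, r))))"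
            by (subst s[of p l q r]) (rule mult.left_commute)
        qed
        also have "\<dots> = sgnp (i * j) * tmul y x (c, a)"
          unfolding tmul_eq by (simp add: case_prod_unfold ev_fun_mult)
        finally show ?thesis using True w(1) by (simp add: tprod_def dual_simps)
      qed (simp add: tprod_def dual_simps)
    qed
    then show "homologous TD (tprod x y) (dgscl TD (sgnp (i * j)) (tprod y x))" by simp
  qed (simp_all add: tprod_lin)
qed

section \<open>Hochschild cohomology of the cobar construction\<close>

abbreviation "QD \<equiv> dual_cx Q"

lemma ev_gdif_Q: "f \<in> dgcar QD \<Longrightarrow> x \<in> gens Q \<Longrightarrow> ev f (gdif Q x) = dQ (enc x) (\<lambda>u. f (dec u))"
proof -
  assume f: "f \<in> dgcar QD" and x: "x \<in> gens Q"
  have "sgnp (wd (enc x)) * ev f (gdif Q x) = sgnp (wd (enc x)) * dQ (enc x) (\<lambda>u. f (dec u))"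
    using dual_Q_dif[OF f, of "enc x"] x by (simp add: dual_simps gens_Q)
  then have "sgnp (wd (enc x)) * (sgnp (wd (enc x)) * ev f (gdif Q x)) = sgnp (wd (enc x)) * (sgnp (wd (enc x)) * dQ (enc x) (\<lambda>u. f (dec u)))"
    by (rule arg_cong)
  then show ?thesis by (simp only: sgn_norm)
qed

lemma QD_graded: "graded_complex QD (dual_pr Q)"
proof (rule dual_graded_complex)
  fix x f g assume x: "x \<in> gens Q" and f: "f \<in> dgcar QD" and g: "g \<in> dgcar QD"
    and fg: "\<And>y. y \<in> gens Q \<Longrightarrow> gdeg Q y = gdeg Q x - 1 \<Longrightarrow> f y = g y"
  show "ev f (gdif Q x) = ev g (gdif Q x)"
    unfolding ev_gdif_Q[OF f x] ev_gdif_Q[OF g x]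
  proof (rule dQ_cong)
    fix z assume z: "ok z" "wd z = wd (enc x) - 1"
    show "f (dec z) = g (dec z)"
    proof (cases "rdc z")
      case True
      then show ?thesis using fg[of "dec z"] z by (simp add: gens_Q)
    qed (use dual_Q_zero[OF f] dual_Q_zero[OF g] in simp)
  qed (use x in \<open>simp add: gens_Q\<close>)
next
  fix f x assume f: "f \<in> dgcar QD" and df: "dgdif QD f \<in> dgcar QD" and x: "x \<in> gens Q"
  let ?u = "enc x"
  have u: "ok ?u" using x by (simp add: gens_Q)
  have "dQ ?u (\<lambda>z. dgdif QD f (dec z)) = dQ ?u (\<lambda>z. sgnp (wd ?u - 1) * dQ z (\<lambda>z. f (dec z)))"
    by (rule dQ_cong[OF u]) (simp add: dual_Q_dif[OF f])
  also have "\<dots> = 0" by (simp add: dQ_lin dQ_dQ[OF u])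
  finally show "dgdif QD (dgdif QD f) x = 0" using dual_Q_dif[OF df u] by simp
qed

abbreviation "cp \<equiv> cup K (shuffle_diag C)"

lemma cup_cnv:
  assumes f: "f \<in> dgcar QD" and g: "g \<in> dgcar QD" and u: "ok u"
  shows "cp f g (dec u) = cnv (\<lambda>u. f (dec u)) (\<lambda>u. g (dec u)) u"
proof (cases "rdc u")
  case True
  then show ?thesis using cup_Diag[OF f g, of "dec u"] u by (simp add: gens_Q cnv_def)
next
  case False
  have "cnv (\<lambda>u. f (dec u)) (\<lambda>u. g (dec u)) u = 0"
    unfolding cnv_def by (rule Diag_not_rdc[OF _ False]) (auto simp: dual_Q_zero[OF f] dual_Q_zero[OF g])
  moreover have "dec u \<notin> gens Q" using False by (simp add: gens_Q)
  ultimately show ?thesis by (simp add: cup_def)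
qed

lemma cup_supp:
  assumes f: "f \<in> dgcar QD" and g: "g \<in> dgcar QD" and x: "cp f g x \<noteq> 0"
  shows "x \<in> gens Q \<and> (\<exists>y z. f y \<noteq> 0 \<and> g z \<noteq> 0 \<and> gdeg Q y + gdeg Q z = gdeg Q x)"
proof -
  have xg: "x \<in> gens Q" using x by (auto simp: cup_def split: if_splits)
  then have u: "ok (enc x)" by (simp add: gens_Q)
  have "\<exists>l r. wd l + wd r = wd (enc x) \<and> f (dec l) * g (dec r) \<noteq> 0"
    using cnv_0[OF _ u, of "\<lambda>u. f (dec u)" "\<lambda>u. g (dec u)"] cup_cnv[OF f g u] x by auto
  then obtain l r where lr: "wd l + wd r = wd (enc x)" "f (dec l) * g (dec r) \<noteq> 0" by blast
  then have "f (dec l) \<noteq> 0" "g (dec r) \<noteq> 0" by auto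
  then show ?thesis using xg lr(1) by (intro conjI exI[of _ "dec l"] exI[of _ "dec r"]) simp_all
qed

lemma cup_cycle:
  assumes f: "f \<in> dgcycles QD" and g: "g \<in> dgcycles QD"
  shows "cp f g \<in> dgcycles QD"
proof -
  have fc: "f \<in> dgcar QD" and gc: "g \<in> dgcar QD" using f g by (auto simp: dgcycles_def)
  have cc: "cp f g \<in> dgcar QD" by (rule dual_product_car[OF fc gc cup_supp[OF fc gc]])
  have z: "dQ u (\<lambda>u. h (dec u)) = 0" if h: "h \<in> dgcycles QD" and u: "ok u" for h u
  proof -
    have "sgnp (wd u) * (sgnp (wd u) * dQ u (\<lambda>u. h (dec u))) = 0"
      using dual_Q_dif[of h u] h u by (simp add: dgcycles_def)
    then show ?thesis by (simp only: sgn_norm)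
  qed
  have "dgdif QD (cp f g) x = 0" for x
  proof (cases "x \<in> gens Q")
    case True
    then have u: "ok (enc x)" by (simp add: gens_Q)
    have "dQ (enc x) (\<lambda>u. cp f g (dec u)) = dQ (enc x) (cnv (\<lambda>u. f (dec u)) (\<lambda>u. g (dec u)))"
      by (rule dQ_cong[OF u]) (simp add: cup_cnv[OF fc gc])
    also have "\<dots> = 0"
    proof -
      have "cnv (\<lambda>l. dQ l (\<lambda>u. f (dec u))) (\<lambda>r. sgnp (wd r) * g (dec r)) (enc x) = 0"
        by (rule cnv_0[OF _ u]) (simp add: z[OF f])
      moreover have "cnv (\<lambda>u. f (dec u)) (\<lambda>r. dQ r (\<lambda>u. g (dec u))) (enc x) = 0"
        by (rule cnv_0[OF _ u]) (simp add: z[OF g])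
      ultimately show ?thesis by (simp add: dQ_cnv[OF u])
    qed
    finally show ?thesis using dual_Q_dif[OF cc u] by simp
  qed (simp add: dual_simps)
  then show ?thesis using cc by (simp add: dgcycles_def fun_eq_iff)
qed

lemma nabla_dual_eq: "nabla_dual C f x = (if x \<in> gens T then nab (\<lambda>u. f (dec u)) x else 0)"
  by (simp only: nabla_dual_def ev_nabla)

lemma nabla_dual_supp:
  assumes "nabla_dual C f x \<noteq> 0"
  shows "x \<in> gens T \<and> (\<exists>y. f y \<noteq> 0 \<and> gdeg Q y = gdeg T x)"
proof -
  obtain c a where ca: "x = (c, a)" "c \<in> gens C" "a \<in> lists Cb" using assms by (auto simp: nabla_dual_eq split: if_splits)
  have "\<exists>u. wd u = gdeg C c + cd a \<and> f (dec u) \<noteq> 0"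
  proof (rule ccontr)
    assume n: "\<not> (\<exists>u. wd u = gdeg C c + cd a \<and> f (dec u) \<noteq> 0)"
    have "nab (\<lambda>u. f (dec u)) (c, a) = nab (\<lambda>u. 0) (c, a)" by (rule nab_cong[OF ca(2,3)]) (use n in blast)
    then show False using assms ca by (simp add: nabla_dual_eq nab_lin)
  qed
  then obtain u where "wd u = gdeg C c + cd a" "f (dec u) \<noteq> 0" by blast
  then show ?thesis using ca by (intro conjI exI[of _ "dec u"]) simp_all
qed

lemma nabla_dual_dif:
  assumes f: "f \<in> dgcar QD"
  shows "nabla_dual C (dgdif QD f) = dgdif TD (nabla_dual C f)"
proof
  fix x show "nabla_dual C (dgdif QD f) x = dgdif TD (nabla_dual C f) x"
  proof (cases "x \<in> gens T")
    case True
    then obtain c a where ca: "x = (c, a)" "c \<in> gens C" "a \<in> lists Cb" by auto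
    have "nab (\<lambda>u. dgdif QD f (dec u)) (c, a) = nab (\<lambda>u. sgnp (gdeg T x) * dQ u (\<lambda>u. f (dec u))) (c, a)"
      by (rule nab_cong[OF ca(2,3)]) (simp add: dual_Q_dif[OF f] ca(1))
    also have "\<dots> = sgnp (gdeg T x) * dT (nab (\<lambda>u. f (dec u))) (c, a)"
      unfolding nab_lin nab_dif[OF ca(2,3)] dT_def ..
    also have "dT (nab (\<lambda>u. f (dec u))) (c, a) = dT (nabla_dual C f) (c, a)"
      by (rule dT_cong[OF ca(2,3)]) (simp add: nabla_dual_eq)
    finally show ?thesis using True ca by (simp add: TD_dif nabla_dual_eq)
  qed (simp add: nabla_dual_eq dual_simps)
qed

lemma nabla_dual_chain: "chain_map QD TD (nabla_dual C)"
  unfolding chain_map_def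
proof (intro conjI ballI allI)
  fix f g a n
  show "f \<in> dgcar QD \<Longrightarrow> nabla_dual C f \<in> dgcar TD" by (rule dual_map_car[OF _ nabla_dual_supp])
  show "f \<in> dgcomp QD n \<Longrightarrow> nabla_dual C f \<in> dgcomp TD n" by (rule dual_map_comp[OF _ nabla_dual_supp])
  show "nabla_dual C (f + g) = nabla_dual C f + nabla_dual C g"
    by (rule ext) (simp add: nabla_dual_eq nab_lin)
  show "nabla_dual C (dgscl QD a f) = dgscl TD a (nabla_dual C f)"
    by (rule ext) (simp add: nabla_dual_eq nab_lin dual_simps)
qed (rule nabla_dual_dif)

text \<open>
  The transpose of \<open>\<pi>\<close> as a map from the dual of \<open>C \<otimes> \<Omega>C\<close> to that of the cyclic bar construction.  It is
  a section of \<open>\<nabla>\<^sup>\<or>\<close> and a chain map, so that \<open>\<nabla>\<^sup>\<or>\<close> is surjective in homology.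
\<close>

definition lft :: "('b \<times> 'b list \<Rightarrow> 'k) \<Rightarrow> 'b list \<times> 'b list list \<Rightarrow> 'k" where
  "lft h x = (if x \<in> gens Q then piw h (enc x) else 0)"

lemma lft_dec: "ok u \<Longrightarrow> lft h (dec u) = piw h u"
  using piw_not_rdc[of u h] by (cases "rdc u") (simp_all add: lft_def gens_Q)

lemma piw_0: "piw (\<lambda>z. 0) u = 0"
  by (simp add: piw_def pw_def sp_lin split: list.split)

lemma lft_supp:
  assumes "lft h x \<noteq> 0"
  shows "x \<in> gens Q \<and> (\<exists>y. h y \<noteq> 0 \<and> gdeg T y = gdeg Q x)"
proof -
  have x: "x \<in> gens Q" "piw h (enc x) \<noteq> 0" using assms by (auto simp: lft_def split: if_splits)
  have "\<exists>y. h y \<noteq> 0 \<and> gdeg T y = gdeg Q x"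
  proof (rule ccontr)
    assume n: "\<not> (\<exists>y. h y \<noteq> 0 \<and> gdeg T y = gdeg Q x)"
    have "piw h (enc x) = piw (\<lambda>z. 0) (enc x)"
    proof (rule piw_cong_deg)
      fix c a assume "gdeg C c + cd a = wd (enc x)"
      then have "gdeg T (c, a) = gdeg Q x" by simp
      then show "h (c, a) = 0" using n by blast
    qed (use x in \<open>simp add: gens_Q\<close>)
    then show False using x by (simp add: piw_0)
  qed
  then show ?thesis using x by blast
qed

lemma lft_car: "h \<in> dgcar TD \<Longrightarrow> lft h \<in> dgcar QD"
  by (rule dual_map_car[OF _ lft_supp])

lemma lft_dif:
  assumes h: "h \<in> dgcar TD" and u: "ok u"
  shows "dgdif QD (lft h) (dec u) = sgnp (wd u) * piw (dT h) u"
proof -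
  have "dQ u (\<lambda>u. lft h (dec u)) = dQ u (piw h)" by (rule dQ_cong[OF u]) (simp add: lft_dec)
  then show ?thesis using dual_Q_dif[OF lft_car[OF h] u] dQ_piw[OF u] by simp
qed

lemma nabla_lft: "h \<in> dgcar TD \<Longrightarrow> nabla_dual C (lft h) = h"
proof
  fix x assume h: "h \<in> dgcar TD"
  show "nabla_dual C (lft h) x = h x"
  proof (cases "x \<in> gens T")
    case True
    then obtain c a where ca: "x = (c, a)" "c \<in> gens C" "a \<in> lists Cb" by auto
    have "nab (\<lambda>u. lft h (dec u)) (c, a) = nab (piw h) (c, a)" by (rule nab_cong[OF ca(2,3)]) (simp add: lft_dec)
    then show ?thesis using True ca by (simp add: nabla_dual_eq nab_piw)
  next
    case False
    then show ?thesis using dual_off[OF h False] False by (simp only: nabla_dual_eq if_False simp_thms)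
  qed
qed

lemma lft_cycle: "h \<in> dgcycles TD \<Longrightarrow> lft h \<in> dgcycles QD"
proof -
  assume h: "h \<in> dgcycles TD"
  then have hc: "h \<in> dgcar TD" by (simp add: dgcycles_def)
  have "dgdif QD (lft h) x = 0" for x
  proof (cases "x \<in> gens Q")
    case True
    then have u: "ok (enc x)" by (simp add: gens_Q)
    have "piw (dT h) (enc x) = piw (\<lambda>z. 0) (enc x)" by (rule piw_cong_deg[OF u]) (rule TD_cycle[OF h])
    then show ?thesis using lft_dif[OF hc u] by (simp add: piw_0)
  qed (simp add: dual_simps)
  then show ?thesis using lft_car[OF hc] by (simp add: dgcycles_def fun_eq_iff)
qed

lemma nabla_exact:
  assumes f: "f \<in> dgcycles QD" and 0: "nabla_dual C f = 0"
  shows "f \<in> boundaries QD"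
proof -
  let ?F = "\<lambda>u. f (dec u)"
  have fc: "f \<in> dgcar QD" using f by (simp add: dgcycles_def)
  obtain S where S: "finite S" "\<forall>x. f x \<noteq> 0 \<longrightarrow> x \<in> gens Q \<and> gdeg Q x \<in> S" using dual_supp[OF fc] .
  have "\<exists>G. (\<forall>z. \<not> (ok z \<and> rdc z) \<longrightarrow> G z = 0) \<and> (\<forall>z. G z \<noteq> 0 \<longrightarrow> wd z + 1 \<in> S) \<and> (\<forall>u. ok u \<longrightarrow> dQ u G = ?F u)"
  proof (rule exact)
    show "?F z = 0" if "\<not> (ok z \<and> rdc z)" for z by (rule dual_Q_zero[OF fc that])
    show "dQ u ?F = 0" if u: "ok u" for u
    proof -
      have "sgnp (wd u) * (sgnp (wd u) * dQ u ?F) = 0"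
        using dual_Q_dif[OF fc u] f by (simp add: dgcycles_def)
      then show ?thesis by (simp only: sgn_norm)
    qed
    show "nab ?F (c, a) = 0" if "c \<in> gens C" "a \<in> lists Cb" for c a
      using fun_cong[OF 0, of "(c, a)"] that by (simp add: nabla_dual_eq)
    show "wd z \<in> S" if "?F z \<noteq> 0" for z using S(2)[rule_format, OF that] by simp
  qed (rule S(1))
  then obtain G where G: "\<And>z. \<not> (ok z \<and> rdc z) \<Longrightarrow> G z = 0" "\<And>z. G z \<noteq> 0 \<Longrightarrow> wd z + 1 \<in> S" "\<And>u. ok u \<Longrightarrow> dQ u G = ?F u"
    by metis
  \<comment> \<open>the sign turns \<open>dQ\<close> into the differential of the dual complex\<close>
  define b where "b x = - sgnp (wd (enc x)) * G (enc x)" for x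
  have b: "b \<in> dgcar QD"
  proof (rule dual_car_supp)
    show "finite ((\<lambda>n. n - 1) ` S)" using S(1) by simp
    fix x assume "b x \<noteq> 0"
    then have "G (enc x) \<noteq> 0" by (auto simp: b_def)
    then have "x \<in> gens Q" "wd (enc x) + 1 \<in> S" using G(1,2) by (auto simp: gens_Q)
    then show "x \<in> gens Q \<and> gdeg Q x \<in> (\<lambda>n. n - 1) ` S" by (auto intro!: image_eqI[of _ _ "wd (enc x) + 1"])
  qed
  have "dgdif QD b x = f x" for x
  proof (cases "x \<in> gens Q")
    case True
    then have u: "ok (enc x)" by (simp add: gens_Q)
    have "dQ (enc x) (\<lambda>u. b (dec u)) = dQ (enc x) (\<lambda>z. sgnp (wd (enc x)) * G z)"
    proof (rule dQ_cong[OF u])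
      fix z assume d: "wd z = wd (enc x) - 1"
      show "b (dec z) = sgnp (wd (enc x)) * G z" by (simp add: b_def d sgn_norm)
    qed
    also have "\<dots> = sgnp (wd (enc x)) * f x" unfolding dQ_lin(4) by (simp add: G(3)[OF u])
    finally show ?thesis using dual_Q_dif[OF b u] by (simp add: sgn_norm)
  next
    case False
    then show ?thesis using dual_off[OF fc False] by (simp add: dual_simps)
  qed
  then have "f = dgdif QD b" by (simp add: fun_eq_iff)
  then show ?thesis using b by (auto simp: boundaries_def)
qed

definition eQ :: "'b list \<times> 'b list list \<Rightarrow> 'k" where
  "eQ x = (if x = (aunit K, []) then 1 else 0)"

lemma eQ_dec: "eQ (dec u) = uQ u"
proof -
  have "dec u = ([], []) \<longleftrightarrow> u = []" using enc_dec[of u] by (auto simp: enc_def)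
  then show ?thesis by (simp add: eQ_def uQ_def)
qed

text \<open>
  Injectivity: if \<open>\<nabla>\<^sup>\<or>x\<close> bounds \<open>h\<close>, then \<open>x\<close> minus the boundary of the lift of \<open>h\<close> vanishes on the image of
  \<open>\<nabla>\<close>, and \<open>nabla_exact\<close> applies.
\<close>

theorem nabla_comparison: "homology_comparison QD (dual_pr Q) TD (dual_pr T) tprod uT (nabla_dual C) cp eQ"
proof -
  interpret M: graded_complex QD "dual_pr Q" by (rule QD_graded)
  interpret N: homology_product TD "dual_pr T" tprod uT by (rule TD_product)
  have ec: "eQ \<in> dgcomp QD 0" by (auto simp: dual_simps eQ_def gens_Q enc_def)
  have eQ_eq: "(\<lambda>u. eQ (dec u)) = uQ" by (rule ext) (rule eQ_dec)
  have sur: "lft z \<in> dgcycles QD" "homologous TD (nabla_dual C (lft z)) z" if "z \<in> dgcycles TD" for z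
    using lft_cycle[OF that] nabla_lft[of z] that by (simp_all add: dgcycles_def)
  show ?thesis
  proof
    fix x y assume x: "x \<in> dgcycles QD" and y: "y \<in> dgcycles QD"
    show "cp x y \<in> dgcycles QD" by (rule cup_cycle[OF x y])
    have xc: "x \<in> dgcar QD" "y \<in> dgcar QD" using x y by (auto simp: dgcycles_def)
    { fix i j assume "x \<in> dgcomp QD i" "y \<in> dgcomp QD j"
      then show "cp x y \<in> dgcomp QD (i + j)" by (rule dual_product_comp[OF _ _ cup_supp[OF xc]]) }
    show "nabla_dual C (cp x y) = tprod (nabla_dual C x) (nabla_dual C y)"
    proof
      fix w show "nabla_dual C (cp x y) w = tprod (nabla_dual C x) (nabla_dual C y) w"
      proof (cases "w \<in> gens T")
        case True
        then obtain c a where ca: "w = (c, a)" "c \<in> gens C" "a \<in> lists Cb" by auto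
        let ?F = "\<lambda>u. x (dec u)" and ?G = "\<lambda>u. y (dec u)"
        have "nab (\<lambda>u. cp x y (dec u)) (c, a) = nab (cnv ?F ?G) (c, a)"
          by (rule nab_cong[OF ca(2,3)]) (rule cup_cnv[OF xc])
        also have "\<dots> = tmul (nab ?F) (nab ?G) (c, a)" unfolding cnv_def
          by (rule nab_Diag[OF ca(2)]) (simp_all add: dual_Q_zero xc)
        also have "\<dots> = tmul (nabla_dual C x) (nabla_dual C y) (c, a)"
          by (rule tmul_cong[OF ca(2,3)]) (simp_all add: nabla_dual_eq)
        finally show ?thesis using True ca(1) by (simp add: nabla_dual_eq tprod_def)
      qed (simp add: nabla_dual_eq tprod_def)
    qed
  next
    fix x assume x: "x \<in> dgcycles QD" and "nabla_dual C x \<in> boundaries TD"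
    then obtain h where h: "h \<in> dgcar TD" "nabla_dual C x = dgdif TD h" by (auto simp: boundaries_def)
    let ?d = "dgdif QD (lft h)"
    have d: "?d \<in> boundaries QD" using lft_car[OF h(1)] by (auto simp: boundaries_def)
    have "nabla_dual C (x - ?d) = nabla_dual C x - nabla_dual C ?d"
      using nab_lin(1)[of "\<lambda>u. (x - ?d) (dec u)" "\<lambda>u. ?d (dec u)"] by (intro ext) (simp add: nabla_dual_eq)
    also have "\<dots> = 0" by (simp add: h nabla_dual_dif[OF lft_car[OF h(1)]] nabla_lft)
    finally have "x - ?d \<in> boundaries QD" by (rule nabla_exact[OF M.cyc_diff[OF x M.bd_cycle[OF d]]])
    then show "x \<in> boundaries QD" using M.bd_add[OF _ d, of "x - ?d"] by simp
  next
    fix z assume "z \<in> dgcycles TD"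
    then show "\<exists>x\<in>dgcycles QD. homologous TD (nabla_dual C x) z" using sur by blast
  next
    fix z n assume z: "z \<in> dgcycles TD" "z \<in> dgcomp TD n"
    have "lft z \<in> dgcomp QD n" by (rule dual_map_comp[OF z(2) lft_supp])
    then show "\<exists>x\<in>dgcycles QD. x \<in> dgcomp QD n \<and> homologous TD (nabla_dual C x) z" using sur[OF z(1)] by blast
  next
    show "eQ \<in> dgcomp QD 0" by (rule ec)
    have "dgdif QD eQ x = 0" for x
    proof (cases "x \<in> gens Q")
      case True
      then show ?thesis using dual_Q_dif[OF M.comp_car[OF ec], of "enc x"] by (simp add: gens_Q eQ_eq dQ_uQ)
    qed (simp add: dual_simps)
    then show "eQ \<in> dgcycles QD" using M.comp_car[OF ec] by (simp add: dgcycles_def fun_eq_iff)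
    show "nabla_dual C eQ = uT"
    proof
      fix x show "nabla_dual C eQ x = uT x"
      proof (cases "x \<in> gens T")
        case True
        then show ?thesis by (auto simp: nabla_dual_eq eQ_eq nab_uQ)
      next
        case False
        then have "x \<noteq> (one, [])" using coaug_gen by auto
        then show ?thesis using False by (simp add: nabla_dual_eq uT_def)
      qed
    qed
  qed (rule nabla_dual_chain)
qed

end


section \<open>Hochschild homology of the dual algebra\<close>

lemma keys_bar_word:
  "(\<And>p. p \<in> set ps \<Longrightarrow> Poly_Mapping.keys p \<subseteq> S) \<Longrightarrow> w \<in> Poly_Mapping.keys (bar_word A ps)
    \<Longrightarrow> set w \<subseteq> S - {aunit A}"
proof (induction ps arbitrary: w)
  case (Cons p ps)
  obtain x where x: "x \<in> Poly_Mapping.keys p"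
    "w \<in> Poly_Mapping.keys (if x = aunit A then 0 else lext (\<lambda>v. bv (x # v)) (bar_word A ps))"
    using keys_lext[OF Cons.prems(2)[unfolded bar_word.simps(2)]] by (rule bexE)
  have n: "x \<noteq> aunit A" using x(2) by (cases "x = aunit A") simp_all
  obtain v where v: "v \<in> Poly_Mapping.keys (bar_word A ps)" "w \<in> Poly_Mapping.keys (bv (x # v) :: 'a list \<Rightarrow>\<^sub>0 'b)"
    using keys_lext[OF x(2)[unfolded if_not_P[OF n]]] by (rule bexE)
  then have "w = x # v" by (simp add: bv_def split: if_splits)
  then show ?case using Cons.IH[OF _ v(1)] Cons.prems(1) x(1) n by auto
qed (simp add: bv_def)

lemma keys_cchain:
  assumes "Poly_Mapping.keys p \<subseteq> gens A" "\<And>q. q \<in> set ps \<Longrightarrow> Poly_Mapping.keys q \<subseteq> gens A"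
  shows "Poly_Mapping.keys (cchain A p ps) \<subseteq> gens (cyclic A)"
proof clarify
  fix a w assume "(a, w) \<in> Poly_Mapping.keys (cchain A p ps)"
  then have "Poly_Mapping.lookup p a * Poly_Mapping.lookup (bar_word A ps) w \<noteq> 0"
    by (simp add: cchain_def in_keys_iff lookup_tens)
  then have a: "a \<in> Poly_Mapping.keys p" and w: "w \<in> Poly_Mapping.keys (bar_word A ps)" by (auto simp: in_keys_iff)
  have "a \<in> gens A" using assms(1) a by (rule subsetD)
  moreover have "set w \<subseteq> gens A - {aunit A}" by (rule keys_bar_word[OF _ w]) (rule assms(2))
  ultimately show "(a, w) \<in> gens (cyclic A)" by (simp add: cyclic_def)
qed

lemma keys_add_subset:
  "Poly_Mapping.keys p \<subseteq> S \<Longrightarrow> Poly_Mapping.keys q \<subseteq> S \<Longrightarrow> Poly_Mapping.keys (p + q) \<subseteq> S"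
  by (rule order_trans[OF Poly_Mapping.keys_add]) simp

lemma keys_scl_subset: "Poly_Mapping.keys p \<subseteq> S \<Longrightarrow> Poly_Mapping.keys (scl a p) \<subseteq> S"
  by (rule order_trans[of _ "Poly_Mapping.keys p"]) (auto simp: in_keys_iff)

lemma keys_sum_subset:
  "(\<And>i. i \<in> I \<Longrightarrow> Poly_Mapping.keys (r i) \<subseteq> S) \<Longrightarrow> Poly_Mapping.keys (sum r I) \<subseteq> S"
  by (induction I rule: infinite_finite_induct) (simp_all add: keys_add_subset)

lemmas keys_subset = keys_add_subset keys_scl_subset keys_sum_subset

context comparison_setting
begin

abbreviation "X \<equiv> cyclic DA"
abbreviation "XF \<equiv> free_cx X"

lemma gens_X: "gens X = gens T"
  by (auto simp: cyclic_def)

lemma bar_deg_DA: "bar_deg DA us = - cd us"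
  by (induction us) (simp_all add: bar_deg_def)

lemma gdeg_X: "gdeg X x = - gdeg T x"
  by (cases x) (simp add: cyclic_def bar_deg_DA)

lemma keys_DA: "Poly_Mapping.keys (gdif DA b) \<subseteq> gens C" "Poly_Mapping.keys (amul DA b c) \<subseteq> gens C"
  by (auto simp: in_keys_iff lk_gdif_DA lk_amul_DA split: if_splits)

lemma keys_cyclic_DA:
  assumes "(b, bs) \<in> gens X"
  shows "Poly_Mapping.keys (cyclic_dif DA (b, bs)) \<subseteq> gens X"
proof -
  have b: "Poly_Mapping.keys (bv b :: 'b \<Rightarrow>\<^sub>0 'k) \<subseteq> gens C" and bs: "set bs \<subseteq> gens C"
    using assms by (auto simp: cyclic_def bv_def)
  have v: "Poly_Mapping.keys q \<subseteq> gens C" if "q \<in> set (map bv bs)" for q :: "'b \<Rightarrow>\<^sub>0 'k"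
    using that bs by (auto simp: bv_def)
  have vt: "Poly_Mapping.keys q \<subseteq> gens C" if "q \<in> set (take i (map bv bs))" for q :: "'b \<Rightarrow>\<^sub>0 'k" and i
    by (rule v) (use that in_set_takeD in fast)
  have vd: "Poly_Mapping.keys q \<subseteq> gens C" if "q \<in> set (drop i (map bv bs))" for q :: "'b \<Rightarrow>\<^sub>0 'k" and i
    by (rule v) (use that in_set_dropD in fast)
  have m: "Poly_Mapping.keys q \<subseteq> gens C"
    if q: "q \<in> set (take i (map bv bs) @ [r] @ drop j (map bv bs))" and rk: "Poly_Mapping.keys r \<subseteq> gens C" for q r :: "'b \<Rightarrow>\<^sub>0 'k" and i j
  proof -
    consider "q \<in> set (take i (map bv bs))" | "q = r" | "q \<in> set (drop j (map bv bs))" using q by auto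
    then show ?thesis
    proof cases
      case 1
      then show ?thesis by (rule vt)
    next
      case 2
      then show ?thesis using rk by simp
    next
      case 3
      then show ?thesis by (rule vd)
    qed
  qed
  have 1: "Poly_Mapping.keys (cchain DA p qs) \<subseteq> gens X"
    if "Poly_Mapping.keys p \<subseteq> gens C" "\<And>q. q \<in> set qs \<Longrightarrow> Poly_Mapping.keys q \<subseteq> gens C" for p qs
    by (rule keys_cchain) (use that in simp_all)
  have zero: "Poly_Mapping.keys (cchain DA (gdif DA p) (map bv bs)) \<subseteq> gens X" for p
    by (rule 1[OF keys_DA(1)]) (erule v)
  have first: "Poly_Mapping.keys (cchain DA (amul DA p q) (drop i (map bv bs))) \<subseteq> gens X" for p q i
    by (rule 1[OF keys_DA(2)]) (erule vd)
  have last: "Poly_Mapping.keys (cchain DA (amul DA p q) (take i (map bv bs))) \<subseteq> gens X" for p q i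
    by (rule 1[OF keys_DA(2)]) (erule vt)
  have mid: "Poly_Mapping.keys (cchain DA (bv b) (take i (map bv bs) @ [r] @ drop j (map bv bs))) \<subseteq> gens X"
    if rk: "Poly_Mapping.keys r \<subseteq> gens C" for i j r
    by (rule 1[OF b]) (erule m[OF _ rk])
  have if0: "Poly_Mapping.keys (if P then 0 else q) \<subseteq> S"
    if "Poly_Mapping.keys q \<subseteq> S" for P and q :: "('b \<times> 'b list) \<Rightarrow>\<^sub>0 'k" and S
    using that by simp
  show ?thesis
    unfolding cyclic_dif_def Let_def prod.case
    by (intro keys_subset if0 zero first last mid keys_DA)
qed

lemma lk_twisted_deg:
  assumes y: "y \<in> gens T" and l: "lk (twisted_dif C y) x \<noteq> 0"
  shows "gdeg T x = gdeg T y - 1"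
proof (rule ccontr)
  assume n: "gdeg T x \<noteq> gdeg T y - 1"
  obtain c a where ca: "y = (c, a)" "c \<in> gens C" "a \<in> lists Cb" using y by auto
  have "dT (\<lambda>z. if z = x then 1 else 0) (c, a) = dT (\<lambda>z. 0) (c, a)"
    by (rule dT_cong[OF ca(2,3)]) (use n ca(1) in auto)
  then show False using l by (simp add: dT_def lookup_eq_ev ca)
qed

lemma keys_X_dif:
  assumes x: "x \<in> gens X" and y: "y \<in> Poly_Mapping.keys (gdif X x)"
  shows "y \<in> gens X \<and> gdeg X y = gdeg X x - 1"
proof -
  have gX: "gdif X = cyclic_dif DA" by (simp add: cyclic_def)
  have yg: "y \<in> gens X" using keys_cyclic_DA[of "fst x" "snd x"] x y by (auto simp: gX)
  obtain b bs c cs where e: "x = (b, bs)" "y = (c, cs)" by (cases x; cases y)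
  have "(c, cs) \<in> gens T" using yg unfolding gens_X e .
  note tr = dif_transpose[OF x[unfolded e] this]
  have "eT (c, cs) * (eT (c, cs) * lk (cyclic_dif DA (b, bs)) (c, cs)) \<noteq> 0"
    unfolding eT_self using y by (simp add: gX e in_keys_iff)
  then have "lk (twisted_dif C (c, cs)) (b, bs) \<noteq> 0" unfolding tr by auto
  then have "gdeg T (b, bs) = gdeg T (c, cs) - 1" by (rule lk_twisted_deg[OF \<open>(c, cs) \<in> gens T\<close>])
  then have "gdeg X y = gdeg X x - 1" unfolding gdeg_X e by linarith
  with yg show ?thesis by (rule conjI)
qed

lemma XF_car: "p \<in> dgcar XF \<longleftrightarrow> Poly_Mapping.keys p \<subseteq> gens X"
  and XF_comp: "p \<in> dgcomp XF n \<longleftrightarrow> Poly_Mapping.keys p \<subseteq> {x \<in> gens X. gdeg X x = n}"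
  and XF_dif: "dgdif XF = lext (cyclic_dif DA)"
  and XF_scl: "dgscl XF = scl"
  by (simp_all add: free_cx_def) (simp add: cyclic_def)

lemma PhiTheta_nz: "PhiTheta C p x \<noteq> 0 \<longleftrightarrow> lk p x \<noteq> 0"
proof
  assume "lk p x \<noteq> 0"
  moreover have "eT x * PhiTheta C p x = lk p x" unfolding PhiTheta_eq using eT_self(2)[of x "lk p x"] by (simp add: ac_simps)
  ultimately show "PhiTheta C p x \<noteq> 0" by auto
qed (auto simp: PhiTheta_eq)

lemma PhiTheta_lin:
  "PhiTheta C (p + q) = PhiTheta C p + PhiTheta C q"
  "PhiTheta C (scl a p) = dgscl TD a (PhiTheta C p)"
  "PhiTheta C (p - q) = PhiTheta C p - PhiTheta C q"
  by (rule ext; simp add: PhiTheta_eq lookup_add lookup_minus algebra_simps dual_simps)+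

lemma PhiTheta_inj: "PhiTheta C p = PhiTheta C q \<Longrightarrow> p = q"
proof (rule poly_mapping_eqI)
  fix x assume "PhiTheta C p = PhiTheta C q"
  then have "PhiTheta C (p - q) x = 0" by (simp add: PhiTheta_lin)
  then have "lk (p - q) x = 0" using PhiTheta_nz by blast
  then show "lk p x = lk q x" by (simp add: lookup_minus)
qed

lemma PhiTheta_car: "p \<in> dgcar XF \<Longrightarrow> PhiTheta C p \<in> dgcar TD"
proof (rule dual_car_supp)
  show "finite (gdeg T ` Poly_Mapping.keys p)" by simp
  fix x assume "p \<in> dgcar XF" "PhiTheta C p x \<noteq> 0"
  then have "x \<in> Poly_Mapping.keys p" "Poly_Mapping.keys p \<subseteq> gens T" by (auto simp: PhiTheta_nz in_keys_iff XF_car gens_X)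
  then show "x \<in> gens T \<and> gdeg T x \<in> gdeg T ` Poly_Mapping.keys p" by blast
qed

lemma PhiTheta_comp: "PhiTheta C p \<in> dgcomp TD n \<longleftrightarrow> p \<in> dgcomp XF n"
  unfolding dual_simps XF_comp PhiTheta_nz gens_X gdeg_X by (force simp: in_keys_iff simp del: T_simps)

lemma PhiTheta_dif: "p \<in> dgcar XF \<Longrightarrow> PhiTheta C (dgdif XF p) = dgdif TD (PhiTheta C p)"
proof
  fix x assume p: "p \<in> dgcar XF"
  show "PhiTheta C (dgdif XF p) x = dgdif TD (PhiTheta C p) x"
  proof (cases "x \<in> gens T")
    case True
    obtain c cs where x: "x = (c, cs)" by (cases x)
    have "PhiTheta C (dgdif XF p) x = ev (\<lambda>y. eT x * lk (cyclic_dif DA y) x) p"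
      unfolding PhiTheta_eq XF_dif lookup_lext ev_fun_mult by (rule mult.commute)
    also have "\<dots> = ev (\<lambda>y. sgnp (gdeg T x) * (lk (twisted_dif C x) y * eT y)) p"
    proof (rule ev_cong)
      fix y assume "y \<in> Poly_Mapping.keys p"
      then have y: "y \<in> gens X" using p by (auto simp: XF_car)
      obtain b bs where e: "y = (b, bs)" by (cases y)
      show "eT x * lk (cyclic_dif DA y) x = sgnp (gdeg T x) * (lk (twisted_dif C x) y * eT y)"
        unfolding x e using dif_transpose[OF y[unfolded e] True[unfolded x]] by (simp add: ac_simps)
    qed
    also have "\<dots> = sgnp (gdeg T x) * ev (PhiTheta C p) (twisted_dif C x)"
    proof -
      have "PhiTheta C p = (\<lambda>y. lk p y * eT y)" by (rule ext) (rule PhiTheta_eq)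
      then show ?thesis unfolding ev_fun_mult by (subst ev_exchange) (simp only:)
    qed
    also have "\<dots> = dgdif TD (PhiTheta C p) x" using True by (simp add: TD_dif dT_def)
    finally show ?thesis .
  next
    case False
    have "Poly_Mapping.keys (dgdif XF p) \<subseteq> gens T"
    proof
      fix y assume "y \<in> Poly_Mapping.keys (dgdif XF p)"
      then obtain z where "z \<in> Poly_Mapping.keys p" "y \<in> Poly_Mapping.keys (gdif X z)"
        unfolding XF_dif using keys_lext by (fastforce simp: cyclic_def)
      then show "y \<in> gens T" using keys_X_dif p unfolding XF_car gens_X by blast
    qed
    then have "lk (dgdif XF p) x = 0" using False by (auto simp: in_keys_iff)
    then show ?thesis using False by (simp add: PhiTheta_eq dual_simps)
  qed
qed

text \<open>
  That the Hochschild differential squares to zero is transported from the twisted tensor product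
  through the injective map \<open>PhiTheta\<close>.
\<close>

lemma XF_graded: "graded_complex XF (free_pr X)"
proof (rule free_graded_complex[OF keys_X_dif])
  interpret G: graded_complex TD "dual_pr T" by (rule TD_graded)
  fix p :: "('b \<times> 'b list) \<Rightarrow>\<^sub>0 'k" assume "Poly_Mapping.keys p \<subseteq> gens X"
  then have p: "p \<in> dgcar XF" by (simp add: XF_car)
  have dp: "dgdif XF p \<in> dgcar XF"
  proof -
    have "y \<in> gens X" if "y \<in> Poly_Mapping.keys (dgdif XF p)" for y
    proof -
      obtain z where "z \<in> Poly_Mapping.keys p" "y \<in> Poly_Mapping.keys (gdif X z)"
        using \<open>y \<in> _\<close> unfolding XF_dif using keys_lext by (fastforce simp: cyclic_def)
      then show ?thesis using keys_X_dif p unfolding XF_car by blast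
    qed
    then show ?thesis unfolding XF_car by blast
  qed
  have "PhiTheta C (dgdif XF (dgdif XF p)) = PhiTheta C 0"
    using G.dif_dif[OF PhiTheta_car[OF p]] by (simp add: PhiTheta_dif[OF dp] PhiTheta_dif[OF p] PhiTheta_eq fun_eq_iff)
  then have "dgdif XF (dgdif XF p) = 0" by (rule PhiTheta_inj)
  then show "lext (gdif X) (lext (gdif X) p) = 0" unfolding XF_dif by (simp add: cyclic_def)
qed

lemma word_deg: "a \<in> lists Cb \<Longrightarrow> int (length a) \<le> cd a \<and> (\<forall>c\<in>set a. gdeg C c \<le> cd a + 1)"
proof (induction a)
  case (Cons c a)
  then have "gdeg C c \<ge> 2" using deg_Cb by auto
  then show ?case using Cons by force
qed simp

text \<open>
  Letters have positive degree, which bounds the length of a word, and \<open>C\<close> has finite type.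
  Consequently forms in the graded dual have finite support, and every one of them comes from
  \<open>C(C\<^sup>\<or>)\<close>.
\<close>

lemma T_finite_type: "finite {x \<in> gens T. gdeg T x = n}"
proof -
  let ?S = "\<Union>i\<in>{0..n + 1}. {c \<in> gens C. gdeg C c = i}"
  have pos: "0 \<le> gdeg C c" if "c \<in> gens C" for c using that deg_Cb[of c] coaug_gen by (cases "c = one") auto
  have "{x \<in> gens T. gdeg T x = n} \<subseteq> ?S \<times> {a. set a \<subseteq> ?S \<and> length a \<le> nat n}"
  proof
    fix x assume x: "x \<in> {x \<in> gens T. gdeg T x = n}"
    obtain c a where ca: "x = (c, a)" by (cases x)
    have c: "c \<in> gens C" "a \<in> lists Cb" "gdeg C c + cd a = n" using x by (auto simp: ca)
    have w: "int (length a) \<le> cd a" "\<forall>c\<in>set a. gdeg C c \<le> cd a + 1" using word_deg[OF c(2)] by auto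
    have "d \<in> ?S" if "d \<in> set a" for d
    proof -
      have "d \<in> gens C" using that c(2) by auto
      then show ?thesis using w(2) that c(3) pos[OF c(1)] pos[of d] by fastforce
    qed
    moreover have "c \<in> ?S" using c w(1) pos[OF c(1)] by auto
    moreover have "length a \<le> nat n" using w(1) c(3) pos[OF c(1)] by linarith
    ultimately show "x \<in> ?S \<times> {a. set a \<subseteq> ?S \<and> length a \<le> nat n}" unfolding ca by blast
  qed
  moreover have S: "finite ?S" using fin by simp
  have "finite (?S \<times> {a. set a \<subseteq> ?S \<and> length a \<le> nat n})"
    by (rule finite_cartesian_product[OF S finite_lists_length_le[OF S]])
  ultimately show ?thesis by (rule finite_subset)
qed

lemma PhiTheta_surj:
  assumes f: "f \<in> dgcar TD"
  shows "\<exists>p. PhiTheta C p = f"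
proof -
  obtain S where S: "finite S" "\<forall>x. f x \<noteq> 0 \<longrightarrow> x \<in> gens T \<and> gdeg T x \<in> S" using dual_supp[OF f] .
  have "finite {x. f x * eT x \<noteq> 0}"
  proof (rule finite_subset)
    show "{x. f x * eT x \<noteq> 0} \<subseteq> (\<Union>n\<in>S. {x \<in> gens T. gdeg T x = n})"
    proof
      fix x assume "x \<in> {x. f x * eT x \<noteq> 0}"
      then have "f x \<noteq> 0" by auto
      then show "x \<in> (\<Union>n\<in>S. {x \<in> gens T. gdeg T x = n})" using S(2) by blast
    qed
  qed (use S(1) T_finite_type in blast)
  then have "lk (Poly_Mapping.Abs_poly_mapping (\<lambda>x. f x * eT x)) = (\<lambda>x. f x * eT x)"
    by (rule lookup_Abs_poly_mapping)
  then have "PhiTheta C (Poly_Mapping.Abs_poly_mapping (\<lambda>x. f x * eT x)) = f"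
    by (intro ext) (simp add: PhiTheta_eq mult.assoc eT_self)
  then show ?thesis by blast
qed

lemma PhiTheta_car_iff: "PhiTheta C p \<in> dgcar TD \<Longrightarrow> p \<in> dgcar XF"
proof -
  assume p: "PhiTheta C p \<in> dgcar TD"
  have "x \<in> gens X" if "x \<in> Poly_Mapping.keys p" for x
  proof (rule ccontr)
    assume "x \<notin> gens X"
    then have "PhiTheta C p x = 0" using dual_off[OF p] unfolding gens_X by blast
    then show False using that PhiTheta_nz[of p x] by (simp add: in_keys_iff)
  qed
  then show ?thesis unfolding XF_car by blast
qed

theorem PhiTheta_iso: "complex_iso XF TD (PhiTheta C)"
  unfolding complex_iso_def chain_map_def
proof (intro conjI ballI allI)
  show "bij_betw (PhiTheta C) (dgcar XF) (dgcar TD)"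
    unfolding bij_betw_def
  proof
    show "inj_on (PhiTheta C) (dgcar XF)" by (rule inj_onI) (rule PhiTheta_inj)
    show "PhiTheta C ` dgcar XF = dgcar TD"
      using PhiTheta_car PhiTheta_surj PhiTheta_car_iff by blast
  qed
  interpret G: graded_complex TD "dual_pr T" by (rule TD_graded)
  show "PhiTheta C ` dgcomp XF n = dgcomp TD n" for n
    using PhiTheta_comp[of _ n] PhiTheta_surj G.comp_car[of _ n] by blast
qed (use PhiTheta_comp in \<open>auto simp: PhiTheta_car PhiTheta_dif PhiTheta_lin XF_scl\<close>)

lemma shuffle_keys:
  assumes p: "p \<in> dgcar XF" and q: "q \<in> dgcar XF"
  shows "shuffle_mult DA p q \<in> dgcar XF"
proof -
  have "PhiTheta C (shuffle_mult DA p q) (c, cs) = 0" if n: "(c, cs) \<notin> gens T" for c cs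
  proof -
    have "lk (shuffle_mult DA p q) (c, cs) = ev (\<lambda>x. ev (\<lambda>y. 0) q) p"
      unfolding shuffle_mult_def lookup_lext ev_tens
    proof (intro ev_cong, goal_cases)
      case (1 x y)
      then have xy: "x \<in> gens T" "y \<in> gens T" using p q unfolding XF_car gens_X by auto
      obtain a xs b ys where e: "x = (a, xs)" "y = (b, ys)" by (cases x; cases y)
      have "lk (amul DA a b) c * lk (shuffle_word DA xs ys) cs = 0"
      proof (cases "c \<in> gens C")
        case True
        then have cs: "cs \<notin> lists Cb" using n by simp
        have "lk (Sh cs) (xs, ys) = ev (\<lambda>z. 0) (Sh cs)"
          unfolding lookup_eq_ev by (rule Sh_cong) (use xy cs in \<open>auto simp: e shr_def\<close>)
        then show ?thesis by (simp add: lk_shuffle_word)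
      qed (simp add: lk_amul_DA)
      then show ?case
        by (simp add: e lookup_tens)
    qed
    then show ?thesis by (simp add: PhiTheta_eq)
  qed
  then have "x \<in> gens X" if "x \<in> Poly_Mapping.keys (shuffle_mult DA p q)" for x
    using that PhiTheta_nz[of "shuffle_mult DA p q" x] unfolding gens_X by (cases x) (auto simp: in_keys_iff simp del: T_simps)
  then show ?thesis unfolding XF_car by blast
qed

lemma PhiTheta_tprod:
  assumes "p \<in> dgcar XF" "q \<in> dgcar XF"
  shows "PhiTheta C (shuffle_mult DA p q) = tprod (PhiTheta C p) (PhiTheta C q)"
proof
  fix x show "PhiTheta C (shuffle_mult DA p q) x = tprod (PhiTheta C p) (PhiTheta C q) x"
  proof (cases "x \<in> gens T")
    case True
    then show ?thesis by (cases x) (simp add: tprod_def PhiTheta_mult)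
  next
    case False
    then show ?thesis using dual_off[OF PhiTheta_car[OF shuffle_keys[OF assms]] False] by (simp only: tprod_def if_False)
  qed
qed

text \<open>
  As \<open>PhiTheta\<close> is bijective, cycles and boundaries on both sides correspond, and products of cycles are
  cycles because this holds in the dual of \<open>C \<otimes> \<Omega>C\<close>.
\<close>

theorem PhiTheta_comparison:
  "homology_comparison XF (free_pr X) TD (dual_pr T) tprod uT (PhiTheta C) (shuffle_mult DA) (bv (aunit DA, []))"
proof -
  interpret M: graded_complex XF "free_pr X" by (rule XF_graded)
  interpret N: homology_product TD "dual_pr T" tprod uT by (rule TD_product)
  have cyc: "p \<in> dgcycles XF \<longleftrightarrow> PhiTheta C p \<in> dgcycles TD" for p
  proof
    assume p: "p \<in> dgcycles XF"
    then have "dgdif TD (PhiTheta C p) = PhiTheta C 0" using PhiTheta_dif[of p] by (simp add: dgcycles_def)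
    then show "PhiTheta C p \<in> dgcycles TD" using p PhiTheta_car by (simp add: dgcycles_def PhiTheta_eq fun_eq_iff)
  next
    assume p: "PhiTheta C p \<in> dgcycles TD"
    then have pc: "p \<in> dgcar XF" using PhiTheta_car_iff by (simp add: dgcycles_def)
    have "PhiTheta C (dgdif XF p) = PhiTheta C 0" using p PhiTheta_dif[OF pc] by (simp add: dgcycles_def PhiTheta_eq fun_eq_iff)
    then show "p \<in> dgcycles XF" using PhiTheta_inj pc by (simp add: dgcycles_def)
  qed
  have unit: "PhiTheta C (bv (aunit DA, [])) = uT"
    by (rule ext) (auto simp: PhiTheta_eq lk_bv uT_def)
  have sur: "\<exists>p\<in>dgcycles XF. PhiTheta C p = z" if "z \<in> dgcycles TD" for z
    using PhiTheta_surj[OF N.cyc_car[OF that]] that cyc by auto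
  show ?thesis
  proof
    show "chain_map XF TD (PhiTheta C)" using PhiTheta_iso by (simp add: complex_iso_def)
    show "bv (aunit DA, []) \<in> dgcycles XF" unfolding cyc unit by (rule N.e_cyc)
    show "bv (aunit DA, []) \<in> dgcomp XF 0" unfolding PhiTheta_comp[symmetric] unit by (rule N.e_comp)
    show "PhiTheta C (bv (aunit DA, [])) = uT" by (rule unit)
  next
    fix z assume "z \<in> dgcycles TD"
    then show "\<exists>x\<in>dgcycles XF. homologous TD (PhiTheta C x) z" using sur N.heq_refl by blast
    fix n assume "z \<in> dgcomp TD n"
    then show "\<exists>x\<in>dgcycles XF. x \<in> dgcomp XF n \<and> homologous TD (PhiTheta C x) z"
      using sur[OF \<open>z \<in> dgcycles TD\<close>] N.heq_refl PhiTheta_comp by blast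
  next
    fix x y assume xy: "x \<in> dgcycles XF" "y \<in> dgcycles XF"
    then have m: "PhiTheta C (shuffle_mult DA x y) = tprod (PhiTheta C x) (PhiTheta C y)"
      by (intro PhiTheta_tprod M.cyc_car)
    then show "PhiTheta C (shuffle_mult DA x y) = tprod (PhiTheta C x) (PhiTheta C y)" .
    show "shuffle_mult DA x y \<in> dgcycles XF"
      unfolding cyc m using xy by (intro N.m_cyc) (simp_all add: cyc)
    { fix i j assume "x \<in> dgcomp XF i" "y \<in> dgcomp XF j"
      then show "shuffle_mult DA x y \<in> dgcomp XF (i + j)"
        unfolding PhiTheta_comp[symmetric] m using xy by (intro N.m_comp) (simp_all add: cyc) }
  next
    fix x assume x: "x \<in> dgcycles XF" and "PhiTheta C x \<in> boundaries TD"
    then obtain h where h: "h \<in> dgcar TD" "PhiTheta C x = dgdif TD h" by (auto simp: boundaries_def)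
    obtain k where k: "PhiTheta C k = h" using PhiTheta_surj[OF h(1)] by blast
    then have kc: "k \<in> dgcar XF" using PhiTheta_car_iff h by simp
    have "x = dgdif XF k" by (rule PhiTheta_inj) (simp add: h PhiTheta_dif[OF kc] k)
    then show "x \<in> boundaries XF" using kc by (auto simp: boundaries_def)
  qed
qed

end

section \<open>The comparison isomorphism is multiplicative\<close>

theorem theorem6p2:
  fixes C :: "('b, 'k::comm_ring_1) free_dgc"
  assumes "coaugmented_dgc C"
    and "finite_type C"
    and "simply_connected C"
    and "cocommutative C"
  shows "quasi_iso (dual_cx (cyclic (cobar C))) (dual_cx (twisted C)) (nabla_dual C)
    \<and> complex_iso (free_cx (cyclic (dual_dga C))) (dual_cx (twisted C)) (PhiTheta C)
    \<and> commutative_graded_algebra (HH_cohomology (cobar C) (shuffle_diag C))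
    \<and> commutative_graded_algebra (HH_homology (dual_dga C))
    \<and> graded_algebra_iso (HH_cohomology (cobar C) (shuffle_diag C)) (HH_homology (dual_dga C)) (HH_iso C)"
proof -
  interpret comparison_setting C
    using assms by (intro comparison_setting.intro cocommutative_setting.intro cocommutative_setting_axioms.intro
        finite_type_setting.intro finite_type_setting_axioms.intro cobar_setting.intro cobar_setting_axioms.intro)
  interpret Q: homology_comparison "dual_cx Q" "dual_pr Q" "dual_cx T" "dual_pr T" tprod uT "nabla_dual C" "cup K (shuffle_diag C)" eQ
    by (rule nabla_comparison)
  interpret X: homology_comparison "free_cx X" "free_pr X" "dual_cx T" "dual_pr T" tprod uT "PhiTheta C" "shuffle_mult DA" "bv (aunit DA, [])"
    by (rule PhiTheta_comparison)
  have Q: "HH_cohomology K (shuffle_diag C) = Q.P.H"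
    by (simp add: HH_cohomology_def eQ_def[abs_def])
  have X: "HH_homology DA = X.P.H" by (simp add: HH_homology_def)
  have car: "carrier X.P.H = homology (free_cx X)" by (simp add: homology_algebra_def)
  have "graded_algebra_iso Q.P.H X.P.H (inv_into (carrier X.P.H) (homology_map (free_cx X) (dual_cx T) (PhiTheta C))
      \<circ> homology_map (dual_cx Q) (dual_cx T) (nabla_dual C))"
  proof (rule graded_algebra_iso_compose_inverse[OF Q.homology_iso X.homology_iso X.P.H_ring])
    show "hgrade X.P.H n \<subseteq> carrier X.P.H" for n unfolding X.P.H_grade X.P.H_car by blast
    fix a x assume "x \<in> carrier X.P.H"
    then obtain z where z: "z \<in> dgcycles (free_cx X)" "x = hclass (free_cx X) z" unfolding X.P.H_car by blast
    show "a \<odot>\<^bsub>X.P.H\<^esub> x \<in> carrier X.P.H"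
      unfolding z(2) X.P.H_scl X.P.H_car by (intro imageI X.M.cyc_scl z(1))
  qed
  then have "graded_algebra_iso Q.P.H X.P.H (HH_iso C)" unfolding HH_iso_def car .
  moreover have "quasi_iso (dual_cx Q) (dual_cx T) (nabla_dual C)"
    using Q.chain Q.homology_bij by (simp add: quasi_iso_def)
  ultimately show ?thesis unfolding Q X
    using PhiTheta_iso Q.P.homology_commutative_graded_algebra X.P.homology_commutative_graded_algebra by blast
qed

end
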